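(* Assume GRH for $F$. Let $0<B_1<B_2\leq B_3<1/d_F$ and suppose that for some $c>0$, \[ V_F(X, \delta)=\frac{1}{2}\delta X^2\Big(d_F \log\frac{1}{\delta}+\log\mathfrak{q}_F+(1-\gamma_0-\log2\pi)d_F\Big)+O\big(\delta^{1+c} X^2\big) \] uniformly for $X^{-B_3}\ll\delta\ll X^{-B_1}$. Then for every $\varepsilon>0$, \begin{eqnarray*} \tilde{V}_F(X,h)&=&h X\Big(d_F \log\frac{X}{h}+\log\mathfrak{q}_F-(\gamma_0+\log 2\pi)d_F\Big)\\ &&+O_\varepsilon\big(hX^{1+\varepsilon}(h/X)^{c/3}\big)+O_\varepsilon\Big(hX^{1+\varepsilon}\big(hX^{-(1-B_1)}\big)^{1/(3(1-B_1))}\Big) \end{eqnarray*} uniformly for $X^{1-B_3}\ll h\ll X^{1-B_2}$.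
   Context: Let $F(s)=\sum_{n\ge1}a_F(n)n^{-s}$ be a primitive element of the Selberg class: the series converges absolutely for $\mathrm{Re}(s)>1$; $F$ extends meromorphically to $\mathbb C$ with at most a pole at $s=1$, whose order is denoted $m_F\ge0$, and $(s-1)^{m_F}F(s)$ is entire of finite order; $F$ satisfies $\Phi(s)=\varepsilon_F\overline{\Phi}(1-s)$ where $\Phi(s)=Q^s\prod_{j=1}^r\Gamma(\lambda_js+\mu_j)F(s)$ with $Q>0$, $\lambda_j>0$, $\mathrm{Re}(\mu_j)\ge0$, $|\varepsilon_F|=1$, and $\overline{\Phi}(s)=\overline{\Phi(\bar s)}$; $a_F(n)\ll_\varepsilon n^\varepsilon$; and $F(s)=\prod_p\exp\big(\sum_{l\ge1}b_F(p^l)p^{-ls}\big)$ with $b_F(p^l)\ll p^{l\theta}$ for some $\theta<1/2$. The degree is $d_F=2\sum_{j}\lambda_j$ and the conductor is $\mathfrak q_F=(2\pi)^{d_F}Q^2\prod_j\lambda_j^{2\lambda_j}$. Define $\Lambda_F(n)$ by $\frac{F'}{F}(s)=-\sum_{n\ge1}\Lambda_F(n)n^{-s}$ ($\mathrm{Re}(s)>1$) and $\psi_F(x)=\sum_{n\le x}\Lambda_F(n)$. GRH for $F$ means all nontrivial zeros of $F$ are $\rho_F=\tfrac12+i\gamma_F$ with $\gamma_F$ real. Define $V_F(X,\delta)=\int_1^X|\psi_F(x+\delta x)-\psi_F(x)-m_F\delta x|^2dx$, $\tilde V_F(X,h)=\int_1^X|\psi_F(x+h)-\psi_F(x)-m_Fh|^2dx$.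 $\gamma_0$ denotes the Euler–Mascheroni constant. "Uniformly for $a\ll y\ll b$" means: for any fixed positive constants $k_1,k_2$, the estimate holds for all $y$ with $k_1a\le y\le k_2b$ (as the main parameter tends to infinity), with implied constants independent of the variables. *)

theory Defs
  imports "HOL-Analysis.Analysis"
begin

definition ds_term :: "(nat \<Rightarrow> complex) \<Rightarrow> complex \<Rightarrow> nat \<Rightarrow> complex" where
  "ds_term a s k = a (Suc k) / (of_nat (Suc k)) powr s"

definition gamma_factor ::
  "real \<Rightarrow> nat \<Rightarrow> (nat \<Rightarrow> real) \<Rightarrow> (nat \<Rightarrow> complex) \<Rightarrow> complex \<Rightarrow> complex" where
  "gamma_factor Q r lam mu s = (of_real Q) powr s * (\<Prod>j<r. Gamma (of_real (lam j) * s + mu j))"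

definition completed ::
  "(complex \<Rightarrow> complex) \<Rightarrow> real \<Rightarrow> nat \<Rightarrow> (nat \<Rightarrow> real) \<Rightarrow> (nat \<Rightarrow> complex) \<Rightarrow> complex \<Rightarrow> complex" where
  "completed F Q r lam mu s = gamma_factor Q r lam mu s * F s"

text \<open>Points where the functional equation is meaningful (both sides away from poles);
  the identity on this dense open set is the meromorphic identity.\<close>
definition fe_regular :: "nat \<Rightarrow> (nat \<Rightarrow> real) \<Rightarrow> (nat \<Rightarrow> complex) \<Rightarrow> complex \<Rightarrow> bool" where
  "fe_regular r lam mu s \<longleftrightarrow> s \<noteq> 0 \<and> s \<noteq> 1 \<and>
     (\<forall>j<r. of_real (lam j) * s + mu j \<notin> \<int>\<^sub>\<le>\<^sub>0 \<and>
            of_real (lam j) * cnj (1 - s) + mu j \<notin> \<int>\<^sub>\<le>\<^sub>0)"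

definition selberg_axioms ::
  "(nat \<Rightarrow> complex) \<Rightarrow> (complex \<Rightarrow> complex) \<Rightarrow> nat \<Rightarrow> real \<Rightarrow> nat \<Rightarrow> (nat \<Rightarrow> real)
    \<Rightarrow> (nat \<Rightarrow> complex) \<Rightarrow> complex \<Rightarrow> bool" where
  "selberg_axioms a F m Q r lam mu eps \<longleftrightarrow>
    \<comment> \<open>(i) absolute convergence for Re s > 1, and F is the Dirichlet series there\<close>
    (\<forall>s. Re s > 1 \<longrightarrow> summable (\<lambda>k. norm (ds_term a s k)) \<and> ds_term a s sums F s) \<and>
    \<comment> \<open>(ii) meromorphic continuation, at most a pole at s=1 of order exactly m,
        (s-1)^m F(s) entire of finite order\<close>
    (\<exists>H. H holomorphic_on UNIV \<and>
         (\<exists>A C. \<forall>s. norm (H s) \<le> C * exp (norm s powr A)) \<and>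
         (\<forall>s. s \<noteq> 1 \<longrightarrow> H s = (s - 1) ^ m * F s) \<and>
         (m = 0 \<longrightarrow> F 1 = H 1) \<and>
         (m > 0 \<longrightarrow> H 1 \<noteq> 0)) \<and>
    \<comment> \<open>(iii) functional equation\<close>
    Q > 0 \<and> (\<forall>j<r. lam j > 0 \<and> Re (mu j) \<ge> 0) \<and> norm eps = 1 \<and>
    (\<forall>s. fe_regular r lam mu s \<longrightarrow>
        completed F Q r lam mu s = eps * cnj (completed F Q r lam mu (cnj (1 - s)))) \<and>
    \<comment> \<open>(iv) Ramanujan hypothesis\<close>
    (\<forall>e>0. \<exists>C. \<forall>n\<ge>1. norm (a n) \<le> C * real n powr e) \<and>
    \<comment> \<open>(v) Euler product\<close>
    (\<exists>b :: nat \<Rightarrow> complex. \<exists>\<theta> C. \<theta> < 1/2 \<and>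
       (\<forall>p l. prime p \<and> l \<ge> 1 \<longrightarrow> norm (b (p ^ l)) \<le> C * real p powr (real l * \<theta>)) \<and>
       (\<forall>s. Re s > 1 \<longrightarrow>
          ((\<lambda>N. \<Prod>p\<in>{p. prime p \<and> p \<le> N}.
               exp (\<Sum>l. b (p ^ Suc l) / (of_nat p) powr (of_nat (Suc l) * s)))
            \<longlongrightarrow> F s) sequentially))"

definition selberg_class :: "(nat \<Rightarrow> complex) \<Rightarrow> (complex \<Rightarrow> complex) \<Rightarrow> bool" where
  "selberg_class a F \<longleftrightarrow> (\<exists>m Q r lam mu eps. selberg_axioms a F m Q r lam mu eps)"

definition selberg_primitive :: "(nat \<Rightarrow> complex) \<Rightarrow> (complex \<Rightarrow> complex) \<Rightarrow> bool" where
  "selberg_primitive a F \<longleftrightarrow> selberg_class a F \<and> \<not> (\<forall>s. Re s > 1 \<longrightarrow> F s = 1) \<and>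
     \<not> (\<exists>a1 F1 a2 F2. selberg_class a1 F1 \<and> selberg_class a2 F2 \<and>
          \<not> (\<forall>s. Re s > 1 \<longrightarrow> F1 s = 1) \<and> \<not> (\<forall>s. Re s > 1 \<longrightarrow> F2 s = 1) \<and>
          (\<forall>s. Re s > 1 \<longrightarrow> F s = F1 s * F2 s))"

definition degree :: "nat \<Rightarrow> (nat \<Rightarrow> real) \<Rightarrow> real" where
  "degree r lam = 2 * (\<Sum>j<r. lam j)"

definition conductor :: "real \<Rightarrow> nat \<Rightarrow> (nat \<Rightarrow> real) \<Rightarrow> real" where
  "conductor Q r lam = (2 * pi) powr degree r lam * Q\<^sup>2 * (\<Prod>j<r. lam j powr (2 * lam j))"

definition is_vonMangoldt_F :: "(complex \<Rightarrow> complex) \<Rightarrow> (nat \<Rightarrow> complex) \<Rightarrow> bool" where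
  "is_vonMangoldt_F F \<Lambda> \<longleftrightarrow> (\<forall>s. Re s > 1 \<longrightarrow> ds_term \<Lambda> s sums (- (deriv F s / F s)))"

definition psiF :: "(nat \<Rightarrow> complex) \<Rightarrow> real \<Rightarrow> complex" where
  "psiF \<Lambda> x = (\<Sum>n\<in>{1..nat \<lfloor>x\<rfloor>}. \<Lambda> n)"

definition VF :: "(nat \<Rightarrow> complex) \<Rightarrow> nat \<Rightarrow> real \<Rightarrow> real \<Rightarrow> real" where
  "VF \<Lambda> m X \<delta> = integral {1..X}
     (\<lambda>x. (norm (psiF \<Lambda> (x + \<delta> * x) - psiF \<Lambda> x - of_real (real m * \<delta> * x)))\<^sup>2)"

definition VtF :: "(nat \<Rightarrow> complex) \<Rightarrow> nat \<Rightarrow> real \<Rightarrow> real \<Rightarrow> real" where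
  "VtF \<Lambda> m X h = integral {1..X}
     (\<lambda>x. (norm (psiF \<Lambda> (x + h) - psiF \<Lambda> x - of_real (real m * h)))\<^sup>2)"

text \<open>GRH: every nontrivial zero (a zero of F other than those at poles of the Gamma factors)
  has real part 1/2.\<close>
definition GRH :: "(complex \<Rightarrow> complex) \<Rightarrow> nat \<Rightarrow> (nat \<Rightarrow> real) \<Rightarrow> (nat \<Rightarrow> complex) \<Rightarrow> bool" where
  "GRH F r lam mu \<longleftrightarrow> (\<forall>s. s \<noteq> 1 \<and> F s = 0 \<and> (\<forall>j<r. of_real (lam j) * s + mu j \<notin> \<int>\<^sub>\<le>\<^sub>0)
      \<longrightarrow> Re s = 1/2)"

end

theory Submission
  imports Defs "HOL-Complex_Analysis.Complex_Analysis" "HOL-Probability.Probability" "HOL-Real_Asymp.Real_Asymp"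
begin

text \<open>
  Under GRH the logarithmic derivative of \<open>F\<close> is of logarithmic size on \<open>Re s = 1/2 + e\<close> (functional equation,
  Phragmen-Lindelof, Borel-Caratheodory). Shifting the contour in the Laplace inversion formula of
  \<open>psi (x + \<delta> x) - psi x - M \<delta> x\<close> and applying Plancherel bounds the mean square of this difference by
  \<open>\<delta>\<close> up to small powers; integrating over \<open>\<delta>\<close> gives an averaged bound for intervals of fixed length.

  To pass from slopes \<open>\<delta>\<close> to lengths \<open>h\<close>, average over \<open>u\<close> in \<open>[h, (1 + \<mu>\<^sup>2) h]\<close> with respect to \<open>du / u\<close>:
  substituting \<open>u = \<delta> x\<close> turns \<open>du / u\<close> into \<open>d\<delta> / \<delta>\<close>, and the inner integral over \<open>x\<close> becomes a difference of two
  values of \<open>VF\<close>, to which the hypothesis applies as long as \<open>x\<close> exceeds \<open>X1 = h powr (1 / (1 - B1))\<close>. The part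
  \<open>x \<le> X1\<close> and the cost of replacing \<open>u\<close> by \<open>h\<close> are controlled by the averaged bound, and
  \<open>\<mu>\<^sup>3 = (h / X) powr min c 1 + X1 / X\<close> balances the errors.

  The residue \<open>M\<close> may differ from \<open>m\<close> a priori, since \<open>F\<close> may vanish at \<open>1\<close> when \<open>m = 0\<close>; the hypothesis on
  \<open>VF\<close> excludes this. It also forces \<open>B3 < 1\<close>, which \<open>B3 < 1 / degree\<close> alone does not when the degree is below \<open>1\<close>.
\<close>

section \<open>Growth of the Gamma ratio and of the logarithmic derivative\<close>

text \<open>The window and the exponents come from costs measured relative to h*X. The window
  [h, (1 + \<mu>^2)*h] has logarithmic length about \<mu>^2, so every averaged error is divided by
  \<mu>^2. To pass from (x, x + u] to (x, x + h] the excess (x + h, x + u] is split off with 2ab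
  \<le> \<mu>*a^2 + b^2/\<mu>: the first part costs \<mu>; the second costs the mean square over
  lengths up to \<mu>^2*h, that is (\<mu>^2*h)^2*X divided by \<mu>*h and by \<mu>^2, again \<mu>
  relatively. What remains is ((h/X)^c + X1/X)/\<mu>^2, and equating it with \<mu> produces the cube
  root, hence the exponents c/3 and 1/(3(1 - B1)). X1 is the point x at which the slope h/x meets
  x^(-B1), the upper end of the range of the hypothesis. The obstacle is that GRH controls the mean
  square for a fixed slope v/x, not for a single short length v. Integration over all slopes, with v
  = x*\<delta> and Jacobian x, yields an average over v, and an average is all that the scheme
  consumes. Lengths up to 2X at small x are large slopes, so the bound under GRH has to hold for
  every \<delta> > 0. Logarithms and small powers end in X^e.\<close>

text \<open>For fixed y the ratio |Gamma(x + i*y)| / Gamma(x) is nondecreasing in x > 0: in the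
  limit product for its reciprocal each factor |x + k + i*y| / (x + k) is nonincreasing in x. The
  form with \<open>rGamma\<close> allows a factorwise comparison of the approximants
  \<open>rGamma_series\<close>.\<close>

lemma norm_rGamma_antimono:
  fixes w :: complex and b :: real
  assumes "Re w > 0" "b \<ge> 0"
  shows "norm (rGamma (w + of_real b)) * rGamma (Re w) \<le> norm (rGamma w) * rGamma (Re w + b)"
proof (rule LIMSEQ_le)
  show "(\<lambda>n. norm (rGamma_series (w + of_real b) n) * rGamma_series (Re w) n)
      \<longlonglongrightarrow> norm (rGamma (w + of_real b)) * rGamma (Re w)"
    by (intro tendsto_intros)
  show "(\<lambda>n. norm (rGamma_series w n) * rGamma_series (Re w + b) n)
      \<longlonglongrightarrow> norm (rGamma w) * rGamma (Re w + b)"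
    by (intro tendsto_intros)
  have factor: "norm (w + of_real b + of_nat k) * (Re w + real k)
      \<le> norm (w + of_nat k) * (Re w + b + real k)" for k :: nat
  proof -
    define x y where "x = Re w + real k" and "y = Im w"
    have x: "x > 0" using assms by (simp add: x_def)
    have "(norm (w + of_real b + of_nat k) * x)\<^sup>2 = ((x + b)\<^sup>2 + y\<^sup>2) * x\<^sup>2"
      unfolding power_mult_distrib cmod_power2 by (simp add: x_def y_def algebra_simps)
    also have "\<dots> = (x + b)\<^sup>2 * x\<^sup>2 + y\<^sup>2 * x\<^sup>2" by algebra
    also have "\<dots> \<le> (x + b)\<^sup>2 * x\<^sup>2 + y\<^sup>2 * (x + b)\<^sup>2"
      using x assms by (intro add_left_mono mult_left_mono power_mono) auto
    also have "\<dots> = (norm (w + of_nat k) * (x + b))\<^sup>2"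
      unfolding power_mult_distrib cmod_power2 by (simp add: x_def y_def algebra_simps)
    finally have "norm (w + of_real b + of_nat k) * x \<le> norm (w + of_nat k) * (x + b)"
      using x assms by (auto intro: power2_le_imp_le)
    thus ?thesis by (simp add: x_def algebra_simps)
  qed
  have "norm (rGamma_series (w + of_real b) n) * rGamma_series (Re w) n
      \<le> norm (rGamma_series w n) * rGamma_series (Re w + b) n" for n
  proof -
    have "norm (pochhammer (w + of_real b) (n+1)) * pochhammer (Re w) (n+1)
        = (\<Prod>k=0..<n+1. norm (w + of_real b + of_nat k) * (Re w + real k))"
      by (simp only: pochhammer_prod prod_norm prod.distrib)
    also have "\<dots> \<le> (\<Prod>k=0..<n+1. norm (w + of_nat k) * (Re w + b + real k))"
      using assms factor by (intro prod_mono) auto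
    also have "\<dots> = norm (pochhammer w (n+1)) * pochhammer (Re w + b) (n+1)"
      by (simp only: pochhammer_prod prod_norm prod.distrib)
    finally have *: "norm (pochhammer (w + of_real b) (n+1)) * pochhammer (Re w) (n+1)
      \<le> norm (pochhammer w (n+1)) * pochhammer (Re w + b) (n+1)" .
    \<comment> \<open>Both sides carry the same normalising denominator, so only the Pochhammer
      products have to be compared.\<close>
    have e1: "norm (rGamma_series (w + of_real b) n) * rGamma_series (Re w) n
       = norm (pochhammer (w + of_real b) (n+1)) * pochhammer (Re w) (n+1)
           / (fact n * exp ((Re w + b) * ln n) * (fact n * exp (Re w * ln n)))"
      unfolding rGamma_series_def
      by (simp add: norm_divide norm_mult del: pochhammer_Suc)
    have e2: "norm (rGamma_series w n) * rGamma_series (Re w + b) n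
       = norm (pochhammer w (n+1)) * pochhammer (Re w + b) (n+1)
           / (fact n * exp ((Re w + b) * ln n) * (fact n * exp (Re w * ln n)))"
      unfolding rGamma_series_def
      by (simp add: norm_divide norm_mult mult_ac del: pochhammer_Suc)
    show ?thesis
      unfolding e1 e2 using * by (intro divide_right_mono) auto
  qed
  thus "\<exists>N. \<forall>n\<ge>N. norm (rGamma_series (w + of_real b) n) * rGamma_series (Re w) n
      \<le> norm (rGamma_series w n) * rGamma_series (Re w + b) n" by blast
qed

text \<open>The real shift a is rounded up to an integer n: monotonicity with b = n - a controls
  Gamma(z + a) by Gamma(z + n), which is a polynomial in z times Gamma(z). \<open>Re z\<close>
  itself may be negative; a nonzero \<open>Im z\<close> keeps all arguments off the poles.\<close>

lemma norm_Gamma_ratio_bound: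
  fixes z :: complex and a :: real
  assumes "Re z + a > 0" "Im z \<noteq> 0" "a \<le> real n"
  shows "norm (Gamma (z + of_real a)) \<le>
    Gamma (Re z + a) / Gamma (Re z + real n) * norm (pochhammer z n) * norm (Gamma z)"
proof -
  define w where "w = z + of_real a"
  define b where "b = real n - a"
  have w: "Re w > 0" "b \<ge> 0" using assms by (auto simp: w_def b_def)
  have "Im u = 0" if "u \<in> \<int>\<^sub>\<le>\<^sub>0" for u :: complex using that by (auto elim!: nonpos_Ints_cases)
  from this[of z] this[of w] this[of "w + of_real b"]
  have nz: "z \<notin> \<int>\<^sub>\<le>\<^sub>0" "w \<notin> \<int>\<^sub>\<le>\<^sub>0" "w + of_real b \<notin> \<int>\<^sub>\<le>\<^sub>0"
    using assms(2) by (auto simp: w_def)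
  have wb: "w + of_real b = z + of_nat n" by (simp add: w_def b_def)
  have re: "Re w + b = Re z + real n" "Re w = Re z + a" by (auto simp: w_def b_def)
  have G: "norm (Gamma (z + of_nat n)) = norm (pochhammer z n) * norm (Gamma z)"
    using pochhammer_Gamma[OF nz(1), of n] nz
    by (simp add: norm_divide norm_mult[symmetric] Gamma_eq_zero_iff field_simps)
  have pos: "Gamma (Re w) > 0" "Gamma (Re w + b) > 0" using w by auto
  have np: "norm (Gamma w) > 0" "norm (Gamma (w + of_real b)) > 0"
    using nz by (auto simp: Gamma_eq_zero_iff)
  from norm_rGamma_antimono[OF w] have
    "inverse (norm (Gamma (w + of_real b))) * inverse (Gamma (Re w))
      \<le> inverse (norm (Gamma w)) * inverse (Gamma (Re w + b))"
    by (simp add: rGamma_inverse_Gamma norm_inverse)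
  hence "norm (Gamma w) \<le> Gamma (Re w) / Gamma (Re w + b) * norm (Gamma (w + of_real b))"
    using pos np by (simp add: field_simps)
  thus ?thesis unfolding wb G re(1) unfolding re(2) unfolding w_def by (simp add: mult.assoc)
qed

text \<open>The damping factor exp(-\<eta>*cos(c*z)) decays doubly exponentially in |Im z|, which
  beats the finite order of f; \<eta> is then sent to 0. Growth is required only for |Im s| \<ge> 1,
  so that a bound obtained by dividing by powers of s - 1 is admissible.\<close>

lemma Phragmen_Lindelof_strip:
  fixes f :: "complex \<Rightarrow> complex"
  assumes S: "open S" and hol: "f holomorphic_on S" and sub: "{s. a \<le> Re s \<and> Re s \<le> b} \<subseteq> S"
    and growth: "\<And>s. a \<le> Re s \<Longrightarrow> Re s \<le> b \<Longrightarrow> \<bar>Im s\<bar> \<ge> 1 \<Longrightarrow> norm (f s) \<le> C * exp (norm s powr A)"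
    and bdry: "\<And>s. Re s = a \<or> Re s = b \<Longrightarrow> norm (f s) \<le> B"
    and B: "B > 0" and s: "a \<le> Re s" "Re s \<le> b"
  shows "norm (f s) \<le> B"
proof -
  define C' where "C' = max C 1"
  define A' where "A' = max A 1"
  define R where "R = \<bar>a\<bar> + \<bar>b\<bar> + 1"
  \<comment> \<open>At this scale |c * Re z| \<le> 1 \<le> pi/3 on the strip, so the cosine of the
    real part stays at least 1/2.\<close>
  define c where "c = 1 / R"
  have R: "R \<ge> 1" and c: "c > 0" by (auto simp: R_def c_def)
  have cosc: "cos (c * x) \<ge> 1/2" if "a \<le> x" "x \<le> b" for x
  proof -
    have "\<bar>c * x\<bar> \<le> 1" using that R by (auto simp: c_def R_def abs_mult field_simps)
    also have "1 \<le> pi / 3" using pi_gt3 by simp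
    finally have *: "\<bar>c * x\<bar> \<le> pi / 3" .
    have "cos (pi/3) \<le> cos \<bar>c * x\<bar>" by (rule cos_monotone_0_pi_le) (use * pi_gt3 in auto)
    thus ?thesis by (simp add: cos_60)
  qed
  have growth': "norm (f z) \<le> C' * exp ((\<bar>Im z\<bar> + R) powr A')"
    if "a \<le> Re z" "Re z \<le> b" "\<bar>Im z\<bar> \<ge> 1" for z
  proof -
    have "norm z \<le> \<bar>Re z\<bar> + \<bar>Im z\<bar>" by (rule cmod_le)
    also have "\<dots> \<le> \<bar>Im z\<bar> + R" using that by (simp add: R_def)
    finally have nz: "norm z \<le> \<bar>Im z\<bar> + R" .
    have n1: "norm z \<ge> 1" using that abs_Im_le_cmod[of z] by linarith
    have "norm z powr A \<le> norm z powr A'" using n1 by (intro powr_mono) (auto simp: A'_def)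
    also have "\<dots> \<le> (\<bar>Im z\<bar> + R) powr A'" using nz by (intro powr_mono2) (auto simp: A'_def)
    finally have "norm z powr A \<le> (\<bar>Im z\<bar> + R) powr A'" .
    hence "C * exp (norm z powr A) \<le> C' * exp ((\<bar>Im z\<bar> + R) powr A')"
      by (intro mult_mono) (auto simp: C'_def)
    with growth[OF that] show ?thesis by linarith
  qed
  have key: "norm (f s) * exp (- \<eta> * Re (cos (of_real c * s))) \<le> B" if \<eta>: "\<eta> > 0" for \<eta> :: real
  proof -
    define F where "F z = f z * exp (- of_real \<eta> * cos (of_real c * z))" for z
    have nF: "norm (F z) = norm (f z) * exp (- \<eta> * Re (cos (of_real c * z)))" for z
      by (simp add: F_def norm_mult)
    have recos: "Re (cos (of_real c * z)) \<ge> exp (c * \<bar>Im z\<bar>) / 4" if "a \<le> Re z" "Re z \<le> b" for z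
    proof -
      have "exp (c * \<bar>Im z\<bar>) \<le> exp (c * Im z) + exp (- (c * Im z))"
        by (cases "Im z \<ge> 0") auto
      hence "(1/2) * (exp (c * \<bar>Im z\<bar>) / 2) \<le> cos (c * Re z) * ((exp (c * Im z) + exp (- (c * Im z))) / 2)"
        using cosc[OF that] by (intro mult_mono) auto
      thus ?thesis by (simp add: Re_cos)
    qed
    have "filterlim (\<lambda>t. (t + R) powr A' - \<eta> / 4 * exp (c * t)) at_bot at_top"
      using R c \<eta> by real_asymp
    hence "\<forall>\<^sub>F t in at_top. (t + R) powr A' - \<eta> / 4 * exp (c * t) \<le> ln (B / C')"
      by (auto simp: filterlim_at_bot)
    then obtain T0 where T0: "\<And>t. t \<ge> T0 \<Longrightarrow> (t + R) powr A' - \<eta> / 4 * exp (c * t) \<le> ln (B / C')"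
      by (auto simp: eventually_at_top_linorder)
    \<comment> \<open>The rectangle has to contain s and to reach the height beyond which the damped
      function is already below B.\<close>
    define T where "T = max (max T0 1) \<bar>Im s\<bar>"
    have far: "norm (F z) \<le> B" if z: "a \<le> Re z" "Re z \<le> b" "\<bar>Im z\<bar> \<ge> T" for z
    proof -
      have "norm (F z) \<le> C' * exp ((\<bar>Im z\<bar> + R) powr A') * exp (- \<eta> * (exp (c * \<bar>Im z\<bar>) / 4))"
        unfolding nF using growth'[of z] recos[of z] z \<eta>
        by (intro mult_mono) (auto simp: T_def C'_def)
      also have "\<dots> = C' * exp ((\<bar>Im z\<bar> + R) powr A' - \<eta> / 4 * exp (c * \<bar>Im z\<bar>))"
        by (simp add: mult.assoc mult_exp_exp)
      also have "\<dots> \<le> C' * exp (ln (B / C'))"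
        using T0[of "\<bar>Im z\<bar>"] z by (intro mult_left_mono) (auto simp: T_def C'_def)
      also have "\<dots> = B" using B by (simp add: C'_def)
      finally show ?thesis .
    qed
    define Q where "Q = cbox (Complex a (-T)) (Complex b T)"
    have memQ: "z \<in> Q \<longleftrightarrow> a \<le> Re z \<and> Re z \<le> b \<and> \<bar>Im z\<bar> \<le> T" for z
      by (auto simp: Q_def in_cbox_complex_iff)
    have holF: "F holomorphic_on S" unfolding F_def using hol by (intro holomorphic_intros)
    have QS: "Q \<subseteq> S" using sub memQ by auto
    have "norm (F s) \<le> B"
    proof (rule maximum_modulus_frontier[where S = Q and f = F])
      show "F holomorphic_on interior Q"
        using holF QS interior_subset by (meson holomorphic_on_subset order_trans)
      have "closure Q = Q" unfolding Q_def by simp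
      thus "continuous_on (closure Q) F"
        using holomorphic_on_imp_continuous_on[OF holF] QS continuous_on_subset by metis
      show "bounded Q" unfolding Q_def by simp
      show "s \<in> Q" using s by (auto simp: memQ T_def)
      fix z assume "z \<in> frontier Q"
      hence z: "z \<in> Q" "z \<notin> box (Complex a (-T)) (Complex b T)"
        unfolding Q_def by (auto simp: frontier_cbox)
      hence z': "a \<le> Re z" "Re z \<le> b" "\<bar>Im z\<bar> \<le> T" using memQ by auto
      from z have "Re z = a \<or> Re z = b \<or> \<bar>Im z\<bar> = T"
        by (auto simp: memQ in_box_complex_iff)
      thus "norm (F z) \<le> B"
      proof (elim disjE)
        assume "\<bar>Im z\<bar> = T" thus ?thesis using far z' by auto
      next
        assume "Re z = a"
        have "norm (F z) \<le> B * 1"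
          unfolding nF using bdry[of z] recos[OF z'(1,2)] \<open>Re z = a\<close> \<eta> B
          by (intro mult_mono) (auto intro!: mult_nonneg_nonneg order.trans[OF _ recos[OF z'(1,2)]])
        thus ?thesis by simp
      next
        assume "Re z = b"
        have "norm (F z) \<le> B * 1"
          unfolding nF using bdry[of z] recos[OF z'(1,2)] \<open>Re z = b\<close> \<eta> B
          by (intro mult_mono) (auto intro!: mult_nonneg_nonneg order.trans[OF _ recos[OF z'(1,2)]])
        thus ?thesis by simp
      qed
    qed
    thus ?thesis by (simp add: nF)
  qed
  have "((\<lambda>\<eta>. norm (f s) * exp (- \<eta> * Re (cos (of_real c * s)))) \<longlongrightarrow>
           norm (f s) * exp (- 0 * Re (cos (of_real c * s)))) (at_right 0)"
    by (intro tendsto_intros)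
  moreover have "\<forall>\<^sub>F \<eta> in at_right 0. norm (f s) * exp (- \<eta> * Re (cos (of_real c * s))) \<le> B"
    using key by (auto simp: eventually_at_right_field intro!: exI[of _ 1])
  ultimately have "norm (f s) * exp (- 0 * Re (cos (of_real c * s))) \<le> B"
    by (intro tendsto_upperbound) auto
  thus ?thesis by simp
qed

text \<open>Schwarz's lemma for h/(2L - h), where h is f moved to the unit disc: Re h < L means that
  h is closer to 0 than to 2L, so the quotient maps the disc into itself.\<close>

lemma Borel_Caratheodory:
  fixes f :: "complex \<Rightarrow> complex"
  assumes hol: "f holomorphic_on ball z0 R" and f0: "f z0 = 0"
    and bd: "\<And>z. z \<in> ball z0 R \<Longrightarrow> Re (f z) < L"
    and w: "norm (w - z0) < R"
  shows "norm (f w) * (R - norm (w - z0)) \<le> 2 * L * norm (w - z0)"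
proof -
  have R: "R > 0" using w norm_ge_zero[of "w - z0"] by linarith
  have L: "L > 0" using bd[of z0] f0 R by simp
  have in_ball: "z0 + of_real R * z \<in> ball z0 R" if "norm z < 1" for z
    using that R by (simp add: dist_norm norm_mult)
  define h where "h z = f (z0 + of_real R * z)" for z
  have holh: "h holomorphic_on ball 0 1"
    unfolding h_def
    by (rule holomorphic_on_compose_gen[OF _ hol, unfolded o_def])
       (use in_ball in \<open>auto intro!: holomorphic_intros\<close>)
  have Reh: "Re (h z) < L" if "norm z < 1" for z
    using bd[OF in_ball[OF that]] by (simp add: h_def)
  have den: "2 * of_real L - h z \<noteq> 0" if "norm z < 1" for z
    using Reh[OF that] L by (auto simp: complex_eq_iff)
  have less: "norm (h z) < norm (2 * of_real L - h z)" if "norm z < 1" for z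
  proof -
    have "0 < 4 * L * (L - Re (h z))" using Reh[OF that] L by simp
    hence "(Re (h z))\<^sup>2 + (Im (h z))\<^sup>2 < (2 * L - Re (h z))\<^sup>2 + (Im (h z))\<^sup>2"
      by (simp add: power2_eq_square algebra_simps)
    hence "(norm (h z))\<^sup>2 < (norm (2 * of_real L - h z))\<^sup>2"
      by (simp add: cmod_power2)
    thus ?thesis by (rule power2_less_imp_less) simp
  qed
  define \<phi> where "\<phi> z = h z / (2 * of_real L - h z)" for z
  define \<xi> where "\<xi> = (w - z0) / of_real R"
  have \<xi>: "norm \<xi> < 1" using w R by (simp add: \<xi>_def norm_divide)
  have "norm (\<phi> \<xi>) \<le> norm \<xi>"
  proof (rule Schwarz_Lemma(1))
    show "\<phi> holomorphic_on ball 0 1"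
      unfolding \<phi>_def using den by (auto intro!: holomorphic_intros holh)
    show "\<phi> 0 = 0" by (simp add: \<phi>_def h_def f0)
    show "norm (\<phi> z) < 1" if "norm z < 1" for z
      using less[OF that] den[OF that] by (simp add: \<phi>_def norm_divide divide_less_eq)
  qed fact
  hence "norm (h \<xi>) \<le> norm \<xi> * norm (2 * of_real L - h \<xi>)"
    using den[OF \<xi>] by (simp add: \<phi>_def norm_divide divide_le_eq)
  also have "\<dots> \<le> norm \<xi> * (2 * L + norm (h \<xi>))"
    using norm_triangle_ineq4[of "2 * of_real L" "h \<xi>"] L by (intro mult_left_mono) (auto simp: norm_mult)
  finally have "norm (h \<xi>) * (1 - norm \<xi>) \<le> 2 * L * norm \<xi>" by (simp add: algebra_simps)
  moreover have "h \<xi> = f w" using R by (simp add: h_def \<xi>_def)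
  moreover have "norm \<xi> = norm (w - z0) / R" using R by (simp add: \<xi>_def norm_divide)
  ultimately have *: "norm (f w) * (1 - norm (w - z0) / R) * R \<le> 2 * L * (norm (w - z0) / R) * R"
    using R by (intro mult_right_mono) auto
  have "norm (f w) * (1 - norm (w - z0) / R) * R = norm (f w) * (R - norm (w - z0))"
    and "2 * L * (norm (w - z0) / R) * R = 2 * L * norm (w - z0)"
    using R by (simp_all add: field_simps)
  with * show ?thesis by simp
qed

text \<open>On the disc g = g(z0)*exp(G), so the bound on |g| is an upper bound on Re G;
  Borel-Caratheodory turns it into a bound on |G|, and Cauchy's inequality bounds G' = g'/g. Both
  use the margin (R - r)/2, which together with the 2 of Borel-Caratheodory gives the 8. The summand
  1 beside L only makes the bound on Re G strict.\<close>

lemma log_deriv_bound_ball: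
  fixes g :: "complex \<Rightarrow> complex"
  assumes hol: "g holomorphic_on ball z0 R" and nz: "\<And>z. z \<in> ball z0 R \<Longrightarrow> g z \<noteq> 0"
    and bd: "\<And>z. z \<in> ball z0 R \<Longrightarrow> norm (g z) \<le> exp L * norm (g z0)" and L: "L \<ge> 0"
    and r: "r < R" "norm (w - z0) \<le> r"
  shows "norm (deriv g w / g w) \<le> 8 * R / (R - r)\<^sup>2 * (L + 1)"
proof -
  have R: "R > 0" "r \<ge> 0" using r norm_ge_zero[of "w - z0"] by linarith+
  have "(\<lambda>z. deriv g z / g z) holomorphic_on ball z0 R"
    using nz by (auto intro!: holomorphic_intros hol holomorphic_deriv)
  then obtain G0 where G0: "\<And>z. z \<in> ball z0 R \<Longrightarrow> (G0 has_field_derivative deriv g z / g z) (at z)"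
    using holomorphic_convex_primitive'[of "ball z0 R" "\<lambda>z. deriv g z / g z"]
    by (auto simp: at_within_open[of _ "ball z0 R"])
  define G where "G z = G0 z - G0 z0" for z
  have G: "(G has_field_derivative deriv g z / g z) (at z)" if "z \<in> ball z0 R" for z
    unfolding G_def by (auto intro!: derivative_eq_intros G0[OF that])
  have holG: "G holomorphic_on ball z0 R"
    unfolding holomorphic_on_def field_differentiable_def by (intro ballI exI, rule has_field_derivative_at_within, rule G)
  have gder: "(g has_field_derivative deriv g z) (at z)" if "z \<in> ball z0 R" for z
    using hol that by (auto intro: holomorphic_derivI)
  have "\<exists>c. \<forall>z \<in> ball z0 R. g z * exp (- G z) = c"
  proof (rule has_field_derivative_zero_constant)
    fix z assume z: "z \<in> ball z0 R"
    have "((\<lambda>z. g z * exp (- G z)) has_field_derivative 0) (at z)"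
      using nz[OF z] by (auto intro!: derivative_eq_intros gder[OF z] G[OF z])
    thus "((\<lambda>z. g z * exp (- G z)) has_field_derivative 0) (at z within ball z0 R)"
      by (rule has_field_derivative_at_within)
  qed auto
  then obtain c where c: "\<And>z. z \<in> ball z0 R \<Longrightarrow> g z * exp (- G z) = c" by auto
  have "c = g z0" using c[of z0] R by (simp add: G_def)
  hence gG: "g z = g z0 * exp (G z)" if "z \<in> ball z0 R" for z
    using c[OF that] by (simp add: exp_minus field_simps)
  have ReG: "Re (G z) < L + 1" if z: "z \<in> ball z0 R" for z
  proof -
    have "norm (g z0) * exp (Re (G z)) \<le> exp L * norm (g z0)"
      using bd[OF z] unfolding gG[OF z] by (simp add: norm_mult)
    hence "exp (Re (G z)) \<le> exp L" using nz[of z0] R by (simp add: mult.commute)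
    thus ?thesis by simp
  qed
  define d where "d = (R - r) / 2"
  have d: "d > 0" using r by (simp add: d_def)
  have Gb: "norm (G z) \<le> 2 * (L + 1) * R / d" if z: "norm (z - w) \<le> d" for z
  proof -
    have "norm (z - z0) \<le> norm (z - w) + norm (w - z0)"
      using norm_triangle_ineq[of "z - w" "w - z0"] by simp
    hence n: "norm (z - z0) \<le> R - d" using z r by (simp add: d_def field_simps)
    have "norm (G z) * d \<le> norm (G z) * (R - norm (z - z0))"
      using n by (intro mult_left_mono) auto
    also have "\<dots> \<le> 2 * (L + 1) * norm (z - z0)"
      by (rule Borel_Caratheodory[OF holG]) (use ReG n d in \<open>auto simp: G_def\<close>)
    also have "\<dots> \<le> 2 * (L + 1) * R"
      using n d L by (intro mult_left_mono) auto
    finally show ?thesis using d by (simp add: field_simps)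
  qed
  have sub: "cball w d \<subseteq> ball z0 R"
  proof
    fix z assume "z \<in> cball w d"
    hence "norm (z - w) \<le> d" by (simp add: dist_norm norm_minus_commute)
    moreover have "norm (z - z0) \<le> norm (z - w) + norm (w - z0)"
      using norm_triangle_ineq[of "z - w" "w - z0"] by simp
    ultimately show "z \<in> ball z0 R" using r d by (auto simp: d_def dist_norm norm_minus_commute)
  qed
  have "norm ((deriv ^^ 1) G w) \<le> fact 1 * (2 * (L + 1) * R / d) / d ^ 1"
  proof (rule Cauchy_inequality)
    show "G holomorphic_on ball w d" using holG sub ball_subset_cball holomorphic_on_subset by (metis order_trans)
    show "continuous_on (cball w d) G"
      using holG sub holomorphic_on_imp_continuous_on continuous_on_subset by metis
  qed (use d Gb in \<open>auto simp: norm_minus_commute\<close>)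
  moreover have "deriv G w = deriv g w / g w"
    using r by (intro DERIV_imp_deriv G) (auto simp: dist_norm norm_minus_commute)
  ultimately have "norm (deriv g w / g w) \<le> 2 * (L + 1) * R / d / d" by simp
  also have "\<dots> = 8 * R / (R - r)\<^sup>2 * (L + 1)"
    using r by (simp add: d_def power2_eq_square field_simps)
  finally show ?thesis .
qed

section \<open>Growth of F from the functional equation, and its logarithmic derivative\<close>

lemma norm_ds_term: "norm (ds_term a s k) = norm (a (Suc k)) / real (Suc k) powr Re s"
proof -
  have "norm ((of_nat (Suc k) :: complex) powr s) = Re (of_nat (Suc k)) powr Re s"
    by (rule norm_powr_real_powr) (auto simp del: of_nat_Suc)
  thus ?thesis by (simp add: ds_term_def norm_divide del: of_nat_Suc)
qed

lemma nonpos_Ints_complex: "Im z = 0 \<and> Re z \<le> 0" if "z \<in> \<int>\<^sub>\<le>\<^sub>0" for z :: complex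
  using that by (auto elim!: nonpos_Ints_cases)

lemma ds_term_bounded_right:
  assumes sm: "summable (\<lambda>k. norm (ds_term a (of_real \<sigma>) k))" and sums: "ds_term a s sums F s"
    and s: "\<sigma> \<le> Re s"
  shows "norm (F s) \<le> (\<Sum>k. norm (ds_term a (of_real \<sigma>) k))"
proof -
  have le: "norm (ds_term a s k) \<le> norm (ds_term a (of_real \<sigma>) k)" for k
    unfolding norm_ds_term using s by (intro divide_left_mono powr_mono) auto
  have sm': "summable (\<lambda>k. norm (ds_term a s k))"
    by (rule summable_comparison_test'[OF sm, of 0]) (use le in auto)
  have "norm (F s) \<le> (\<Sum>k. norm (ds_term a s k))"
    using summable_norm[OF sm'] sums_unique[OF sums] by simp
  also have "\<dots> \<le> (\<Sum>k. norm (ds_term a (of_real \<sigma>) k))"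
    by (rule suminf_le[OF le sm' sm])
  finally show ?thesis .
qed

lemma norm_pochhammer_le: "norm (pochhammer (z::complex) n) \<le> (norm z + real n) ^ n"
proof -
  have "norm (pochhammer z n) = (\<Prod>k=0..<n. norm (z + of_nat k))"
    by (simp add: pochhammer_prod prod_norm)
  also have "\<dots> \<le> (\<Prod>k=0..<n. norm z + real n)"
  proof (rule prod_mono)
    fix k assume "k \<in> {0..<n}"
    thus "0 \<le> norm (z + of_nat k) \<and> norm (z + of_nat k) \<le> norm z + real n"
      using norm_triangle_ineq[of z "of_nat k"] by auto
  qed
  also have "\<dots> = (norm z + real n) ^ n" by simp
  finally show ?thesis .
qed

text \<open>On the line Re s = -1 the reflected point cnj(1 - s) equals s + 3, so the two Gamma
  arguments differ by the real shift 3*l. The lower bound on |Im s| keeps them off the real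
  axis.\<close>

lemma Gamma_reflected_ratio_bound:
  fixes l :: real and \<mu> :: complex
  assumes l: "l > 0" and \<mu>: "Re \<mu> \<ge> 0"
  shows "\<exists>C n. C \<ge> 0 \<and> (\<forall>s. Re s = -1 \<longrightarrow> \<bar>Im s\<bar> > \<bar>Im \<mu>\<bar> / l \<longrightarrow>
     norm (Gamma (of_real l * cnj (1 - s) + \<mu>)) \<le> C * (1 + \<bar>Im s\<bar>) ^ n * norm (Gamma (of_real l * s + \<mu>)))"
proof -
  obtain n :: nat where n: "3 * l \<le> real n" using real_arch_simple by blast
  define G where "G = \<bar>Gamma (2 * l + Re \<mu>) / Gamma (Re \<mu> - l + real n)\<bar>"
  define C where "C = G * (l + norm \<mu> + real n) ^ n"
  have "norm (Gamma (of_real l * cnj (1 - s) + \<mu>)) \<le> C * (1 + \<bar>Im s\<bar>) ^ n * norm (Gamma (of_real l * s + \<mu>))"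
    if s: "Re s = -1" "\<bar>Im s\<bar> > \<bar>Im \<mu>\<bar> / l" for s
  proof -
    define z where "z = of_real l * s + \<mu>"
    have eq: "of_real l * cnj (1 - s) + \<mu> = z + of_real (3 * l)"
      by (rule complex_eqI) (simp_all add: z_def s(1))
    have rz: "Re z = Re \<mu> - l" using s by (simp add: z_def)
    have im: "Im z \<noteq> 0"
    proof
      assume "Im z = 0"
      hence "l * Im s + Im \<mu> = 0" by (simp add: z_def)
      hence "Im \<mu> = - (l * Im s)" by linarith
      hence "\<bar>Im \<mu>\<bar> / l = \<bar>Im s\<bar>" using l by (simp only: abs_minus_cancel abs_mult) simp
      thus False using s(2) by linarith
    qed
    have "norm (Gamma (z + of_real (3 * l))) \<le>
       Gamma (Re z + 3 * l) / Gamma (Re z + real n) * norm (pochhammer z n) * norm (Gamma z)"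
      by (rule norm_Gamma_ratio_bound[OF _ im n]) (use rz l \<mu> in linarith)
    also have "\<dots> \<le> G * ((l + norm \<mu> + real n) * (1 + \<bar>Im s\<bar>)) ^ n * norm (Gamma z)"
    proof (intro mult_right_mono mult_mono)
      show "Gamma (Re z + 3 * l) / Gamma (Re z + real n) \<le> G"
      proof -
        have "Re z + 3 * l = 2 * l + Re \<mu>" by (simp add: rz)
        hence "Gamma (Re z + 3 * l) / Gamma (Re z + real n) = Gamma (2 * l + Re \<mu>) / Gamma (Re \<mu> - l + real n)"
          by (simp add: rz)
        thus ?thesis unfolding G_def by (simp only: abs_ge_self)
      qed
      have "norm s \<le> 1 + \<bar>Im s\<bar>" using cmod_le[of s] s by simp
      hence "norm z \<le> l * (1 + \<bar>Im s\<bar>) + norm \<mu>"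
        unfolding z_def using l
        by (intro norm_triangle_le add_right_mono) (simp add: norm_mult)
      moreover have "0 \<le> (norm \<mu> + real n) * \<bar>Im s\<bar>" by simp
      moreover have "(l + norm \<mu> + real n) * (1 + \<bar>Im s\<bar>)
          = l * (1 + \<bar>Im s\<bar>) + norm \<mu> + real n + (norm \<mu> + real n) * \<bar>Im s\<bar>"
        by (simp add: algebra_simps)
      ultimately have "norm z + real n \<le> (l + norm \<mu> + real n) * (1 + \<bar>Im s\<bar>)" by linarith
      thus "norm (pochhammer z n) \<le> ((l + norm \<mu> + real n) * (1 + \<bar>Im s\<bar>)) ^ n"
        by (intro order.trans[OF norm_pochhammer_le] power_mono) auto
    qed (auto simp: G_def)
    finally show ?thesis unfolding eq z_def[symmetric] C_def power_mult_distrib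
      by (simp only: mult.assoc)
  qed
  moreover have "C \<ge> 0" unfolding C_def G_def using l by (intro mult_nonneg_nonneg zero_le_power add_nonneg_nonneg) simp_all
  ultimately show ?thesis by blast
qed

text \<open>The factors are treated one by one; the power of Q contributes Q^3 for the same reason,
  the shift by 3.\<close>

lemma gamma_factor_reflected_ratio_bound:
  assumes Q: "Q > 0" and lm: "\<And>j. j < r \<Longrightarrow> lam j > 0 \<and> Re (mu j) \<ge> 0"
  shows "\<exists>C n t0. C \<ge> 0 \<and> t0 \<ge> 1 \<and> (\<forall>s. Re s = -1 \<longrightarrow> \<bar>Im s\<bar> > t0 \<longrightarrow>
     (\<forall>j<r. \<bar>Im s\<bar> > \<bar>Im (mu j)\<bar> / lam j) \<and>
     norm (gamma_factor Q r lam mu (cnj (1 - s))) \<le> C * (1 + \<bar>Im s\<bar>) ^ n * norm (gamma_factor Q r lam mu s))"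
proof -
  have "\<forall>j. \<exists>C n. j < r \<longrightarrow> C \<ge> 0 \<and> (\<forall>s. Re s = -1 \<longrightarrow> \<bar>Im s\<bar> > \<bar>Im (mu j)\<bar> / lam j \<longrightarrow>
     norm (Gamma (of_real (lam j) * cnj (1 - s) + mu j)) \<le> C * (1 + \<bar>Im s\<bar>) ^ n * norm (Gamma (of_real (lam j) * s + mu j)))"
    using Gamma_reflected_ratio_bound lm by meson
  then obtain C n where Cn: "\<And>j. j < r \<Longrightarrow> C j \<ge> 0 \<and> (\<forall>s. Re s = -1 \<longrightarrow> \<bar>Im s\<bar> > \<bar>Im (mu j)\<bar> / lam j \<longrightarrow>
     norm (Gamma (of_real (lam j) * cnj (1 - s) + mu j)) \<le> C j * (1 + \<bar>Im s\<bar>) ^ n j * norm (Gamma (of_real (lam j) * s + mu j)))"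
    by metis
  \<comment> \<open>The sum dominates every single threshold and is meaningful for r = 0 as
    well.\<close>
  define t0 where "t0 = 1 + (\<Sum>j<r. \<bar>Im (mu j)\<bar> / lam j)"
  have t0: "\<bar>Im (mu j)\<bar> / lam j \<le> t0" if "j < r" for j
  proof -
    have "\<bar>Im (mu j)\<bar> / lam j \<le> (\<Sum>j<r. \<bar>Im (mu j)\<bar> / lam j)"
      using that lm by (intro member_le_sum) (auto simp: less_imp_le)
    thus ?thesis by (simp add: t0_def)
  qed
  have t01: "t0 \<ge> 1" using lm by (auto simp: t0_def less_imp_le intro!: sum_nonneg)
  have "(\<forall>j<r. \<bar>Im s\<bar> > \<bar>Im (mu j)\<bar> / lam j) \<and>
     norm (gamma_factor Q r lam mu (cnj (1 - s))) \<le> (Q ^ 3 * (\<Prod>j<r. C j)) * (1 + \<bar>Im s\<bar>) ^ (\<Sum>j<r. n j) * norm (gamma_factor Q r lam mu s)"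
    if s: "Re s = -1" "\<bar>Im s\<bar> > t0" for s
  proof
    show im: "\<forall>j<r. \<bar>Im s\<bar> > \<bar>Im (mu j)\<bar> / lam j" using t0 s by force
    have Q1: "norm (of_real Q powr cnj (1 - s)) = Q ^ 3 * norm (of_real Q powr s)"
    proof -
      have "norm (of_real Q powr cnj (1 - s)) = Q powr 2"
        using Q s by (simp add: norm_powr_real_powr)
      moreover have "norm (of_real Q powr s) = Q powr (-1)"
        using Q s by (simp add: norm_powr_real_powr)
      moreover have "Q powr 2 = Q ^ 3 * Q powr (-1)"
        using Q by (simp add: powr_minus power3_eq_cube power2_eq_square field_simps)
      ultimately show ?thesis by simp
    qed
    have "norm (\<Prod>j<r. Gamma (of_real (lam j) * cnj (1 - s) + mu j)) \<le>
        (\<Prod>j<r. C j * (1 + \<bar>Im s\<bar>) ^ n j * norm (Gamma (of_real (lam j) * s + mu j)))"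
      unfolding prod_norm[symmetric] using Cn s im by (intro prod_mono) auto
    also have "\<dots> = (\<Prod>j<r. C j) * (1 + \<bar>Im s\<bar>) ^ (\<Sum>j<r. n j) * norm (\<Prod>j<r. Gamma (of_real (lam j) * s + mu j))"
      by (simp add: prod.distrib power_sum prod_norm)
    finally have "Q ^ 3 * norm (of_real Q powr s) * norm (\<Prod>j<r. Gamma (of_real (lam j) * cnj (1 - s) + mu j)) \<le>
      Q ^ 3 * norm (of_real Q powr s) * ((\<Prod>j<r. C j) * (1 + \<bar>Im s\<bar>) ^ (\<Sum>j<r. n j) * norm (\<Prod>j<r. Gamma (of_real (lam j) * s + mu j)))"
      using Q by (intro mult_left_mono) auto
    thus "norm (gamma_factor Q r lam mu (cnj (1 - s))) \<le> (Q ^ 3 * (\<Prod>j<r. C j)) * (1 + \<bar>Im s\<bar>) ^ (\<Sum>j<r. n j) * norm (gamma_factor Q r lam mu s)"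
      unfolding gamma_factor_def norm_mult Q1 by (simp add: mult_ac)
  qed
  moreover have "Q ^ 3 * (\<Prod>j<r. C j) \<ge> 0" using Q Cn by (auto intro!: mult_nonneg_nonneg prod_nonneg)
  ultimately show ?thesis using t01 by blast
qed

lemma selberg_axiomsD:
  assumes "selberg_axioms a F m Q r lam mu eps"
  shows "Re s > 1 \<Longrightarrow> summable (\<lambda>k. norm (ds_term a s k))"
    and "Re s > 1 \<Longrightarrow> ds_term a s sums F s"
    and "Q > 0"
    and "j < r \<Longrightarrow> lam j > 0 \<and> Re (mu j) \<ge> 0"
    and "norm eps = 1"
    and "fe_regular r lam mu s \<Longrightarrow>
      completed F Q r lam mu s = eps * cnj (completed F Q r lam mu (cnj (1 - s)))"
    and "\<exists>H. H holomorphic_on UNIV \<and>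
         (\<exists>A C. \<forall>s. norm (H s) \<le> C * exp (norm s powr A)) \<and>
         (\<forall>s. s \<noteq> 1 \<longrightarrow> H s = (s - 1) ^ m * F s) \<and>
         (m = 0 \<longrightarrow> F 1 = H 1) \<and>
         (m > 0 \<longrightarrow> H 1 \<noteq> 0)"
  using assms unfolding selberg_axioms_def by (elim conjE, simp)+

text \<open>The functional equation sends Re s = -1 to Re s = 2, where the Dirichlet series is
  bounded; the Gamma factors contribute the polynomial. Large |Im s| makes the point regular for the
  equation.\<close>

lemma selberg_growth_left:
  assumes ax: "selberg_axioms a F m Q r lam mu eps"
  shows "\<exists>C n t0. C \<ge> 0 \<and> t0 \<ge> 1 \<and> (\<forall>s. Re s = -1 \<longrightarrow> \<bar>Im s\<bar> > t0 \<longrightarrow> norm (F s) \<le> C * (1 + \<bar>Im s\<bar>) ^ n)"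
proof -
  note Q = selberg_axiomsD(3)[OF ax] and lm = selberg_axiomsD(4)[OF ax] and e = selberg_axiomsD(5)[OF ax]
    and fe = selberg_axiomsD(6)[OF ax] and sm = selberg_axiomsD(1,2)[OF ax]
  obtain C n t0 where C: "C \<ge> 0" "t0 \<ge> 1" and b: "\<And>s. Re s = -1 \<Longrightarrow> \<bar>Im s\<bar> > t0 \<Longrightarrow>
     (\<forall>j<r. \<bar>Im s\<bar> > \<bar>Im (mu j)\<bar> / lam j) \<and>
     norm (gamma_factor Q r lam mu (cnj (1 - s))) \<le> C * (1 + \<bar>Im s\<bar>) ^ n * norm (gamma_factor Q r lam mu s)"
    using gamma_factor_reflected_ratio_bound[where r = r and mu = mu, OF Q lm] by metis
  define S where "S = (\<Sum>k. norm (ds_term a (of_real 2) k))"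
  have S: "S \<ge> 0" unfolding S_def by (intro suminf_nonneg sm) auto
  have "norm (F s) \<le> (C * S) * (1 + \<bar>Im s\<bar>) ^ n" if s: "Re s = -1" "\<bar>Im s\<bar> > t0" for s
  proof -
    have nint: "of_real (lam j) * w + mu j \<notin> \<int>\<^sub>\<le>\<^sub>0" if j: "j < r" and w: "Im w = Im s" for j w
    proof
      assume "of_real (lam j) * w + mu j \<in> \<int>\<^sub>\<le>\<^sub>0"
      hence "Im (of_real (lam j) * w + mu j) = 0" using nonpos_Ints_complex by blast
      hence "lam j * Im s + Im (mu j) = 0" using w by simp
      hence "Im (mu j) = - (lam j * Im s)" by linarith
      hence "\<bar>Im (mu j)\<bar> / lam j = \<bar>Im s\<bar>" using lm[OF j] by (simp only: abs_minus_cancel abs_mult) simp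
      moreover have "\<bar>Im s\<bar> > \<bar>Im (mu j)\<bar> / lam j" using b[OF s] j by blast
      ultimately show False by linarith
    qed
    have "fe_regular r lam mu s"
      unfolding fe_regular_def
    proof (intro conjI allI impI)
      show "s \<noteq> 0" "s \<noteq> 1" using s(1) by auto
      show "of_real (lam j) * s + mu j \<notin> \<int>\<^sub>\<le>\<^sub>0" if "j < r" for j by (rule nint[OF that]) simp
      show "of_real (lam j) * cnj (1 - s) + mu j \<notin> \<int>\<^sub>\<le>\<^sub>0" if "j < r" for j by (rule nint[OF that]) simp
    qed
    from fe[OF this] have "norm (completed F Q r lam mu s) = norm (completed F Q r lam mu (cnj (1 - s)))"
      using e by (simp add: norm_mult)
    hence "norm (gamma_factor Q r lam mu s) * norm (F s) = norm (gamma_factor Q r lam mu (cnj (1 - s))) * norm (F (cnj (1 - s)))"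
      by (simp add: completed_def norm_mult)
    also have "\<dots> \<le> (C * (1 + \<bar>Im s\<bar>) ^ n * norm (gamma_factor Q r lam mu s)) * S"
    proof (rule mult_mono)
      show "norm (F (cnj (1 - s))) \<le> S"
        unfolding S_def by (rule ds_term_bounded_right) (use sm s in auto)
    qed (use b[OF s] S C in auto)
    also have "\<dots> = norm (gamma_factor Q r lam mu s) * ((C * S) * (1 + \<bar>Im s\<bar>) ^ n)" by (simp add: mult_ac)
    finally have "norm (gamma_factor Q r lam mu s) * norm (F s) \<le> norm (gamma_factor Q r lam mu s) * ((C * S) * (1 + \<bar>Im s\<bar>) ^ n)" .
    moreover have "norm (gamma_factor Q r lam mu s) > 0"
    proof -
      have "Gamma (of_real (lam j) * s + mu j) \<noteq> 0" if "j < r" for j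
        using nint[OF that refl] by (simp add: Gamma_eq_zero_iff)
      thus ?thesis unfolding gamma_factor_def using Q by auto
    qed
    ultimately show ?thesis by simp
  qed
  thus ?thesis using C S by (intro exI[of _ "C * S"] exI[of _ n] exI[of _ t0]) auto
qed

text \<open>For Re s > 1/2 every Gamma argument has positive real part, so a zero there is never
  trivial. The point s = 1 is exempt in \<open>GRH\<close> and therefore stays open here.\<close>

lemma GRH_nonvanishing:
  assumes grh: "GRH F r lam mu" and lm: "\<And>j. j < r \<Longrightarrow> lam j > 0 \<and> Re (mu j) \<ge> 0"
    and s: "Re s > 1/2" "s \<noteq> 1"
  shows "F s \<noteq> 0"
proof
  assume "F s = 0"
  have "of_real (lam j) * s + mu j \<notin> \<int>\<^sub>\<le>\<^sub>0" if j: "j < r" for j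
  proof
    assume "of_real (lam j) * s + mu j \<in> \<int>\<^sub>\<le>\<^sub>0"
    hence "Re (of_real (lam j) * s + mu j) \<le> 0" using nonpos_Ints_complex by blast
    moreover have "lam j * Re s > 0" using lm[OF j] s by simp
    ultimately show False using lm[OF j] by simp
  qed
  hence "Re s = 1/2" using grh \<open>F s = 0\<close> s(2) unfolding GRH_def by blast
  thus False using s by simp
qed

text \<open>Supplies the centre for Borel-Caratheodory. Far to the right the first nonzero
  coefficient, at n = K + 1, dominates: the tail relative to it decays like ((K + 1)/(K +
  2))^\<sigma>. The bound \<sigma> \<ge> 5 puts the centre to the right of all points at which the
  logarithmic derivative is needed.\<close>

lemma Dirichlet_series_lower_bound:
  assumes sm: "\<And>s. Re s > 1 \<Longrightarrow> summable (\<lambda>k. norm (ds_term a s k))"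
    and sums: "\<And>s. Re s > 1 \<Longrightarrow> ds_term a s sums F s" and nz: "F 2 \<noteq> 0"
  shows "\<exists>\<sigma> c. \<sigma> \<ge> 5 \<and> c > 0 \<and> (\<forall>s. Re s = \<sigma> \<longrightarrow> norm (F s) \<ge> c)"
proof -
  have ex: "\<exists>k. a (Suc k) \<noteq> 0"
  proof (rule ccontr)
    assume "\<not> ?thesis"
    hence "ds_term a 2 = (\<lambda>_. 0)" by (auto simp: ds_term_def)
    with sums[of 2] have "(\<lambda>_. 0) sums F 2" by simp
    hence "F 2 = 0" using sums_unique2 sums_zero by blast
    with nz show False by simp
  qed
  define K where "K = (LEAST k. a (Suc k) \<noteq> 0)"
  have K: "a (Suc K) \<noteq> 0" unfolding K_def using ex by (rule LeastI_ex)
  have K0: "a (Suc k) = 0" if "k < K" for k using not_less_Least[of k] that unfolding K_def by blast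
  define S where "S = (\<Sum>k. norm (ds_term a (of_real 2) k))"
  have "((\<lambda>\<sigma>. (real K + 2) powr 2 * S * ((real K + 1) / (real K + 2)) powr \<sigma>) \<longlongrightarrow> (real K + 2) powr 2 * S * 0) at_top"
  proof (intro tendsto_mult_left)
    have "((\<lambda>\<sigma>. q powr \<sigma>) \<longlongrightarrow> 0) at_top" if "0 < q" "q < 1" for q :: real
      using that by real_asymp
    thus "((\<lambda>\<sigma>. ((real K + 1) / (real K + 2)) powr \<sigma>) \<longlongrightarrow> 0) at_top" by simp
  qed
  hence "\<forall>\<^sub>F \<sigma> in at_top. (real K + 2) powr 2 * S * ((real K + 1) / (real K + 2)) powr \<sigma> < norm (a (Suc K)) / 2"
    using K by (intro order_tendstoD(2)[where y = "(real K + 2) powr 2 * S * 0"]) auto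
  then obtain \<sigma>0 where \<sigma>0: "\<And>\<sigma>. \<sigma> \<ge> \<sigma>0 \<Longrightarrow> (real K + 2) powr 2 * S * ((real K + 1) / (real K + 2)) powr \<sigma> < norm (a (Suc K)) / 2"
    by (auto simp: eventually_at_top_linorder)
  define \<sigma> where "\<sigma> = max \<sigma>0 5"
  have \<sigma>: "\<sigma> \<ge> 5" "\<sigma> \<ge> \<sigma>0" by (auto simp: \<sigma>_def)
  define c where "c = norm (a (Suc K)) / (real K + 1) powr \<sigma> / 2"
  have "norm (F s) \<ge> c" if s: "Re s = \<sigma>" for s
  proof -
    have s1: "Re s > 1" using s \<sigma> by simp
    \<comment> \<open>The tail is compared with the series at 2: for n \<ge> K + 2 the factor n^(2 -
      \<sigma>) is at most (K + 2)^(2 - \<sigma>).\<close>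
    have le: "norm (ds_term a s (k + Suc K)) \<le> (real K + 2) powr (2 - \<sigma>) * norm (ds_term a (of_real 2) (k + Suc K))" for k
    proof -
      define n where "n = real (Suc (k + Suc K))"
      have n: "n \<ge> real K + 2" by (simp add: n_def)
      have "1 / n powr \<sigma> = n powr (2 - \<sigma>) / n powr 2" using n by (simp add: powr_diff)
      also have "\<dots> \<le> (real K + 2) powr (2 - \<sigma>) / n powr 2"
        using n \<sigma> by (intro divide_right_mono powr_mono2') auto
      finally have "norm (a (Suc (k + Suc K))) * (1 / n powr \<sigma>) \<le> norm (a (Suc (k + Suc K))) * ((real K + 2) powr (2 - \<sigma>) / n powr 2)"
        by (intro mult_left_mono) auto
      thus ?thesis unfolding norm_ds_term s n_def[symmetric] by (simp add: mult_ac)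
    qed
    have sm2: "summable (\<lambda>k. norm (ds_term a (of_real 2) k))" using sm[of "of_real 2"] by simp
    have sm2': "summable (\<lambda>k. norm (ds_term a (of_real 2) (k + Suc K)))"
      using sm2 by (subst summable_iff_shift)
    have smt: "summable (\<lambda>k. norm (ds_term a s (k + Suc K)))"
      using sm[OF s1] by (subst summable_iff_shift)
    have "F s = (\<Sum>k. ds_term a s (k + Suc K)) + (\<Sum>k<Suc K. ds_term a s k)"
      using suminf_split_initial_segment[of "ds_term a s" "Suc K"] sums[OF s1]
      by (metis sums_summable sums_unique)
    moreover have "(\<Sum>k<Suc K. ds_term a s k) = ds_term a s K"
      using K0 by (simp add: ds_term_def)
    ultimately have "norm (F s) \<ge> norm (ds_term a s K) - norm (\<Sum>k. ds_term a s (k + Suc K))"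
      by (metis add.commute norm_diff_ineq)
    moreover have "norm (ds_term a s K) = norm (a (Suc K)) / (real K + 1) powr \<sigma>"
      by (simp add: norm_ds_term s algebra_simps)
    moreover have "norm (\<Sum>k. ds_term a s (k + Suc K)) \<le> c"
    proof -
      have "norm (\<Sum>k. ds_term a s (k + Suc K)) \<le> (\<Sum>k. norm (ds_term a s (k + Suc K)))"
        by (rule summable_norm[OF smt])
      also have "\<dots> \<le> (\<Sum>k. (real K + 2) powr (2 - \<sigma>) * norm (ds_term a (of_real 2) (k + Suc K)))"
        by (intro suminf_le le smt summable_mult sm2')
      also have "\<dots> = (real K + 2) powr (2 - \<sigma>) * (\<Sum>k. norm (ds_term a (of_real 2) (k + Suc K)))"
        by (intro suminf_mult sm2')
      also have "\<dots> \<le> (real K + 2) powr (2 - \<sigma>) * S"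
        unfolding S_def using suminf_split_initial_segment[OF sm2, of "Suc K"]
        by (intro mult_left_mono) (simp_all add: sum_nonneg)
      also have "(real K + 2) powr (2 - \<sigma>) * S = (real K + 2) powr 2 * S * ((real K + 1) / (real K + 2)) powr \<sigma> / (real K + 1) powr \<sigma>"
        by (simp add: powr_diff powr_divide field_simps)
      also have "\<dots> \<le> norm (a (Suc K)) / 2 / (real K + 1) powr \<sigma>"
        using \<sigma>0[OF \<sigma>(2)] by (intro divide_right_mono) auto
      also have "\<dots> = c" by (simp add: c_def)
      finally show ?thesis .
    qed
    ultimately show ?thesis by (simp add: c_def)
  qed
  moreover have "c > 0" using K by (simp add: c_def)
  ultimately show ?thesis using \<sigma> by blast
qed

text \<open>Splits off the whole zero at z globally: \<open>zor_poly\<close> gives the cofactor near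
  z, the plain quotient gives it elsewhere. One nonzero value excludes H = 0, and k = 0 is
  allowed.\<close>

lemma entire_factor_zero:
  fixes H :: "complex \<Rightarrow> complex"
  assumes hol: "H holomorphic_on UNIV" and nz: "H w \<noteq> 0"
  shows "\<exists>k g. g holomorphic_on UNIV \<and> g z \<noteq> 0 \<and> (\<forall>s. H s = (s - z) ^ k * g s)"
proof -
  define k where "k = nat (zorder H z)"
  obtain r where r: "r > 0" and zp: "zor_poly H z holomorphic_on cball z r"
     "\<And>w. w \<in> cball z r \<Longrightarrow> H w = zor_poly H z w * (w - z) ^ k \<and> zor_poly H z w \<noteq> 0"
    using zorder_exist_zero[OF hol open_UNIV connected_UNIV UNIV_I, of z] nz unfolding k_def by blast
  define g where "g s = (if s = z then zor_poly H z z else H s / (s - z) ^ k)" for s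
  have geq: "g s = zor_poly H z s" if "s \<in> cball z r" for s
    using zp(2)[OF that] by (auto simp: g_def)
  have "g holomorphic_on ball z r \<union> (UNIV - {z})"
  proof (rule holomorphic_on_Un)
    show "g holomorphic_on ball z r"
      using zp(1) geq by (subst holomorphic_cong[OF refl, of _ g "zor_poly H z"])
        (auto intro: holomorphic_on_subset)
    have "(\<lambda>s. H s / (s - z) ^ k) holomorphic_on UNIV - {z}"
      using holomorphic_on_subset[OF hol] by (intro holomorphic_intros) auto
    thus "g holomorphic_on UNIV - {z}"
      by (rule holomorphic_transform) (auto simp: g_def)
  qed auto
  moreover have "ball z r \<union> (UNIV - {z}) = UNIV" using r by auto
  ultimately have "g holomorphic_on UNIV" by simp
  moreover have "g z \<noteq> 0" using zp(2)[of z] r by (simp add: g_def)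
  moreover have "H s = (s - z) ^ k * g s" for s
  proof (cases "s = z")
    case True
    thus ?thesis using zp(2)[of z] geq[of z] r by (simp add: mult.commute)
  qed (simp add: g_def)
  ultimately show ?thesis by blast
qed

text \<open>Phragmen-Lindelof for g/(s + 3)^N between Re s = -1, where the functional equation
  bounds F, and Re s = b, where the Dirichlet series does. The factor s + 3 has no zero in the
  strip.\<close>

lemma selberg_polynomial_growth:
  assumes ax: "selberg_axioms a F m Q r lam mu eps"
    and g: "g holomorphic_on UNIV" and gF: "\<And>s. s \<noteq> 1 \<Longrightarrow> (s - 1) ^ m * F s = (s - 1) ^ k * g s"
    and b: "b \<ge> 5"
  shows "\<exists>B N. B > 0 \<and> (\<forall>s. -1 \<le> Re s \<longrightarrow> Re s \<le> b \<longrightarrow> norm (g s) \<le> B * norm (s + 3) ^ N)"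
proof -
  obtain C0 A where ord: "\<And>s. s \<noteq> 1 \<Longrightarrow> norm ((s - 1) ^ m * F s) \<le> C0 * exp (norm s powr A)"
    using selberg_axiomsD(7)[OF ax] by metis
  obtain C n t0 where C: "C \<ge> 0" "t0 \<ge> 1"
    and left: "\<And>s. Re s = -1 \<Longrightarrow> \<bar>Im s\<bar> > t0 \<Longrightarrow> norm (F s) \<le> C * (1 + \<bar>Im s\<bar>) ^ n"
    using selberg_growth_left[OF ax] by metis
  define S where "S = (\<Sum>k. norm (ds_term a (of_real 2) k))"
  have S: "S \<ge> 0" unfolding S_def by (intro suminf_nonneg selberg_axiomsD(1)[OF ax]) auto
  have right: "norm (F s) \<le> S" if "Re s \<ge> 2" for s
    unfolding S_def using that by (intro ds_term_bounded_right selberg_axiomsD(1,2)[OF ax]) auto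
  have g_le: "norm (g s) \<le> norm (s - 1) ^ m * norm (F s)" if "norm (s - 1) \<ge> 1" for s
  proof -
    have s: "s \<noteq> 1" using that by auto
    have "norm (g s) \<le> norm (s - 1) ^ k * norm (g s)"
      using that by (simp add: mult_le_cancel_right1 one_le_power)
    also have "\<dots> = norm ((s - 1) ^ k * g s)" by (simp add: norm_mult norm_power)
    also have "\<dots> = norm (s - 1) ^ m * norm (F s)" using gF[OF s] by (simp add: norm_mult norm_power flip: gF[OF s])
    finally show ?thesis .
  qed
  \<comment> \<open>The exponent n is the growth of F on the left line, m comes from the factor (s -
    1)^m between F and g.\<close>
  define N where "N = n + m"
  have cont: "continuous_on UNIV g" using g by (rule holomorphic_on_imp_continuous_on)
  \<comment> \<open>On the left line the bound from the functional equation starts only beyond |Im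
    s| = t0; below that g is bounded by compactness.\<close>
  have "compact (g ` (cbox (Complex (-1) (-t0)) (Complex (-1) t0)))"
    by (intro compact_continuous_image continuous_on_subset[OF cont]) auto
  hence "bounded (g ` (cbox (Complex (-1) (-t0)) (Complex (-1) t0)))" by (rule compact_imp_bounded)
  then obtain B0 where B0: "\<And>s. s \<in> cbox (Complex (-1) (-t0)) (Complex (-1) t0) \<Longrightarrow> norm (g s) \<le> B0"
    unfolding bounded_iff by (metis imageI)
  define B where "B = max B0 0 + 3 ^ m * (C * 2 ^ n + S) + 1"
  have B: "B > 0" using C S by (auto simp: B_def intro!: add_nonneg_pos add_nonneg_nonneg)
  define f where "f s = g s / (s + 3) ^ N" for s
  have nz3: "s + 3 \<noteq> 0" if "Re s > -2" for s using that by (auto simp: complex_eq_iff)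
  have "norm (f s) \<le> B" if s: "-1 \<le> Re s" "Re s \<le> b" for s
  proof (rule Phragmen_Lindelof_strip[where S = "{s. Re s > -2}" and a = "-1" and b = b and s = s])
    show "open {s. Re s > -2}" by (rule open_halfspace_Re_gt)
    show "f holomorphic_on {s. Re s > -2}"
      unfolding f_def using nz3 holomorphic_on_subset[OF g] by (intro holomorphic_intros) auto
    show "{s. - 1 \<le> Re s \<and> Re s \<le> b} \<subseteq> {s. Re s > -2}" by auto
    show "- 1 \<le> Re s" "Re s \<le> b" "B > 0" by fact+
  next
    fix s assume s: "-1 \<le> Re s" "Re s \<le> b" "\<bar>Im s\<bar> \<ge> 1"
    have s1: "s \<noteq> 1" using s by auto
    have n1: "norm (s - 1) \<ge> 1" using abs_Im_le_cmod[of "s - 1"] s by simp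
    have n3: "norm (s + 3) \<ge> 1" using abs_Im_le_cmod[of "s + 3"] s by simp
    have "norm (f s) = norm (g s) / norm (s + 3) ^ N" by (simp add: f_def norm_divide norm_power)
    also have "\<dots> \<le> norm (g s) / 1" using n3 nz3[of s] s by (intro divide_left_mono) (auto simp: one_le_power)
    also have "\<dots> \<le> norm ((s - 1) ^ m * F s)" using g_le[OF n1] by (simp add: norm_mult norm_power)
    also have "\<dots> \<le> C0 * exp (norm s powr A)" by (rule ord[OF s1])
    finally show "norm (f s) \<le> C0 * exp (norm s powr A)" .
  next
    fix s assume s: "Re s = -1 \<or> Re s = b"
    have n1: "norm (s - 1) \<ge> 1" using abs_Re_le_cmod[of "s - 1"] s b by auto
    have n3: "norm (s + 3) \<ge> 2" using abs_Re_le_cmod[of "s + 3"] s b by auto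
    have i3: "norm (s + 3) \<ge> \<bar>Im s\<bar>" using abs_Im_le_cmod[of "s + 3"] by simp
    have le1: "1 + \<bar>Im s\<bar> \<le> 2 * norm (s + 3)" using n3 i3 by linarith
    have le2: "norm (s - 1) \<le> 3 * norm (s + 3)"
      using norm_triangle_ineq4[of "s + 3" 4] n3 by simp
    have main: "norm (g s) \<le> B * norm (s + 3) ^ N"
    proof (cases "Re s = -1 \<and> \<bar>Im s\<bar> \<le> t0")
      case True
      hence "s \<in> cbox (Complex (-1) (-t0)) (Complex (-1) t0)" by (auto simp: in_cbox_complex_iff)
      hence "norm (g s) \<le> B0" by (rule B0)
      also have "B0 \<le> B * 1" using C S by (auto simp: B_def intro!: add_increasing2 add_nonneg_nonneg)
      also have "\<dots> \<le> B * norm (s + 3) ^ N" using B n3 by (intro mult_left_mono one_le_power) auto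
      finally show ?thesis .
    next
      case False
      have Fb: "norm (F s) \<le> (C * 2 ^ n + S) * norm (s + 3) ^ n"
      proof (cases "Re s = -1")
        case True
        have "norm (F s) \<le> C * (1 + \<bar>Im s\<bar>) ^ n" using False True by (intro left) auto
        also have "\<dots> \<le> C * (2 * norm (s + 3)) ^ n" using C le1 by (intro mult_left_mono power_mono) auto
        also have "\<dots> \<le> (C * 2 ^ n + S) * norm (s + 3) ^ n"
          using S by (simp add: power_mult_distrib distrib_right)
        finally show ?thesis .
      next
        case False
        have "norm (F s) \<le> S * 1" using s False b right[of s] by simp
        also have "\<dots> \<le> (C * 2 ^ n + S) * norm (s + 3) ^ n"
          using S C n3 by (intro mult_mono one_le_power) auto
        finally show ?thesis .
      qed
      have "norm (g s) \<le> norm (s - 1) ^ m * norm (F s)" by (rule g_le[OF n1])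
      also have "\<dots> \<le> (3 * norm (s + 3)) ^ m * ((C * 2 ^ n + S) * norm (s + 3) ^ n)"
        using le2 Fb by (intro mult_mono power_mono) auto
      also have "\<dots> = (3 ^ m * (C * 2 ^ n + S)) * norm (s + 3) ^ N"
        by (simp add: N_def power_mult_distrib power_add mult_ac)
      also have "\<dots> \<le> B * norm (s + 3) ^ N" by (intro mult_right_mono) (auto simp: B_def)
      finally show ?thesis .
    qed
    have "norm (s + 3) ^ N > 0" using n3 by (intro zero_less_power) linarith
    thus "norm (f s) \<le> B" using main by (simp add: f_def norm_divide norm_power divide_le_eq)
  qed
  moreover have "norm (s + 3) ^ N > 0" if "-1 \<le> Re s" for s
    using nz3[of s] that by simp
  ultimately have "norm (g s) \<le> B * norm (s + 3) ^ N" if "-1 \<le> Re s" "Re s \<le> b" for s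
    using that by (simp add: f_def norm_divide norm_power divide_le_eq)
  thus ?thesis using B by blast
qed

text \<open>The disc about \<sigma> + i*t of radius \<sigma> - 1/2 touches Re s = 1/2 and so lies in
  the zero-free half plane of g; shrunk by e it still reaches Re s = 1/2 + e. On it |g| exceeds its
  value at the centre by at most a power of 3 + |t|, and the logarithm of that power is the
  bound.\<close>

lemma selberg_log_deriv_bound:
  assumes ax: "selberg_axioms a F m Q r lam mu eps" and grh: "GRH F r lam mu"
    and g: "g holomorphic_on UNIV" and gF: "\<And>s. s \<noteq> 1 \<Longrightarrow> (s - 1) ^ m * F s = (s - 1) ^ k * g s"
    and nz: "\<And>s. Re s > 1/2 \<Longrightarrow> g s \<noteq> 0" and e: "e > 0"
  shows "\<exists>C. C \<ge> 0 \<and> (\<forall>s. 1/2 + e \<le> Re s \<longrightarrow> Re s \<le> 5 \<longrightarrow> norm (deriv g s / g s) \<le> C * ln (3 + \<bar>Im s\<bar>))"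
proof -
  have "F 2 \<noteq> 0" by (rule GRH_nonvanishing[OF grh selberg_axiomsD(4)[OF ax]]) auto
  then obtain \<sigma> c where \<sigma>: "\<sigma> \<ge> 5" and c: "c > 0" and low: "\<And>s. Re s = \<sigma> \<Longrightarrow> norm (F s) \<ge> c"
    using Dirichlet_series_lower_bound[OF selberg_axiomsD(1,2)[OF ax]] by metis
  \<comment> \<open>The disc extends to the right as far as 2*\<sigma> - 1/2, so polynomial growth
    is needed up to 2*\<sigma>.\<close>
  have \<sigma>': "2 * \<sigma> \<ge> 5" using \<sigma> by simp
  obtain B N where B: "B > 0" and gb: "\<And>s. -1 \<le> Re s \<Longrightarrow> Re s \<le> 2 * \<sigma> \<Longrightarrow> norm (g s) \<le> B * norm (s + 3) ^ N"
    using selberg_polynomial_growth[OF ax g gF \<sigma>'] by metis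
  define R where "R = \<sigma> - 1/2"
  \<comment> \<open>With T = 3 + |t| the product D*T dominates |z + 3| on the disc and |z0 -
    1|.\<close>
  define D where "D = 3 * \<sigma> + 3"
  define C1 where "C1 = max 1 (B * D ^ N * D ^ k / c)"
  have C1: "C1 \<ge> 1" by (simp add: C1_def)
  define C where "C = 8 * R / e\<^sup>2 * (ln C1 + real (N + k) + 1)"
  have C: "C \<ge> 0" using \<sigma> C1 by (auto simp: C_def R_def)
  have "norm (deriv g s / g s) \<le> C * ln (3 + \<bar>Im s\<bar>)" if s: "1/2 + e \<le> Re s" "Re s \<le> 5" for s
  proof -
    define t where "t = Im s"
    define T where "T = 3 + \<bar>t\<bar>"
    have T: "T \<ge> 3" by (simp add: T_def)
    have lnT: "ln T \<ge> 1"
    proof -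
      have "exp 1 \<le> T" using exp_le T by linarith
      thus ?thesis using T by (subst ln_ge_iff) auto
    qed
    define z0 where "z0 = Complex \<sigma> t"
    define L where "L = ln C1 + real (N + k) * ln T"
    have eL: "exp L = C1 * T ^ (N + k)"
      unfolding L_def exp_add using C1 T by (simp add: exp_of_nat_mult del: of_nat_add)
    have n1: "norm (z0 - 1) \<ge> 1" using abs_Re_le_cmod[of "z0 - 1"] \<sigma> by (simp add: z0_def)
    have n2: "norm (z0 - 1) \<le> D * T"
    proof -
      have "norm (z0 - 1) \<le> \<bar>Re (z0 - 1)\<bar> + \<bar>Im (z0 - 1)\<bar>" by (rule cmod_le)
      also have "\<dots> \<le> D * 1 + 1 * \<bar>t\<bar>" using \<sigma> by (simp add: z0_def D_def)
      also have "\<dots> \<le> D * 3 + D * \<bar>t\<bar>" using \<sigma> by (intro add_mono mult_mono) (auto simp: D_def)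
      finally show ?thesis by (simp add: T_def algebra_simps)
    qed
    have gz0: "c \<le> (D * T) ^ k * norm (g z0)"
    proof -
      have "c \<le> 1 * norm (F z0)" using low[of z0] by (simp add: z0_def)
      also have "\<dots> \<le> norm (z0 - 1) ^ m * norm (F z0)"
        using n1 by (intro mult_right_mono one_le_power) auto
      also have "\<dots> = norm (z0 - 1) ^ k * norm (g z0)"
        using gF[of z0] n1 by (metis norm_mult norm_power norm_zero not_one_le_zero right_minus_eq)
      also have "\<dots> \<le> (D * T) ^ k * norm (g z0)" using n2 by (intro mult_right_mono power_mono) auto
      finally show ?thesis .
    qed
    have "norm (deriv g s / g s) \<le> 8 * R / (R - (R - e))\<^sup>2 * (L + 1)"
    proof (rule log_deriv_bound_ball)
      show "g holomorphic_on ball z0 R" using holomorphic_on_subset[OF g] by blast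
      have Re_ball: "1/2 < Re z \<and> Re z < 2 * \<sigma>" if "z \<in> ball z0 R" for z
        using that abs_Re_le_cmod[of "z0 - z"] by (auto simp: dist_norm z0_def R_def)
      show "g z \<noteq> 0" if "z \<in> ball z0 R" for z using Re_ball[OF that] by (intro nz) auto
      show "norm (g z) \<le> exp L * norm (g z0)" if z: "z \<in> ball z0 R" for z
      proof -
        have "norm (z + 3) \<le> norm (z - z0) + norm (z0 + 3)" using norm_triangle_ineq[of "z - z0" "z0 + 3"] by simp
        also have "norm (z - z0) \<le> R" using z by (simp add: dist_norm norm_minus_commute)
        also have "norm (z0 + 3) \<le> \<sigma> + 3 + \<bar>t\<bar>" using cmod_le[of "z0 + 3"] \<sigma> by (simp add: z0_def)
        also have "R + (\<sigma> + 3 + \<bar>t\<bar>) \<le> D * 3 + D * \<bar>t\<bar>"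
          using \<sigma> mult_right_mono[of 1 D "\<bar>t\<bar>"] by (simp add: D_def R_def)
        finally have z3: "norm (z + 3) \<le> D * T" by (simp add: T_def algebra_simps)
        have "norm (g z) * c \<le> (B * norm (z + 3) ^ N) * ((D * T) ^ k * norm (g z0))"
          using Re_ball[OF z] gz0 c B by (intro mult_mono gb) auto
        also have "\<dots> \<le> (B * (D * T) ^ N) * ((D * T) ^ k * norm (g z0))"
          using z3 B T \<sigma> by (intro mult_right_mono mult_left_mono power_mono) (auto simp: D_def)
        also have "\<dots> = (B * D ^ N * D ^ k / c) * T ^ (N + k) * norm (g z0) * c"
          using c by (simp add: power_mult_distrib power_add mult_ac)
        also have "\<dots> \<le> C1 * T ^ (N + k) * norm (g z0) * c"
          using T c by (intro mult_right_mono) (auto simp: C1_def)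
        finally show ?thesis unfolding eL using c by simp
      qed
      show "L \<ge> 0" using C1 lnT by (auto simp: L_def intro!: add_nonneg_nonneg mult_nonneg_nonneg)
      show "R - e < R" using e by simp
      have "s - z0 = of_real (Re s - \<sigma>)" by (simp add: z0_def t_def complex_eq_iff)
      hence "norm (s - z0) = \<bar>Re s - \<sigma>\<bar>" by (simp only: norm_of_real)
      thus "norm (s - z0) \<le> R - e" using s \<sigma> by (simp add: R_def)
    qed
    also have "L + 1 \<le> (ln C1 + real (N + k) + 1) * ln T"
    proof -
      have "ln C1 * 1 \<le> ln C1 * ln T" using C1 lnT by (intro mult_left_mono) auto
      thus ?thesis using lnT by (simp add: L_def distrib_right)
    qed
    hence "8 * R / (R - (R - e))\<^sup>2 * (L + 1) \<le> 8 * R / (R - (R - e))\<^sup>2 * ((ln C1 + real (N + k) + 1) * ln T)"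
      using \<sigma> by (intro mult_left_mono) (auto simp: R_def)
    also have "\<dots> = C * ln T" by (simp add: C_def)
    finally show ?thesis by (simp add: T_def t_def)
  qed
  thus ?thesis using C by blast
qed

text \<open>Since \<open>GRH\<close> is silent at s = 1, both the pole and a possible zero of F
  there are moved into powers of s - 1; only then is g zero-free on the whole half plane. The
  residue of -F'/F at 1 is m - k.\<close>

lemma selberg_factorization:
  assumes ax: "selberg_axioms a F m Q r lam mu eps" and grh: "GRH F r lam mu"
  obtains g k where "g holomorphic_on UNIV" "\<And>s. s \<noteq> 1 \<Longrightarrow> (s - 1) ^ m * F s = (s - 1) ^ k * g s"
    "\<And>s. Re s > 1/2 \<Longrightarrow> g s \<noteq> 0"
    "\<And>s. Re s > 1 \<Longrightarrow> deriv F s / F s = deriv g s / g s + (of_nat k - of_nat m) / (s - 1)"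
proof -
  obtain H where H: "H holomorphic_on UNIV" "\<And>s. s \<noteq> 1 \<Longrightarrow> H s = (s - 1) ^ m * F s"
    using selberg_axiomsD(7)[OF ax] by metis
  have Fnz: "F s \<noteq> 0" if "Re s > 1/2" "s \<noteq> 1" for s
    by (rule GRH_nonvanishing[OF grh selberg_axiomsD(4)[OF ax] that]) auto
  have "H 2 \<noteq> 0" using Fnz[of 2] by (simp add: H(2))
  then obtain k g where g: "g holomorphic_on UNIV" "g 1 \<noteq> 0" and Hg: "\<And>s. H s = (s - 1) ^ k * g s"
    using entire_factor_zero[OF H(1), of 2 1] by metis
  have gF: "(s - 1) ^ m * F s = (s - 1) ^ k * g s" if "s \<noteq> 1" for s
    using H(2)[OF that] Hg[of s] by simp
  have gnz: "g s \<noteq> 0" if "Re s > 1/2" for s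
  proof (cases "s = 1")
    case False
    thus ?thesis using Fnz[OF that False] gF[OF False] by auto
  qed (use g in auto)
  have ld: "deriv F s / F s = deriv g s / g s + (of_nat k - of_nat m) / (s - 1)" if s: "Re s > 1" for s
  proof -
    have s1: "s \<noteq> 1" and s0: "s - 1 \<noteq> 0" using s by auto
    have Fg: "F z = (s - 1) ^ 0 * ((z - 1) ^ k * g z / (z - 1) ^ m)" if "z \<noteq> 1" for z
      using gF[OF that] that by (simp add: field_simps)
    have gd: "(g has_field_derivative deriv g s) (at s)"
      using g(1) by (auto intro: holomorphic_derivI)
    have pw: "((\<lambda>z. (z - 1) ^ n) has_field_derivative of_nat n * (s - 1) ^ n / (s - 1)) (at s)" for n
    proof -
      have "((\<lambda>z. (z - 1) ^ n) has_field_derivative of_nat n * (1 * (s - 1) ^ (n - Suc 0))) (at s)"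
        by (intro DERIV_power DERIV_cong[OF DERIV_diff[OF DERIV_ident DERIV_const]]) simp
      also have "of_nat n * (1 * (s - 1) ^ (n - Suc 0)) = of_nat n * (s - 1) ^ n / (s - 1)"
        using s0 by (cases n) auto
      finally show ?thesis .
    qed
    have "((\<lambda>z. (z - 1) ^ k * g z / (z - 1) ^ m) has_field_derivative
        F s * (deriv g s / g s + (of_nat k - of_nat m) / (s - 1))) (at s)"
    proof (rule DERIV_cong[OF DERIV_divide[OF DERIV_mult[OF pw gd] pw]])
      define p q where "p = (s - 1) ^ k" and "q = (s - 1) ^ m"
      have "q \<noteq> 0" "g s \<noteq> 0" using s0 gnz[of s] s by (auto simp: q_def)
      thus "((of_nat k * (s - 1) ^ k / (s - 1) * g s + deriv g s * (s - 1) ^ k) * (s - 1) ^ m -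
          (s - 1) ^ k * g s * (of_nat m * (s - 1) ^ m / (s - 1))) / ((s - 1) ^ m * (s - 1) ^ m) =
        F s * (deriv g s / g s + (of_nat k - of_nat m) / (s - 1))"
        unfolding Fg[OF s1] p_def[symmetric] q_def[symmetric] using s0
        by (simp add: divide_simps) (simp add: algebra_simps)
      show "(s - 1) ^ m \<noteq> 0" using s0 by simp
    qed
    moreover have "\<forall>\<^sub>F z in nhds s. F z = (z - 1) ^ k * g z / (z - 1) ^ m"
    proof -
      have "\<forall>\<^sub>F z in nhds s. z \<noteq> 1" using s1 by (simp add: t1_space_nhds)
      thus ?thesis by eventually_elim (use Fg in auto)
    qed
    ultimately have "(F has_field_derivative F s * (deriv g s / g s + (of_nat k - of_nat m) / (s - 1))) (at s)"
      by (subst DERIV_cong_ev[OF refl _ refl])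
    hence "deriv F s = F s * (deriv g s / g s + (of_nat k - of_nat m) / (s - 1))" by (rule DERIV_imp_deriv)
    thus ?thesis using Fnz[of s] s s1 by simp
  qed
  show ?thesis by (rule that[OF g(1) gF gnz ld])
qed

section \<open>Plancherel inequality and Laplace inversion\<close>

text \<open>A majorant p(x)*q(y) with integrable factors settles both conditions of Fubini's
  theorem; the Bochner interchanges below rest on it.\<close>

lemma integrable_pair_lborel_bound:
  fixes f :: "real \<Rightarrow> real \<Rightarrow> 'b::{banach,second_countable_topology}"
  assumes [measurable]: "(\<lambda>(x, y). f x y) \<in> borel_measurable (lborel \<Otimes>\<^sub>M lborel)"
    and p: "integrable lborel p" and q: "integrable lborel q"
    and b: "\<And>x y. norm (f x y) \<le> p x * q y"
  shows "integrable (lborel \<Otimes>\<^sub>M lborel) (\<lambda>(x, y). f x y)"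
proof (rule lborel_pair.Fubini_integrable)
  have ifx: "integrable lborel (\<lambda>y. f x y)" for x
    by (rule Bochner_Integration.integrable_bound[OF integrable_mult_right[OF q, of "p x"]])
       (use b in \<open>auto intro!: AE_I2 order.trans[OF b abs_ge_self]\<close>)
  show "AE x in lborel. integrable lborel (\<lambda>y. case (x, y) of (x, y) \<Rightarrow> f x y)" using ifx by simp
  have "integrable lborel (\<lambda>x. \<integral>y. norm (f x y) \<partial>lborel)"
  proof (rule Bochner_Integration.integrable_bound)
    show "integrable lborel (\<lambda>x. p x * (\<integral>y. q y \<partial>lborel))" using p by simp
    have "(\<integral>y. norm (f x y) \<partial>lborel) \<le> p x * (\<integral>y. q y \<partial>lborel)" for x
    proof -
      have "(\<integral>y. norm (f x y) \<partial>lborel) \<le> (\<integral>y. p x * q y \<partial>lborel)"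
        by (intro integral_mono integrable_norm ifx integrable_mult_right q b)
      thus ?thesis by simp
    qed
    thus "AE x in lborel. norm (\<integral>y. norm (f x y) \<partial>lborel) \<le> norm (p x * (\<integral>y. q y \<partial>lborel))"
      by (auto intro!: AE_I2 order.trans[OF _ abs_ge_self])
  qed measurable
  thus "integrable lborel (\<lambda>x. \<integral>y. norm (case (x, y) of (x, y) \<Rightarrow> f x y) \<partial>lborel)" by simp
qed measurable

lemma norm_integral_le_nn_integral:
  fixes f :: "'a \<Rightarrow> 'b :: {banach, second_countable_topology}"
  shows "ennreal (norm (integral\<^sup>L M f)) \<le> (\<integral>\<^sup>+x. norm (f x) \<partial>M)"
  by (cases "integrable M f") (auto simp: integral_norm_bound_ennreal not_integrable_integral_eq)

lemma gaussian_eq_normal_density: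
  assumes "\<kappa> > 0"
  shows "exp (- (\<kappa> * t)\<^sup>2 / 2) = sqrt (2 * pi) / \<kappa> * normal_density 0 (1 / \<kappa>) t"
  using assms by (simp add: normal_density_def real_sqrt_mult real_sqrt_divide power_mult_distrib field_simps)

lemma integrable_gaussian:
  assumes "\<kappa> > 0"
  shows "integrable lborel (\<lambda>t. exp (- (\<kappa> * t)\<^sup>2 / 2) :: real)"
  unfolding gaussian_eq_normal_density[OF assms] using assms by simp

text \<open>The characteristic function of the standard normal law after scaling. Writing the
  transform as a multiple of a normal density makes its total mass available for Schur's
  test.\<close>

lemma fourier_gaussian:
  fixes \<kappa> w :: real
  assumes \<kappa>: "\<kappa> > 0"
  shows "(\<integral>t. of_real (exp (- (\<kappa> * t)\<^sup>2 / 2)) * iexp (t * w) \<partial>lborel)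
     = of_real (2 * pi * normal_density 0 \<kappa> w)"
proof -
  have std: "(\<integral>x. of_real (std_normal_density x) * iexp (v * x) \<partial>lborel) = of_real (exp (- v\<^sup>2 / 2))" for v
  proof -
    have "of_real (exp (- v\<^sup>2 / 2)) = char std_normal_distribution v"
      by (simp add: char_std_normal_distribution)
    also have "\<dots> = (\<integral>x. std_normal_density x *\<^sub>R iexp (v * x) \<partial>lborel)"
      unfolding char_def by (rule integral_density) (auto simp: normal_density_nonneg)
    finally show ?thesis by (simp add: scaleR_conv_of_real)
  qed
  have "of_real (exp (- (w / \<kappa>)\<^sup>2 / 2)) = (\<integral>x. of_real (std_normal_density x) * iexp ((w / \<kappa>) * x) \<partial>lborel)"
    by (rule std[symmetric])
  also have "\<dots> = \<bar>\<kappa>\<bar> *\<^sub>R (\<integral>t. of_real (std_normal_density (0 + \<kappa> * t)) * iexp ((w / \<kappa>) * (0 + \<kappa> * t)) \<partial>lborel)"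
    by (rule lborel_integral_real_affine) (use \<kappa> in auto)
  also have "\<dots> = \<kappa> *\<^sub>R (\<integral>t. of_real (1 / sqrt (2 * pi)) * (of_real (exp (- (\<kappa> * t)\<^sup>2 / 2)) * iexp (t * w)) \<partial>lborel)"
    using \<kappa> by (simp add: std_normal_density_def mult_ac)
  also have "\<dots> = of_real (\<kappa> / sqrt (2 * pi)) * (\<integral>t. of_real (exp (- (\<kappa> * t)\<^sup>2 / 2)) * iexp (t * w) \<partial>lborel)"
    by (simp add: scaleR_conv_of_real)
  finally have eq: "of_real (\<kappa> / sqrt (2 * pi)) * (\<integral>t. of_real (exp (- (\<kappa> * t)\<^sup>2 / 2)) * iexp (t * w) \<partial>lborel)
     = complex_of_real (exp (- (w / \<kappa>)\<^sup>2 / 2))" by simp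
  define c where "c = \<kappa> / sqrt (2 * pi)"
  have c: "c > 0" using \<kappa> by (simp add: c_def)
  have cc: "2 * pi * normal_density 0 \<kappa> w = exp (- (w / \<kappa>)\<^sup>2 / 2) / c"
    using \<kappa> by (simp add: c_def normal_density_def real_sqrt_mult power_divide field_simps)
  show ?thesis unfolding cc using eq[folded c_def] c by (simp add: field_simps)
qed

text \<open>Only the inequality half of Plancherel is needed; testing against a Gaussian weight reduces it
  to Schur's test for the (positive) Gaussian kernel.\<close>

lemma plancherel_le:
  fixes h :: "real \<Rightarrow> complex"
  assumes h: "integrable lborel h" and \<kappa>: "\<kappa> > 0"
  shows "(\<integral>\<^sup>+y. exp (- (\<kappa> * y)\<^sup>2 / 2) * (norm (\<integral>t. h t * iexp (t * y) \<partial>lborel))\<^sup>2 \<partial>lborel)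
     \<le> 2 * pi * (\<integral>\<^sup>+t. (norm (h t))\<^sup>2 \<partial>lborel)"
proof -
  have [measurable]: "h \<in> borel_measurable borel" using h by (simp add: borel_measurable_integrable)
  have [measurable]: "cnj \<in> borel_measurable borel"
    by (intro borel_measurable_continuous_onI continuous_intros)
  \<comment> \<open>The weight makes the y-integral absolutely convergent, which permits the
    interchanges; the constant obtained does not depend on \<kappa>.\<close>
  define G where "G y = exp (- (\<kappa> * y)\<^sup>2 / 2)" for y :: real
  have [measurable]: "G \<in> borel_measurable borel" unfolding G_def by measurable
  have G: "integrable lborel G" unfolding G_def by (rule integrable_gaussian[OF \<kappa>])
  define N where "N w = normal_density 0 \<kappa> w" for w
  have [measurable]: "N \<in> borel_measurable borel" unfolding N_def by measurable
  have N0: "N w \<ge> 0" for w by (simp add: N_def)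
  define f where "f y = (\<integral>t. h t * iexp (t * y) \<partial>lborel)" for y
  have [measurable]: "f \<in> borel_measurable borel" unfolding f_def by measurable
  define A where "A = (\<integral>t. norm (h t) \<partial>lborel)"
  have fA: "norm (f y) \<le> A" for y
    unfolding f_def A_def by (rule order.trans[OF integral_norm_bound]) (simp add: norm_mult)
  have Gf: "integrable lborel (\<lambda>y. of_real (G y) * f y)"
    by (rule Bochner_Integration.integrable_bound[OF integrable_mult_left[OF G, of A]])
       (use fA in \<open>auto intro!: AE_I2 mult_mono order.trans[OF _ abs_ge_self] simp: norm_mult G_def\<close>)
  have inner: "(\<integral>y. of_real (G y) * f y * iexp (- (t * y)) \<partial>lborel)
      = (\<integral>t'. h t' * of_real (2 * pi * N (t' - t)) \<partial>lborel)" for t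
  proof -
    have "(\<integral>y. of_real (G y) * f y * iexp (- (t * y)) \<partial>lborel)
        = (\<integral>y. (\<integral>t'. of_real (G y) * iexp (- (t * y)) * (h t' * iexp (t' * y)) \<partial>lborel) \<partial>lborel)"
      by (intro Bochner_Integration.integral_cong refl, subst integral_mult_right_zero) (simp add: f_def mult_ac)
    also have "\<dots> = (\<integral>t'. (\<integral>y. of_real (G y) * iexp (- (t * y)) * (h t' * iexp (t' * y)) \<partial>lborel) \<partial>lborel)"
      by (rule lborel_pair.Fubini_integral[symmetric],
          rule integrable_pair_lborel_bound[OF _ G integrable_norm[OF h]])
         (auto simp: norm_mult G_def)
    also have "\<dots> = (\<integral>t'. h t' * (\<integral>y. of_real (G y) * iexp (y * (t' - t)) \<partial>lborel) \<partial>lborel)"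
    proof (intro Bochner_Integration.integral_cong refl)
      fix t'
      have "(\<integral>y. of_real (G y) * iexp (- (t * y)) * (h t' * iexp (t' * y)) \<partial>lborel)
          = (\<integral>y. h t' * (of_real (G y) * iexp (y * (t' - t))) \<partial>lborel)"
        by (intro Bochner_Integration.integral_cong refl)
           (simp add: mult_exp_exp algebra_simps)
      thus "(\<integral>y. of_real (G y) * iexp (- (t * y)) * (h t' * iexp (t' * y)) \<partial>lborel)
          = h t' * (\<integral>y. of_real (G y) * iexp (y * (t' - t)) \<partial>lborel)" by simp
    qed
    also have "\<dots> = (\<integral>t'. h t' * of_real (2 * pi * N (t' - t)) \<partial>lborel)"
      unfolding G_def N_def fourier_gaussian[OF \<kappa>] ..
    finally show ?thesis .
  qed
  define J where "J = (\<integral>y. G y * (norm (f y))\<^sup>2 \<partial>lborel)"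
  have Gff: "integrable lborel (\<lambda>y. G y * (norm (f y))\<^sup>2)"
    by (rule Bochner_Integration.integrable_bound[OF integrable_mult_left[OF G, of "A\<^sup>2"]])
       (use fA in \<open>auto intro!: AE_I2 mult_mono power_mono order.trans[OF _ abs_ge_self] simp: norm_mult G_def\<close>)
  \<comment> \<open>Writing |f|^2 as f times its conjugate turns J into a quadratic form in h with
    kernel 2*pi*N(t' - t).\<close>
  have "of_real J = (\<integral>y. complex_of_real (G y * (norm (f y))\<^sup>2) \<partial>lborel)"
    unfolding J_def by (rule integral_complex_of_real[symmetric])
  also have "\<dots> = (\<integral>y. (\<integral>t. of_real (G y) * f y * (cnj (h t) * iexp (- (t * y))) \<partial>lborel) \<partial>lborel)"
  proof (intro Bochner_Integration.integral_cong refl)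
    fix y
    have "cnj (f y) = (\<integral>t. cnj (h t * iexp (t * y)) \<partial>lborel)"
      unfolding f_def by (rule Bochner_Integration.integral_cnj[symmetric])
    also have "\<dots> = (\<integral>t. cnj (h t) * iexp (- (t * y)) \<partial>lborel)"
      by (simp add: exp_cnj)
    finally have cn: "cnj (f y) = (\<integral>t. cnj (h t) * iexp (- (t * y)) \<partial>lborel)" .
    have "complex_of_real (G y * (norm (f y))\<^sup>2) = of_real (G y) * f y * cnj (f y)"
      using complex_norm_square[of "f y"] by (simp add: mult.assoc)
    thus "complex_of_real (G y * (norm (f y))\<^sup>2) = (\<integral>t. of_real (G y) * f y * (cnj (h t) * iexp (- (t * y))) \<partial>lborel)"
      unfolding cn by simp
  qed
  also have "\<dots> = (\<integral>t. (\<integral>y. of_real (G y) * f y * (cnj (h t) * iexp (- (t * y))) \<partial>lborel) \<partial>lborel)"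
    by (rule lborel_pair.Fubini_integral[symmetric],
        rule integrable_pair_lborel_bound[OF _ integrable_norm[OF Gf] integrable_norm[OF h]])
       (auto simp: norm_mult G_def)
  also have "\<dots> = (\<integral>t. cnj (h t) * (\<integral>y. of_real (G y) * f y * iexp (- (t * y)) \<partial>lborel) \<partial>lborel)"
    by (intro Bochner_Integration.integral_cong refl, subst integral_mult_right_zero[symmetric]) (simp add: mult_ac)
  also have "\<dots> = (\<integral>t. cnj (h t) * (\<integral>t'. h t' * of_real (2 * pi * N (t' - t)) \<partial>lborel) \<partial>lborel)"
    unfolding inner ..
  finally have J: "of_real J = (\<integral>t. cnj (h t) * (\<integral>t'. h t' * of_real (2 * pi * N (t' - t)) \<partial>lborel) \<partial>lborel)" .
  have J0: "J \<ge> 0" unfolding J_def by (auto simp: G_def)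
  have "(\<integral>\<^sup>+y. G y * (norm (f y))\<^sup>2 \<partial>lborel) = ennreal J"
    unfolding J_def by (rule nn_integral_eq_integral[OF Gff]) (auto simp: G_def)
  also have "\<dots> = ennreal (norm (complex_of_real J))" using J0 by simp
  also have "\<dots> \<le> (\<integral>\<^sup>+t. norm (cnj (h t) * (\<integral>t'. h t' * of_real (2 * pi * N (t' - t)) \<partial>lborel)) \<partial>lborel)"
    unfolding J by (rule norm_integral_le_nn_integral)
  \<comment> \<open>Schur's test: 2ab \<le> a^2 + b^2 separates the two values of h, and in each of
    the two parts the kernel N integrates to 1.\<close>
  also have "\<dots> \<le> (\<integral>\<^sup>+t. \<integral>\<^sup>+t'. ennreal (pi * N (t' - t) * (norm (h t))\<^sup>2) + ennreal (pi * N (t' - t) * (norm (h t'))\<^sup>2) \<partial>lborel \<partial>lborel)"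
  proof (rule nn_integral_mono)
    fix t
    have "ennreal (norm (cnj (h t) * (\<integral>t'. h t' * of_real (2 * pi * N (t' - t)) \<partial>lborel)))
       = ennreal (norm (\<integral>t'. cnj (h t) * (h t' * of_real (2 * pi * N (t' - t))) \<partial>lborel))" by simp
    also have "\<dots> \<le> (\<integral>\<^sup>+t'. norm (cnj (h t) * (h t' * of_real (2 * pi * N (t' - t)))) \<partial>lborel)"
      by (rule norm_integral_le_nn_integral)
    also have "\<dots> \<le> (\<integral>\<^sup>+t'. ennreal (pi * N (t' - t) * (norm (h t))\<^sup>2) + ennreal (pi * N (t' - t) * (norm (h t'))\<^sup>2) \<partial>lborel)"
    proof (rule nn_integral_mono)
      fix t'
      have "norm (cnj (h t) * (h t' * of_real (2 * pi * N (t' - t)))) = pi * N (t' - t) * (2 * norm (h t) * norm (h t'))"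
        using N0[of "t' - t"] by (simp add: norm_mult mult_ac)
      also have "\<dots> \<le> pi * N (t' - t) * ((norm (h t))\<^sup>2 + (norm (h t'))\<^sup>2)"
        using N0[of "t' - t"] by (intro mult_left_mono sum_squares_bound) auto
      finally show "ennreal (norm (cnj (h t) * (h t' * of_real (2 * pi * N (t' - t)))))
          \<le> ennreal (pi * N (t' - t) * (norm (h t))\<^sup>2) + ennreal (pi * N (t' - t) * (norm (h t'))\<^sup>2)"
        using N0[of "t' - t"] by (simp add: distrib_left flip: ennreal_plus)
    qed
    finally show "ennreal (norm (cnj (h t) * (\<integral>t'. h t' * of_real (2 * pi * N (t' - t)) \<partial>lborel)))
      \<le> (\<integral>\<^sup>+t'. ennreal (pi * N (t' - t) * (norm (h t))\<^sup>2) + ennreal (pi * N (t' - t) * (norm (h t'))\<^sup>2) \<partial>lborel)" .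
  qed
  also have "\<dots> = (\<integral>\<^sup>+t. \<integral>\<^sup>+t'. ennreal (pi * N (t' - t) * (norm (h t))\<^sup>2) \<partial>lborel \<partial>lborel)
      + (\<integral>\<^sup>+t. \<integral>\<^sup>+t'. ennreal (pi * N (t' - t) * (norm (h t'))\<^sup>2) \<partial>lborel \<partial>lborel)"
    by (simp add: nn_integral_add)
  also have "(\<integral>\<^sup>+t. \<integral>\<^sup>+t'. ennreal (pi * N (t' - t) * (norm (h t'))\<^sup>2) \<partial>lborel \<partial>lborel)
       = (\<integral>\<^sup>+t'. \<integral>\<^sup>+t. ennreal (pi * N (t' - t) * (norm (h t'))\<^sup>2) \<partial>lborel \<partial>lborel)"
    by (rule lborel_pair.Fubini') measurable
  also have "(\<integral>\<^sup>+t. \<integral>\<^sup>+t'. ennreal (pi * N (t' - t) * (norm (h t))\<^sup>2) \<partial>lborel \<partial>lborel) = (\<integral>\<^sup>+t. pi * (norm (h t))\<^sup>2 \<partial>lborel)"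
  proof (intro nn_integral_cong)
    fix t
    have "(\<integral>\<^sup>+t'. ennreal (pi * N (t' - t) * (norm (h t))\<^sup>2) \<partial>lborel)
        = (\<integral>\<^sup>+t'. ennreal (pi * (norm (h t))\<^sup>2) * ennreal (normal_density t \<kappa> t') \<partial>lborel)"
      by (intro nn_integral_cong) (simp add: N_def normal_density_def mult_ac flip: ennreal_mult')
    also have "\<dots> = ennreal (pi * (norm (h t))\<^sup>2) * (\<integral>\<^sup>+t'. ennreal (normal_density t \<kappa> t') \<partial>lborel)"
      by (rule nn_integral_cmult) measurable
    also have "(\<integral>\<^sup>+t'. ennreal (normal_density t \<kappa> t') \<partial>lborel) = 1"
      using \<kappa> by (subst nn_integral_eq_integral) auto
    finally show "(\<integral>\<^sup>+t'. ennreal (pi * N (t' - t) * (norm (h t))\<^sup>2) \<partial>lborel) = ennreal (pi * (norm (h t))\<^sup>2)" by simp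
  qed
  also have "(\<integral>\<^sup>+t'. \<integral>\<^sup>+t. ennreal (pi * N (t' - t) * (norm (h t'))\<^sup>2) \<partial>lborel \<partial>lborel) = (\<integral>\<^sup>+t. pi * (norm (h t))\<^sup>2 \<partial>lborel)"
  proof (intro nn_integral_cong)
    fix t'
    have Nt: "N (t' - t) = normal_density t' \<kappa> t" for t
      unfolding N_def normal_density_def using power2_commute[of t' t] by simp
    have "(\<integral>\<^sup>+t. ennreal (pi * N (t' - t) * (norm (h t'))\<^sup>2) \<partial>lborel)
        = (\<integral>\<^sup>+t. ennreal (pi * (norm (h t'))\<^sup>2) * ennreal (normal_density t' \<kappa> t) \<partial>lborel)"
      by (intro nn_integral_cong) (simp add: Nt mult_ac flip: ennreal_mult')
    also have "\<dots> = ennreal (pi * (norm (h t'))\<^sup>2) * (\<integral>\<^sup>+t. ennreal (normal_density t' \<kappa> t) \<partial>lborel)"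
      by (rule nn_integral_cmult) measurable
    also have "(\<integral>\<^sup>+t. ennreal (normal_density t' \<kappa> t) \<partial>lborel) = 1"
      using \<kappa> by (subst nn_integral_eq_integral) auto
    finally show "(\<integral>\<^sup>+t. ennreal (pi * N (t' - t) * (norm (h t'))\<^sup>2) \<partial>lborel) = ennreal (pi * (norm (h t'))\<^sup>2)" by simp
  qed
  also have "(\<integral>\<^sup>+t. pi * (norm (h t))\<^sup>2 \<partial>lborel) + (\<integral>\<^sup>+t. pi * (norm (h t))\<^sup>2 \<partial>lborel) = 2 * pi * (\<integral>\<^sup>+t. (norm (h t))\<^sup>2 \<partial>lborel)"
  proof -
    have "(\<integral>\<^sup>+t. pi * (norm (h t))\<^sup>2 \<partial>lborel) = ennreal pi * (\<integral>\<^sup>+t. (norm (h t))\<^sup>2 \<partial>lborel)"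
      by (subst nn_integral_cmult[symmetric]) (auto simp: ennreal_mult')
    thus ?thesis by (simp only: mult_2 distrib_right ennreal_plus[OF pi_ge_zero pi_ge_zero])
  qed
  finally show ?thesis unfolding G_def f_def .
qed

section \<open>Contour shift and Laplace inversion with a Gaussian regulariser\<close>

text \<open>Cauchy's theorem on a rectangle: the vertical sides differ by what the two horizontal
  sides, each of length b - a, contribute.\<close>

lemma rectangle_vertical_sides:
  fixes W :: "complex \<Rightarrow> complex"
  assumes hol: "W holomorphic_on S" and sub: "{s. a \<le> Re s \<and> Re s \<le> b} \<subseteq> S"
    and ab: "a < b" and T: "T > 0"
    and bd: "\<And>s. a \<le> Re s \<Longrightarrow> Re s \<le> b \<Longrightarrow> \<bar>Im s\<bar> = T \<Longrightarrow> norm (W s) \<le> B"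
  shows "norm (integral {-T..T} (\<lambda>t. W (Complex b t)) - integral {-T..T} (\<lambda>t. W (Complex a t))) \<le> 2 * (b - a) * B"
proof -
  define Q where "Q = cbox (Complex a (-T)) (Complex b T)"
  have memQ: "z \<in> Q \<longleftrightarrow> a \<le> Re z \<and> Re z \<le> b \<and> \<bar>Im z\<bar> \<le> T" for z
    by (auto simp: Q_def in_cbox_complex_iff)
  have holQ: "W holomorphic_on Q" using hol by (rule holomorphic_on_subset) (use sub memQ in auto)
  have cvx: "convex Q" unfolding Q_def by (rule convex_box)
  define p1 p2 p3 p4 where "p1 = Complex a (-T)" and "p2 = Complex b (-T)" and "p3 = Complex b T" and "p4 = Complex a T"
  have pQ: "p1 \<in> Q" "p2 \<in> Q" "p3 \<in> Q" "p4 \<in> Q"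
    using ab T by (auto simp: memQ p1_def p2_def p3_def p4_def)
  have seg: "closed_segment u v \<subseteq> Q" if "u \<in> Q" "v \<in> Q" for u v
    using that cvx by (simp add: closed_segment_subset)
  have cont: "continuous_on (closed_segment u v) W" if "u \<in> Q" "v \<in> Q" for u v
    using holomorphic_on_imp_continuous_on[OF holQ] seg[OF that] continuous_on_subset by blast
  have ci: "W contour_integrable_on linepath u v" if "u \<in> Q" "v \<in> Q" for u v
    by (rule contour_integrable_continuous_linepath[OF cont[OF that]])
  define \<gamma> where "\<gamma> = linepath p1 p2 +++ linepath p2 p3 +++ linepath p3 p4 +++ linepath p4 p1"
  have "(W has_contour_integral 0) \<gamma>"
  proof (rule Cauchy_theorem_convex_simple[OF holQ cvx])
    show "path_image \<gamma> \<subseteq> Q" unfolding \<gamma>_def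
      using seg pQ by (auto simp: path_image_join)
  qed (auto simp: \<gamma>_def)
  hence "0 = contour_integral \<gamma> W" by (simp add: contour_integral_unique)
  also have "\<dots> = contour_integral (linepath p1 p2) W + contour_integral (linepath p2 p3) W
      + contour_integral (linepath p3 p4) W + contour_integral (linepath p4 p1) W"
    unfolding \<gamma>_def using ci pQ by (simp add: contour_integrable_joinI valid_path_join)
  also have "contour_integral (linepath p4 p1) W = - contour_integral (linepath p1 p4) W"
    by (rule contour_integral_reverse_linepath) (use cont pQ in auto)
  finally have eq: "contour_integral (linepath p2 p3) W - contour_integral (linepath p1 p4) W
      = - (contour_integral (linepath p1 p2) W + contour_integral (linepath p3 p4) W)"
    by (simp add: algebra_simps)
  have v1: "contour_integral (linepath p2 p3) W = \<i> * integral {-T..T} (\<lambda>t. W (Complex b t))"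
    by (rule contour_integral_linepath_same_Re) (use T in \<open>auto simp: p2_def p3_def\<close>)
  have v2: "contour_integral (linepath p1 p4) W = \<i> * integral {-T..T} (\<lambda>t. W (Complex a t))"
    by (rule contour_integral_linepath_same_Re) (use T in \<open>auto simp: p1_def p4_def\<close>)
  have B0: "B \<ge> 0" using order.trans[OF norm_ge_zero bd[of p3]] ab T by (simp add: p3_def)
  have h1: "norm (contour_integral (linepath p1 p2) W) \<le> B * norm (p2 - p1)"
  proof (rule contour_integral_bound_linepath[OF ci[OF pQ(1,2)] B0])
    fix x assume "x \<in> closed_segment p1 p2"
    hence "Im x = - T" "a \<le> Re x" "Re x \<le> b"
      using ab by (auto simp: p1_def p2_def closed_segment_same_Im closed_segment_eq_real_ivl)
    thus "norm (W x) \<le> B" using T by (intro bd) auto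
  qed
  have h2: "norm (contour_integral (linepath p3 p4) W) \<le> B * norm (p4 - p3)"
  proof (rule contour_integral_bound_linepath[OF ci[OF pQ(3,4)] B0])
    fix x assume "x \<in> closed_segment p3 p4"
    hence "Im x = T" "a \<le> Re x" "Re x \<le> b"
      using ab by (auto simp: p3_def p4_def closed_segment_same_Im closed_segment_eq_real_ivl)
    thus "norm (W x) \<le> B" using T by (intro bd) auto
  qed
  have d1: "norm (p2 - p1) = b - a"
  proof -
    have "p2 - p1 = of_real (b - a)" by (simp add: p1_def p2_def complex_eq_iff)
    hence "norm (p2 - p1) = \<bar>b - a\<bar>" by (simp only: norm_of_real)
    thus ?thesis using ab by linarith
  qed
  have d2: "norm (p4 - p3) = b - a"
  proof -
    have "p4 - p3 = of_real (a - b)" by (simp add: p3_def p4_def complex_eq_iff)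
    hence "norm (p4 - p3) = \<bar>a - b\<bar>" by (simp only: norm_of_real)
    thus ?thesis using ab by linarith
  qed
  have "norm (integral {-T..T} (\<lambda>t. W (Complex b t)) - integral {-T..T} (\<lambda>t. W (Complex a t)))
     = norm (contour_integral (linepath p2 p3) W - contour_integral (linepath p1 p4) W)"
    unfolding v1 v2 by (simp add: norm_mult flip: right_diff_distrib)
  also have "\<dots> \<le> norm (contour_integral (linepath p1 p2) W) + norm (contour_integral (linepath p3 p4) W)"
    unfolding eq norm_minus_cancel by (rule norm_triangle_ineq)
  also have "\<dots> \<le> B * (b - a) + B * (b - a)" using h1 h2 unfolding d1 d2 by (rule add_mono)
  also have "\<dots> = 2 * (b - a) * B" by (simp add: algebra_simps)
  finally show ?thesis .
qed

lemma integral_symmetric_interval_LIMSEQ: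
  fixes f :: "real \<Rightarrow> complex"
  assumes f: "integrable lborel f"
  shows "(\<lambda>n. integral {- real n..real n} f) \<longlonglongrightarrow> integral\<^sup>L lborel f"
proof -
  have [measurable]: "f \<in> borel_measurable borel" using f by (simp add: borel_measurable_integrable)
  have si: "set_integrable lborel {- real n..real n} f" for n
    unfolding set_integrable_def using f by (intro integrable_mult_indicator) auto
  have "(\<lambda>n. \<integral>t. indicator {- real n..real n} t *\<^sub>R f t \<partial>lborel) \<longlonglongrightarrow> integral\<^sup>L lborel f"
  proof (rule integral_dominated_convergence[where w = "\<lambda>t. norm (f t)"])
    show "AE t in lborel. (\<lambda>n. indicator {- real n..real n} t *\<^sub>R f t) \<longlonglongrightarrow> f t"
    proof (rule AE_I2)
      fix t :: real
      obtain N :: nat where N: "\<bar>t\<bar> \<le> real N" using real_arch_simple by blast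
      have "\<forall>\<^sub>F n in sequentially. indicator {- real n..real n} t *\<^sub>R f t = f t"
        using eventually_ge_at_top[of N] by eventually_elim (use N in \<open>auto simp: indicator_def\<close>)
      thus "(\<lambda>n. indicator {- real n..real n} t *\<^sub>R f t) \<longlonglongrightarrow> f t" by (rule tendsto_eventually)
    qed
    show "integrable lborel (\<lambda>t. norm (f t))" using f by simp
  qed (auto simp: indicator_def)
  thus ?thesis
    unfolding set_borel_integral_eq_integral(2)[OF si, symmetric] set_lebesgue_integral_def .
qed

text \<open>The Gaussian bound makes every vertical integral absolutely convergent and lets the
  horizontal sides vanish as the height runs through the positive integers.\<close>

lemma vertical_line_shift:
  fixes W :: "complex \<Rightarrow> complex"
  assumes hol: "W holomorphic_on S" and sub: "{s. a \<le> Re s \<and> Re s \<le> b} \<subseteq> S" and ab: "a < b" and \<kappa>: "\<kappa> > 0"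
    and bd: "\<And>s. a \<le> Re s \<Longrightarrow> Re s \<le> b \<Longrightarrow> norm (W s) \<le> C * exp (- (\<kappa> * Im s)\<^sup>2 / 2)"
  shows "(\<integral>t. W (Complex b t) \<partial>lborel) = (\<integral>t. W (Complex a t) \<partial>lborel)"
    and "\<And>x. a \<le> x \<Longrightarrow> x \<le> b \<Longrightarrow> integrable lborel (\<lambda>t. W (Complex x t))"
proof -
  show int: "integrable lborel (\<lambda>t. W (Complex x t))" if x: "a \<le> x" "x \<le> b" for x
  proof (rule Bochner_Integration.integrable_bound[OF integrable_mult_right[OF integrable_gaussian[OF \<kappa>], of C]])
    have "continuous_on UNIV (\<lambda>t. W (Complex x t))"
      by (rule continuous_on_compose2[OF holomorphic_on_imp_continuous_on[OF hol]])
         (use sub x in \<open>auto intro!: continuous_intros simp: Complex_eq\<close>)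
    thus "(\<lambda>t. W (Complex x t)) \<in> borel_measurable lborel"
      by (simp add: borel_measurable_continuous_onI)
    show "AE t in lborel. norm (W (Complex x t)) \<le> norm (C * exp (- (\<kappa> * t)\<^sup>2 / 2))"
      using bd[of "Complex x _"] x by (auto intro!: AE_I2 order.trans[OF _ abs_ge_self])
  qed
  have lim0: "(\<lambda>n. 2 * (b - a) * (C * exp (- (\<kappa> * real n)\<^sup>2 / 2))) \<longlonglongrightarrow> 2 * (b - a) * (C * 0)"
    by (intro tendsto_mult_left) (use \<kappa> in real_asymp)
  have "(\<lambda>n. integral {- real n..real n} (\<lambda>t. W (Complex b t)) - integral {- real n..real n} (\<lambda>t. W (Complex a t)))
     \<longlonglongrightarrow> (\<integral>t. W (Complex b t) \<partial>lborel) - (\<integral>t. W (Complex a t) \<partial>lborel)"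
    using ab by (intro tendsto_diff integral_symmetric_interval_LIMSEQ int) auto
  moreover have "(\<lambda>n. integral {- real n..real n} (\<lambda>t. W (Complex b t)) - integral {- real n..real n} (\<lambda>t. W (Complex a t))) \<longlonglongrightarrow> 0"
  proof (rule Lim_null_comparison)
    show "(\<lambda>n. 2 * (b - a) * (C * exp (- (\<kappa> * real n)\<^sup>2 / 2))) \<longlonglongrightarrow> 0" using lim0 by simp
    show "\<forall>\<^sub>F n in sequentially. norm (integral {- real n..real n} (\<lambda>t. W (Complex b t)) - integral {- real n..real n} (\<lambda>t. W (Complex a t)))
        \<le> 2 * (b - a) * (C * exp (- (\<kappa> * real n)\<^sup>2 / 2))"
      using eventually_gt_at_top[of 0]
    proof eventually_elim
      case (elim n)
      show ?case
      proof (rule rectangle_vertical_sides[OF hol sub ab])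
        show "real n > 0" using elim by simp
        fix s assume s: "a \<le> Re s" "Re s \<le> b" "\<bar>Im s\<bar> = real n"
        hence "(\<kappa> * Im s)\<^sup>2 = (\<kappa> * real n)\<^sup>2" by (metis power2_abs power_mult_distrib)
        thus "norm (W s) \<le> C * exp (- (\<kappa> * real n)\<^sup>2 / 2)" using bd[OF s(1,2)] by simp
      qed
    qed
  qed
  ultimately show "(\<integral>t. W (Complex b t) \<partial>lborel) = (\<integral>t. W (Complex a t) \<partial>lborel)"
    using LIMSEQ_unique by fastforce
qed

text \<open>Majorant for the mollification; the 3 is the exponent in the growth bound on D.
  Completing the square turns exp(3z) and exp(-3z) times the standard density into exp(9/2) times
  the densities centred at 3 and -3.\<close>

lemma integrable_exp_abs_std_normal:
  "integrable lborel (\<lambda>z::real. exp (3 * \<bar>z\<bar>) * std_normal_density z)"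
proof (rule Bochner_Integration.integrable_bound)
  show "integrable lborel (\<lambda>z. exp (9/2) * normal_density 3 1 z + exp (9/2) * normal_density (-3) 1 z)"
    by (intro Bochner_Integration.integrable_add integrable_mult_right integrable_normal_density) auto
  have e1: "exp (9/2) * normal_density 3 1 z = exp (3 * z) * std_normal_density z" for z :: real
    by (simp add: normal_density_def mult_exp_exp power2_eq_square field_simps)
  have e2: "exp (9/2) * normal_density (-3) 1 z = exp (- 3 * z) * std_normal_density z" for z :: real
    by (simp add: normal_density_def mult_exp_exp power2_eq_square field_simps)
  have "exp (3 * \<bar>z\<bar>) * std_normal_density z \<le> exp (3 * z) * std_normal_density z + exp (- 3 * z) * std_normal_density z" for z :: real
    by (cases "z \<ge> 0") (auto simp: normal_density_nonneg)
  thus "AE z in lborel. norm (exp (3 * \<bar>z\<bar>) * std_normal_density z)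
     \<le> norm (exp (9/2) * normal_density 3 1 z + exp (9/2) * normal_density (-3) 1 z)"
    unfolding e1 e2 by (auto intro!: AE_I2 order.trans[OF _ abs_ge_self])
qed measurable

text \<open>The value does not depend on the abscissa x: after completing the square, the factor B
  cancels the shift by \<open>\<kappa>\<^sup>2 * x\<close> in the density.\<close>

lemma gaussian_vertical_integral:
  assumes \<kappa>: "\<kappa> > 0"
  shows "(\<integral>t. exp (of_real (\<kappa>\<^sup>2 / 2) * (Complex x t)\<^sup>2 + Complex x t * of_real w) \<partial>lborel)
     = of_real (2 * pi * normal_density 0 \<kappa> w)"
proof -
  define B where "B = exp (\<kappa>\<^sup>2 * x\<^sup>2 / 2 + x * w)"
  have "exp (of_real (\<kappa>\<^sup>2 / 2) * (Complex x t)\<^sup>2 + Complex x t * of_real w)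
      = of_real B * (of_real (exp (- (\<kappa> * t)\<^sup>2 / 2)) * iexp (t * (w + \<kappa>\<^sup>2 * x)))" for t
  proof -
    have "of_real (\<kappa>\<^sup>2 / 2) * (Complex x t)\<^sup>2 + Complex x t * of_real w
       = of_real (\<kappa>\<^sup>2 * x\<^sup>2 / 2 + x * w) + (of_real (- (\<kappa> * t)\<^sup>2 / 2) + \<i> * of_real (t * (w + \<kappa>\<^sup>2 * x)))"
      by (rule complex_eqI) (simp_all add: power2_eq_square field_simps)
    thus ?thesis by (simp only: exp_add B_def exp_of_real)
  qed
  hence "(\<integral>t. exp (of_real (\<kappa>\<^sup>2 / 2) * (Complex x t)\<^sup>2 + Complex x t * of_real w) \<partial>lborel)
     = of_real B * (\<integral>t. of_real (exp (- (\<kappa> * t)\<^sup>2 / 2)) * iexp (t * (w + \<kappa>\<^sup>2 * x)) \<partial>lborel)"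
    by (simp only: integral_mult_right_zero)
  also have "\<dots> = of_real (2 * pi * (B * normal_density 0 \<kappa> (w + \<kappa>\<^sup>2 * x)))"
    unfolding fourier_gaussian[OF \<kappa>] by simp
  also have "B * normal_density 0 \<kappa> (w + \<kappa>\<^sup>2 * x) = normal_density 0 \<kappa> w"
  proof -
    have "\<kappa>\<^sup>2 * x\<^sup>2 / 2 + x * w + - (w + \<kappa>\<^sup>2 * x)\<^sup>2 / (2 * \<kappa>\<^sup>2) = - w\<^sup>2 / (2 * \<kappa>\<^sup>2)"
      using \<kappa> by (simp add: field_simps power2_eq_square)
    hence "B * exp (- (w + \<kappa>\<^sup>2 * x)\<^sup>2 / (2 * \<kappa>\<^sup>2)) = exp (- w\<^sup>2 / (2 * \<kappa>\<^sup>2))"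
      unfolding B_def by (simp only: mult_exp_exp)
    thus ?thesis unfolding normal_density_def by simp
  qed
  finally show ?thesis .
qed

text \<open>Multiplying the transform by exp(\<kappa>^2*s^2/2) makes the inversion integral
  absolutely convergent; on the side of D it amounts to convolution with the normal density of width
  \<kappa>. The line Re s = 4 lies to the right of the growth exponent 3 of D.\<close>

lemma laplace_inversion_smoothed:
  fixes D :: "real \<Rightarrow> complex" and T :: "complex \<Rightarrow> complex"
  assumes Dm: "D \<in> borel_measurable borel"
    and C0: "C0 \<ge> 0" and Db: "\<And>u. norm (D u) \<le> C0 * exp (3 * u)" and D0: "\<And>u. u < - A0 \<Longrightarrow> D u = 0"
    and lap: "\<And>s. Re s = 4 \<Longrightarrow> (\<integral>u. D u * exp (- s * of_real u) \<partial>lborel) = T s"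
    and \<kappa>: "\<kappa> > 0"
  shows "(\<integral>t. T (Complex 4 t) * exp (of_real (\<kappa>\<^sup>2 / 2) * (Complex 4 t)\<^sup>2 + Complex 4 t * of_real y) \<partial>lborel)
     = of_real (2 * pi) * (\<integral>u. D u * of_real (normal_density 0 \<kappa> (y - u)) \<partial>lborel)"
proof -
  note [measurable] = Dm
  have p: "integrable lborel (\<lambda>u. norm (D u) * exp (- 4 * u))"
  proof (rule Bochner_Integration.integrable_bound)
    show "integrable lborel (\<lambda>u. C0 * (indicator {- A0..} u * exp (- u)))"
    proof (rule integrable_mult_right)
      have "integrable lborel (\<lambda>v. indicator {0<..} v *\<^sub>R exp (-(1::real) * v))"
        using integrable_I0i_exp_mscale[of 1] by (simp add: set_integrable_def)
      \<comment> \<open>The extra 1 lets the open half line contain the closed half line starting at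
        -A0.\<close>
      hence "integrable lborel (\<lambda>v. indicator {0<..} (A0 + 1 + 1 * v) *\<^sub>R exp (-(1::real) * (A0 + 1 + 1 * v)))"
        by (rule lborel_integrable_real_affine) simp
      hence "integrable lborel (\<lambda>v. exp (A0 + 1) * (indicator {0<..} (A0 + 1 + 1 * v) *\<^sub>R exp (-(1::real) * (A0 + 1 + 1 * v))))"
        by (rule integrable_mult_right)
      thus "integrable lborel (\<lambda>u. indicator {- A0..} u * exp (- u) :: real)"
        by (rule Bochner_Integration.integrable_bound)
           (auto intro!: AE_I2 simp: indicator_def mult_exp_exp)
    qed
    have "norm (D u) * exp (- 4 * u) \<le> C0 * (indicator {- A0..} u * exp (- u))" for u
    proof (cases "u < - A0")
      case False
      have "norm (D u) * exp (- 4 * u) \<le> C0 * exp (3 * u) * exp (- 4 * u)"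
        by (intro mult_right_mono Db) auto
      also have "\<dots> = C0 * exp (- u)" by (simp add: mult.assoc mult_exp_exp)
      finally show ?thesis using False by simp
    qed (simp add: D0)
    thus "AE u in lborel. norm (norm (D u) * exp (- 4 * u)) \<le> norm (C0 * (indicator {- A0..} u * exp (- u)))"
      by (auto intro!: AE_I2 order.trans[OF _ abs_ge_self])
  qed measurable
  define E where "E t w = exp (of_real (\<kappa>\<^sup>2 / 2) * (Complex 4 t)\<^sup>2 + Complex 4 t * of_real w)" for t w
  have E_def': "E t w = exp (of_real (\<kappa>\<^sup>2 / 2) * (4 + \<i> * of_real t)\<^sup>2 + (4 + \<i> * of_real t) * of_real w)" for t w
    by (simp add: E_def Complex_eq)
  have [measurable]: "(\<lambda>(t, w). E t w) \<in> borel_measurable (borel \<Otimes>\<^sub>M borel)"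
    unfolding E_def' by measurable
  have nE: "norm (E t w) = exp (8 * \<kappa>\<^sup>2 + 4 * w) * exp (- (\<kappa> * t)\<^sup>2 / 2)" for t w
  proof -
    have "Re (of_real (\<kappa>\<^sup>2 / 2) * (Complex 4 t)\<^sup>2 + Complex 4 t * of_real w) = (8 * \<kappa>\<^sup>2 + 4 * w) + (- (\<kappa> * t)\<^sup>2 / 2)"
      by (simp add: power2_eq_square field_simps)
    thus ?thesis by (simp only: E_def norm_exp_eq_Re mult_exp_exp)
  qed
  have "(\<integral>t. T (Complex 4 t) * E t y \<partial>lborel) = (\<integral>t. (\<integral>u. D u * E t (y - u) \<partial>lborel) \<partial>lborel)"
  proof (intro Bochner_Integration.integral_cong refl)
    fix t
    have "T (Complex 4 t) * E t y = (\<integral>u. D u * exp (- Complex 4 t * of_real u) \<partial>lborel) * E t y"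
      by (subst lap) auto
    also have "\<dots> = (\<integral>u. D u * exp (- Complex 4 t * of_real u) * E t y \<partial>lborel)" by simp
    also have "\<dots> = (\<integral>u. D u * E t (y - u) \<partial>lborel)"
      by (intro Bochner_Integration.integral_cong refl)
         (simp add: E_def mult.assoc mult_exp_exp algebra_simps)
    finally show "T (Complex 4 t) * E t y = (\<integral>u. D u * E t (y - u) \<partial>lborel)" .
  qed
  also have "\<dots> = (\<integral>u. (\<integral>t. D u * E t (y - u) \<partial>lborel) \<partial>lborel)"
  proof (rule lborel_pair.Fubini_integral, rule integrable_pair_lborel_bound[OF _ p])
    show "integrable lborel (\<lambda>t. exp (8 * \<kappa>\<^sup>2 + 4 * y) * exp (- (\<kappa> * t)\<^sup>2 / 2))"
      by (intro integrable_mult_right integrable_gaussian \<kappa>)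
    show "norm (D u * E t (y - u)) \<le> norm (D u) * exp (- 4 * u) * (exp (8 * \<kappa>\<^sup>2 + 4 * y) * exp (- (\<kappa> * t)\<^sup>2 / 2))" for u t
      by (simp add: norm_mult nE mult_exp_exp algebra_simps)
  qed measurable
  also have "\<dots> = (\<integral>u. of_real (2 * pi) * (D u * of_real (normal_density 0 \<kappa> (y - u))) \<partial>lborel)"
    unfolding integral_mult_right_zero E_def gaussian_vertical_integral[OF \<kappa>]
    by (subst integral_mult_right_zero[symmetric]) (simp add: mult_ac)
  finally show ?thesis unfolding E_def by simp
qed

text \<open>After the inversion line has been moved from 4 to \<sigma>, exp(-\<sigma>*y) times the
  mollified D is a Fourier transform in y, and the Plancherel inequality applies. The bound is
  uniform in \<kappa> \<le> 1, as the later limit requires, and in a and b.\<close>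

lemma laplace_plancherel_smoothed:
  fixes D :: "real \<Rightarrow> complex" and T :: "complex \<Rightarrow> complex"
  assumes Dm: "D \<in> borel_measurable borel"
    and C0: "C0 \<ge> 0" and Db: "\<And>u. norm (D u) \<le> C0 * exp (3 * u)" and D0: "\<And>u. u < - A0 \<Longrightarrow> D u = 0"
    and lap: "\<And>s. Re s = 4 \<Longrightarrow> (\<integral>u. D u * exp (- s * of_real u) \<partial>lborel) = T s"
    and hol: "T holomorphic_on {s. Re s > 1/2}" and \<sigma>: "1/2 < \<sigma>" "\<sigma> < 4"
    and Tb: "\<And>s. \<sigma> \<le> Re s \<Longrightarrow> Re s \<le> 4 \<Longrightarrow> norm (T s) \<le> C1"
    and \<kappa>: "\<kappa> > 0" "\<kappa> \<le> 1"
  shows "(\<integral>\<^sup>+y. indicator {a..b} y * ennreal ((norm (\<integral>u. D u * of_real (normal_density 0 \<kappa> (y - u)) \<partial>lborel))\<^sup>2 * exp (- 2 * \<sigma> * y)) \<partial>lborel)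
     \<le> ennreal (exp 17) * (\<integral>\<^sup>+t. (norm (T (Complex \<sigma> t)))\<^sup>2 \<partial>lborel)"
proof -
  note [measurable] = Dm
  have C1: "C1 \<ge> 0" using order.trans[OF norm_ge_zero Tb[of 4]] \<sigma> by simp
  define W where "W y s = T s * exp (of_real (\<kappa>\<^sup>2 / 2) * s\<^sup>2 + s * of_real y)" for y s
  have k2: "\<kappa>\<^sup>2 \<le> 1" using \<kappa> by (simp add: power_le_one)
  have Wb: "norm (W y s) \<le> C1 * exp (8 + 4 * \<bar>y\<bar>) * exp (- (\<kappa> * Im s)\<^sup>2 / 2)" if s: "\<sigma> \<le> Re s" "Re s \<le> 4" for y s
  proof -
    have eq: "Re (of_real (\<kappa>\<^sup>2 / 2) * s\<^sup>2 + s * of_real y) = \<kappa>\<^sup>2 * (Re s)\<^sup>2 / 2 + Re s * y + (- (\<kappa> * Im s)\<^sup>2 / 2)"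
      by (simp add: power2_eq_square field_simps)
    have "\<kappa>\<^sup>2 * (Re s)\<^sup>2 / 2 \<le> 1 * 4\<^sup>2 / 2"
      using k2 s \<sigma> by (intro divide_right_mono mult_mono power_mono) auto
    hence b1: "\<kappa>\<^sup>2 * (Re s)\<^sup>2 / 2 \<le> 8" by simp
    have b2: "Re s * y \<le> 4 * \<bar>y\<bar>"
      using s \<sigma> by (intro order.trans[OF mult_left_mono[OF abs_ge_self[of y]] mult_right_mono]) auto
    have "Re (of_real (\<kappa>\<^sup>2 / 2) * s\<^sup>2 + s * of_real y) \<le> (8 + 4 * \<bar>y\<bar>) + (- (\<kappa> * Im s)\<^sup>2 / 2)"
      unfolding eq using b1 b2 by (intro add_mono order_refl)
    hence "norm (exp (of_real (\<kappa>\<^sup>2 / 2) * s\<^sup>2 + s * of_real y)) \<le> exp (8 + 4 * \<bar>y\<bar>) * exp (- (\<kappa> * Im s)\<^sup>2 / 2)"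
      unfolding norm_exp_eq_Re exp_add[symmetric] by simp
    hence "norm (W y s) \<le> C1 * (exp (8 + 4 * \<bar>y\<bar>) * exp (- (\<kappa> * Im s)\<^sup>2 / 2))"
      unfolding W_def norm_mult using Tb[OF s] C1 by (intro mult_mono) auto
    thus ?thesis by (simp add: mult.assoc)
  qed
  have holW: "W y holomorphic_on {s. Re s > 1/2}" for y
    unfolding W_def using hol by (intro holomorphic_intros)
  have sub: "{s. \<sigma> \<le> Re s \<and> Re s \<le> 4} \<subseteq> {s. Re s > 1/2}" using \<sigma> by auto
  note shift = vertical_line_shift[OF holW sub \<sigma>(2) \<kappa>(1) Wb]
  define h where "h t = W 0 (Complex \<sigma> t)" for t
  have hint: "integrable lborel h" unfolding h_def using shift(2)[of \<sigma> 0] \<sigma> by auto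
  have [measurable]: "h \<in> borel_measurable borel" using hint by (simp add: borel_measurable_integrable)
  have Wh: "W y (Complex \<sigma> t) = of_real (exp (\<sigma> * y)) * (h t * iexp (t * y))" for y t
  proof -
    have "Complex \<sigma> t * of_real y = of_real (\<sigma> * y) + \<i> * of_real (t * y)" by (simp add: complex_eq_iff)
    thus ?thesis unfolding W_def h_def by (simp add: exp_add exp_of_real[symmetric] mult_ac)
  qed
  define f where "f y = (\<integral>t. h t * iexp (t * y) \<partial>lborel)" for y
  define Dk where "Dk y = (\<integral>u. D u * of_real (normal_density 0 \<kappa> (y - u)) \<partial>lborel)" for y
  have [measurable]: "f \<in> borel_measurable borel" unfolding f_def by measurable
  have Df: "of_real (2 * pi) * Dk y = of_real (exp (\<sigma> * y)) * f y" for y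
  proof -
    have "of_real (2 * pi) * Dk y = (\<integral>t. W y (Complex 4 t) \<partial>lborel)"
      unfolding Dk_def W_def by (rule laplace_inversion_smoothed[OF Dm C0 Db D0 lap \<kappa>(1), symmetric])
    also have "\<dots> = (\<integral>t. W y (Complex \<sigma> t) \<partial>lborel)" by (rule shift(1))
    also have "\<dots> = of_real (exp (\<sigma> * y)) * f y" unfolding Wh f_def by simp
    finally show ?thesis .
  qed
  have nD: "(norm (Dk y))\<^sup>2 * exp (- 2 * \<sigma> * y) = (norm (f y))\<^sup>2 / (2 * pi)\<^sup>2" for y
  proof -
    have "2 * pi * norm (Dk y) = exp (\<sigma> * y) * norm (f y)"
      using arg_cong[OF Df[of y], of norm] by (simp add: norm_mult)
    hence "norm (Dk y) = exp (\<sigma> * y) * norm (f y) / (2 * pi)" by (simp add: field_simps)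
    moreover have "(exp (\<sigma> * y))\<^sup>2 * exp (- 2 * \<sigma> * y) = 1"
      by (simp add: power2_eq_square mult_exp_exp)
    ultimately show ?thesis by (simp add: power_divide power_mult_distrib mult_ac)
  qed
  \<comment> \<open>A Gaussian so flat that it is at least exp(-1/2) on [a, b] stands in for the
    indicator of [a, b].\<close>
  define R where "R = \<bar>a\<bar> + \<bar>b\<bar> + 1"
  have R: "R \<ge> 1" by (simp add: R_def)
  define G where "G y = exp (- (1 / R * y)\<^sup>2 / 2)" for y :: real
  have G1: "1 \<le> exp (1/2) * G y" if "y \<in> {a..b}" for y
  proof -
    have "\<bar>1 / R * y\<bar> \<le> 1" using that R by (auto simp: R_def abs_mult field_simps)
    hence "(1 / R * y)\<^sup>2 \<le> 1" by (simp add: abs_square_le_1)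
    thus ?thesis unfolding G_def mult_exp_exp by simp
  qed
  have "(\<integral>\<^sup>+y. indicator {a..b} y * ennreal ((norm (Dk y))\<^sup>2 * exp (- 2 * \<sigma> * y)) \<partial>lborel)
     \<le> (\<integral>\<^sup>+y. ennreal (exp (1/2) / (2 * pi)\<^sup>2) * ennreal (G y * (norm (f y))\<^sup>2) \<partial>lborel)"
  proof (rule nn_integral_mono)
    fix y
    show "indicator {a..b} y * ennreal ((norm (Dk y))\<^sup>2 * exp (- 2 * \<sigma> * y)) \<le> ennreal (exp (1/2) / (2 * pi)\<^sup>2) * ennreal (G y * (norm (f y))\<^sup>2)"
    proof (cases "y \<in> {a..b}")
      case True
      have "1 * ((norm (f y))\<^sup>2 / (2 * pi)\<^sup>2) \<le> (exp (1/2) * G y) * ((norm (f y))\<^sup>2 / (2 * pi)\<^sup>2)"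
        using G1[OF True] by (intro mult_right_mono) auto
      hence "(norm (Dk y))\<^sup>2 * exp (- 2 * \<sigma> * y) \<le> exp (1/2) / (2 * pi)\<^sup>2 * (G y * (norm (f y))\<^sup>2)"
        unfolding nD by simp
      thus ?thesis using True by (simp add: ennreal_mult'[symmetric] ennreal_leI)
    qed simp
  qed
  also have "\<dots> = ennreal (exp (1/2) / (2 * pi)\<^sup>2) * (\<integral>\<^sup>+y. G y * (norm (f y))\<^sup>2 \<partial>lborel)"
    unfolding G_def by (rule nn_integral_cmult) measurable
  also have "(\<integral>\<^sup>+y. G y * (norm (f y))\<^sup>2 \<partial>lborel) \<le> ennreal (2 * pi) * (\<integral>\<^sup>+t. (norm (h t))\<^sup>2 \<partial>lborel)"
    unfolding G_def f_def by (rule plancherel_le[OF hint]) (use R in auto)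
  also have "(\<integral>\<^sup>+t. (norm (h t))\<^sup>2 \<partial>lborel) \<le> (\<integral>\<^sup>+t. ennreal (exp 16) * ennreal ((norm (T (Complex \<sigma> t)))\<^sup>2) \<partial>lborel)"
  proof (rule nn_integral_mono)
    fix t
    have "Re (of_real (\<kappa>\<^sup>2 / 2) * (Complex \<sigma> t)\<^sup>2) = \<kappa>\<^sup>2 * \<sigma>\<^sup>2 / 2 - (\<kappa> * t)\<^sup>2 / 2"
      by (simp add: power2_eq_square field_simps)
    also have "\<dots> \<le> 1 * 4\<^sup>2 / 2 - 0"
      using k2 \<sigma> by (intro diff_mono divide_right_mono mult_mono power_mono) auto
    finally have "norm (exp (of_real (\<kappa>\<^sup>2 / 2) * (Complex \<sigma> t)\<^sup>2)) \<le> exp 8" by simp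
    hence "norm (h t) \<le> exp 8 * norm (T (Complex \<sigma> t))"
      unfolding h_def W_def by (simp add: norm_mult mult_left_mono mult.commute)
    hence "(norm (h t))\<^sup>2 \<le> (exp 8 * norm (T (Complex \<sigma> t)))\<^sup>2" by (intro power_mono) auto
    also have "\<dots> = exp 16 * (norm (T (Complex \<sigma> t)))\<^sup>2"
      by (simp add: power_mult_distrib power2_eq_square mult_exp_exp)
    finally show "ennreal ((norm (h t))\<^sup>2) \<le> ennreal (exp 16) * ennreal ((norm (T (Complex \<sigma> t)))\<^sup>2)"
      by (simp add: ennreal_mult'[symmetric] ennreal_leI)
  qed
  also have "\<dots> = ennreal (exp 16) * (\<integral>\<^sup>+t. ennreal ((norm (T (Complex \<sigma> t)))\<^sup>2) \<partial>lborel)"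
  proof (rule nn_integral_cmult)
    have "continuous_on UNIV (\<lambda>t. T (Complex \<sigma> t))"
      by (rule continuous_on_compose2[OF holomorphic_on_imp_continuous_on[OF hol]])
         (use \<sigma> in \<open>auto intro!: continuous_intros simp: Complex_eq\<close>)
    hence [measurable]: "(\<lambda>t. T (Complex \<sigma> t)) \<in> borel_measurable borel"
      by (simp add: borel_measurable_continuous_onI)
    show "(\<lambda>t. ennreal ((norm (T (Complex \<sigma> t)))\<^sup>2)) \<in> borel_measurable lborel" by measurable
  qed
  finally have "(\<integral>\<^sup>+y. indicator {a..b} y * ennreal ((norm (Dk y))\<^sup>2 * exp (- 2 * \<sigma> * y)) \<partial>lborel)
     \<le> ennreal (exp (1/2) / (2 * pi)\<^sup>2) * (ennreal (2 * pi) * (ennreal (exp 16) * (\<integral>\<^sup>+t. ennreal ((norm (T (Complex \<sigma> t)))\<^sup>2) \<partial>lborel)))"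
    by (simp add: mult_left_mono)
  also have "\<dots> = ennreal (exp (1/2) / (2 * pi)\<^sup>2 * (2 * pi) * exp 16) * (\<integral>\<^sup>+t. ennreal ((norm (T (Complex \<sigma> t)))\<^sup>2) \<partial>lborel)"
  proof -
    have "ennreal (exp (1/2) / (2 * pi)\<^sup>2 * (2 * pi) * exp 16) = ennreal (exp (1/2) / (2 * pi)\<^sup>2) * ennreal (2 * pi) * ennreal (exp 16)"
      by (subst ennreal_mult, simp, simp, subst ennreal_mult) simp_all
    thus ?thesis by (simp only: mult.assoc)
  qed
  \<comment> \<open>The exponent is 1/2 from the flat Gaussian plus 16 from squaring
    |exp(\<kappa>^2*s^2/2)| \<le> exp 8 on the line of abscissa \<sigma> < 4, rounded up to
    17.\<close>
  also have "\<dots> \<le> ennreal (exp 17) * (\<integral>\<^sup>+t. ennreal ((norm (T (Complex \<sigma> t)))\<^sup>2) \<partial>lborel)"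
  proof (intro mult_right_mono ennreal_leI)
    have "exp (1/2) / (2 * pi)\<^sup>2 * (2 * pi) * exp 16 = exp (33/2) / (2 * pi)"
      by (simp add: power2_eq_square mult_exp_exp field_simps)
    also have "\<dots> \<le> exp (33/2) / 1" using pi_gt3 by (intro divide_left_mono) auto
    also have "\<dots> \<le> exp (17::real)" by simp
    finally show "exp (1/2) / (2 * pi)\<^sup>2 * (2 * pi) * exp 16 \<le> exp (17::real)" .
  qed auto
  finally show ?thesis unfolding Dk_def .
qed

text \<open>After u = y - z/(n + 1) the kernel is the fixed standard density. As the width is at
  most 1, |D| at the moved point is at most a constant times exp(3|z|), so dominated convergence
  applies.\<close>

lemma gaussian_mollifier_LIMSEQ:
  fixes D :: "real \<Rightarrow> complex"
  assumes Dm: "D \<in> borel_measurable borel"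
    and C0: "C0 \<ge> 0" and Db: "\<And>u. norm (D u) \<le> C0 * exp (3 * u)" and cont: "isCont D y"
  shows "(\<lambda>n. \<integral>u. D u * of_real (normal_density 0 (1 / real (Suc n)) (y - u)) \<partial>lborel) \<longlonglongrightarrow> D y"
proof -
  note [measurable] = Dm
  define k where "k n = 1 / real (Suc n)" for n
  have k: "k n > 0" "k n \<le> 1" for n by (auto simp: k_def)
  have k0: "k \<longlonglongrightarrow> 0" unfolding k_def by real_asymp
  have eq: "(\<integral>u. D u * of_real (normal_density 0 (k n) (y - u)) \<partial>lborel)
      = (\<integral>z. D (y + - k n * z) * of_real (std_normal_density z) \<partial>lborel)" for n
  proof -
    have nd: "k n * normal_density 0 (k n) (k n * z) = std_normal_density z" for z
      using k[of n] by (simp add: normal_density_def real_sqrt_mult power_mult_distrib)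
    have "(\<integral>u. D u * of_real (normal_density 0 (k n) (y - u)) \<partial>lborel)
       = \<bar>- k n\<bar> *\<^sub>R (\<integral>z. D (y + - k n * z) * of_real (normal_density 0 (k n) (y - (y + - k n * z))) \<partial>lborel)"
      by (rule lborel_integral_real_affine) (use k[of n] in auto)
    also have "\<dots> = (\<integral>z. \<bar>- k n\<bar> *\<^sub>R (D (y + - k n * z) * of_real (normal_density 0 (k n) (y - (y + - k n * z)))) \<partial>lborel)"
      by (rule integral_scaleR_right[symmetric])
    also have "\<dots> = (\<integral>z. D (y + - k n * z) * of_real (std_normal_density z) \<partial>lborel)"
    proof (intro Bochner_Integration.integral_cong refl)
      fix z
      have "\<bar>- k n\<bar> *\<^sub>R (D (y + - k n * z) * of_real (normal_density 0 (k n) (y - (y + - k n * z))))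
          = D (y + - k n * z) * of_real (k n * normal_density 0 (k n) (k n * z))"
        using k(1)[of n] by (simp add: scaleR_conv_of_real mult_ac)
      thus "\<bar>- k n\<bar> *\<^sub>R (D (y + - k n * z) * of_real (normal_density 0 (k n) (y - (y + - k n * z))))
          = D (y + - k n * z) * of_real (std_normal_density z)" by (simp only: nd)
    qed
    finally show ?thesis .
  qed
  have "(\<lambda>n. \<integral>z. D (y + - k n * z) * of_real (std_normal_density z) \<partial>lborel)
      \<longlonglongrightarrow> (\<integral>z. D y * of_real (std_normal_density z) \<partial>lborel)"
  proof (rule integral_dominated_convergence)
    show "integrable lborel (\<lambda>z. C0 * exp (3 * y) * (exp (3 * \<bar>z\<bar>) * std_normal_density z))"
      by (intro integrable_mult_right integrable_exp_abs_std_normal)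
    show "AE z in lborel. (\<lambda>n. D (y + - k n * z) * of_real (std_normal_density z)) \<longlonglongrightarrow> D y * of_real (std_normal_density z)"
    proof (rule AE_I2, rule tendsto_mult_right)
      fix z
      have "(\<lambda>n. y + - k n * z) \<longlonglongrightarrow> y + - 0 * z" by (intro tendsto_intros k0)
      thus "(\<lambda>n. D (y + - k n * z)) \<longlonglongrightarrow> D y" using cont by (intro isCont_tendsto_compose[of y D]) auto
    qed
    show "AE z in lborel. norm (D (y + - k n * z) * of_real (std_normal_density z)) \<le> C0 * exp (3 * y) * (exp (3 * \<bar>z\<bar>) * std_normal_density z)" for n
    proof (rule AE_I2)
      fix z
      have "\<bar>- k n * z\<bar> \<le> 1 * \<bar>z\<bar>"
        unfolding abs_mult using k[of n] by (intro mult_right_mono) auto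
      hence "- k n * z \<le> \<bar>z\<bar>" by (metis abs_ge_self mult_1 order_trans)
      moreover have "3 * (y + q) \<le> 3 * y + 3 * \<bar>z\<bar>" if "q \<le> \<bar>z\<bar>" for q using that by simp
      ultimately have "3 * (y + - k n * z) \<le> 3 * y + 3 * \<bar>z\<bar>" by blast
      hence "C0 * exp (3 * (y + - k n * z)) \<le> C0 * exp (3 * y + 3 * \<bar>z\<bar>)"
        using C0 by (intro mult_left_mono) (simp_all only: exp_le_cancel_iff)
      hence "norm (D (y + - k n * z)) \<le> C0 * exp (3 * y) * exp (3 * \<bar>z\<bar>)"
        using Db[of "y + - k n * z"] by (simp add: exp_add mult.assoc)
      hence "norm (D (y + - k n * z)) * std_normal_density z \<le> C0 * exp (3 * y) * exp (3 * \<bar>z\<bar>) * std_normal_density z"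
        by (intro mult_right_mono) auto
      thus "norm (D (y + - k n * z) * of_real (std_normal_density z)) \<le> C0 * exp (3 * y) * (exp (3 * \<bar>z\<bar>) * std_normal_density z)"
        by (simp add: norm_mult mult.assoc)
    qed
  qed measurable
  also have "(\<integral>z. D y * of_real (std_normal_density z) \<partial>lborel) = D y * of_real (\<integral>z. std_normal_density z \<partial>lborel)"
    by simp
  also have "\<dots> = D y" by simp
  finally have "(\<lambda>n. \<integral>u. D u * of_real (normal_density 0 (k n) (y - u)) \<partial>lborel) \<longlonglongrightarrow> D y"
    by (simp only: eq)
  thus ?thesis by (simp only: k_def)
qed

text \<open>Fatou's lemma removes the mollifier. Convergence is needed only almost everywhere, so D
  may have jumps on a null set.\<close>

lemma laplace_plancherel:
  fixes D :: "real \<Rightarrow> complex" and T :: "complex \<Rightarrow> complex"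
  assumes Dm: "D \<in> borel_measurable borel"
    and C0: "C0 \<ge> 0" and Db: "\<And>u. norm (D u) \<le> C0 * exp (3 * u)" and D0: "\<And>u. u < - A0 \<Longrightarrow> D u = 0"
    and lap: "\<And>s. Re s = 4 \<Longrightarrow> (\<integral>u. D u * exp (- s * of_real u) \<partial>lborel) = T s"
    and hol: "T holomorphic_on {s. Re s > 1/2}" and \<sigma>: "1/2 < \<sigma>" "\<sigma> < 4"
    and Tb: "\<And>s. \<sigma> \<le> Re s \<Longrightarrow> Re s \<le> 4 \<Longrightarrow> norm (T s) \<le> C1"
    and cont: "AE y in lborel. isCont D y"
  shows "(\<integral>\<^sup>+y. indicator {a..b} y * ennreal ((norm (D y))\<^sup>2 * exp (- 2 * \<sigma> * y)) \<partial>lborel)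
     \<le> ennreal (exp 17) * (\<integral>\<^sup>+t. (norm (T (Complex \<sigma> t)))\<^sup>2 \<partial>lborel)"
proof -
  note [measurable] = Dm
  define u where "u n y = indicator {a..b} y * ennreal ((norm (\<integral>u. D u * of_real (normal_density 0 (1 / real (Suc n)) (y - u)) \<partial>lborel))\<^sup>2 * exp (- 2 * \<sigma> * y))" for n y
  have [measurable]: "u n \<in> borel_measurable borel" for n unfolding u_def by measurable
  have "(\<integral>\<^sup>+y. indicator {a..b} y * ennreal ((norm (D y))\<^sup>2 * exp (- 2 * \<sigma> * y)) \<partial>lborel)
      = (\<integral>\<^sup>+y. liminf (\<lambda>n. u n y) \<partial>lborel)"
  proof (rule nn_integral_cong_AE)
    from cont show "AE y in lborel. indicator {a..b} y * ennreal ((norm (D y))\<^sup>2 * exp (- 2 * \<sigma> * y)) = liminf (\<lambda>n. u n y)"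
    proof eventually_elim
      case (elim y)
      have "(\<lambda>n. u n y) \<longlonglongrightarrow> indicator {a..b} y * ennreal ((norm (D y))\<^sup>2 * exp (- 2 * \<sigma> * y))"
      proof (cases "y \<in> {a..b}")
        case True
        have "(\<lambda>n. ennreal ((norm (\<integral>u. D u * of_real (normal_density 0 (1 / real (Suc n)) (y - u)) \<partial>lborel))\<^sup>2 * exp (- 2 * \<sigma> * y)))
           \<longlonglongrightarrow> ennreal ((norm (D y))\<^sup>2 * exp (- 2 * \<sigma> * y))"
          by (intro tendsto_ennrealI tendsto_mult_right tendsto_power tendsto_norm gaussian_mollifier_LIMSEQ[OF Dm C0 Db elim])
        thus ?thesis using True unfolding u_def by simp
      qed (simp add: u_def)
      thus ?case using lim_imp_Liminf[OF sequentially_bot] by fastforce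
    qed
  qed
  also have "\<dots> \<le> liminf (\<lambda>n. \<integral>\<^sup>+y. u n y \<partial>lborel)"
    by (rule nn_integral_liminf) measurable
  also have "\<dots> \<le> ennreal (exp 17) * (\<integral>\<^sup>+t. (norm (T (Complex \<sigma> t)))\<^sup>2 \<partial>lborel)"
  proof (rule Liminf_le)
    show "\<forall>\<^sub>F n in sequentially. (\<integral>\<^sup>+y. u n y \<partial>lborel) \<le> ennreal (exp 17) * (\<integral>\<^sup>+t. (norm (T (Complex \<sigma> t)))\<^sup>2 \<partial>lborel)"
      unfolding u_def
      by (intro always_eventually allI laplace_plancherel_smoothed[OF Dm C0 Db D0 lap hol \<sigma> Tb]) auto
  qed simp
  finally show ?thesis .
qed

section \<open>Mean square under GRH\<close>

lemma psiF_measurable [measurable]: "psiF \<Lambda> \<in> borel_measurable borel"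
proof -
  have "(\<lambda>x::real. nat \<lfloor>x\<rfloor>) \<in> borel \<rightarrow>\<^sub>M count_space UNIV"
    by (rule measurable_compose[OF measurable_real_floor]) simp
  from measurable_compose[OF this, of "\<lambda>n. \<Sum>k\<in>{1..n}. \<Lambda> k" borel]
  show ?thesis by (simp add: psiF_def[abs_def])
qed

lemma psiF_eq_0: "x < 1 \<Longrightarrow> psiF \<Lambda> x = 0"
  by (simp add: psiF_def)

lemma psiF_locally_constant:
  assumes "x \<notin> \<int>"
  shows "\<forall>\<^sub>F y in nhds x. psiF \<Lambda> y = psiF \<Lambda> x"
proof -
  have "of_int \<lfloor>x\<rfloor> < x" using assms by (metis Ints_of_int floor_correct less_le)
  moreover have "x < of_int \<lfloor>x\<rfloor> + 1" by (rule floor_correct[THEN conjunct2, simplified])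
  ultimately have "\<forall>\<^sub>F y in nhds x. y \<in> {of_int \<lfloor>x\<rfloor> <..< of_int \<lfloor>x\<rfloor> + 1}"
    by (intro eventually_nhds_in_open) auto
  thus ?thesis
  proof eventually_elim
    case (elim y)
    hence "\<lfloor>y\<rfloor> = \<lfloor>x\<rfloor>" by (intro floor_unique) auto
    thus ?case by (simp add: psiF_def)
  qed
qed

text \<open>The terms of the convergent series at s = 2 are bounded. This crude estimate only has to
  yield a growth bound for psi and absolute convergence on Re s = 4.\<close>

lemma vonMangoldt_F_quadratic_bound:
  assumes "is_vonMangoldt_F F \<Lambda>"
  obtains C where "C \<ge> 0" "\<And>n. n \<ge> 1 \<Longrightarrow> norm (\<Lambda> n) \<le> C * real n ^ 2"
proof -
  have "ds_term \<Lambda> 2 sums - (deriv F 2 / F 2)" using assms unfolding is_vonMangoldt_F_def by simp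
  hence "ds_term \<Lambda> 2 \<longlonglongrightarrow> 0" by (intro summable_LIMSEQ_zero) (rule sums_summable)
  hence "Bseq (ds_term \<Lambda> 2)" by (intro convergent_imp_Bseq) (auto simp: convergent_def)
  then obtain C where C: "C > 0" "\<And>k. norm (ds_term \<Lambda> 2 k) \<le> C" by (auto simp: Bseq_def)
  have "norm (\<Lambda> n) \<le> C * real n ^ 2" if n: "n \<ge> 1" for n
  proof -
    obtain k where k: "n = Suc k" using n by (cases n) auto
    have "norm (\<Lambda> n) / real n powr 2 \<le> C" using C(2)[of k] unfolding norm_ds_term k by simp
    thus ?thesis using n by (simp add: divide_le_eq)
  qed
  thus ?thesis using C that[of C] by auto
qed

lemma psiF_cubic_bound:
  assumes C: "C \<ge> 0" "\<And>n. n \<ge> 1 \<Longrightarrow> norm (\<Lambda> n) \<le> C * real n ^ 2" and x: "x \<ge> 0"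
  shows "norm (psiF \<Lambda> x) \<le> C * x ^ 3"
proof -
  define N where "N = nat \<lfloor>x\<rfloor>"
  have N: "real N \<le> x" using x by (simp add: N_def)
  have "norm (psiF \<Lambda> x) \<le> (\<Sum>n\<in>{1..N}. C * real N ^ 2)"
    unfolding psiF_def N_def[symmetric]
  proof (rule sum_norm_le)
    fix n assume n: "n \<in> {1..N}"
    hence "norm (\<Lambda> n) \<le> C * real n ^ 2" by (intro C) auto
    also have "\<dots> \<le> C * real N ^ 2" using n C by (intro mult_left_mono power_mono) auto
    finally show "norm (\<Lambda> n) \<le> C * real N ^ 2" .
  qed
  also have "\<dots> = C * real N ^ 3" by (simp add: power3_eq_cube power2_eq_square mult_ac)
  also have "\<dots> \<le> C * x ^ 3" using C N by (intro mult_left_mono power_mono) auto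
  finally show ?thesis .
qed

lemma has_bochner_integral_exp_halfline:
  fixes s :: complex
  assumes s: "Re s > 0"
  shows "has_bochner_integral lborel (\<lambda>u. indicator {a..} u *\<^sub>R exp (- s * of_real u)) (exp (- s * of_real a) / s)"
proof -
  have s0: "s \<noteq> 0" using s by auto
  have "integrable lborel (\<lambda>u. indicator {a<..} u *\<^sub>R exp (- Re s * u) :: real)"
  proof -
    have "integrable lborel (\<lambda>x. indicator {0<..} x *\<^sub>R exp (-(x * Re s)) :: real)"
      using integrable_I0i_exp_mscale[OF s] by (simp add: set_integrable_def)
    hence "integrable lborel (\<lambda>x. indicator {0<..} (- a + 1 * x) *\<^sub>R exp (-((- a + 1 * x) * Re s)) :: real)"
      by (rule lborel_integrable_real_affine) simp
    hence "integrable lborel (\<lambda>x. exp (- a * Re s) * (indicator {0<..} (- a + 1 * x) *\<^sub>R exp (-((- a + 1 * x) * Re s))) :: real)"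
      by (rule integrable_mult_right)
    also have "(\<lambda>x. exp (- a * Re s) * (indicator {0<..} (- a + 1 * x) *\<^sub>R exp (-((- a + 1 * x) * Re s))))
       = (\<lambda>u. indicator {a<..} u *\<^sub>R exp (- Re s * u))"
      by (auto simp: indicator_def mult_exp_exp algebra_simps fun_eq_iff)
    finally show ?thesis .
  qed
  hence int: "set_integrable lborel {a<..} (\<lambda>u. exp (- s * of_real u))"
    unfolding set_integrable_def
    by (rule Bochner_Integration.integrable_bound) (auto intro!: AE_I2 simp: indicator_def)
  have "(LBINT u=ereal a..\<infinity>. exp (- s * of_real u)) = 0 - (- exp (- s * of_real a) / s)"
  proof (rule interval_integral_FTC_integrable[where F = "\<lambda>u. - exp (- s * of_real u) / s"])
    show "((\<lambda>u. - exp (- s * of_real u) / s) has_vector_derivative exp (- s * of_real x)) (at x)" for x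
      using s0 by (auto intro!: derivative_eq_intros has_vector_derivative_real_field)
    show "isCont (\<lambda>u. exp (- s * of_real u)) x" for x by (intro continuous_intros)
    show "set_integrable lborel (einterval (ereal a) \<infinity>) (\<lambda>u. exp (- s * of_real u))" using int by simp
    show "(((\<lambda>u. - exp (- s * of_real u) / s) \<circ> real_of_ereal) \<longlongrightarrow> - exp (- s * of_real a) / s) (at_right (ereal a))"
      unfolding o_def ereal_tendsto_simps1 ereal_tendsto_simps by (intro tendsto_intros s0)
    have "((\<lambda>u. exp (- Re s * u)) \<longlongrightarrow> 0) at_top" using s by real_asymp
    hence "((\<lambda>u. exp (- s * of_real u)) \<longlongrightarrow> 0) at_top"
      by (subst tendsto_norm_zero_iff[symmetric]) simp
    hence "((\<lambda>u. - exp (- s * of_real u) / s) \<longlongrightarrow> - 0 / s) at_top" by (intro tendsto_intros s0)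
    thus "(((\<lambda>u. - exp (- s * of_real u) / s) \<circ> real_of_ereal) \<longlongrightarrow> 0) (at_left \<infinity>)"
      unfolding ereal_tendsto_simps1 by simp
  qed auto
  hence "(\<integral>u. indicator {a<..} u *\<^sub>R exp (- s * of_real u) \<partial>lborel) = exp (- s * of_real a) / s"
    by (simp add: interval_lebesgue_integral_def set_lebesgue_integral_def)
  hence "has_bochner_integral lborel (\<lambda>u. indicator {a<..} u *\<^sub>R exp (- s * of_real u)) (exp (- s * of_real a) / s)"
    using int by (simp add: has_bochner_integral_iff set_integrable_def)
  \<comment> \<open>The closed half line is the one needed, because psi at x includes the term n =
    x; it differs from the open one by a point.\<close>
  moreover have "AE u in lborel. indicator {a<..} u *\<^sub>R exp (- s * of_real u) = indicator {a..} u *\<^sub>R exp (- s * of_real u)"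
    using AE_lborel_singleton[of a] by eventually_elim (auto simp: indicator_def)
  ultimately show ?thesis
    by (subst (asm) has_bochner_integral_cong_AE) auto
qed

text \<open>psi(exp u) is the sum over n of \<Lambda>(n) times the indicator of u \<ge> ln n, and
  each step function has transform n^(-s)/s. Quadratic coefficients against n^(-4) make the
  integrals of the norms summable.\<close>

lemma laplace_psiF:
  assumes C: "C \<ge> 0" "\<And>n. n \<ge> 1 \<Longrightarrow> norm (\<Lambda> n) \<le> C * real n ^ 2" and s: "Re s = 4"
    and sums: "ds_term \<Lambda> s sums L"
  shows "has_bochner_integral lborel (\<lambda>u. psiF \<Lambda> (exp u) * exp (- s * of_real u)) (L / s)"
proof -
  have s0: "s \<noteq> 0" and s4: "Re s > 0" using s by auto
  define f where "f k u = \<Lambda> (Suc k) * (indicator {ln (real (Suc k))..} u *\<^sub>R exp (- s * of_real u))" for k :: nat and u :: real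
  have pw: "exp (- s * of_real (ln (real (Suc k)))) = 1 / of_nat (Suc k) powr s" for k :: nat
  proof -
    have "(of_nat (Suc k) :: complex) powr s = exp (s * of_real (ln (real (Suc k))))"
      by (simp add: powr_def Ln_of_nat del: of_nat_Suc)
    thus ?thesis by (simp add: exp_minus field_simps)
  qed
  have fk: "has_bochner_integral lborel (f k) (ds_term \<Lambda> s k / s)" for k
  proof -
    have "has_bochner_integral lborel (f k) (\<Lambda> (Suc k) * (exp (- s * of_real (ln (real (Suc k)))) / s))"
      unfolding f_def by (intro has_bochner_integral_mult_right has_bochner_integral_exp_halfline s4)
    thus ?thesis unfolding pw by (simp add: ds_term_def)
  qed
  have nf: "(\<integral>u. norm (f k u) \<partial>lborel) = norm (\<Lambda> (Suc k)) * (1 / real (Suc k) ^ 4 / 4)" for k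
  proof -
    have "(\<integral>u. norm (f k u) \<partial>lborel) = Re (\<integral>u. complex_of_real (norm (f k u)) \<partial>lborel)" by simp
    also have "(\<lambda>u. complex_of_real (norm (f k u))) = (\<lambda>u. of_real (norm (\<Lambda> (Suc k))) * (indicator {ln (real (Suc k))..} u *\<^sub>R exp (- 4 * of_real u)))"
    proof
      fix u
      have "norm (exp (- s * of_real u)) = exp (- 4 * u)" using s by simp
      moreover have "complex_of_real (exp (- 4 * u)) = exp (- 4 * of_real u)" by (simp flip: exp_of_real)
      ultimately show "complex_of_real (norm (f k u)) = of_real (norm (\<Lambda> (Suc k))) * (indicator {ln (real (Suc k))..} u *\<^sub>R exp (- 4 * of_real u))"
        unfolding f_def norm_mult norm_scaleR by (simp only: of_real_mult) (simp add: indicator_def scaleR_conv_of_real)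
    qed
    also have "integral\<^sup>L lborel \<dots> = of_real (norm (\<Lambda> (Suc k))) * (exp (- 4 * of_real (ln (real (Suc k)))) / 4)"
      using has_bochner_integral_mult_right[OF has_bochner_integral_exp_halfline[of 4 "ln (real (Suc k))"], of "of_real (norm (\<Lambda> (Suc k)))"]
      by (simp add: has_bochner_integral_integral_eq)
    also have "exp (- 4 * complex_of_real (ln (real (Suc k)))) = of_real (1 / real (Suc k) ^ 4)"
    proof -
      have "exp (- 4 * complex_of_real (ln (real (Suc k)))) = of_real (exp (- (4 * ln (real (Suc k)))))" by (simp flip: exp_of_real)
      also have "exp (- (4 * ln (real (Suc k)))) = 1 / exp (ln (real (Suc k))) ^ 4"
        using exp_of_nat_mult[of 4 "ln (real (Suc k))"] by (simp add: exp_minus divide_inverse del: of_nat_Suc)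
      finally show ?thesis by (simp del: of_nat_Suc)
    qed
    finally show ?thesis by (simp del: of_nat_Suc flip: of_real_mult)
  qed
  have smn: "summable (\<lambda>k. \<integral>u. norm (f k u) \<partial>lborel)"
  proof (rule summable_comparison_test)
    have "summable (\<lambda>k. 1 / real k ^ 2)" using inverse_power_summable[of 2] by (simp add: divide_inverse)
    hence "summable (\<lambda>k. 1 / real (Suc k) ^ 2)" by (subst summable_Suc_iff)
    thus "summable (\<lambda>k. C * (1 / real (Suc k) ^ 2))" by (rule summable_mult)
    have "norm (\<Lambda> (Suc k)) * (1 / real (Suc k) ^ 4 / 4) \<le> C * (1 / real (Suc k) ^ 2)" for k
    proof -
      have "norm (\<Lambda> (Suc k)) * (1 / real (Suc k) ^ 4 / 4) \<le> (C * real (Suc k) ^ 2) * (1 / real (Suc k) ^ 4 / 1)"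
        by (intro mult_mono C divide_left_mono) (auto intro!: mult_nonneg_nonneg C)
      also have "\<dots> = C * (1 / real (Suc k) ^ 2)"
        by (simp add: power2_eq_square power4_eq_xxxx field_simps del: of_nat_Suc)
      finally show ?thesis .
    qed
    thus "\<exists>N. \<forall>k\<ge>N. norm (\<integral>u. norm (f k u) \<partial>lborel) \<le> C * (1 / real (Suc k) ^ 2)"
      unfolding nf by (auto simp del: of_nat_Suc)
  qed
  have zero: "f k u = 0" if "k \<notin> {..<nat \<lfloor>exp u\<rfloor>}" for k u
  proof -
    have "exp u < real (Suc k)" using that by (simp add: not_less) linarith
    hence "u < ln (real (Suc k))" by (metis exp_gt_zero ln_exp ln_less_cancel_iff order.strict_trans)
    thus ?thesis by (simp add: f_def)
  qed
  have sumf: "(\<Sum>k. f k u) = psiF \<Lambda> (exp u) * exp (- s * of_real u)" for u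
  proof -
    have "(\<Sum>k. f k u) = (\<Sum>k\<in>{..<nat \<lfloor>exp u\<rfloor>}. f k u)"
      by (rule suminf_finite) (use zero in auto)
    also have "\<dots> = (\<Sum>k\<in>{..<nat \<lfloor>exp u\<rfloor>}. \<Lambda> (Suc k) * exp (- s * of_real u))"
    proof (rule sum.cong[OF refl])
      fix k assume "k \<in> {..<nat \<lfloor>exp u\<rfloor>}"
      hence "real (Suc k) \<le> exp u" by simp linarith
      hence "ln (real (Suc k)) \<le> u" by (metis ln_exp ln_mono of_nat_0_less_iff zero_less_Suc)
      thus "f k u = \<Lambda> (Suc k) * exp (- s * of_real u)" by (simp add: f_def)
    qed
    also have "\<dots> = (\<Sum>k\<in>{..<nat \<lfloor>exp u\<rfloor>}. \<Lambda> (Suc k)) * exp (- s * of_real u)" by (simp add: sum_distrib_right)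
    also have "(\<Sum>k\<in>{..<nat \<lfloor>exp u\<rfloor>}. \<Lambda> (Suc k)) = psiF \<Lambda> (exp u)"
      unfolding psiF_def by (rule sum.reindex_bij_witness[of _ "\<lambda>n. n - 1" Suc]) auto
    finally show ?thesis .
  qed
  have sm: "AE u in lborel. summable (\<lambda>k. norm (f k u))"
    using zero by (intro AE_I2 summable_finite[of "{..<nat \<lfloor>exp _\<rfloor>}"]) auto
  have fi: "integrable lborel (f k)" for k using fk has_bochner_integral_iff by blast
  have "(\<lambda>k. integral\<^sup>L lborel (f k)) sums (\<integral>u. (\<Sum>k. f k u) \<partial>lborel)"
    by (rule sums_integral[OF fi sm smn])
  moreover have "(\<lambda>k. integral\<^sup>L lborel (f k)) = (\<lambda>k. ds_term \<Lambda> s k / s)"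
    using fk has_bochner_integral_integral_eq by blast
  moreover have "(\<lambda>k. ds_term \<Lambda> s k / s) sums (L / s)" by (rule sums_divide[OF sums])
  ultimately have "(\<integral>u. (\<Sum>k. f k u) \<partial>lborel) = L / s" using sums_unique2 by metis
  moreover have "integrable lborel (\<lambda>u. \<Sum>k. f k u)" by (rule integrable_suminf[OF fi sm smn])
  ultimately show ?thesis unfolding sumf by (simp add: has_bochner_integral_iff)
qed

lemma nn_integral_vertical_powr:
  fixes \<sigma> q :: real
  assumes \<sigma>: "\<sigma> \<ge> 1/2" and q: "q > 1"
  obtains C where "C \<ge> 0" "(\<integral>\<^sup>+t. ennreal (norm (Complex \<sigma> t) powr (-q)) \<partial>lborel) \<le> ennreal C"
proof -
  define f where "f t = (1 + t) powr (- q)" for t :: real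
  have [measurable]: "f \<in> borel_measurable borel" unfolding f_def by measurable
  have I: "(\<integral>\<^sup>+t. ennreal (f t) * indicator {0..} t \<partial>lborel) = ennreal (0 - (- ((1 + 0) powr (1 - q)) / (q - 1)))"
  proof (rule nn_integral_FTC_atLeast[where F = "\<lambda>t. - ((1 + t) powr (1 - q)) / (q - 1)"])
    show "DERIV (\<lambda>t. - ((1 + t) powr (1 - q)) / (q - 1)) x :> f x" if "0 \<le> x" for x
    proof -
      have g: "DERIV (\<lambda>t. 1 + t) x :> 1" by (auto intro!: derivative_eq_intros)
      have "DERIV (\<lambda>t. - ((1 + t) powr (1 - q)) / (q - 1)) x :> - ((1 - q) * (1 + x) powr (1 - q - of_nat 1) * 1) / (q - 1)"
        using that by (intro DERIV_cdivide DERIV_minus DERIV_fun_powr[OF g]) auto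
      also have "- ((1 - q) * (1 + x) powr (1 - q - of_nat 1) * 1) / (q - 1) = f x"
        using q by (simp add: f_def field_simps)
      finally show ?thesis .
    qed
    show "((\<lambda>t. - ((1 + t) powr (1 - q)) / (q - 1)) \<longlongrightarrow> 0) at_top"
      using q by real_asymp
  qed (auto simp: f_def)
  have split: "ennreal (f \<bar>t\<bar>) \<le> ennreal (f t) * indicator {0..} t + ennreal (f (0 + (-1) * t)) * indicator {0..} (0 + (-1) * t)" for t
    by (auto simp: indicator_def)
  have "(\<integral>\<^sup>+t. ennreal (f \<bar>t\<bar>) \<partial>lborel)
      \<le> (\<integral>\<^sup>+t. ennreal (f t) * indicator {0..} t + ennreal (f (0 + (-1) * t)) * indicator {0..} (0 + (-1) * t) \<partial>lborel)"
    by (intro nn_integral_mono split)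
  also have "\<dots> = (\<integral>\<^sup>+t. ennreal (f t) * indicator {0..} t \<partial>lborel)
      + (\<integral>\<^sup>+t. ennreal (f (0 + (-1) * t)) * indicator {0..} (0 + (-1) * t) \<partial>lborel)"
    by (rule nn_integral_add) measurable
  also have "(\<integral>\<^sup>+t. ennreal (f (0 + (-1) * t)) * indicator {0..} (0 + (-1) * t) \<partial>lborel) = (\<integral>\<^sup>+t. ennreal (f t) * indicator {0..} t \<partial>lborel)"
    using nn_integral_real_affine[of "\<lambda>t. ennreal (f t) * indicator {0..} t" "-1" 0] by simp
  finally have fin: "(\<integral>\<^sup>+t. ennreal (f \<bar>t\<bar>) \<partial>lborel) \<le> ennreal (2 / (q - 1))"
    unfolding I using q by (simp flip: ennreal_plus)
  \<comment> \<open>Using |s| \<ge> 1/2 twice and |s| \<ge> |t| once gives 3|s| \<ge> 1 +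
    |t|.\<close>
  have le: "norm (Complex \<sigma> t) powr (-q) \<le> 3 powr q * f \<bar>t\<bar>" for t
  proof -
    have "norm (Complex \<sigma> t) \<ge> 1/2" using abs_Re_le_cmod[of "Complex \<sigma> t"] \<sigma> by simp
    moreover have "norm (Complex \<sigma> t) \<ge> \<bar>t\<bar>" using abs_Im_le_cmod[of "Complex \<sigma> t"] by simp
    ultimately have "(1 + \<bar>t\<bar>) / 3 \<le> norm (Complex \<sigma> t)" by simp
    hence "norm (Complex \<sigma> t) powr (-q) \<le> ((1 + \<bar>t\<bar>) / 3) powr (-q)"
      using q by (intro powr_mono2') auto
    also have "\<dots> = 3 powr q * f \<bar>t\<bar>" by (simp add: f_def powr_divide powr_minus field_simps)
    finally show ?thesis .
  qed
  have "(\<integral>\<^sup>+t. ennreal (norm (Complex \<sigma> t) powr (-q)) \<partial>lborel) \<le> (\<integral>\<^sup>+t. ennreal (3 powr q) * ennreal (f \<bar>t\<bar>) \<partial>lborel)"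
    by (intro nn_integral_mono) (use le in \<open>simp add: ennreal_leI flip: ennreal_mult'\<close>)
  also have "\<dots> = ennreal (3 powr q) * (\<integral>\<^sup>+t. ennreal (f \<bar>t\<bar>) \<partial>lborel)" by (rule nn_integral_cmult) measurable
  also have "\<dots> \<le> ennreal (3 powr q) * ennreal (2 / (q - 1))" by (intro mult_left_mono fin) auto
  also have "\<dots> = ennreal (3 powr q * (2 / (q - 1)))" by (simp flip: ennreal_mult')
  finally show ?thesis using q by (intro that[of "3 powr q * (2 / (q - 1))"]) auto
qed

lemma norm_exp_minus_one_le:
  fixes z :: complex
  assumes "Re z \<ge> 0"
  shows "norm (exp z - 1) \<le> exp (Re z) * norm z"
proof -
  have "norm (exp z - exp 0) \<le> exp (Re z) * norm (z - 0)"
  proof (rule field_differentiable_bound[where S = "closed_segment 0 z" and f' = exp])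
    show "(exp has_field_derivative exp w) (at w within closed_segment 0 z)" for w
      by (rule has_field_derivative_at_within) (rule DERIV_exp)
    fix w assume "w \<in> closed_segment 0 z"
    then obtain u where "0 \<le> u" "u \<le> 1" "w = of_real u * z"
      by (auto simp: closed_segment_def scaleR_conv_of_real)
    thus "norm (exp w) \<le> exp (Re z)" using assms by (simp add: mult_left_le_one_le)
  qed auto
  thus ?thesis by simp
qed

text \<open>The logarithm is traded for |s|^e, which leaves the decay |s|^(e - 1) for the transform
  of the remainder.\<close>

lemma log_deriv_quotient_bound:
  fixes g :: "complex \<Rightarrow> complex" and M e :: real
  assumes C: "C \<ge> 0" "\<And>s. 1/2 + e \<le> Re s \<Longrightarrow> Re s \<le> 5 \<Longrightarrow> norm (deriv g s / g s) \<le> C * ln (3 + \<bar>Im s\<bar>)"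
    and e: "e > 0"
  obtains C' where "C' \<ge> 0" "\<And>s. 1/2 + e \<le> Re s \<Longrightarrow> Re s \<le> 5 \<Longrightarrow>
      norm (- (deriv g s / g s + of_real M) / s) \<le> C' * norm s powr (e - 1)"
proof -
  define C' where "C' = C * (7 powr e / e) + \<bar>M\<bar> * 2 powr e"
  have C': "C' \<ge> 0" using C e by (auto simp: C'_def)
  have "norm (- (deriv g s / g s + of_real M) / s) \<le> C' * norm s powr (e - 1)" if s: "1/2 + e \<le> Re s" "Re s \<le> 5" for s
  proof -
    have ns: "norm s \<ge> 1/2" using abs_Re_le_cmod[of s] s e by linarith
    have "3 + \<bar>Im s\<bar> \<le> 7 * norm s" using ns abs_Im_le_cmod[of s] by simp
    hence "ln (3 + \<bar>Im s\<bar>) \<le> ln (7 * norm s)" using ns by (subst ln_le_cancel_iff) auto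
    also have "\<dots> \<le> (7 * norm s) powr e / e" using ns e by (intro ln_powr_bound) auto
    also have "\<dots> = 7 powr e / e * norm s powr e" by (simp add: powr_mult)
    finally have l: "C * ln (3 + \<bar>Im s\<bar>) \<le> C * (7 powr e / e * norm s powr e)" using C by (intro mult_left_mono)
    have "1 \<le> (2 * norm s) powr e" using ns e by (intro ge_one_powr_ge_zero) auto
    hence "\<bar>M\<bar> * 1 \<le> \<bar>M\<bar> * (2 powr e * norm s powr e)" by (intro mult_left_mono) (auto simp: powr_mult)
    hence "norm (deriv g s / g s + of_real M) \<le> C' * norm s powr e"
      using norm_triangle_ineq[of "deriv g s / g s" "of_real M"] C(2)[OF s] l
      by (simp add: C'_def distrib_right mult.assoc)
    hence "norm (deriv g s / g s + of_real M) / norm s \<le> C' * norm s powr e / norm s"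
      by (intro divide_right_mono) auto
    also have "\<dots> = C' * norm s powr (e - 1)" using ns by (simp add: powr_diff)
    finally show ?thesis by (simp only: norm_divide norm_minus_cancel)
  qed
  thus ?thesis using C' that by blast
qed

text \<open>The term M*exp u cut off at u = 0 has transform M/(s - 1), and M/(s(s - 1)) - M/(s - 1)
  = -M/s. The pole at 1 disappears, so the right-hand side makes sense for Re s > 1/2.\<close>

lemma laplace_remainder:
  assumes C: "C \<ge> 0" "\<And>n. n \<ge> 1 \<Longrightarrow> norm (\<Lambda> n) \<le> C * real n ^ 2" and s: "Re s = 4"
    and sums: "ds_term \<Lambda> s sums (- w + of_real M / (s - 1))"
  shows "has_bochner_integral lborel (\<lambda>u. (if u \<ge> 0 then psiF \<Lambda> (exp u) - of_real (M * exp u) else 0) * exp (- s * of_real u))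
     (- (w + of_real M) / s)"
proof -
  have s1: "s \<noteq> 0" "s - 1 \<noteq> 0" using s by auto
  have "has_bochner_integral lborel (\<lambda>u. psiF \<Lambda> (exp u) * exp (- s * of_real u)
        - of_real M * (indicator {0..} u *\<^sub>R exp (- (s - 1) * of_real u)))
     ((- w + of_real M / (s - 1)) / s - of_real M * (exp (- (s - 1) * of_real 0) / (s - 1)))"
    by (intro has_bochner_integral_diff has_bochner_integral_mult_right laplace_psiF[OF C s sums]
        has_bochner_integral_exp_halfline) (use s in auto)
  also have "(\<lambda>u. psiF \<Lambda> (exp u) * exp (- s * of_real u) - of_real M * (indicator {0..} u *\<^sub>R exp (- (s - 1) * of_real u)))
      = (\<lambda>u. (if u \<ge> 0 then psiF \<Lambda> (exp u) - of_real (M * exp u) else 0) * exp (- s * of_real u))"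
  proof
    fix u :: real
    show "psiF \<Lambda> (exp u) * exp (- s * of_real u) - of_real M * (indicator {0..} u *\<^sub>R exp (- (s - 1) * of_real u))
      = (if u \<ge> 0 then psiF \<Lambda> (exp u) - of_real (M * exp u) else 0) * exp (- s * of_real u)"
    proof (cases "u \<ge> 0")
      case True
      have "exp (- (s - 1) * of_real u) = of_real (exp u) * exp (- s * of_real u)"
        unfolding exp_of_real[symmetric] mult_exp_exp by (simp add: algebra_simps)
      thus ?thesis using True by (simp add: algebra_simps)
    qed (simp add: psiF_eq_0)
  qed
  also have "(- w + of_real M / (s - 1)) / s - of_real M * (exp (- (s - 1) * of_real 0) / (s - 1)) = - (w + of_real M) / s"
    using s1 by (simp add: divide_simps) (simp add: algebra_simps)
  finally show ?thesis .
qed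

text \<open>Translation by \<alpha> multiplies a transform by exp(\<alpha>*s), so the increment has
  transform (exp(\<alpha>*s) - 1) times that of the remainder. Under x = exp y the weight
  exp(-2*\<sigma>*y) dy with \<sigma> = 1/2 + e becomes x^(-2 - 2e) dx.\<close>

lemma psi_remainder_mean_square:
  assumes C: "C \<ge> 0" "\<And>n. n \<ge> 1 \<Longrightarrow> norm (\<Lambda> n) \<le> C * real n ^ 2"
    and hol: "g holomorphic_on UNIV" and gnz: "\<And>s. Re s > 1/2 \<Longrightarrow> g s \<noteq> 0"
    and sums: "\<And>s. Re s > 1 \<Longrightarrow> ds_term \<Lambda> s sums (- (deriv g s / g s) + of_real M / (s - 1))"
    and e: "0 < e" "e < 1/8"
    and K: "C' \<ge> 0" "\<And>s. 1/2 + e \<le> Re s \<Longrightarrow> Re s \<le> 5 \<Longrightarrow>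
      norm (- (deriv g s / g s + of_real M) / s) \<le> C' * norm s powr (e - 1)"
    and \<alpha>: "\<alpha> > 0"
  shows "(\<integral>\<^sup>+x. indicator {1..X} x * ennreal ((norm (psiF \<Lambda> (exp \<alpha> * x) - psiF \<Lambda> x - of_real (M * (exp \<alpha> - 1) * x)))\<^sup>2 * x powr (- 2 - 2 * e)) \<partial>lborel)
    \<le> ennreal (exp 17) * (\<integral>\<^sup>+t. (norm ((exp (of_real \<alpha> * Complex (1/2 + e) t) - 1)
        * (- (deriv g (Complex (1/2 + e) t) / g (Complex (1/2 + e) t) + of_real M) / Complex (1/2 + e) t)))\<^sup>2 \<partial>lborel)"
proof (cases "X \<ge> 1")
  case False
  hence "(\<lambda>x. indicator {1..X} x * ennreal ((norm (psiF \<Lambda> (exp \<alpha> * x) - psiF \<Lambda> x - of_real (M * (exp \<alpha> - 1) * x)))\<^sup>2 * x powr (- 2 - 2 * e))) = (\<lambda>_. 0)"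
    by auto
  thus ?thesis by simp
next
  case X: True
  define R where "R u = (if u \<ge> 0 then psiF \<Lambda> (exp u) - of_real (M * exp u) else 0)" for u
  have [measurable]: "R \<in> borel_measurable borel" unfolding R_def by measurable
  define Kf where "Kf s = - (deriv g s / g s + of_real M) / s" for s
  define T where "T s = (exp (of_real \<alpha> * s) - 1) * Kf s" for s
  define D where "D u = R (u + \<alpha>) - R u" for u
  have Dm: "D \<in> borel_measurable borel" unfolding D_def by measurable
  define C1 where "C1 = C + \<bar>M\<bar>"
  have C1: "C1 \<ge> 0" using C by (simp add: C1_def)
  have Rb: "norm (R u) \<le> C1 * exp (3 * u)" for u
  proof (cases "u \<ge> 0")
    case True
    have e3: "exp u ^ 3 = exp (3 * u)" by (simp flip: exp_of_nat_mult)
    have "norm (R u) \<le> norm (psiF \<Lambda> (exp u)) + norm (complex_of_real (M * exp u))"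
      using True unfolding R_def by (simp only: if_True norm_triangle_ineq4)
    also have "norm (psiF \<Lambda> (exp u)) \<le> C * exp (3 * u)"
      using psiF_cubic_bound[OF C, of "exp u"] e3 by simp
    also have "norm (complex_of_real (M * exp u)) \<le> \<bar>M\<bar> * exp (3 * u)"
      unfolding norm_of_real abs_mult using True by (intro mult_left_mono) auto
    finally show ?thesis by (simp add: C1_def distrib_right)
  qed (use C1 in \<open>auto simp: R_def\<close>)
  have Db: "norm (D u) \<le> (C1 * (exp (3 * \<alpha>) + 1)) * exp (3 * u)" for u
  proof -
    have "norm (D u) \<le> norm (R (u + \<alpha>)) + norm (R u)" unfolding D_def by (rule norm_triangle_ineq4)
    also have "\<dots> \<le> C1 * exp (3 * (u + \<alpha>)) + C1 * exp (3 * u)" by (intro add_mono Rb)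
    also have "\<dots> = (C1 * (exp (3 * \<alpha>) + 1)) * exp (3 * u)" by (simp add: distrib_left distrib_right exp_add mult_ac)
    finally show ?thesis .
  qed
  \<comment> \<open>The translate of R starts at -\<alpha>, and so does D. On [0, ln X] neither
    cutoff is visible and D is the true increment.\<close>
  have D0: "D u = 0" if "u < - \<alpha>" for u using that \<alpha> by (simp add: D_def R_def)
  have lap: "(\<integral>u. D u * exp (- s * of_real u) \<partial>lborel) = T s" if s: "Re s = 4" for s
  proof -
    have R1: "has_bochner_integral lborel (\<lambda>u. R u * exp (- s * of_real u)) (Kf s)"
      unfolding R_def Kf_def by (rule laplace_remainder[OF C s sums]) (use s in auto)
    have "integrable lborel (\<lambda>u. R (\<alpha> + 1 * u) * exp (- s * of_real (\<alpha> + 1 * u)))"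
      using lborel_integrable_real_affine[of "\<lambda>u. R u * exp (- s * of_real u)" 1 \<alpha>] R1
      by (simp add: has_bochner_integral_iff)
    moreover have "(\<integral>u. R (\<alpha> + 1 * u) * exp (- s * of_real (\<alpha> + 1 * u)) \<partial>lborel) = Kf s"
      using lborel_integral_real_affine[of 1 "\<lambda>u. R u * exp (- s * of_real u)" \<alpha>] R1
      by (simp add: has_bochner_integral_iff)
    ultimately have "has_bochner_integral lborel (\<lambda>u. R (\<alpha> + 1 * u) * exp (- s * of_real (\<alpha> + 1 * u))) (Kf s)"
      by (simp add: has_bochner_integral_iff)
    from has_bochner_integral_mult_right[OF this, of "exp (of_real \<alpha> * s)"]
    have "has_bochner_integral lborel (\<lambda>u. exp (of_real \<alpha> * s) * (R (\<alpha> + 1 * u) * exp (- s * of_real (\<alpha> + 1 * u)))) (exp (of_real \<alpha> * s) * Kf s)"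
      by simp
    from has_bochner_integral_diff[OF this R1]
    have "has_bochner_integral lborel (\<lambda>u. exp (of_real \<alpha> * s) * (R (\<alpha> + 1 * u) * exp (- s * of_real (\<alpha> + 1 * u))) - R u * exp (- s * of_real u)) (T s)"
      by (simp add: T_def algebra_simps)
    also have "(\<lambda>u. exp (of_real \<alpha> * s) * (R (\<alpha> + 1 * u) * exp (- s * of_real (\<alpha> + 1 * u))) - R u * exp (- s * of_real u))
        = (\<lambda>u. D u * exp (- s * of_real u))"
    proof
      fix u
      have "exp (of_real \<alpha> * s) * exp (- s * of_real (\<alpha> + 1 * u)) = exp (- s * of_real u)"
        unfolding mult_exp_exp by (simp add: algebra_simps)
      hence "exp (of_real \<alpha> * s) * (R (\<alpha> + 1 * u) * exp (- s * of_real (\<alpha> + 1 * u))) = R (\<alpha> + 1 * u) * exp (- s * of_real u)"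
        by (metis mult.left_commute)
      thus "exp (of_real \<alpha> * s) * (R (\<alpha> + 1 * u) * exp (- s * of_real (\<alpha> + 1 * u))) - R u * exp (- s * of_real u) = D u * exp (- s * of_real u)"
        by (simp add: D_def left_diff_distrib add.commute)
    qed
    finally show ?thesis by (simp add: has_bochner_integral_integral_eq)
  qed
  have holT: "T holomorphic_on {s. Re s > 1/2}"
  proof -
    have "deriv g holomorphic_on {s. Re s > 1/2}"
      using holomorphic_deriv[OF hol] holomorphic_on_subset by blast
    moreover have "g holomorphic_on {s. Re s > 1/2}" using hol holomorphic_on_subset by blast
    moreover have "open {s. Re s > 1/2}" by (rule open_halfspace_Re_gt)
    ultimately show ?thesis unfolding T_def Kf_def
      using gnz by (intro holomorphic_intros) auto
  qed
  \<comment> \<open>Used only to shift the contour, so the dependence on \<alpha> does no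
    harm.\<close>
  have Tb: "norm (T s) \<le> (exp (4 * \<alpha>) + 1) * (C' * (1/2) powr (e - 1))" if s: "1/2 + e \<le> Re s" "Re s \<le> 4" for s
  proof -
    have ns: "norm s \<ge> 1/2" using abs_Re_le_cmod[of s] s e by linarith
    have "norm (exp (of_real \<alpha> * s) - 1) \<le> norm (exp (of_real \<alpha> * s)) + norm (1 :: complex)" by (rule norm_triangle_ineq4)
    also have "norm (exp (of_real \<alpha> * s)) \<le> exp (4 * \<alpha>)" using s \<alpha> by (simp add: mult.commute mult_right_mono)
    finally have 1: "norm (exp (of_real \<alpha> * s) - 1) \<le> exp (4 * \<alpha>) + 1" by simp
    have "norm (Kf s) \<le> C' * norm s powr (e - 1)" unfolding Kf_def using s by (intro K) auto
    also have "\<dots> \<le> C' * (1/2) powr (e - 1)" using ns e K by (intro mult_left_mono powr_mono2') auto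
    finally have 2: "norm (Kf s) \<le> C' * (1/2) powr (e - 1)" .
    show ?thesis unfolding T_def norm_mult by (intro mult_mono 1 2) auto
  qed
  have contR: "isCont R u" if "exp u \<notin> \<int>" for u
  proof -
    \<comment> \<open>The cutoff of R at 0 is among the excluded points, since exp 0 = 1 is an
      integer.\<close>
    have u0: "u \<noteq> 0" using that by auto
    have "\<forall>\<^sub>F v in nhds u. psiF \<Lambda> (exp v) = psiF \<Lambda> (exp u)"
      by (rule eventually_compose_filterlim[OF psiF_locally_constant[OF that]])
         (auto intro!: tendsto_intros filterlim_ident simp: filterlim_ident)
    hence ev: "\<forall>\<^sub>F v in nhds u. (\<lambda>v. psiF \<Lambda> (exp v)) v = (\<lambda>v. psiF \<Lambda> (exp u)) v" by simp
    have c1: "isCont (\<lambda>v. psiF \<Lambda> (exp v)) u" using isCont_cong[OF ev] by simp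
    have "\<forall>\<^sub>F v in nhds u. R v = (if u > 0 then psiF \<Lambda> (exp v) - of_real (M * exp v) else 0)"
    proof (cases "u > 0")
      case True
      hence "\<forall>\<^sub>F v in nhds u. v \<in> {0<..}" by (intro eventually_nhds_in_open) auto
      thus ?thesis by eventually_elim (use True in \<open>auto simp: R_def\<close>)
    next
      case False
      hence "\<forall>\<^sub>F v in nhds u. v \<in> {..<0}" using u0 by (intro eventually_nhds_in_open) auto
      thus ?thesis by eventually_elim (use False in \<open>auto simp: R_def\<close>)
    qed
    moreover have "isCont (\<lambda>v. if u > 0 then psiF \<Lambda> (exp v) - of_real (M * exp v) else 0) u"
      using c1 by (cases "u > 0") (auto intro!: continuous_intros)
    ultimately show ?thesis by (subst isCont_cong)
  qed
  have cnt: "countable {u::real. exp (u + c) \<in> \<int>}" for c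
  proof -
    have "{u. exp (u + c) \<in> \<int>} \<subseteq> (\<lambda>k. ln (real_of_int k) - c) ` UNIV"
    proof
      fix u assume "u \<in> {u. exp (u + c) \<in> \<int>}"
      then obtain k where k: "exp (u + c) = of_int k" by (auto elim: Ints_cases)
      hence "u = ln (real_of_int k) - c" by (metis add_diff_cancel_right' ln_exp)
      thus "u \<in> (\<lambda>k. ln (real_of_int k) - c) ` UNIV" by blast
    qed
    thus ?thesis by (rule countable_subset) auto
  qed
  have "{u. exp (u + \<alpha>) \<in> \<int>} \<union> {u. exp (u + 0) \<in> \<int>} \<in> null_sets lborel"
    by (intro countable_imp_null_set_lborel countable_Un cnt)
  hence "AE u in lborel. u \<notin> {u. exp (u + \<alpha>) \<in> \<int>} \<union> {u. exp (u + 0) \<in> \<int>}" by (rule AE_not_in)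
  hence cont: "AE u in lborel. isCont D u"
  proof eventually_elim
    case (elim u)
    have "isCont (\<lambda>u. R (u + \<alpha>)) u"
      by (rule isCont_o2[where f = "\<lambda>u. u + \<alpha>" and g = R]) (use elim in \<open>auto intro!: continuous_intros contR\<close>)
    moreover have "isCont R u" using elim by (intro contR) auto
    ultimately show ?case unfolding D_def by (intro continuous_intros)
  qed
  have "(\<integral>\<^sup>+x. indicator {1..X} x * ennreal ((norm (psiF \<Lambda> (exp \<alpha> * x) - psiF \<Lambda> x - of_real (M * (exp \<alpha> - 1) * x)))\<^sup>2 * x powr (- 2 - 2 * e)) \<partial>lborel)
     = (\<integral>\<^sup>+y. indicator {0..ln X} y * ennreal ((norm (D y))\<^sup>2 * exp (- 2 * (1/2 + e) * y)) \<partial>lborel)"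
  proof -
    define f where "f x = (norm (psiF \<Lambda> (exp \<alpha> * x) - psiF \<Lambda> x - of_real (M * (exp \<alpha> - 1) * x)))\<^sup>2 * x powr (- 2 - 2 * e)" for x
    have [measurable]: "f \<in> borel_measurable borel" unfolding f_def by measurable
    have "(\<integral>\<^sup>+x. f x * indicator {exp 0..exp (ln X)} x \<partial>lborel) = (\<integral>\<^sup>+y. f (exp y) * exp y * indicator {0..ln X} y \<partial>lborel)"
      by (rule nn_integral_substitution) (use X in \<open>auto intro!: derivative_eq_intros continuous_intros simp: set_borel_measurable_def\<close>)
    moreover have "(\<integral>\<^sup>+x. f x * indicator {exp 0..exp (ln X)} x \<partial>lborel) = (\<integral>\<^sup>+x. indicator {1..X} x * ennreal (f x) \<partial>lborel)"
      using X by (intro nn_integral_cong) (auto simp: indicator_def)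
    moreover have "(\<integral>\<^sup>+y. f (exp y) * exp y * indicator {0..ln X} y \<partial>lborel) = (\<integral>\<^sup>+y. indicator {0..ln X} y * ennreal ((norm (D y))\<^sup>2 * exp (- 2 * (1/2 + e) * y)) \<partial>lborel)"
    proof (intro nn_integral_cong)
      fix y
      show "ennreal (f (exp y) * exp y * indicator {0..ln X} y) = indicator {0..ln X} y * ennreal ((norm (D y))\<^sup>2 * exp (- 2 * (1/2 + e) * y))"
      proof (cases "y \<in> {0..ln X}")
        case True
        have "D y = psiF \<Lambda> (exp \<alpha> * exp y) - psiF \<Lambda> (exp y) - of_real (M * (exp \<alpha> - 1) * exp y)"
          using True \<alpha> by (simp add: D_def R_def exp_add algebra_simps)
        moreover have "exp y powr (- 2 - 2 * e) * exp y = exp (- 2 * (1/2 + e) * y)"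
          by (simp add: powr_def mult_exp_exp algebra_simps)
        ultimately have "f (exp y) * exp y = (norm (D y))\<^sup>2 * exp (- 2 * (1/2 + e) * y)"
          unfolding f_def by (simp add: mult.assoc)
        thus ?thesis using True by simp
      qed simp
    qed
    ultimately show ?thesis unfolding f_def by simp
  qed
  also have "\<dots> \<le> ennreal (exp 17) * (\<integral>\<^sup>+t. (norm (T (Complex (1/2 + e) t)))\<^sup>2 \<partial>lborel)"
    by (rule laplace_plancherel[OF Dm _ Db D0 lap holT _ _ Tb cont]) (use C1 e in auto)
  finally show ?thesis unfolding T_def Kf_def .
qed

text \<open>For \<delta> \<le> 1 the kernel exp(\<alpha>*s) - 1 with \<alpha> = ln(1 + \<delta>) is
  bounded by 3 and by 2*\<delta>*|s|; its square is interpolated to the power p = 1 - 4e of the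
  latter. This p makes the total exponent p + 2e - 2 = -(1 + 2e) integrable along the line and loses
  only \<delta>^(-4e). Large \<delta> is paid for by the factor (1 + \<delta>)^(6e).\<close>

lemma mellin_kernel_square_bound:
  fixes \<delta> e t :: real
  assumes \<delta>: "\<delta> > 0" and e: "0 < e" "e < 1/8"
  defines "s \<equiv> Complex (1/2 + e) t"
  shows "(norm (exp (of_real (ln (1 + \<delta>)) * s) - 1))\<^sup>2 * (norm s powr (e - 1))\<^sup>2
     \<le> 18 * \<delta> powr (1 - 4 * e) * (1 + \<delta>) powr (6 * e) * norm s powr (- (1 + 2 * e))"
proof -
  define \<alpha> where "\<alpha> = ln (1 + \<delta>)"
  define p where "p = 1 - 4 * e"
  have p: "p > 0" "p \<le> 1" using e by (auto simp: p_def)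
  have \<alpha>: "\<alpha> > 0" using \<delta> by (simp add: \<alpha>_def)
  have \<alpha>\<delta>: "\<alpha> \<le> \<delta>" unfolding \<alpha>_def using \<delta> ln_add_one_self_le_self[of \<delta>] by simp
  have ns: "norm s \<ge> 1/2" using abs_Re_le_cmod[of s] e by (simp add: s_def)
  have ns0: "norm s > 0" using ns by linarith
  have re: "Re (of_real \<alpha> * s) = \<alpha> * (1/2 + e)" by (simp add: s_def)
  have ex: "exp (Re (of_real \<alpha> * s)) = (1 + \<delta>) powr (1/2 + e)"
    using \<delta> unfolding re by (simp add: \<alpha>_def powr_def mult.commute)
  have sq: "(norm s powr (e - 1))\<^sup>2 = norm s powr (2 * e - 2)"
    by (simp add: power2_eq_square flip: powr_add)
  have b1: "norm (exp (of_real \<alpha> * s) - 1) \<le> (1 + \<delta>) powr (1/2 + e) + 1"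
    using norm_triangle_ineq4[of "exp (of_real \<alpha> * s)" 1] by (simp only: norm_exp_eq_Re ex norm_one)
  have one6: "1 \<le> (1 + \<delta>) powr (6 * e)" using \<delta> e by (intro ge_one_powr_ge_zero) auto
  show ?thesis
  proof (cases "\<delta> \<le> 1")
    case True
    have "(1 + \<delta>) powr (1/2 + e) \<le> (1 + \<delta>) powr 1" using \<delta> e by (intro powr_mono) auto
    hence e2: "(1 + \<delta>) powr (1/2 + e) \<le> 2" using True \<delta> by simp
    have b3: "norm (exp (of_real \<alpha> * s) - 1) \<le> 3" using b1 e2 by linarith
    have "norm (exp (of_real \<alpha> * s) - 1) \<le> exp (Re (of_real \<alpha> * s)) * norm (of_real \<alpha> * s)"
      by (rule norm_exp_minus_one_le) (use re \<alpha> e in auto)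
    also have "\<dots> \<le> 2 * (\<delta> * norm s)"
      unfolding ex norm_mult using e2 \<alpha>\<delta> \<alpha> by (intro mult_mono) auto
    finally have b2: "norm (exp (of_real \<alpha> * s) - 1) \<le> 2 * \<delta> * norm s" by simp
    define z where "z = 2 * \<delta> * norm s"
    have z: "z > 0" using \<delta> ns0 by (simp add: z_def)
    \<comment> \<open>Interpolation: z^2 \<le> z^p when z \<le> 1, and the constant 9 suffices when
      z > 1.\<close>
    have "(norm (exp (of_real \<alpha> * s) - 1))\<^sup>2 \<le> 9 * z powr p"
    proof (cases "z \<le> 1")
      case True
      have "(norm (exp (of_real \<alpha> * s) - 1))\<^sup>2 \<le> z\<^sup>2" using b2 unfolding z_def by (intro power_mono) auto
      also have "\<dots> = z powr 2" using z by simp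
      also have "\<dots> \<le> z powr p" using True z p by (intro powr_mono') auto
      also have "\<dots> \<le> 9 * z powr p" by simp
      finally show ?thesis .
    next
      case False
      have "(norm (exp (of_real \<alpha> * s) - 1))\<^sup>2 \<le> 3\<^sup>2" using b3 by (intro power_mono) auto
      also have "\<dots> \<le> 9 * z powr p" using False p by (simp add: ge_one_powr_ge_zero)
      finally show ?thesis .
    qed
    also have "\<dots> = 9 * (2 powr p * \<delta> powr p * norm s powr p)" using \<delta> by (simp add: z_def powr_mult)
    also have "\<dots> \<le> 9 * (2 powr 1 * \<delta> powr p * norm s powr p)"
      using p by (intro mult_left_mono mult_right_mono powr_mono) auto
    finally have "(norm (exp (of_real \<alpha> * s) - 1))\<^sup>2 * (norm s powr (e - 1))\<^sup>2
        \<le> 18 * \<delta> powr p * norm s powr p * norm s powr (2 * e - 2)"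
      unfolding sq by (intro mult_right_mono) auto
    also have "\<dots> = 18 * \<delta> powr p * 1 * norm s powr (- (1 + 2 * e))"
    proof -
      have "p + (2 * e - 2) = - (1 + 2 * e)" by (simp add: p_def)
      thus ?thesis by (simp only: mult.assoc powr_add[symmetric] mult_1_right mult_1_left)
    qed
    also have "\<dots> \<le> 18 * \<delta> powr p * (1 + \<delta>) powr (6 * e) * norm s powr (- (1 + 2 * e))"
      using one6 by (intro mult_right_mono mult_left_mono) auto
    finally show ?thesis by (simp add: \<alpha>_def p_def)
  next
    case False
    have "1 \<le> (1 + \<delta>) powr (1/2 + e)" using \<delta> e by (intro ge_one_powr_ge_zero) auto
    hence "norm (exp (of_real \<alpha> * s) - 1) \<le> 2 * (1 + \<delta>) powr (1/2 + e)" using b1 by linarith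
    hence "(norm (exp (of_real \<alpha> * s) - 1))\<^sup>2 \<le> (2 * (1 + \<delta>) powr (1/2 + e))\<^sup>2" by (intro power_mono) auto
    \<comment> \<open>The exponent 6e originates in 1 + 2e = p + 6e.\<close>
    also have "\<dots> = 4 * (1 + \<delta>) powr (p + 6 * e)"
    proof -
      have "(1/2 + e) + (1/2 + e) = p + 6 * e" by (simp add: p_def)
      hence "(1 + \<delta>) powr (1/2 + e) * (1 + \<delta>) powr (1/2 + e) = (1 + \<delta>) powr (p + 6 * e)"
        by (simp only: powr_add[symmetric])
      thus ?thesis by (simp add: power2_eq_square)
    qed
    also have "\<dots> = 4 * ((1 + \<delta>) powr p * (1 + \<delta>) powr (6 * e))" by (simp add: powr_add)
    also have "\<dots> \<le> 4 * ((2 * \<delta>) powr p * (1 + \<delta>) powr (6 * e))"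
      using False \<delta> p by (intro mult_left_mono mult_right_mono powr_mono2) auto
    also have "\<dots> \<le> 4 * ((2 powr 1 * \<delta> powr p) * (1 + \<delta>) powr (6 * e))"
      using \<delta> p unfolding powr_mult by (intro mult_left_mono mult_right_mono powr_mono) auto
    finally have A: "(norm (exp (of_real \<alpha> * s) - 1))\<^sup>2 \<le> 8 * \<delta> powr p * (1 + \<delta>) powr (6 * e)" by simp
    have "norm s powr (2 * e - 2) = norm s powr (- (1 + 2 * e)) * norm s powr (4 * e - 1)"
    proof -
      have "- (1 + 2 * e) + (4 * e - 1) = 2 * e - 2" by simp
      thus ?thesis by (simp only: powr_add[symmetric])
    qed
    also have "\<dots> \<le> norm s powr (- (1 + 2 * e)) * (1/2) powr (4 * e - 1)"
      using ns e by (intro mult_left_mono powr_mono2') auto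
    also have "\<dots> \<le> norm s powr (- (1 + 2 * e)) * 2"
    proof (intro mult_left_mono)
      have "(1/2) powr (4 * e - 1) = (2::real) powr (1 - 4 * e)" by (simp add: powr_divide powr_minus_divide[symmetric])
      also have "\<dots> \<le> 2 powr 1" using e by (intro powr_mono) auto
      finally show "(1/2) powr (4 * e - 1) \<le> (2::real)" by simp
    qed auto
    finally have B: "norm s powr (2 * e - 2) \<le> norm s powr (- (1 + 2 * e)) * 2" .
    have "(norm (exp (of_real \<alpha> * s) - 1))\<^sup>2 * (norm s powr (e - 1))\<^sup>2
        \<le> (8 * \<delta> powr p * (1 + \<delta>) powr (6 * e)) * (norm s powr (- (1 + 2 * e)) * 2)"
      unfolding sq using A B by (intro mult_mono) auto
    also have "\<dots> = 16 * (\<delta> powr p * (1 + \<delta>) powr (6 * e) * norm s powr (- (1 + 2 * e)))" by simp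
    also have "\<dots> \<le> 18 * (\<delta> powr p * (1 + \<delta>) powr (6 * e) * norm s powr (- (1 + 2 * e)))"
      by (intro mult_right_mono) auto
    finally show ?thesis by (simp add: \<alpha>_def p_def mult.assoc)
  qed
qed

text \<open>M is the residue m - k of -F'/F at 1. It is obtained before e is chosen, because a
  single number has to serve for all e.\<close>

lemma selberg_GRH_mean_square:
  assumes ax: "selberg_axioms a F m Q r lam mu eps" and grh: "GRH F r lam mu" and Lam: "is_vonMangoldt_F F \<Lambda>"
  obtains M :: real where "\<And>e. 0 < e \<Longrightarrow> e < 1/8 \<Longrightarrow> \<exists>C\<ge>0. \<forall>\<delta>>0. \<forall>X.
     (\<integral>\<^sup>+x. indicator {1..X} x * ennreal ((norm (psiF \<Lambda> (x + \<delta> * x) - psiF \<Lambda> x - of_real (M * \<delta> * x)))\<^sup>2 * x powr (- 2 - 2 * e)) \<partial>lborel)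
       \<le> ennreal (C * (\<delta> powr (1 - 4 * e) * (1 + \<delta>) powr (6 * e)))"
proof -
  obtain g k where g: "g holomorphic_on UNIV" "\<And>s. s \<noteq> 1 \<Longrightarrow> (s - 1) ^ m * F s = (s - 1) ^ k * g s"
    and gnz: "\<And>s. Re s > 1/2 \<Longrightarrow> g s \<noteq> 0"
    and ld: "\<And>s. Re s > 1 \<Longrightarrow> deriv F s / F s = deriv g s / g s + (of_nat k - of_nat m) / (s - 1)"
    using selberg_factorization[OF ax grh] by metis
  obtain CL where CL: "CL \<ge> 0" "\<And>n. n \<ge> 1 \<Longrightarrow> norm (\<Lambda> n) \<le> CL * real n ^ 2"
    using vonMangoldt_F_quadratic_bound[OF Lam] by metis
  define M where "M = real m - real k"
  have sums: "ds_term \<Lambda> s sums (- (deriv g s / g s) + of_real M / (s - 1))" if s: "Re s > 1" for s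
  proof -
    have "ds_term \<Lambda> s sums (- (deriv F s / F s))" using Lam s unfolding is_vonMangoldt_F_def by blast
    also have "- (deriv F s / F s) = - (deriv g s / g s) + of_real M / (s - 1)"
      unfolding ld[OF s] by (simp add: M_def diff_divide_distrib)
    finally show ?thesis .
  qed
  show ?thesis
  proof (rule that[of M])
    fix e :: real assume e: "0 < e" "e < 1/8"
    obtain C0 where "C0 \<ge> 0" "\<And>s. 1/2 + e \<le> Re s \<Longrightarrow> Re s \<le> 5 \<Longrightarrow> norm (deriv g s / g s) \<le> C0 * ln (3 + \<bar>Im s\<bar>)"
      using selberg_log_deriv_bound[OF ax grh g gnz e(1)] by metis
    then obtain C' where C': "C' \<ge> 0" "\<And>s. 1/2 + e \<le> Re s \<Longrightarrow> Re s \<le> 5 \<Longrightarrow>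
      norm (- (deriv g s / g s + of_real M) / s) \<le> C' * norm s powr (e - 1)"
      using log_deriv_quotient_bound[where g = g and e = e and M = M] e(1) by metis
    obtain I where I: "I \<ge> 0" "(\<integral>\<^sup>+t. ennreal (norm (Complex (1/2 + e) t) powr (- (1 + 2 * e))) \<partial>lborel) \<le> ennreal I"
      using nn_integral_vertical_powr[of "1/2 + e" "1 + 2 * e"] e by (metis add.commute add_increasing2 less_add_same_cancel1 less_eq_real_def mult_pos_pos zero_less_numeral order_refl)
    define C where "C = exp 17 * (18 * C'\<^sup>2 * I)"
    have C: "C \<ge> 0" using I by (simp add: C_def)
    have "(\<integral>\<^sup>+x. indicator {1..X} x * ennreal ((norm (psiF \<Lambda> (x + \<delta> * x) - psiF \<Lambda> x - of_real (M * \<delta> * x)))\<^sup>2 * x powr (- 2 - 2 * e)) \<partial>lborel)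
       \<le> ennreal (C * (\<delta> powr (1 - 4 * e) * (1 + \<delta>) powr (6 * e)))" if \<delta>: "\<delta> > 0" for \<delta> X
    proof -
      define \<alpha> where "\<alpha> = ln (1 + \<delta>)"
      have \<alpha>: "\<alpha> > 0" and ea: "exp \<alpha> = 1 + \<delta>" using \<delta> by (auto simp: \<alpha>_def)
      define B where "B = 18 * C'\<^sup>2 * (\<delta> powr (1 - 4 * e) * (1 + \<delta>) powr (6 * e))"
      have "(\<integral>\<^sup>+x. indicator {1..X} x * ennreal ((norm (psiF \<Lambda> (exp \<alpha> * x) - psiF \<Lambda> x - of_real (M * (exp \<alpha> - 1) * x)))\<^sup>2 * x powr (- 2 - 2 * e)) \<partial>lborel)
        \<le> ennreal (exp 17) * (\<integral>\<^sup>+t. (norm ((exp (of_real \<alpha> * Complex (1/2 + e) t) - 1)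
            * (- (deriv g (Complex (1/2 + e) t) / g (Complex (1/2 + e) t) + of_real M) / Complex (1/2 + e) t)))\<^sup>2 \<partial>lborel)"
        by (rule psi_remainder_mean_square[OF CL g(1) gnz sums e C' \<alpha>])
      also have "\<dots> \<le> ennreal (exp 17) * (\<integral>\<^sup>+t. ennreal B * ennreal (norm (Complex (1/2 + e) t) powr (- (1 + 2 * e))) \<partial>lborel)"
      proof (intro mult_left_mono nn_integral_mono)
        fix t
        define s where "s = Complex (1/2 + e) t"
        have "norm (- (deriv g s / g s + of_real M) / s) \<le> C' * norm s powr (e - 1)"
          by (rule C') (use e in \<open>auto simp: s_def\<close>)
        hence "(norm (- (deriv g s / g s + of_real M) / s))\<^sup>2 \<le> (C' * norm s powr (e - 1))\<^sup>2" by (intro power_mono) auto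
        hence "(norm ((exp (of_real \<alpha> * s) - 1) * (- (deriv g s / g s + of_real M) / s)))\<^sup>2
            \<le> (norm (exp (of_real \<alpha> * s) - 1))\<^sup>2 * (C' * norm s powr (e - 1))\<^sup>2"
          unfolding norm_mult power_mult_distrib by (intro mult_left_mono) auto
        also have "\<dots> = C'\<^sup>2 * ((norm (exp (of_real \<alpha> * s) - 1))\<^sup>2 * (norm s powr (e - 1))\<^sup>2)"
          by (simp add: power_mult_distrib mult_ac)
        also have "\<dots> \<le> C'\<^sup>2 * (18 * \<delta> powr (1 - 4 * e) * (1 + \<delta>) powr (6 * e) * norm s powr (- (1 + 2 * e)))"
          unfolding \<alpha>_def s_def by (intro mult_left_mono mellin_kernel_square_bound \<delta> e) auto
        also have "\<dots> = B * norm s powr (- (1 + 2 * e))" by (simp add: B_def mult_ac)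
        finally have "ennreal ((norm ((exp (of_real \<alpha> * s) - 1) * (- (deriv g s / g s + of_real M) / s)))\<^sup>2) \<le> ennreal (B * norm s powr (- (1 + 2 * e)))"
          by (rule ennreal_leI)
        also have "\<dots> = ennreal B * ennreal (norm s powr (- (1 + 2 * e)))" by (rule ennreal_mult'') auto
        finally show "ennreal ((norm ((exp (of_real \<alpha> * Complex (1/2 + e) t) - 1)
            * (- (deriv g (Complex (1/2 + e) t) / g (Complex (1/2 + e) t) + of_real M) / Complex (1/2 + e) t)))\<^sup>2)
          \<le> ennreal B * ennreal (norm (Complex (1/2 + e) t) powr (- (1 + 2 * e)))" unfolding s_def .
      qed auto
      also have "\<dots> = ennreal (exp 17) * (ennreal B * (\<integral>\<^sup>+t. ennreal (norm (Complex (1/2 + e) t) powr (- (1 + 2 * e))) \<partial>lborel))"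
      proof -
        have "continuous_on UNIV (\<lambda>t. Complex (1/2 + e) t)" unfolding Complex_eq by (intro continuous_intros)
        hence [measurable]: "(\<lambda>t. Complex (1/2 + e) t) \<in> borel_measurable borel" by (rule borel_measurable_continuous_onI)
        show ?thesis by (subst nn_integral_cmult) (auto intro!: measurable_compose[OF _ measurable_ennreal])
      qed
      also have "\<dots> \<le> ennreal (exp 17) * (ennreal B * ennreal I)" by (intro mult_left_mono I) auto
      also have "\<dots> = ennreal (C * (\<delta> powr (1 - 4 * e) * (1 + \<delta>) powr (6 * e)))"
        using I by (simp add: C_def B_def mult_ac flip: ennreal_mult')
      finally show ?thesis unfolding ea by (simp add: distrib_right)
    qed
    thus "\<exists>C\<ge>0. \<forall>\<delta>>0. \<forall>X.
     (\<integral>\<^sup>+x. indicator {1..X} x * ennreal ((norm (psiF \<Lambda> (x + \<delta> * x) - psiF \<Lambda> x - of_real (M * \<delta> * x)))\<^sup>2 * x powr (- 2 - 2 * e)) \<partial>lborel)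
       \<le> ennreal (C * (\<delta> powr (1 - 4 * e) * (1 + \<delta>) powr (6 * e)))" using C by blast
  qed
qed

section \<open>From fixed slopes to averages over lengths\<close>

text \<open>M is a free parameter: the bound under GRH concerns the residue of -F'/F, the hypothesis
  on \<open>VF\<close> concerns m.\<close>

definition psi_gap :: "(nat \<Rightarrow> complex) \<Rightarrow> real \<Rightarrow> real \<Rightarrow> real \<Rightarrow> complex" where
  "psi_gap \<Lambda> M x v = psiF \<Lambda> (x + v) - psiF \<Lambda> x - of_real (M * v)"

lemma psi_gap_measurable [measurable]:
  "(\<lambda>(x, v). psi_gap \<Lambda> M x v) \<in> borel_measurable (borel \<Otimes>\<^sub>M borel)"
  unfolding psi_gap_def by measurable

lemma psi_gap_0 [simp]: "psi_gap \<Lambda> M x 0 = 0"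
  by (simp add: psi_gap_def)

text \<open>The uniformity in all \<delta> > 0 matters: a length v at small x is a large slope
  v/x.\<close>

definition mean_square_bounded :: "(nat \<Rightarrow> complex) \<Rightarrow> real \<Rightarrow> bool" where
  "mean_square_bounded \<Lambda> M \<longleftrightarrow> (\<forall>e. 0 < e \<longrightarrow> e < 1/8 \<longrightarrow> (\<exists>C\<ge>0. \<forall>\<delta>>0. \<forall>X.
     (\<integral>\<^sup>+x. indicator {1..X} x * ennreal ((norm (psi_gap \<Lambda> M x (\<delta> * x)))\<^sup>2 * x powr (- 2 - 2 * e)) \<partial>lborel)
       \<le> ennreal (C * (\<delta> powr (1 - 4 * e) * (1 + \<delta>) powr (6 * e)))))"

text \<open>The integral at fixed slope that arises from v = x*\<delta>; the extra factor x is the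
  Jacobian.\<close>

lemma mean_square_slope_integral:
  assumes "mean_square_bounded \<Lambda> M" and e: "0 < e" "e < 1/8"
  obtains C where "C \<ge> 0" "\<And>\<delta> X w. \<delta> > 0 \<Longrightarrow> X \<ge> 1 \<Longrightarrow> w > 0 \<Longrightarrow>
     (\<integral>\<^sup>+x. indicator {1..X} x * (indicator {0..w} (x * \<delta>) * (ennreal x * ennreal ((norm (psi_gap \<Lambda> M x (x * \<delta>)))\<^sup>2))) \<partial>lborel)
       \<le> ennreal (C * (X powr (1 + 7 * e) * w powr (2 - 5 * e) * (1 + w) powr (6 * e) * \<delta> powr (e - 1)) * indicator {0..w} \<delta>)"
proof -
  obtain C where C: "C \<ge> 0" and b: "\<And>\<delta> X. \<delta> > 0 \<Longrightarrow>
     (\<integral>\<^sup>+x. indicator {1..X} x * ennreal ((norm (psi_gap \<Lambda> M x (\<delta> * x)))\<^sup>2 * x powr (- 2 - 2 * e)) \<partial>lborel)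
       \<le> ennreal (C * (\<delta> powr (1 - 4 * e) * (1 + \<delta>) powr (6 * e)))"
    using assms(1)[unfolded mean_square_bounded_def, rule_format, OF e] by blast
  show ?thesis
  proof (rule that[OF C])
    fix \<delta> X w :: real assume \<delta>: "\<delta> > 0" and X: "X \<ge> 1" and w: "w > 0"
    \<comment> \<open>x^(3 + 2e) is split into x^(1 + 7e), estimated by x \<le> X, and x^(2 - 5e),
      estimated by x \<le> w/\<delta>. The second exponent is chosen so that \<delta>^(e - 1) is
      left, which is just integrable at 0.\<close>
    define B where "B = X powr (1 + 7 * e) * (w / \<delta>) powr (2 - 5 * e)"
    have B: "B \<ge> 0" by (simp add: B_def)
    show "(\<integral>\<^sup>+x. indicator {1..X} x * (indicator {0..w} (x * \<delta>) * (ennreal x * ennreal ((norm (psi_gap \<Lambda> M x (x * \<delta>)))\<^sup>2))) \<partial>lborel)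
       \<le> ennreal (C * (X powr (1 + 7 * e) * w powr (2 - 5 * e) * (1 + w) powr (6 * e) * \<delta> powr (e - 1)) * indicator {0..w} \<delta>)"
    \<comment> \<open>As x \<ge> 1, slopes above w admit no x at all; this yields the indicator on
      the right-hand side.\<close>
    proof (cases "\<delta> \<le> w")
      case False
      have z: "indicator {1..X} x * (indicator {0..w} (x * \<delta>) * (ennreal x * ennreal ((norm (psi_gap \<Lambda> M x (x * \<delta>)))\<^sup>2))) = 0" for x
      proof (cases "x \<ge> 1")
        case True
        hence "1 * \<delta> \<le> x * \<delta>" using \<delta> by (intro mult_right_mono) auto
        thus ?thesis using False by simp
      qed simp
      show ?thesis unfolding z by simp
    next
      case True
      have "(\<integral>\<^sup>+x. indicator {1..X} x * (indicator {0..w} (x * \<delta>) * (ennreal x * ennreal ((norm (psi_gap \<Lambda> M x (x * \<delta>)))\<^sup>2))) \<partial>lborel)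
          \<le> (\<integral>\<^sup>+x. ennreal B * (indicator {1..X} x * ennreal ((norm (psi_gap \<Lambda> M x (\<delta> * x)))\<^sup>2 * x powr (- 2 - 2 * e))) \<partial>lborel)"
      proof (rule nn_integral_mono)
        fix x
        show "indicator {1..X} x * (indicator {0..w} (x * \<delta>) * (ennreal x * ennreal ((norm (psi_gap \<Lambda> M x (x * \<delta>)))\<^sup>2)))
           \<le> ennreal B * (indicator {1..X} x * ennreal ((norm (psi_gap \<Lambda> M x (\<delta> * x)))\<^sup>2 * x powr (- 2 - 2 * e)))"
        proof (cases "x \<in> {1..X} \<and> x * \<delta> \<le> w")
          case T: True
          hence x: "1 \<le> x" "x \<le> X" "x \<le> w / \<delta>" using \<delta> by (auto simp: field_simps)
          have "x = x powr (1 + 7 * e) * x powr (2 - 5 * e) * x powr (- 2 - 2 * e)"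
            using x by (simp flip: powr_add)
          also have "\<dots> \<le> B * x powr (- 2 - 2 * e)"
            unfolding B_def using x e by (intro mult_right_mono mult_mono powr_mono2) auto
          finally have xB: "x \<le> B * x powr (- 2 - 2 * e)" .
          have "x * (norm (psi_gap \<Lambda> M x (x * \<delta>)))\<^sup>2 \<le> B * x powr (- 2 - 2 * e) * (norm (psi_gap \<Lambda> M x (x * \<delta>)))\<^sup>2"
            by (intro mult_right_mono xB) auto
          also have "\<dots> = B * ((norm (psi_gap \<Lambda> M x (\<delta> * x)))\<^sup>2 * x powr (- 2 - 2 * e))" by (simp add: mult_ac)
          finally have "ennreal (x * (norm (psi_gap \<Lambda> M x (x * \<delta>)))\<^sup>2) \<le> ennreal (B * ((norm (psi_gap \<Lambda> M x (\<delta> * x)))\<^sup>2 * x powr (- 2 - 2 * e)))"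
            by (rule ennreal_leI)
          thus ?thesis using T x B by (auto simp: indicator_def ennreal_mult')
        qed (auto simp: indicator_def)
      qed
      also have "\<dots> = ennreal B * (\<integral>\<^sup>+x. indicator {1..X} x * ennreal ((norm (psi_gap \<Lambda> M x (\<delta> * x)))\<^sup>2 * x powr (- 2 - 2 * e)) \<partial>lborel)"
        by (rule nn_integral_cmult) measurable
      also have "\<dots> \<le> ennreal B * ennreal (C * (\<delta> powr (1 - 4 * e) * (1 + \<delta>) powr (6 * e)))"
        by (intro mult_left_mono b \<delta>) auto
      also have "\<dots> = ennreal (B * (C * (\<delta> powr (1 - 4 * e) * (1 + \<delta>) powr (6 * e))))"
        using B by (simp add: ennreal_mult')
      also have "\<dots> \<le> ennreal (B * (C * (\<delta> powr (1 - 4 * e) * (1 + w) powr (6 * e))))"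
        using B C \<delta> True e by (intro ennreal_leI mult_left_mono powr_mono2) auto
      also have "B * (C * (\<delta> powr (1 - 4 * e) * (1 + w) powr (6 * e)))
          = C * (X powr (1 + 7 * e) * w powr (2 - 5 * e) * (1 + w) powr (6 * e) * (\<delta> powr (1 - 4 * e) / \<delta> powr (2 - 5 * e)))"
        by (simp add: B_def powr_divide)
      also have "\<delta> powr (1 - 4 * e) / \<delta> powr (2 - 5 * e) = \<delta> powr (e - 1)" using \<delta> by (simp flip: powr_diff)
      finally show ?thesis using True \<delta> by simp
    qed
  qed
qed

text \<open>Fubini and v = x*\<delta> reduce the average over lengths to the bounds at fixed slope.
  Up to X^\<epsilon> the result is w^2*X, which is what a mean square of size v*X at each length v
  would give.\<close>

lemma psi_gap_average_bound:
  assumes ms: "mean_square_bounded \<Lambda> M" and \<epsilon>: "\<epsilon> > 0"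
  obtains C where "C \<ge> 0" "\<And>X w. X \<ge> 1 \<Longrightarrow> 1 / X \<le> w \<Longrightarrow> w \<le> 2 * X \<Longrightarrow>
    (\<integral>\<^sup>+v. indicator {0..w} v * (\<integral>\<^sup>+x. indicator {1..X} x * ennreal ((norm (psi_gap \<Lambda> M x v))\<^sup>2) \<partial>lborel) \<partial>lborel)
      \<le> ennreal (C * (w\<^sup>2 * X powr (1 + \<epsilon>)))"
proof -
  \<comment> \<open>17e = 7e + 4e + 6e collects the losses in X^(1 + 7e), in w^(-4e) \<le> X^(4e)
    and in (1 + w)^(6e). The cap 1/16 ensures e < 1/8 and 3^(6e) \<le> 3.\<close>
  define e where "e = min (\<epsilon> / 17) (1/16)"
  have e: "0 < e" "e < 1/8" "17 * e \<le> \<epsilon>" "6 * e \<le> 1" using \<epsilon> by (auto simp: e_def)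
  show ?thesis
  proof (rule mean_square_slope_integral[OF ms e(1,2)])
    fix C assume C: "C \<ge> 0" and b: "\<And>\<delta> X w. \<delta> > 0 \<Longrightarrow> X \<ge> 1 \<Longrightarrow> w > 0 \<Longrightarrow>
     (\<integral>\<^sup>+x. indicator {1..X} x * (indicator {0..w} (x * \<delta>) * (ennreal x * ennreal ((norm (psi_gap \<Lambda> M x (x * \<delta>)))\<^sup>2))) \<partial>lborel)
       \<le> ennreal (C * (X powr (1 + 7 * e) * w powr (2 - 5 * e) * (1 + w) powr (6 * e) * \<delta> powr (e - 1)) * indicator {0..w} \<delta>)"

  show ?thesis
  proof (rule that[of "C / e * 3"])
    show "C / e * 3 \<ge> 0" using C e by simp
    fix X w :: real assume X: "X \<ge> 1" and w1: "1 / X \<le> w" and w2: "w \<le> 2 * X"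
    have w: "w > 0" using w1 X by (meson divide_pos_pos less_le_trans zero_less_one)
    define G where "G x v = indicator {1..X} x * (indicator {0..w} v * ennreal ((norm (psi_gap \<Lambda> M x v))\<^sup>2))" for x v :: real
    have [measurable]: "case_prod G \<in> borel_measurable (borel \<Otimes>\<^sub>M borel)" unfolding G_def by measurable
    define D where "D = X powr (1 + 7 * e) * w powr (2 - 5 * e) * (1 + w) powr (6 * e)"
    have D: "D \<ge> 0" by (simp add: D_def)
    have "(\<integral>\<^sup>+v. indicator {0..w} v * (\<integral>\<^sup>+x. indicator {1..X} x * ennreal ((norm (psi_gap \<Lambda> M x v))\<^sup>2) \<partial>lborel) \<partial>lborel)
        = (\<integral>\<^sup>+v. \<integral>\<^sup>+x. G x v \<partial>lborel \<partial>lborel)"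
    proof (rule nn_integral_cong)
      fix v
      have "(\<integral>\<^sup>+x. G x v \<partial>lborel) = (\<integral>\<^sup>+x. indicator {0..w} v * (indicator {1..X} x * ennreal ((norm (psi_gap \<Lambda> M x v))\<^sup>2)) \<partial>lborel)"
        by (simp add: G_def mult_ac)
      also have "\<dots> = indicator {0..w} v * (\<integral>\<^sup>+x. indicator {1..X} x * ennreal ((norm (psi_gap \<Lambda> M x v))\<^sup>2) \<partial>lborel)"
        by (rule nn_integral_cmult) measurable
      finally show "indicator {0..w} v * (\<integral>\<^sup>+x. indicator {1..X} x * ennreal ((norm (psi_gap \<Lambda> M x v))\<^sup>2) \<partial>lborel) = (\<integral>\<^sup>+x. G x v \<partial>lborel)" by simp
    qed
    also have "\<dots> = (\<integral>\<^sup>+x. \<integral>\<^sup>+v. G x v \<partial>lborel \<partial>lborel)"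
      by (rule lborel_pair.Fubini') measurable
    \<comment> \<open>The substitution is made for each x separately; afterwards \<delta> can be
      made the outer variable.\<close>
    also have "\<dots> = (\<integral>\<^sup>+x. \<integral>\<^sup>+\<delta>. ennreal x * G x (x * \<delta>) \<partial>lborel \<partial>lborel)"
    proof (rule nn_integral_cong)
      fix x
      show "(\<integral>\<^sup>+v. G x v \<partial>lborel) = (\<integral>\<^sup>+\<delta>. ennreal x * G x (x * \<delta>) \<partial>lborel)"
      proof (cases "x \<in> {1..X}")
        case True
        have "(\<integral>\<^sup>+v. G x v \<partial>lborel) = ennreal \<bar>x\<bar> * (\<integral>\<^sup>+\<delta>. G x (0 + x * \<delta>) \<partial>lborel)"
          by (rule nn_integral_real_affine) (use True in auto)
        also have "\<dots> = (\<integral>\<^sup>+\<delta>. ennreal x * G x (x * \<delta>) \<partial>lborel)"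
          using True by (subst nn_integral_cmult) auto
        finally show ?thesis .
      next
        case False
        have "G x v = 0" for v using False by (simp add: G_def indicator_def)
        thus ?thesis by simp
      qed
    qed
    also have "\<dots> = (\<integral>\<^sup>+\<delta>. \<integral>\<^sup>+x. ennreal x * G x (x * \<delta>) \<partial>lborel \<partial>lborel)"
      by (rule lborel_pair.Fubini') measurable
    also have "\<dots> \<le> (\<integral>\<^sup>+\<delta>. ennreal (C * D) * (ennreal (\<delta> powr (e - 1)) * indicator {0..w} \<delta>) \<partial>lborel)"
    proof (rule nn_integral_mono)
      fix \<delta>
      show "(\<integral>\<^sup>+x. ennreal x * G x (x * \<delta>) \<partial>lborel) \<le> ennreal (C * D) * (ennreal (\<delta> powr (e - 1)) * indicator {0..w} \<delta>)"
      proof (cases "\<delta> > 0")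
        case True
        have "(\<integral>\<^sup>+x. ennreal x * G x (x * \<delta>) \<partial>lborel)
            = (\<integral>\<^sup>+x. indicator {1..X} x * (indicator {0..w} (x * \<delta>) * (ennreal x * ennreal ((norm (psi_gap \<Lambda> M x (x * \<delta>)))\<^sup>2))) \<partial>lborel)"
          by (simp add: G_def mult_ac)
        also have "\<dots> \<le> ennreal (C * (D * \<delta> powr (e - 1)) * indicator {0..w} \<delta>)"
          using b[OF True X w] by (simp add: D_def mult.assoc)
        also have "\<dots> = ennreal (C * D) * (ennreal (\<delta> powr (e - 1)) * indicator {0..w} \<delta>)"
          using C D by (auto simp: indicator_def ennreal_mult' mult.assoc)
        finally show ?thesis .
      next
        case False
        have z: "ennreal x * G x (x * \<delta>) = 0" for x
        proof (cases "\<delta> = 0 \<or> x < 1")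
          case True
          thus ?thesis by (auto simp: G_def)
        next
          case F: False
          hence "x * \<delta> < 0" using False by (intro mult_pos_neg) auto
          thus ?thesis by (simp add: G_def)
        qed
        show ?thesis unfolding z by simp
      qed
    qed
    also have "\<dots> = ennreal (C * D) * (\<integral>\<^sup>+\<delta>. ennreal (\<delta> powr (e - 1)) * indicator {0..w} \<delta> \<partial>lborel)"
      by (rule nn_integral_cmult) measurable
    also have "(\<integral>\<^sup>+\<delta>. ennreal (\<delta> powr (e - 1)) * indicator {0..w} \<delta> \<partial>lborel) = ennreal (w powr (e - 1 + 1) / (e - 1 + 1))"
      by (rule nn_integral_has_integral_lebesgue'[OF _ has_integral_powr_from_0]) (use e w in auto)
    also have "ennreal (C * D) * ennreal (w powr (e - 1 + 1) / (e - 1 + 1)) = ennreal (C / e * (D * w powr e))"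
      using C D e by (simp flip: ennreal_mult')
    also have "\<dots> \<le> ennreal (C / e * 3 * (w\<^sup>2 * X powr (1 + \<epsilon>)))"
    proof (rule ennreal_leI)
      have "D * w powr e = X powr (1 + 7 * e) * (w powr 2 * w powr (- 4 * e)) * (1 + w) powr (6 * e)"
        by (simp add: D_def flip: powr_add)
      also have "\<dots> \<le> X powr (1 + 7 * e) * (w powr 2 * X powr (4 * e)) * (3 * X powr (6 * e))"
      proof -
        have "w powr (- 4 * e) \<le> (1 / X) powr (- 4 * e)" using w1 X e by (intro powr_mono2') auto
        also have "\<dots> = X powr (4 * e)" using X by (simp add: powr_divide powr_minus)
        finally have f1: "w powr (- 4 * e) \<le> X powr (4 * e)" .
        have "(1 + w) powr (6 * e) \<le> (3 * X) powr (6 * e)" using w w2 X e by (intro powr_mono2) auto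
        also have "\<dots> = 3 powr (6 * e) * X powr (6 * e)" using X by (simp add: powr_mult)
        also have "\<dots> \<le> 3 powr 1 * X powr (6 * e)" using e by (intro mult_right_mono powr_mono) auto
        finally have f2: "(1 + w) powr (6 * e) \<le> 3 * X powr (6 * e)" by simp
        show ?thesis by (rule mult_mono[OF mult_left_mono[OF mult_left_mono[OF f1]] f2]) simp_all
      qed
      also have "\<dots> = 3 * w\<^sup>2 * X powr (1 + 17 * e)"
      proof -
        have "X powr (1 + 7 * e) * X powr (4 * e) * X powr (6 * e) = X powr (1 + 17 * e)"
          unfolding powr_add[symmetric] by (rule arg_cong) simp
        moreover have "X powr (1 + 7 * e) * (w powr 2 * X powr (4 * e)) * (3 * X powr (6 * e))
            = 3 * w powr 2 * (X powr (1 + 7 * e) * X powr (4 * e) * X powr (6 * e))" by (simp only: mult_ac)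
        ultimately show ?thesis using w by simp
      qed
      also have "\<dots> \<le> 3 * w\<^sup>2 * X powr (1 + \<epsilon>)"
        using X e by (intro mult_left_mono powr_mono) auto
      finally have "C / e * (D * w powr e) \<le> C / e * (3 * w\<^sup>2 * X powr (1 + \<epsilon>))"
        using C e by (intro mult_left_mono) auto
      thus "C / e * (D * w powr e) \<le> C / e * 3 * (w\<^sup>2 * X powr (1 + \<epsilon>))" by simp
    qed
    finally show "(\<integral>\<^sup>+v. indicator {0..w} v * (\<integral>\<^sup>+x. indicator {1..X} x * ennreal ((norm (psi_gap \<Lambda> M x v))\<^sup>2) \<partial>lborel) \<partial>lborel)
      \<le> ennreal (C / e * 3 * (w\<^sup>2 * X powr (1 + \<epsilon>)))" .
  qed
  qed
qed

section \<open>Constraints imposed by the asymptotic formula\<close>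

text \<open>The constant c1 collects everything in the bracket that does not depend on \<delta>, so
  that the arguments below see only d and c1.\<close>

definition VF_asymptotic :: "(nat \<Rightarrow> complex) \<Rightarrow> nat \<Rightarrow> real \<Rightarrow> real \<Rightarrow> real \<Rightarrow> real \<Rightarrow> real \<Rightarrow> bool" where
  "VF_asymptotic \<Lambda> m d c1 c B1 B3 \<longleftrightarrow> (\<forall>k1>0. \<forall>k2>0. \<exists>C X0. \<forall>X\<ge>X0. \<forall>\<delta>.
        k1 * X powr (- B3) \<le> \<delta> \<and> \<delta> \<le> k2 * X powr (- B1) \<longrightarrow>
        \<bar>VF \<Lambda> m X \<delta> - 1/2 * \<delta> * X\<^sup>2 * (d * ln (1 / \<delta>) + c1)\<bar> \<le> C * (\<delta> powr (1 + c) * X\<^sup>2))"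

lemma VF_asymptoticD:
  assumes "VF_asymptotic \<Lambda> m d c1 c B1 B3" "k1 > 0" "k2 > 0"
  obtains C X0 where "C \<ge> 0" "X0 \<ge> 1" "\<And>X \<delta>. X \<ge> X0 \<Longrightarrow> k1 * X powr (- B3) \<le> \<delta> \<Longrightarrow> \<delta> \<le> k2 * X powr (- B1) \<Longrightarrow>
     \<bar>VF \<Lambda> m X \<delta> - 1/2 * \<delta> * X\<^sup>2 * (d * ln (1 / \<delta>) + c1)\<bar> \<le> C * (\<delta> powr (1 + c) * X\<^sup>2)"
proof -
  from assms(1)[unfolded VF_asymptotic_def, rule_format, OF assms(2,3)]
  obtain C X0 where *: "\<forall>X\<ge>X0. \<forall>\<delta>. k1 * X powr (- B3) \<le> \<delta> \<and> \<delta> \<le> k2 * X powr (- B1) \<longrightarrow>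
        \<bar>VF \<Lambda> m X \<delta> - 1/2 * \<delta> * X\<^sup>2 * (d * ln (1 / \<delta>) + c1)\<bar> \<le> C * (\<delta> powr (1 + c) * X\<^sup>2)" by blast
  show ?thesis
  proof (rule that[of "max C 0" "max X0 1"])
    fix X \<delta> assume X: "X \<ge> max X0 1" and \<delta>: "k1 * X powr (- B3) \<le> \<delta>" "\<delta> \<le> k2 * X powr (- B1)"
    have "\<bar>VF \<Lambda> m X \<delta> - 1/2 * \<delta> * X\<^sup>2 * (d * ln (1 / \<delta>) + c1)\<bar> \<le> C * (\<delta> powr (1 + c) * X\<^sup>2)" using * X \<delta> by auto
    also have "\<dots> \<le> max C 0 * (\<delta> powr (1 + c) * X\<^sup>2)" by (intro mult_right_mono) auto
    finally show "\<bar>VF \<Lambda> m X \<delta> - 1/2 * \<delta> * X\<^sup>2 * (d * ln (1 / \<delta>) + c1)\<bar> \<le> max C 0 * (\<delta> powr (1 + c) * X\<^sup>2)" .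
  qed auto
qed

text \<open>The interval (x, x + \<delta>*x] is shorter than 1/2, so it contains at most one
  integer. That integer is at most N because x \<le> N + 1/4, and at least 2 because x > 1; it is n
  exactly when x lies in [n/(1 + \<delta>), n].\<close>

lemma psiF_increment_small_slope:
  fixes N :: nat and x \<delta> :: real
  assumes \<delta>: "\<delta> > 0" "\<delta> * (real N + 1) < 1/2" and x: "1 \<le> x" "x \<le> real N + 1/4" "x \<notin> \<int>"
  obtains "psiF \<Lambda> (x + \<delta> * x) - psiF \<Lambda> x = 0" "\<And>n. n \<in> {2..N} \<Longrightarrow> x \<notin> {real n / (1 + \<delta>)..real n}"
  | j where "j \<in> {2..N}" "psiF \<Lambda> (x + \<delta> * x) - psiF \<Lambda> x = \<Lambda> j"
      "\<And>n. n \<in> {2..N} \<Longrightarrow> x \<in> {real n / (1 + \<delta>)..real n} \<longleftrightarrow> n = j"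
proof -
  define j where "j = nat \<lfloor>x\<rfloor>"
  have j: "real j < x" "x < real j + 1" "j \<ge> 1"
  proof -
    have fl: "of_int \<lfloor>x\<rfloor> \<le> x" "x < of_int \<lfloor>x\<rfloor> + 1" by linarith+
    have "real j = of_int \<lfloor>x\<rfloor>" using x by (simp add: j_def)
    moreover have "of_int \<lfloor>x\<rfloor> \<noteq> x" using x(3) by (metis Ints_of_int)
    ultimately show "real j < x" "x < real j + 1" using fl by linarith+
    show "j \<ge> 1" using x by (simp add: j_def le_nat_iff)
  qed
  have "\<delta> * x \<le> \<delta> * (real N + 1)" using \<delta> x by (intro mult_left_mono) auto
  hence dx: "\<delta> * x < 1/2" using \<delta> by linarith
  have mem: "x \<in> {real n / (1 + \<delta>)..real n} \<longleftrightarrow> real n \<le> x + \<delta> * x \<and> x \<le> real n" for n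
    using \<delta> by (auto simp: field_simps)
  have jx: "real j + 1 \<le> x + \<delta> * x \<longrightarrow> j + 1 \<in> {2..N}"
  proof
    assume "real j + 1 \<le> x + \<delta> * x"
    hence "real j < real N" using x dx by linarith
    thus "j + 1 \<in> {2..N}" using j by auto
  qed
  have iff: "x \<in> {real n / (1 + \<delta>)..real n} \<longleftrightarrow> n = j + 1 \<and> real j + 1 \<le> x + \<delta> * x" for n
  proof
    assume "x \<in> {real n / (1 + \<delta>)..real n}"
    hence n: "real n \<le> x + \<delta> * x" "x \<le> real n" using mem by auto
    have "real j < real n" "real n < real j + 2" using n j dx by linarith+
    hence "n = j + 1" by linarith
    thus "n = j + 1 \<and> real j + 1 \<le> x + \<delta> * x" using n by auto
  next
    assume "n = j + 1 \<and> real j + 1 \<le> x + \<delta> * x"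
    thus "x \<in> {real n / (1 + \<delta>)..real n}" unfolding mem using j by auto
  qed
  show ?thesis
  proof (cases "real j + 1 \<le> x + \<delta> * x")
    case True
    have "\<lfloor>x + \<delta> * x\<rfloor> = int (j + 1)" using True j dx by (intro floor_unique) auto
    hence "nat \<lfloor>x + \<delta> * x\<rfloor> = Suc j" by simp
    hence "psiF \<Lambda> (x + \<delta> * x) - psiF \<Lambda> x = \<Lambda> (j + 1)" by (simp add: psiF_def j_def[symmetric])
    thus ?thesis using True jx iff by (intro that(2)[of "j + 1"]) auto
  next
    case False
    have dx0: "\<delta> * x \<ge> 0" using \<delta> x by simp
    have "\<lfloor>x + \<delta> * x\<rfloor> = int j" using False j dx0 by (intro floor_unique) auto
    hence "psiF \<Lambda> (x + \<delta> * x) - psiF \<Lambda> x = 0" by (simp add: psiF_def j_def[symmetric])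
    thus ?thesis using False iff by (intro that(1)) auto
  qed
qed

text \<open>On [n/(1 + \<delta>), n] the increment is \<Lambda>(n) and the square is expanded there,
  while the term quadratic in m is integrated over the whole range. The offset 1/4 in X keeps the
  end away from these pieces.\<close>

lemma VF_small_slope:
  fixes N m :: nat and \<delta> :: real and \<Lambda> :: "nat \<Rightarrow> complex"
  assumes \<delta>: "\<delta> > 0" "\<delta> * (real N + 1) < 1/2"
  defines "X \<equiv> real N + 1/4"
  shows "VF \<Lambda> m X \<delta> = (\<Sum>n\<in>{2..N}. (norm (\<Lambda> n))\<^sup>2 * (real n - real n / (1 + \<delta>))
       - real m * \<delta> * Re (\<Lambda> n) * (real n ^ 2 - (real n / (1 + \<delta>)) ^ 2)) + (if N = 0 then 0 else (real m)\<^sup>2 * \<delta>\<^sup>2 * (X ^ 3 - 1) / 3)"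
\<comment> \<open>For N = 0 the range [1, 1/4] is empty, whereas the closed formula for the last
  term need not vanish.\<close>
proof (cases "N = 0")
  case True
  thus ?thesis by (simp add: VF_def X_def)
next
  case N: False
  define t where "t n x = (norm (\<Lambda> n))\<^sup>2 - 2 * real m * \<delta> * Re (\<Lambda> n) * x" for n and x :: real
  define g where "g x = (\<Sum>n\<in>{2..N}. if x \<in> {real n / (1 + \<delta>)..real n} then t n x else 0) + (real m)\<^sup>2 * \<delta>\<^sup>2 * x\<^sup>2" for x
  define gap where "gap x = (norm (psiF \<Lambda> (x + \<delta> * x) - psiF \<Lambda> x - of_real (real m * \<delta> * x)))\<^sup>2" for x
  have X1: "1 \<le> X" using N by (simp add: X_def)
  \<comment> \<open>The integers in the range are left out; they form a finite set, which the
    integral ignores.\<close>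
  have eq: "gap x = g x" if x: "x \<in> {1..X} - real ` {0..N}" for x
  proof -
    have "x \<notin> \<int>"
    proof
      assume "x \<in> \<int>"
      then obtain i where i: "x = of_int i" by (auto elim: Ints_cases)
      hence "x = real (nat i)" using x by auto
      moreover from this have "nat i \<le> N" using x by (simp add: X_def)
      ultimately show False using x by auto
    qed
    hence x': "1 \<le> x" "x \<le> real N + 1/4" "x \<notin> \<int>" using x by (auto simp: X_def)
    show ?thesis
    proof (rule psiF_increment_small_slope[OF \<delta> x', of \<Lambda>])
      assume a: "psiF \<Lambda> (x + \<delta> * x) - psiF \<Lambda> x = 0" "\<And>n. n \<in> {2..N} \<Longrightarrow> x \<notin> {real n / (1 + \<delta>)..real n}"
      have "(\<Sum>n\<in>{2..N}. if x \<in> {real n / (1 + \<delta>)..real n} then t n x else 0) = 0"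
        by (rule sum.neutral) (use a(2) in auto)
      thus ?thesis unfolding gap_def g_def a(1) by (simp add: norm_mult power_mult_distrib)
    next
      fix j assume j: "j \<in> {2..N}" "psiF \<Lambda> (x + \<delta> * x) - psiF \<Lambda> x = \<Lambda> j"
        "\<And>n. n \<in> {2..N} \<Longrightarrow> x \<in> {real n / (1 + \<delta>)..real n} \<longleftrightarrow> n = j"
      have "(\<Sum>n\<in>{2..N}. if x \<in> {real n / (1 + \<delta>)..real n} then t n x else 0) = (\<Sum>n\<in>{2..N}. if n = j then t n x else 0)"
        by (rule sum.cong[OF refl]) (simp only: j(3))
      also have "\<dots> = t j x" using j(1) by simp
      finally have s: "(\<Sum>n\<in>{2..N}. if x \<in> {real n / (1 + \<delta>)..real n} then t n x else 0) = t j x" .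
      define q where "q = real m * \<delta> * x"
      have n1: "(norm (\<Lambda> j - of_real q))\<^sup>2 = (Re (\<Lambda> j) - q)\<^sup>2 + (Im (\<Lambda> j))\<^sup>2" by (simp add: cmod_power2)
      have n2: "(norm (\<Lambda> j))\<^sup>2 = (Re (\<Lambda> j))\<^sup>2 + (Im (\<Lambda> j))\<^sup>2" by (rule cmod_power2)
      show ?thesis unfolding gap_def g_def j(2) s unfolding q_def[symmetric] n1 t_def n2
        by (simp add: q_def power2_eq_square algebra_simps)
    qed
  qed
  have "((\<lambda>x. if x \<in> {real n / (1 + \<delta>)..real n} then t n x else 0) has_integral
      ((norm (\<Lambda> n))\<^sup>2 * (real n - real n / (1 + \<delta>)) - real m * \<delta> * Re (\<Lambda> n) * (real n ^ 2 - (real n / (1 + \<delta>)) ^ 2))) {1..X}"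
    if n: "n \<in> {2..N}" for n
  proof -
    have le: "real n / (1 + \<delta>) \<le> real n" using \<delta> by (simp add: field_simps)
    have "\<delta> * 1 \<le> \<delta> * (real N + 1)" using \<delta> by (intro mult_left_mono) auto
    hence d1: "\<delta> \<le> 1" using \<delta> by linarith
    have "1 + \<delta> \<le> real n" using n d1 by auto
    hence "1 \<le> real n / (1 + \<delta>)" using \<delta> by simp
    hence sub: "{real n / (1 + \<delta>)..real n} \<subseteq> {1..X}" using n by (auto simp: X_def)
    have "(t n has_integral ((norm (\<Lambda> n))\<^sup>2 * real n - real m * \<delta> * Re (\<Lambda> n) * real n ^ 2)
       - ((norm (\<Lambda> n))\<^sup>2 * (real n / (1 + \<delta>)) - real m * \<delta> * Re (\<Lambda> n) * (real n / (1 + \<delta>)) ^ 2)) {real n / (1 + \<delta>)..real n}"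
      unfolding t_def
      by (rule fundamental_theorem_of_calculus[OF le])
         (auto intro!: derivative_eq_intros simp: has_real_derivative_iff_has_vector_derivative[symmetric])
    hence "(t n has_integral ((norm (\<Lambda> n))\<^sup>2 * (real n - real n / (1 + \<delta>)) - real m * \<delta> * Re (\<Lambda> n) * (real n ^ 2 - (real n / (1 + \<delta>)) ^ 2))) {real n / (1 + \<delta>)..real n}"
      by (simp add: algebra_simps)
    thus ?thesis using has_integral_restrict[OF sub] by blast
  qed
  hence "((\<lambda>x. \<Sum>n\<in>{2..N}. if x \<in> {real n / (1 + \<delta>)..real n} then t n x else 0) has_integral
      (\<Sum>n\<in>{2..N}. (norm (\<Lambda> n))\<^sup>2 * (real n - real n / (1 + \<delta>)) - real m * \<delta> * Re (\<Lambda> n) * (real n ^ 2 - (real n / (1 + \<delta>)) ^ 2))) {1..X}"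
    by (intro has_integral_sum) auto
  moreover have "((\<lambda>x. (real m)\<^sup>2 * \<delta>\<^sup>2 * x\<^sup>2) has_integral ((real m)\<^sup>2 * \<delta>\<^sup>2 * X ^ 3 / 3 - (real m)\<^sup>2 * \<delta>\<^sup>2 * 1 ^ 3 / 3)) {1..X}"
    by (rule fundamental_theorem_of_calculus[OF X1])
       (auto intro!: derivative_eq_intros simp: has_real_derivative_iff_has_vector_derivative[symmetric])
  ultimately have "(g has_integral ((\<Sum>n\<in>{2..N}. (norm (\<Lambda> n))\<^sup>2 * (real n - real n / (1 + \<delta>)) - real m * \<delta> * Re (\<Lambda> n) * (real n ^ 2 - (real n / (1 + \<delta>)) ^ 2))
      + ((real m)\<^sup>2 * \<delta>\<^sup>2 * X ^ 3 / 3 - (real m)\<^sup>2 * \<delta>\<^sup>2 * 1 ^ 3 / 3))) {1..X}"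
    unfolding g_def by (rule has_integral_add)
  hence "(gap has_integral ((\<Sum>n\<in>{2..N}. (norm (\<Lambda> n))\<^sup>2 * (real n - real n / (1 + \<delta>)) - real m * \<delta> * Re (\<Lambda> n) * (real n ^ 2 - (real n / (1 + \<delta>)) ^ 2))
      + ((real m)\<^sup>2 * \<delta>\<^sup>2 * X ^ 3 / 3 - (real m)\<^sup>2 * \<delta>\<^sup>2 * 1 ^ 3 / 3))) {1..X}"
    by (rule has_integral_spike_finite[where S = "real ` {0..N}", rotated 2]) (use eq in auto)
  hence "VF \<Lambda> m X \<delta> = (\<Sum>n\<in>{2..N}. (norm (\<Lambda> n))\<^sup>2 * (real n - real n / (1 + \<delta>)) - real m * \<delta> * Re (\<Lambda> n) * (real n ^ 2 - (real n / (1 + \<delta>)) ^ 2))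
      + ((real m)\<^sup>2 * \<delta>\<^sup>2 * X ^ 3 / 3 - (real m)\<^sup>2 * \<delta>\<^sup>2 * 1 ^ 3 / 3)"
    unfolding VF_def gap_def by (rule integral_unique)
  thus ?thesis using N by (simp add: right_diff_distrib diff_divide_distrib)
qed

text \<open>Multiplied by (1 + \<eta>)^2/\<eta>, the value of V at a small slope \<eta> is a cubic
  polynomial in \<eta>, and the weights 1, -4, 6, -4, 1 annihilate cubics.\<close>

lemma VF_fourth_difference:
  fixes N m :: nat and \<delta> :: real and \<Lambda> :: "nat \<Rightarrow> complex"
  assumes \<delta>: "\<delta> > 0" "5 * \<delta> * (real N + 1) < 1/2"
  defines "G \<equiv> (\<lambda>j. VF \<Lambda> m (real N + 1/4) (j * \<delta>) * (1 + j * \<delta>)\<^sup>2 / (j * \<delta>))"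
  shows "G 1 - 4 * G 2 + 6 * G 3 - 4 * G 4 + G 5 = 0"
proof -
  define A where "A = (\<Sum>n\<in>{2..N}. (norm (\<Lambda> n))\<^sup>2 * real n)"
  define B where "B = (\<Sum>n\<in>{2..N}. real m * Re (\<Lambda> n) * real n ^ 2)"
  define D where "D = (if N = 0 then 0 else (real m)\<^sup>2 * ((real N + 1/4) ^ 3 - 1) / 3)"
  have G: "G j = A * (1 + j * \<delta>) - j * \<delta> * B * (2 + j * \<delta>) + j * \<delta> * (1 + j * \<delta>)\<^sup>2 * D" if j: "0 < j" "j \<le> 5" for j
  proof -
    define \<eta> where "\<eta> = j * \<delta>"
    have \<eta>: "\<eta> > 0" using j \<delta> by (simp add: \<eta>_def)
    have "\<eta> * (real N + 1) \<le> 5 * \<delta> * (real N + 1)" unfolding \<eta>_def using j \<delta> by (intro mult_right_mono) auto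
    hence \<eta>2: "\<eta> * (real N + 1) < 1/2" using \<delta> by linarith
    have V: "VF \<Lambda> m (real N + 1/4) \<eta> = A * (\<eta> / (1 + \<eta>)) - \<eta> * B * (\<eta> * (2 + \<eta>) / (1 + \<eta>)\<^sup>2) + \<eta>\<^sup>2 * D"
    proof -
      have e1: "real n - real n / (1 + \<eta>) = real n * (\<eta> / (1 + \<eta>))" for n using \<eta> by (simp add: field_simps)
      have e2: "real n ^ 2 - (real n / (1 + \<eta>)) ^ 2 = real n ^ 2 * (\<eta> * (2 + \<eta>) / (1 + \<eta>)\<^sup>2)" for n
      proof -
        have "1 - 1 / (1 + \<eta>)\<^sup>2 = \<eta> * (2 + \<eta>) / (1 + \<eta>)\<^sup>2" 
        proof -
          have "(1 + \<eta>)\<^sup>2 - 1 = \<eta> * (2 + \<eta>)" by (simp add: power2_eq_square algebra_simps)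
          hence "((1 + \<eta>)\<^sup>2 - 1) / (1 + \<eta>)\<^sup>2 = \<eta> * (2 + \<eta>) / (1 + \<eta>)\<^sup>2" by simp
          thus ?thesis using \<eta> by (simp add: diff_divide_distrib)
        qed
        hence "real n ^ 2 * (1 - 1 / (1 + \<eta>)\<^sup>2) = real n ^ 2 * (\<eta> * (2 + \<eta>) / (1 + \<eta>)\<^sup>2)" by simp
        thus ?thesis by (simp add: power_divide right_diff_distrib)
      qed
      have "(\<Sum>n\<in>{2..N}. (norm (\<Lambda> n))\<^sup>2 * (real n - real n / (1 + \<eta>)) - real m * \<eta> * Re (\<Lambda> n) * (real n ^ 2 - (real n / (1 + \<eta>)) ^ 2))
         = A * (\<eta> / (1 + \<eta>)) - \<eta> * B * (\<eta> * (2 + \<eta>) / (1 + \<eta>)\<^sup>2)"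
        unfolding e1 e2 A_def B_def sum_subtractf sum_distrib_right sum_distrib_left
        by (intro arg_cong2[where f = "(-)"] sum.cong refl) (simp_all add: mult_ac)
      thus ?thesis unfolding VF_small_slope[OF \<eta> \<eta>2] D_def by (simp add: mult_ac)
    qed
    have "VF \<Lambda> m (real N + 1/4) \<eta> * (1 + \<eta>)\<^sup>2 / \<eta> = A * (1 + \<eta>) - \<eta> * B * (2 + \<eta>) + \<eta> * (1 + \<eta>)\<^sup>2 * D"
    proof -
      have "(A * (\<eta> / w) - \<eta> * B * (\<eta> * (2 + \<eta>) / w\<^sup>2) + \<eta>\<^sup>2 * D) * w\<^sup>2 / \<eta> = A * w - \<eta> * B * (2 + \<eta>) + \<eta> * w\<^sup>2 * D"
        if "w > 0" for w using that \<eta> by (simp add: field_simps power2_eq_square)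
      from this[of "1 + \<eta>"] show ?thesis unfolding V using \<eta> by simp
    qed
    thus ?thesis unfolding G_def \<eta>_def .
  qed
  have "G 1 - 4 * G 2 + 6 * G 3 - 4 * G 4 + G 5 =
    (A * (1 + 1 * \<delta>) - 1 * \<delta> * B * (2 + 1 * \<delta>) + 1 * \<delta> * (1 + 1 * \<delta>)\<^sup>2 * D)
    - 4 * (A * (1 + 2 * \<delta>) - 2 * \<delta> * B * (2 + 2 * \<delta>) + 2 * \<delta> * (1 + 2 * \<delta>)\<^sup>2 * D)
    + 6 * (A * (1 + 3 * \<delta>) - 3 * \<delta> * B * (2 + 3 * \<delta>) + 3 * \<delta> * (1 + 3 * \<delta>)\<^sup>2 * D)
    - 4 * (A * (1 + 4 * \<delta>) - 4 * \<delta> * B * (2 + 4 * \<delta>) + 4 * \<delta> * (1 + 4 * \<delta>)\<^sup>2 * D)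
    + (A * (1 + 5 * \<delta>) - 5 * \<delta> * B * (2 + 5 * \<delta>) + 5 * \<delta> * (1 + 5 * \<delta>)\<^sup>2 * D)"
    by (simp only: G zero_less_one one_le_numeral zero_less_numeral order_refl numeral_le_iff) (simp add: G)
  also have "\<dots> = 0" by algebra
  finally show ?thesis .
qed

text \<open>If the range reached slopes below \<open>1/X\<close>, then \<open>V\<close> would be governed by isolated jumps of \<open>psiF\<close> and
  \<open>V (1 + \<delta>)\<^sup>2 / \<delta>\<close> would be a cubic polynomial in \<open>\<delta>\<close>; the logarithm in the asymptotic formula is not.\<close>

lemma VF_asymptotic_range:
  assumes as: "VF_asymptotic \<Lambda> m d c1 c B1 B3" and B: "0 < B1" "B1 \<le> B3" and c: "c > 0" and d: "d > 0"
  shows "B3 < 1"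
proof (rule ccontr)
  assume "\<not> B3 < 1"
  hence B3: "B3 \<ge> 1" by simp
  obtain C X0 where C: "C \<ge> 0" "X0 \<ge> 1" and V: "\<And>X \<delta>. X \<ge> X0 \<Longrightarrow> 1/20 * X powr (- B3) \<le> \<delta> \<Longrightarrow> \<delta> \<le> 1 * X powr (- B1) \<Longrightarrow>
     \<bar>VF \<Lambda> m X \<delta> - 1/2 * \<delta> * X\<^sup>2 * (d * ln (1 / \<delta>) + c1)\<bar> \<le> C * (\<delta> powr (1 + c) * X\<^sup>2)"
    by (rule VF_asymptoticD[OF as, of "1/20" 1]) (auto simp del: mult_1)
  define X where "X N = real N + 1/4" for N
  \<comment> \<open>The factor 1/20 yields 5*\<delta>*(N + 1) < 1/2 even in the borderline case B3 =
    1.\<close>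
  define \<delta> where "\<delta> N = 1/20 * X N powr (- B3)" for N
  \<comment> \<open>The fourth difference of -(1 + j*\<delta>)^2 * ln j, in which j = 1 contributes
    nothing. The terms with ln(1/\<delta>) and c1 multiply the quadratic (1 + j*\<delta>)^2 and are
    annihilated.\<close>
  define S where "S N = 4 * (1 + 2 * \<delta> N)\<^sup>2 * ln 2 - 6 * (1 + 3 * \<delta> N)\<^sup>2 * ln 3 + 4 * (1 + 4 * \<delta> N)\<^sup>2 * ln 4 - (1 + 5 * \<delta> N)\<^sup>2 * ln (5::real)" for N
  have \<delta>0: "\<delta> \<longlonglongrightarrow> 0" unfolding \<delta>_def X_def using B3 by real_asymp
  have "S \<longlonglongrightarrow> 4 * (1 + 2 * 0)\<^sup>2 * ln 2 - 6 * (1 + 3 * 0)\<^sup>2 * ln 3 + 4 * (1 + 4 * 0)\<^sup>2 * ln 4 - (1 + 5 * 0)\<^sup>2 * ln (5::real)"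
    unfolding S_def by (intro tendsto_intros \<delta>0)
  hence Slim: "S \<longlonglongrightarrow> 4 * ln 2 - 6 * ln 3 + 4 * ln 4 - ln (5::real)" by simp
  have err: "\<bar>d * S N\<bar> \<le> 128 * C * (5 * \<delta> N) powr c" if N: "real N \<ge> X0" for N
  proof -
    have N1: "real N \<ge> 1" using N C by linarith
    have XX: "X N \<ge> X0" "X N \<ge> 1" using N C by (auto simp: X_def)
    have dp: "\<delta> N > 0" using XX by (simp add: \<delta>_def)
    have "X N powr (- B3) \<le> X N powr (-1)" using XX B3 by (intro powr_mono) auto
    hence Xi: "X N powr (- B3) \<le> 1 / X N" using XX by (simp add: powr_minus_divide)
    have "5 * \<delta> N * (real N + 1) \<le> 1/4 * (1 / X N) * (real N + 1)"
      unfolding \<delta>_def using Xi by (intro mult_right_mono) auto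
    also have "\<dots> < 1/2" using N1 by (simp add: X_def field_simps)
    finally have small: "5 * \<delta> N * (real N + 1) < 1/2" .
    have "5 * \<delta> N * 1 \<le> 5 * \<delta> N * (real N + 1)" using dp by (intro mult_left_mono) auto
    hence d1: "5 * \<delta> N \<le> 1" using small by linarith
    define G where "G j = VF \<Lambda> m (real N + 1/4) (j * \<delta> N) * (1 + j * \<delta> N)\<^sup>2 / (j * \<delta> N)" for j
    have G0: "G 1 - 4 * G 2 + 6 * G 3 - 4 * G 4 + G 5 = 0"
      unfolding G_def by (rule VF_fourth_difference[OF dp small])
    define L where "L j = 1/2 * (X N)\<^sup>2 * (1 + j * \<delta> N)\<^sup>2 * (d * ln (1 / (j * \<delta> N)) + c1)" for j
    define E where "E = 4 * C * (5 * \<delta> N) powr c * (X N)\<^sup>2"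
    have GL: "\<bar>G j - L j\<bar> \<le> E" if j: "1 \<le> j" "j \<le> 5" for j
    proof -
      define \<eta> where "\<eta> = j * \<delta> N"
      have \<eta>: "\<eta> > 0" using j dp by (simp add: \<eta>_def)
      have \<eta>5: "\<eta> \<le> 5 * \<delta> N" unfolding \<eta>_def using j dp by (intro mult_right_mono) auto
      have "1/20 * X N powr (- B3) \<le> \<eta>" using j dp mult_right_mono[of 1 j "\<delta> N"] by (simp add: \<eta>_def \<delta>_def)
      moreover have "\<eta> \<le> 1 * X N powr (- B1)"
      proof -
        have "\<eta> \<le> 1/4 * X N powr (- B3)" using \<eta>5 by (simp add: \<delta>_def)
        also have "\<dots> \<le> 1 * X N powr (- B1)" using XX B by (intro mult_mono powr_mono) auto
        finally show ?thesis .
      qed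
      ultimately have v: "\<bar>VF \<Lambda> m (X N) \<eta> - 1/2 * \<eta> * (X N)\<^sup>2 * (d * ln (1 / \<eta>) + c1)\<bar> \<le> C * (\<eta> powr (1 + c) * (X N)\<^sup>2)"
        by (rule V[OF XX(1)])
      have "G j - L j = (VF \<Lambda> m (X N) \<eta> - 1/2 * \<eta> * (X N)\<^sup>2 * (d * ln (1 / \<eta>) + c1)) * ((1 + \<eta>)\<^sup>2 / \<eta>)"
      proof -
        have "v * w / \<eta> - 1/2 * x * w * l = (v - 1/2 * \<eta> * x * l) * (w / \<eta>)" for v w x l :: real
          using \<eta> by (simp add: field_simps)
        thus ?thesis unfolding G_def L_def \<eta>_def[symmetric] X_def[symmetric] .
      qed
      hence "\<bar>G j - L j\<bar> = \<bar>VF \<Lambda> m (X N) \<eta> - 1/2 * \<eta> * (X N)\<^sup>2 * (d * ln (1 / \<eta>) + c1)\<bar> * ((1 + \<eta>)\<^sup>2 / \<eta>)"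
        using \<eta> by (simp only: abs_mult) simp
      also have "\<dots> \<le> C * (\<eta> powr (1 + c) * (X N)\<^sup>2) * (4 / \<eta>)"
      proof (intro mult_mono v divide_right_mono)
        have "(1 + \<eta>)\<^sup>2 \<le> 2\<^sup>2" using \<eta> \<eta>5 d1 by (intro power_mono) auto
        thus "(1 + \<eta>)\<^sup>2 \<le> 4" by simp
      qed (use \<eta> C in auto)
      also have "\<dots> = 4 * C * \<eta> powr c * (X N)\<^sup>2" using \<eta> by (simp add: powr_add)
      also have "\<dots> \<le> E" unfolding E_def using C \<eta> \<eta>5 c by (intro mult_right_mono mult_left_mono powr_mono2) auto
      finally show ?thesis .
    qed
    \<comment> \<open>16 is the sum of the absolute values of the weights, and the fourth difference
      of G vanishes.\<close>
    have "\<bar>L 1 - 4 * L 2 + 6 * L 3 - 4 * L 4 + L 5\<bar> \<le> 16 * E"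
      using GL[of 1] GL[of 2] GL[of 3] GL[of 4] GL[of 5] G0 by simp
    moreover have "L 1 - 4 * L 2 + 6 * L 3 - 4 * L 4 + L 5 = 1/2 * (X N)\<^sup>2 * (d * S N)"
    proof -
      define q where "q = d * ln (1 / \<delta> N) + c1"
      have lnj: "d * ln (1 / (j * \<delta> N)) + c1 = q - d * ln j" if "j > 0" for j
        using that dp by (simp add: q_def ln_div ln_mult algebra_simps)
      have L1: "L 1 = 1/2 * (X N)\<^sup>2 * (1 + 1 * \<delta> N)\<^sup>2 * q" by (simp add: L_def q_def)
      have Lj: "L j = 1/2 * (X N)\<^sup>2 * (1 + j * \<delta> N)\<^sup>2 * (q - d * ln j)" if "j > 0" for j
        unfolding L_def lnj[OF that] ..
      have L2: "L 2 = 1/2 * (X N)\<^sup>2 * (1 + 2 * \<delta> N)\<^sup>2 * (q - d * ln 2)" by (rule Lj) simp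
      have L3: "L 3 = 1/2 * (X N)\<^sup>2 * (1 + 3 * \<delta> N)\<^sup>2 * (q - d * ln 3)" by (rule Lj) simp
      have L4: "L 4 = 1/2 * (X N)\<^sup>2 * (1 + 4 * \<delta> N)\<^sup>2 * (q - d * ln 4)" by (rule Lj) simp
      have L5: "L 5 = 1/2 * (X N)\<^sup>2 * (1 + 5 * \<delta> N)\<^sup>2 * (q - d * ln 5)" by (rule Lj) simp
      show ?thesis unfolding L1 L2 L3 L4 L5 S_def
        by (simp add: power2_eq_square) (simp add: algebra_simps)
    qed
    ultimately have "\<bar>1/2 * (X N)\<^sup>2 * (d * S N)\<bar> \<le> 16 * E" by simp
    hence "(X N)\<^sup>2 * \<bar>d * S N\<bar> \<le> (X N)\<^sup>2 * (128 * C * (5 * \<delta> N) powr c)"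
      by (simp add: E_def abs_mult mult_ac)
    thus ?thesis using XX by simp
  qed
  have "(\<lambda>N. 128 * C * (5 * \<delta> N) powr c) \<longlonglongrightarrow> 128 * C * 0"
    unfolding \<delta>_def X_def using B3 c by (intro tendsto_mult_left) real_asymp
  hence lim0: "(\<lambda>N. 128 * C * (5 * \<delta> N) powr c) \<longlonglongrightarrow> 0" by simp
  have "(\<lambda>N. d * S N) \<longlonglongrightarrow> 0"
  proof (rule Lim_null_comparison[OF _ lim0])
    obtain N0 :: nat where "X0 \<le> real N0" using real_arch_simple by blast
    thus "\<forall>\<^sub>F N in sequentially. norm (d * S N) \<le> 128 * C * (5 * \<delta> N) powr c"
      using err by (auto simp: eventually_at_top_linorder intro!: exI[of _ N0])
  qed
  moreover have "(\<lambda>N. d * S N) \<longlonglongrightarrow> d * (4 * ln 2 - 6 * ln 3 + 4 * ln 4 - ln (5::real))"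
    by (intro tendsto_intros Slim)
  ultimately have "d * (4 * ln 2 - 6 * ln 3 + 4 * ln 4 - ln (5::real)) = 0" by (rule LIMSEQ_unique[symmetric])
  \<comment> \<open>The contradiction is arithmetical: 2^4 * 4^4 = 4096 against 3^6 * 5 =
    3645.\<close>
  hence "4 * ln 2 + 4 * ln 4 = 6 * ln 3 + ln (5::real)" using d by simp
  moreover have "4 * ln 2 + 4 * ln 4 = ln (4096::real)"
    using ln_realpow[of 2 4] ln_realpow[of 4 4] ln_mult[of "2^4" "4^4::real"] by simp
  moreover have "6 * ln 3 + ln 5 = ln (3645::real)"
    using ln_realpow[of 3 6] ln_mult[of "3^6" "5::real"] by simp
  ultimately show False by simp
qed

section \<open>Logarithmic averaging\<close>

lemma set_integrable_bounded_Icc: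
  fixes g :: "real \<Rightarrow> real"
  assumes [measurable]: "g \<in> borel_measurable borel" and b: "\<And>x. a \<le> x \<Longrightarrow> x \<le> b \<Longrightarrow> \<bar>g x\<bar> \<le> B"
  shows "set_integrable lborel {a..b} g"
  unfolding set_integrable_def
  by (rule integrableI_bounded_set[where A = "{a..b}" and B = B])
     (use b in \<open>auto simp: indicator_def emeasure_lborel_Icc_eq\<close>)

text \<open>At fixed slope the admissible x form an interval, over which the integral is a
  difference of two values of V; since x*\<delta>*q has antiderivative \<delta>*x^2*q/2, the main
  terms cancel exactly. Because c \<le> 1, \<delta>^(c - 1) is largest at the smallest slope
  h/X.\<close>

lemma slope_slice_bound:
  fixes f :: "real \<Rightarrow> real \<Rightarrow> real"
  assumes meas: "(\<lambda>x. f x (\<delta> * x)) \<in> borel_measurable borel"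
    and bdd: "\<And>x u. 1 \<le> x \<Longrightarrow> x \<le> X \<Longrightarrow> 0 \<le> u \<Longrightarrow> u \<le> 2 * h \<Longrightarrow> \<bar>f x u\<bar> \<le> Bd"
    and h: "0 < h" and k: "1 < k" "k \<le> 2" and X1: "1 \<le> X1" "X1 \<le> X" and c: "0 < c" "c \<le> 1" and C: "C \<ge> 0"
    and H: "\<And>y. X1 \<le> y \<Longrightarrow> y \<le> X \<Longrightarrow> h \<le> \<delta> * y \<Longrightarrow> \<delta> * y \<le> k * h \<Longrightarrow>
       \<bar>integral {1..y} (\<lambda>x. f x (\<delta> * x)) - 1/2 * \<delta> * y\<^sup>2 * q\<bar> \<le> C * (\<delta> powr (1 + c) * y\<^sup>2)"
    and \<delta>: "h / X \<le> \<delta>"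
  shows "\<bar>\<integral>x. indicator {max X1 (h / \<delta>)..min X (k * h / \<delta>)} x * ((f x (\<delta> * x) - x * \<delta> * q) / \<delta>) \<partial>lborel\<bar>
     \<le> 8 * C * h\<^sup>2 * (h / X) powr (c - 1) / \<delta>"
proof -
  define a b where "a = max X1 (h / \<delta>)" and "b = min X (k * h / \<delta>)"
  have \<delta>0: "\<delta> > 0" using \<delta> h X1 by (meson divide_pos_pos less_le_trans zero_less_one)
  have rhs0: "0 \<le> 8 * C * h\<^sup>2 * (h / X) powr (c - 1) / \<delta>" using C \<delta>0 by simp
  show ?thesis
  proof (cases "a \<le> b")
    case False
    have "(\<lambda>x. indicator {a..b} x * ((f x (\<delta> * x) - x * \<delta> * q) / \<delta>)) = (\<lambda>_. 0)" using False by auto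
    thus ?thesis using rhs0 unfolding a_def[symmetric] b_def[symmetric] by simp
  next
    case True
    note [measurable] = meas
    have ab: "X1 \<le> a" "b \<le> X" "h \<le> \<delta> * a" "\<delta> * b \<le> k * h"
      using \<delta>0 by (auto simp: a_def b_def field_simps min_def max_def split: if_splits)
    have da: "\<delta> * a \<le> k * h" "h \<le> \<delta> * b"
      using ab True mult_left_mono[OF True, of \<delta>] \<delta>0 by linarith+
    have fb: "\<bar>f x (\<delta> * x)\<bar> \<le> Bd" if "1 \<le> x" "x \<le> b" for x
    proof (rule bdd)
      have "\<delta> * x \<le> \<delta> * b" using that \<delta>0 by (intro mult_left_mono) auto
      also have "\<dots> \<le> 2 * h" using ab k h by (intro order.trans[OF ab(4)] mult_right_mono) auto
      finally show "\<delta> * x \<le> 2 * h" .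
    qed (use that \<delta>0 ab in auto)
    have si: "set_integrable lborel {1..b} (\<lambda>x. f x (\<delta> * x))"
      by (rule set_integrable_bounded_Icc[OF meas fb])
    have si': "set_integrable lborel {a..b} (\<lambda>x. f x (\<delta> * x))"
      by (rule set_integrable_subset[OF si]) (use ab X1 in auto)
    have sx: "set_integrable lborel {a..b} (\<lambda>x. x * \<delta> * q)"
      by (rule borel_integrable_atLeastAtMost') (auto intro!: continuous_intros)
    have "(\<integral>x. indicator {a..b} x * ((f x (\<delta> * x) - x * \<delta> * q) / \<delta>) \<partial>lborel)
        = (\<integral>x. (indicator {a..b} x *\<^sub>R f x (\<delta> * x) - indicator {a..b} x *\<^sub>R (x * \<delta> * q)) / \<delta> \<partial>lborel)"
      by (intro Bochner_Integration.integral_cong refl) (simp add: algebra_simps)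
    also have "\<dots> = ((LINT x:{a..b}|lborel. f x (\<delta> * x)) - (LINT x:{a..b}|lborel. x * \<delta> * q)) / \<delta>"
      using si' sx unfolding set_lebesgue_integral_def set_integrable_def by simp
    also have "(LINT x:{a..b}|lborel. f x (\<delta> * x)) = integral {a..b} (\<lambda>x. f x (\<delta> * x))"
      by (rule set_borel_integral_eq_integral(2)[OF si'])
    also have "integral {a..b} (\<lambda>x. f x (\<delta> * x)) = integral {1..b} (\<lambda>x. f x (\<delta> * x)) - integral {1..a} (\<lambda>x. f x (\<delta> * x))"
      using Henstock_Kurzweil_Integration.integral_combine[of 1 a b "\<lambda>x. f x (\<delta> * x)"] set_borel_integral_eq_integral(1)[OF si] ab X1 True
      by simp
    also have "(LINT x:{a..b}|lborel. x * \<delta> * q) = 1/2 * \<delta> * b\<^sup>2 * q - 1/2 * \<delta> * a\<^sup>2 * q"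
      unfolding set_lebesgue_integral_def
      by (rule integral_FTC_Icc[OF True]) (auto intro!: derivative_eq_intros continuous_intros simp: has_real_derivative_iff_has_vector_derivative[symmetric])
    also have "((integral {1..b} (\<lambda>x. f x (\<delta> * x)) - integral {1..a} (\<lambda>x. f x (\<delta> * x))) - (1/2 * \<delta> * b\<^sup>2 * q - 1/2 * \<delta> * a\<^sup>2 * q)) / \<delta>
      = ((integral {1..b} (\<lambda>x. f x (\<delta> * x)) - 1/2 * \<delta> * b\<^sup>2 * q) - (integral {1..a} (\<lambda>x. f x (\<delta> * x)) - 1/2 * \<delta> * a\<^sup>2 * q)) / \<delta>"
      by (rule arg_cong[where f = "\<lambda>z. z / \<delta>"]) simp
    finally have eq: "(\<integral>x. indicator {a..b} x * ((f x (\<delta> * x) - x * \<delta> * q) / \<delta>) \<partial>lborel)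
      = ((integral {1..b} (\<lambda>x. f x (\<delta> * x)) - 1/2 * \<delta> * b\<^sup>2 * q) - (integral {1..a} (\<lambda>x. f x (\<delta> * x)) - 1/2 * \<delta> * a\<^sup>2 * q)) / \<delta>" .
    have Hb: "\<bar>integral {1..b} (\<lambda>x. f x (\<delta> * x)) - 1/2 * \<delta> * b\<^sup>2 * q\<bar> \<le> C * (\<delta> powr (1 + c) * b\<^sup>2)"
      by (rule H) (use ab da True in auto)
    have Ha: "\<bar>integral {1..a} (\<lambda>x. f x (\<delta> * x)) - 1/2 * \<delta> * a\<^sup>2 * q\<bar> \<le> C * (\<delta> powr (1 + c) * a\<^sup>2)"
      by (rule H) (use ab da True in auto)
    have a2: "a\<^sup>2 \<le> b\<^sup>2" using True ab X1 by (intro power_mono) auto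
    have b2: "(\<delta> * b)\<^sup>2 \<le> (2 * h)\<^sup>2"
    proof (rule power_mono)
      show "\<delta> * b \<le> 2 * h" using ab k h by (intro order.trans[OF ab(4)] mult_right_mono) auto
      show "0 \<le> \<delta> * b" using \<delta>0 da h by linarith
    qed
    have "\<bar>\<integral>x. indicator {a..b} x * ((f x (\<delta> * x) - x * \<delta> * q) / \<delta>) \<partial>lborel\<bar>
        \<le> (C * (\<delta> powr (1 + c) * b\<^sup>2) + C * (\<delta> powr (1 + c) * a\<^sup>2)) / \<delta>"
    proof -
      have tri: "\<bar>p - r\<bar> / \<delta> \<le> (p' + r') / \<delta>" if "\<bar>p\<bar> \<le> p'" "\<bar>r\<bar> \<le> r'" for p r p' r' :: real
        using that \<delta>0 by (intro divide_right_mono) auto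
      show ?thesis unfolding eq abs_divide abs_of_pos[OF \<delta>0] by (rule tri[OF Hb Ha])
    qed
    also have "\<dots> \<le> (C * (\<delta> powr (1 + c) * b\<^sup>2) + C * (\<delta> powr (1 + c) * b\<^sup>2)) / \<delta>"
      using C a2 \<delta>0 by (intro divide_right_mono add_mono mult_left_mono) auto
    also have "\<dots> = 2 * C * \<delta> powr (c - 1) * (\<delta> * b)\<^sup>2 / \<delta>"
    proof -
      have "\<delta> powr (1 + c) = \<delta> powr (c - 1) * \<delta>\<^sup>2"
        using \<delta>0 powr_add[of \<delta> "c - 1" 2] by (simp add: algebra_simps)
      thus ?thesis by (simp add: power_mult_distrib mult_ac)
    qed
    also have "\<dots> \<le> 2 * C * (h / X) powr (c - 1) * (2 * h)\<^sup>2 / \<delta>"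
      using C \<delta> \<delta>0 h X1 c b2
      by (intro divide_right_mono mult_mono mult_left_mono powr_mono2') (auto intro!: mult_nonneg_nonneg)
    also have "\<dots> = 8 * C * h\<^sup>2 * (h / X) powr (c - 1) / \<delta>" by (simp add: power_mult_distrib)
    finally show ?thesis unfolding a_def b_def .
  qed
qed

text \<open>Under u = \<delta>*x the model u*(d*ln(x/u) + c1) becomes x*\<delta>*q with q depending
  on \<delta> alone, so each slope contributes a slice as above. The slice bound is a multiple of
  1/\<delta>, and its integral over the possible slopes is the logarithm.\<close>

lemma log_average_change_of_variables:
  fixes f :: "real \<Rightarrow> real \<Rightarrow> real"
  assumes meas: "(\<lambda>(x, u). f x u) \<in> borel_measurable (borel \<Otimes>\<^sub>M borel)"
    and bdd: "\<And>x u. 1 \<le> x \<Longrightarrow> x \<le> X \<Longrightarrow> 0 \<le> u \<Longrightarrow> u \<le> 2 * h \<Longrightarrow> \<bar>f x u\<bar> \<le> Bd"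
    and h: "0 < h" and k: "1 < k" "k \<le> 2" and X1: "1 \<le> X1" "X1 \<le> X" "k * h \<le> X1"
    and c: "0 < c" "c \<le> 1" and C: "C \<ge> 0"
    and H: "\<And>\<delta> y. X1 \<le> y \<Longrightarrow> y \<le> X \<Longrightarrow> h \<le> \<delta> * y \<Longrightarrow> \<delta> * y \<le> k * h \<Longrightarrow>
       \<bar>integral {1..y} (\<lambda>x. f x (\<delta> * x)) - 1/2 * \<delta> * y\<^sup>2 * (d * ln (1 / \<delta>) + c1)\<bar> \<le> C * (\<delta> powr (1 + c) * y\<^sup>2)"
  shows "\<bar>\<integral>u. (\<integral>x. indicator {X1..X} x * (indicator {h..k*h} u * ((f x u - u * (d * ln (x / u) + c1)) / u)) \<partial>lborel) \<partial>lborel\<bar>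
     \<le> 8 * C * h * X * (h / X) powr c * ln (2 * X)"
    and "integrable lborel (\<lambda>u. \<integral>x. indicator {X1..X} x * (indicator {h..k*h} u * ((f x u - u * (d * ln (x / u) + c1)) / u)) \<partial>lborel)"
proof -
  note [measurable] = meas
  define Q where "Q x u = indicator {X1..X} x * (indicator {h..k*h} u * ((f x u - u * (d * ln (x / u) + c1)) / u))" for x u :: real
  have [measurable]: "(\<lambda>(x, u). Q x u) \<in> borel_measurable (borel \<Otimes>\<^sub>M borel)" unfolding Q_def by measurable
  have hX: "h \<le> X" using X1 k h mult_right_mono[of 1 k h] by linarith
  have X0: "X > 0" using X1 by linarith
  define Bq where "Bq = Bd / h + \<bar>d\<bar> * ln (X / h) + \<bar>c1\<bar>"
  have kh2: "k * h \<le> 2 * h" using k h by simp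
  have Bd0: "Bd \<ge> 0" using bdd[of 1 0] X1 h by (meson abs_ge_zero order_trans less_imp_le order_refl mult_nonneg_nonneg zero_le_numeral)
  have lnXh: "ln (X / h) \<ge> 0" using hX h by (intro ln_ge_zero) auto
  have Bq0: "Bq \<ge> 0" using Bd0 h lnXh by (auto simp: Bq_def)
  have Qb: "\<bar>Q x u\<bar> \<le> Bq * indicator {X1..X} x * indicator {h..k*h} u" for x u
  proof (cases "x \<in> {X1..X} \<and> u \<in> {h..k*h}")
    case True
    hence x: "X1 \<le> x" "x \<le> X" and u: "h \<le> u" "u \<le> k * h" by auto
    have u0: "u > 0" using u h by linarith
    have "u \<le> x" using u X1 x by linarith
    hence "1 \<le> x / u" using u0 by simp
    moreover have "x / u \<le> X / h" using x u h X0 by (intro frac_le) auto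
    ultimately have l: "\<bar>ln (x / u)\<bar> \<le> ln (X / h)" by simp
    have "\<bar>(f x u - u * (d * ln (x / u) + c1)) / u\<bar> = \<bar>f x u / u - (d * ln (x / u) + c1)\<bar>"
      using u0 by (simp add: diff_divide_distrib)
    also have "\<dots> \<le> \<bar>f x u / u\<bar> + (\<bar>d * ln (x / u)\<bar> + \<bar>c1\<bar>)" by linarith
    also have "\<bar>f x u / u\<bar> \<le> Bd / h"
      unfolding abs_divide using bdd[of x u] x u X1 kh2 h u0 by (intro frac_le) auto
    also have "\<bar>d * ln (x / u)\<bar> \<le> \<bar>d\<bar> * ln (X / h)" unfolding abs_mult by (intro mult_left_mono l) auto
    finally show ?thesis using True by (simp add: Q_def Bq_def)
  qed (auto simp: Q_def indicator_def)
  have intI: "integrable lborel (\<lambda>x. indicator {a..b} x :: real)" for a b :: real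
    by (rule integrable_real_indicator) (auto simp: emeasure_lborel_Icc_eq)
  have intQ: "integrable (lborel \<Otimes>\<^sub>M lborel) (\<lambda>(x, u). Q x u)"
    by (rule integrable_pair_lborel_bound[where p = "\<lambda>x. Bq * indicator {X1..X} x" and q = "indicator {h..k*h}"])
       (use Qb intI in auto)
  define Q2 where "Q2 x \<delta> = x * Q x (x * \<delta>)" for x \<delta>
  have [measurable]: "(\<lambda>(x, \<delta>). Q2 x \<delta>) \<in> borel_measurable (borel \<Otimes>\<^sub>M borel)" unfolding Q2_def by measurable
  \<comment> \<open>The extreme slopes compatible with X1 \<le> x \<le> X and h \<le> u \<le>
    k*h.\<close>
  define \<delta>1 \<delta>2 where "\<delta>1 = h / X" and "\<delta>2 = k * h / X1"
  have \<delta>1: "\<delta>1 > 0" using h X0 by (simp add: \<delta>1_def)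
  have \<delta>12: "\<delta>1 \<le> \<delta>2" unfolding \<delta>1_def \<delta>2_def using h k X1 by (intro frac_le) auto
  have supp: "\<delta>1 \<le> \<delta> \<and> \<delta> \<le> \<delta>2" if "x \<in> {X1..X}" "x * \<delta> \<in> {h..k*h}" for x \<delta>
  proof -
    have x0: "x > 0" using that X1 by auto
    have "\<delta> = x * \<delta> / x" using x0 by simp
    moreover have "h / X \<le> x * \<delta> / x" using that x0 h by (intro frac_le) auto
    moreover have "x * \<delta> / x \<le> k * h / X1" using that X1 h by (intro frac_le) auto
    ultimately show ?thesis by (simp add: \<delta>1_def \<delta>2_def)
  qed
  have Q2b: "\<bar>Q2 x \<delta>\<bar> \<le> X * Bq * indicator {X1..X} x * indicator {\<delta>1..\<delta>2} \<delta>" for x \<delta>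
  proof (cases "x \<in> {X1..X} \<and> x * \<delta> \<in> {h..k*h}")
    case True
    hence s: "\<delta> \<in> {\<delta>1..\<delta>2}" using supp by auto
    have "\<bar>Q2 x \<delta>\<bar> = x * \<bar>Q x (x * \<delta>)\<bar>" using True X1 by (simp add: Q2_def abs_mult)
    also have "\<dots> \<le> X * (Bq * indicator {X1..X} x * indicator {h..k*h} (x * \<delta>))"
      using True X0 by (intro mult_mono Qb) auto
    finally show ?thesis using True s by simp
  next
    case False
    hence "Q2 x \<delta> = 0" by (auto simp: Q2_def Q_def)
    thus ?thesis using X0 Bq0 by simp
  qed
  have intQ2: "integrable (lborel \<Otimes>\<^sub>M lborel) (\<lambda>(x, u). Q2 x u)"
    by (rule integrable_pair_lborel_bound[where p = "\<lambda>x. X * Bq * indicator {X1..X} x" and q = "indicator {\<delta>1..\<delta>2}"])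
       (use Q2b intI in auto)
  show "integrable lborel (\<lambda>u. \<integral>x. indicator {X1..X} x * (indicator {h..k*h} u * ((f x u - u * (d * ln (x / u) + c1)) / u)) \<partial>lborel)"
    using lborel_pair.integrable_snd[OF intQ] unfolding Q_def by simp
  define K where "K = 8 * C * h\<^sup>2 * (h / X) powr (c - 1)"
  have K: "K \<ge> 0" using C by (simp add: K_def)
  have "(\<integral>u. (\<integral>x. Q x u \<partial>lborel) \<partial>lborel) = (\<integral>x. (\<integral>u. Q x u \<partial>lborel) \<partial>lborel)"
    by (rule lborel_pair.Fubini_integral[OF intQ])
  also have "\<dots> = (\<integral>x. (\<integral>\<delta>. Q2 x \<delta> \<partial>lborel) \<partial>lborel)"
  proof (rule Bochner_Integration.integral_cong[OF refl])
    fix x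
    show "(\<integral>u. Q x u \<partial>lborel) = (\<integral>\<delta>. Q2 x \<delta> \<partial>lborel)"
    proof (cases "x \<in> {X1..X}")
      case True
      have "(\<integral>u. Q x u \<partial>lborel) = \<bar>x\<bar> *\<^sub>R (\<integral>\<delta>. Q x (0 + x * \<delta>) \<partial>lborel)"
        by (rule lborel_integral_real_affine) (use True X1 in auto)
      also have "\<dots> = (\<integral>\<delta>. Q2 x \<delta> \<partial>lborel)" using True X1 by (simp add: Q2_def)
      finally show ?thesis .
    next
      case False
      hence "Q x = (\<lambda>_. 0)" "Q2 x = (\<lambda>_. 0)" by (auto simp: Q_def Q2_def fun_eq_iff)
      thus ?thesis by simp
    qed
  qed
  also have "\<dots> = (\<integral>\<delta>. (\<integral>x. Q2 x \<delta> \<partial>lborel) \<partial>lborel)"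
    by (rule lborel_pair.Fubini_integral[OF intQ2, symmetric])
  finally have eq: "(\<integral>u. (\<integral>x. Q x u \<partial>lborel) \<partial>lborel) = (\<integral>\<delta>. (\<integral>x. Q2 x \<delta> \<partial>lborel) \<partial>lborel)" .
  have slice: "\<bar>\<integral>x. Q2 x \<delta> \<partial>lborel\<bar> \<le> indicator {\<delta>1..\<delta>2} \<delta> *\<^sub>R (K / \<delta>)" for \<delta>
  proof (cases "\<delta> \<in> {\<delta>1..\<delta>2}")
    case True
    have \<delta>0: "\<delta> > 0" using True \<delta>1 by auto
    have "Q2 x \<delta> = indicator {max X1 (h / \<delta>)..min X (k * h / \<delta>)} x * ((f x (\<delta> * x) - x * \<delta> * (d * ln (1 / \<delta>) + c1)) / \<delta>)" for x
    proof (cases "x \<in> {X1..X} \<and> x * \<delta> \<in> {h..k*h}")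
      case T: True
      hence x0: "x > 0" using X1 by auto
      have "x \<in> {max X1 (h / \<delta>)..min X (k * h / \<delta>)}" using T \<delta>0 by (auto simp: field_simps)
      moreover have "x / (x * \<delta>) = 1 / \<delta>" using x0 by simp
      ultimately show ?thesis using T x0 by (simp add: Q2_def Q_def mult.commute)
    next
      case F: False
      hence "x \<notin> {max X1 (h / \<delta>)..min X (k * h / \<delta>)}" using \<delta>0 by (auto simp: field_simps)
      thus ?thesis using F by (auto simp: Q2_def Q_def)
    qed
    hence "\<bar>\<integral>x. Q2 x \<delta> \<partial>lborel\<bar> = \<bar>\<integral>x. indicator {max X1 (h / \<delta>)..min X (k * h / \<delta>)} x * ((f x (\<delta> * x) - x * \<delta> * (d * ln (1 / \<delta>) + c1)) / \<delta>) \<partial>lborel\<bar>"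
      by simp
    also have "\<dots> \<le> 8 * C * h\<^sup>2 * (h / X) powr (c - 1) / \<delta>"
      by (rule slope_slice_bound[where f = f and \<delta> = \<delta> and q = "d * ln (1 / \<delta>) + c1", OF _ bdd h k X1(1,2) c C H]) (use True in \<open>auto simp: \<delta>1_def\<close>)
    finally show ?thesis using True by (simp add: K_def)
  next
    case False
    hence "Q2 x \<delta> = 0" for x using supp[of x \<delta>] by (auto simp: Q2_def Q_def indicator_def)
    thus ?thesis using False by simp
  qed
  have "\<bar>\<integral>\<delta>. (\<integral>x. Q2 x \<delta> \<partial>lborel) \<partial>lborel\<bar> \<le> (\<integral>\<delta>. \<bar>\<integral>x. Q2 x \<delta> \<partial>lborel\<bar> \<partial>lborel)"
    by (rule integral_abs_bound)
  also have "\<dots> \<le> (\<integral>\<delta>. indicator {\<delta>1..\<delta>2} \<delta> *\<^sub>R (K / \<delta>) \<partial>lborel)"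
  proof (rule integral_mono)
    show "integrable lborel (\<lambda>\<delta>. \<bar>\<integral>x. Q2 x \<delta> \<partial>lborel\<bar>)"
      using lborel_pair.integrable_snd[OF intQ2] by (intro integrable_abs) simp
    have "set_integrable lborel {\<delta>1..\<delta>2} (\<lambda>\<delta>. K / \<delta>)"
      by (rule borel_integrable_atLeastAtMost') (use \<delta>1 in \<open>auto intro!: continuous_intros\<close>)
    thus "integrable lborel (\<lambda>\<delta>. indicator {\<delta>1..\<delta>2} \<delta> *\<^sub>R (K / \<delta>))" by (simp add: set_integrable_def)
  qed (rule slice)
  also have "\<dots> = K * ln \<delta>2 - K * ln \<delta>1"
    by (rule integral_FTC_Icc[OF \<delta>12]) (use \<delta>1 in \<open>auto intro!: derivative_eq_intros continuous_intros simp: has_real_derivative_iff_has_vector_derivative[symmetric]\<close>)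
  also have "\<dots> = K * ln (\<delta>2 / \<delta>1)" using \<delta>1 \<delta>12 by (simp add: ln_div algebra_simps)
  also have "\<dots> \<le> K * ln (2 * X)"
  proof (intro mult_left_mono K)
    have "\<delta>2 / \<delta>1 = k * X / X1" using h X0 by (simp add: \<delta>1_def \<delta>2_def)
    also have "\<dots> \<le> 2 * X / 1" using k X0 X1 by (intro frac_le mult_right_mono) auto
    finally show "ln (\<delta>2 / \<delta>1) \<le> ln (2 * X)" using \<delta>1 \<delta>12 X0 by (subst ln_le_cancel_iff) auto
  qed
  also have "K = 8 * C * h * X * (h / X) powr c"
  proof -
    have "(h / X) powr c = (h / X) powr (c - 1) * (h / X)" using h X0 powr_add[of "h / X" "c - 1" 1] by simp
    thus ?thesis using X0 by (simp add: K_def power2_eq_square)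
  qed
  finally show "\<bar>\<integral>u. (\<integral>x. indicator {X1..X} x * (indicator {h..k*h} u * ((f x u - u * (d * ln (x / u) + c1)) / u)) \<partial>lborel) \<partial>lborel\<bar>
     \<le> 8 * C * h * X * (h / X) powr c * ln (2 * X)"
    unfolding eq[symmetric] Q_def .
qed

lemma psiF_bounded: "x \<le> Y \<Longrightarrow> norm (psiF \<Lambda> x) \<le> (\<Sum>n\<in>{1..nat \<lfloor>Y\<rfloor>}. norm (\<Lambda> n))"
proof -
  assume "x \<le> Y"
  hence sub: "nat \<lfloor>x\<rfloor> \<le> nat \<lfloor>Y\<rfloor>" by (intro nat_mono floor_mono)
  have "norm (psiF \<Lambda> x) \<le> (\<Sum>n\<in>{1..nat \<lfloor>x\<rfloor>}. norm (\<Lambda> n))" unfolding psiF_def by (rule norm_sum)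
  also have "\<dots> \<le> (\<Sum>n\<in>{1..nat \<lfloor>Y\<rfloor>}. norm (\<Lambda> n))" using sub by (intro sum_mono2) auto
  finally show ?thesis .
qed

text \<open>Purely qualitative: B may depend on all the data and serves only integrability.\<close>

lemma psi_gap_bounded:
  obtains B where "B \<ge> 0" "\<And>x v. x \<le> Y \<Longrightarrow> 0 \<le> v \<Longrightarrow> v \<le> w \<Longrightarrow> (norm (psi_gap \<Lambda> M x v))\<^sup>2 \<le> B"
proof -
  define S where "S = (\<Sum>n\<in>{1..nat \<lfloor>Y + max w 0\<rfloor>}. norm (\<Lambda> n))"
  have S0: "S \<ge> 0" unfolding S_def by (intro sum_nonneg) auto
  show ?thesis
  proof (rule that[of "(S + S + \<bar>M\<bar> * max w 0)\<^sup>2"])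
    fix x v :: real assume x: "x \<le> Y" and v: "0 \<le> v" "v \<le> w"
    have "norm (psi_gap \<Lambda> M x v) \<le> norm (psiF \<Lambda> (x + v)) + norm (psiF \<Lambda> x) + norm (complex_of_real (M * v))"
      unfolding psi_gap_def by (meson add_right_mono norm_triangle_ineq4 order_trans)
    also have "\<dots> \<le> S + S + \<bar>M\<bar> * max w 0"
    proof (intro add_mono)
      have "v \<le> max w 0" "0 \<le> max w 0" using v by auto
      hence "x + v \<le> Y + max w 0" "x \<le> Y + max w 0" using x by linarith+
      thus "norm (psiF \<Lambda> (x + v)) \<le> S" "norm (psiF \<Lambda> x) \<le> S" unfolding S_def by (simp_all only: psiF_bounded)
      show "norm (complex_of_real (M * v)) \<le> \<bar>M\<bar> * max w 0"
        unfolding norm_of_real abs_mult using v by (intro mult_left_mono) auto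
    qed
    finally show "(norm (psi_gap \<Lambda> M x v))\<^sup>2 \<le> (S + S + \<bar>M\<bar> * max w 0)\<^sup>2" by (intro power_mono) auto
  qed auto
qed

text \<open>Links the three integrals in play: the gauge integral in \<open>VF\<close> and
  \<open>VtF\<close>, the Bochner integral of the averaging argument, and the nonnegative integral
  of the averaged bounds.\<close>

lemma psi_gap_integrals:
  fixes \<Lambda> M v a b
  defines "f \<equiv> (\<lambda>x. (norm (psi_gap \<Lambda> M x v))\<^sup>2)"
  assumes v: "v \<ge> 0"
  shows "set_integrable lborel {a..b} f"
    and "integral {a..b} f = (\<integral>x. indicator {a..b} x * f x \<partial>lborel)"
    and "(\<integral>\<^sup>+x. indicator {a..b} x * ennreal (f x) \<partial>lborel) = ennreal (\<integral>x. indicator {a..b} x * f x \<partial>lborel)"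
    and "0 \<le> (\<integral>x. indicator {a..b} x * f x \<partial>lborel)"
proof -
  obtain B where B: "\<And>x w. x \<le> b \<Longrightarrow> 0 \<le> w \<Longrightarrow> w \<le> v \<Longrightarrow> (norm (psi_gap \<Lambda> M x w))\<^sup>2 \<le> B"
    using psi_gap_bounded[of b v \<Lambda> M] by metis
  have m: "f \<in> borel_measurable borel" unfolding f_def by measurable
  show si: "set_integrable lborel {a..b} f"
    by (rule set_integrable_bounded_Icc[OF m, where B = B]) (use B v in \<open>auto simp: f_def\<close>)
  show "integral {a..b} f = (\<integral>x. indicator {a..b} x * f x \<partial>lborel)"
    using set_borel_integral_eq_integral(2)[OF si] by (simp add: set_lebesgue_integral_def)
  have i: "integrable lborel (\<lambda>x. indicator {a..b} x * f x)" using si by (simp add: set_integrable_def)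
  have "(\<integral>\<^sup>+x. ennreal (indicator {a..b} x * f x) \<partial>lborel) = ennreal (\<integral>x. indicator {a..b} x * f x \<partial>lborel)"
    by (rule nn_integral_eq_integral[OF i]) (auto simp: f_def)
  moreover have "(\<integral>\<^sup>+x. ennreal (indicator {a..b} x * f x) \<partial>lborel) = (\<integral>\<^sup>+x. indicator {a..b} x * ennreal (f x) \<partial>lborel)"
    by (intro nn_integral_cong) (auto simp: indicator_def)
  ultimately show "(\<integral>\<^sup>+x. indicator {a..b} x * ennreal (f x) \<partial>lborel) = ennreal (\<integral>x. indicator {a..b} x * f x \<partial>lborel)" by simp
  show "0 \<le> (\<integral>x. indicator {a..b} x * f x \<partial>lborel)" by (intro Bochner_Integration.integral_nonneg) (auto simp: f_def)
qed

lemma nn_integral_le_imp_integral_le: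
  fixes g :: "real \<Rightarrow> real"
  assumes [measurable]: "g \<in> borel_measurable borel" and g: "\<And>x. 0 \<le> g x" and B: "(\<integral>\<^sup>+x. ennreal (g x) \<partial>lborel) \<le> ennreal B" "B \<ge> 0"
  shows "integrable lborel g" "integral\<^sup>L lborel g \<le> B"
proof -
  show i: "integrable lborel g"
    by (rule integrableI_nonneg) (use g B in \<open>auto intro: le_less_trans\<close>)
  have "ennreal (integral\<^sup>L lborel g) = (\<integral>\<^sup>+x. ennreal (g x) \<partial>lborel)"
    by (rule nn_integral_eq_integral[OF i, symmetric]) (use g in auto)
  hence "ennreal (integral\<^sup>L lborel g) \<le> ennreal B" using B by simp
  thus "integral\<^sup>L lborel g \<le> B" using B by (simp add: ennreal_le_iff)
qed

text \<open>Integrates a pointwise inequality over the window, where du/u has mass ln k. The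
  functions a, w and r enter unweighted: the factor 1/u, or a bound for it, is already inside them
  or in their coefficients.\<close>

lemma log_average_le:
  fixes a w r :: "real \<Rightarrow> real"
  assumes h: "h > 0" and k: "1 < k" and int: "integrable lborel a" "integrable lborel w" "integrable lborel r"
    and pt: "\<And>u. h \<le> u \<Longrightarrow> u \<le> k * h \<Longrightarrow> s / u \<le> p1 * a u + B0 / u + p2 * w u + p3 * r u"
    and out: "\<And>u. u \<notin> {h..k*h} \<Longrightarrow> a u = 0 \<and> w u = 0 \<and> r u = 0"
  shows "s * ln k \<le> p1 * integral\<^sup>L lborel a + B0 * ln k + p2 * integral\<^sup>L lborel w + p3 * integral\<^sup>L lborel r"
proof -
  have hk: "h \<le> k * h" using h k by simp
  have si: "set_integrable lborel {h..k*h} (\<lambda>u. z / u)" for z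
    by (rule borel_integrable_atLeastAtMost') (use h in \<open>auto intro!: continuous_intros\<close>)
  have I: "(\<integral>u. indicator {h..k*h} u *\<^sub>R (z / u) \<partial>lborel) = z * ln k" for z
  proof -
    have "(\<integral>u. indicator {h..k*h} u *\<^sub>R (z / u) \<partial>lborel) = z * ln (k * h) - z * ln h"
      by (rule integral_FTC_Icc[OF hk]) (use h in \<open>auto intro!: derivative_eq_intros continuous_intros simp: has_real_derivative_iff_has_vector_derivative[symmetric]\<close>)
    also have "\<dots> = z * ln k" using h k by (simp add: ln_mult algebra_simps)
    finally show ?thesis .
  qed
  have "s * ln k = (\<integral>u. indicator {h..k*h} u *\<^sub>R (s / u) \<partial>lborel)" by (rule I[symmetric])
  also have "\<dots> \<le> (\<integral>u. p1 * a u + indicator {h..k*h} u *\<^sub>R (B0 / u) + p2 * w u + p3 * r u \<partial>lborel)"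
  proof (rule integral_mono)
    show "integrable lborel (\<lambda>u. indicator {h..k*h} u *\<^sub>R (s / u))" using si by (simp add: set_integrable_def)
    show "integrable lborel (\<lambda>u. p1 * a u + indicator {h..k*h} u *\<^sub>R (B0 / u) + p2 * w u + p3 * r u)"
      using si[of B0] int by (auto simp: set_integrable_def)
    show "indicator {h..k*h} u *\<^sub>R (s / u) \<le> p1 * a u + indicator {h..k*h} u *\<^sub>R (B0 / u) + p2 * w u + p3 * r u" for u
      using pt[of u] out[of u] by (cases "u \<in> {h..k*h}") auto
  qed
  also have "\<dots> = p1 * integral\<^sup>L lborel a + (\<integral>u. indicator {h..k*h} u *\<^sub>R (B0 / u) \<partial>lborel) + p2 * integral\<^sup>L lborel w + p3 * integral\<^sup>L lborel r"
    using si[of B0] int by (simp add: set_integrable_def)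
  finally show ?thesis unfolding I .
qed

text \<open>The gaps for M and for m differ by (M - m)*\<delta>*x, whose mean square is about (M -
  m)^2*\<delta>^2*X^3/3. At \<delta> = X^(-B1) this is too much: the hypothesis gives
  \<delta>*X^2*ln X for m and the bound under GRH gives \<delta>*X^2 up to a small power for M,
  while \<delta>*X = X^(1 - B1).\<close>

lemma residue_eq_pole_order:
  assumes ms: "mean_square_bounded \<Lambda> M" and as: "VF_asymptotic \<Lambda> m d c1 c B1 B3"
    and B: "0 < B1" "B1 \<le> B3" "B1 < 1" and c: "c > 0"
  shows "M = real m"
proof (rule ccontr)
  assume "M \<noteq> real m"
  define D where "D = (M - real m)\<^sup>2"
  have D: "D > 0" using \<open>M \<noteq> real m\<close> by (simp add: D_def)
  \<comment> \<open>6e \<le> (1 - B1)/2 confines the losses X^(2e) and \<delta>^(-4e) to half of the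
    exponent 1 - B1.\<close>
  define e where "e = min (1/16) ((1 - B1) / 12)"
  have e: "0 < e" "e < 1/8" "6 * e \<le> (1 - B1) / 2" using B by (auto simp: e_def min_def)
  obtain C1 where C1: "C1 \<ge> 0" and b1: "\<And>\<delta> X. \<delta> > 0 \<Longrightarrow>
     (\<integral>\<^sup>+x. indicator {1..X} x * ennreal ((norm (psi_gap \<Lambda> M x (\<delta> * x)))\<^sup>2 * x powr (- 2 - 2 * e)) \<partial>lborel)
       \<le> ennreal (C1 * (\<delta> powr (1 - 4 * e) * (1 + \<delta>) powr (6 * e)))"
    using ms[unfolded mean_square_bounded_def, rule_format, OF e(1,2)] by blast
  obtain C2 X0 where C2: "C2 \<ge> 0" "X0 \<ge> 1" and V: "\<And>X \<delta>. X \<ge> X0 \<Longrightarrow> 1 * X powr (- B3) \<le> \<delta> \<Longrightarrow> \<delta> \<le> 1 * X powr (- B1) \<Longrightarrow>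
     \<bar>VF \<Lambda> m X \<delta> - 1/2 * \<delta> * X\<^sup>2 * (d * ln (1 / \<delta>) + c1)\<bar> \<le> C2 * (\<delta> powr (1 + c) * X\<^sup>2)"
    by (rule VF_asymptoticD[OF as, of 1 1]) (auto simp del: mult_1)
  \<comment> \<open>The comparison after division by \<delta>*X^2: order X^(1 - B1) on the left, a
    logarithm and X^((1 - B1)/2) on the right.\<close>
  have main: "D * (X powr (- B1) * (X - 1)) / 3 \<le> 2 * ((\<bar>d\<bar> + 1) * B1 * ln X + (\<bar>c1\<bar> + C2 + 1)) + 4 * (C1 + 1) * X powr ((1 - B1) / 2)"
    if X: "X \<ge> X0" for X
  proof -
    have X1: "X \<ge> 1" using X C2 by linarith
    define \<delta> where "\<delta> = X powr (- B1)"
    have \<delta>: "\<delta> > 0" using X1 by (simp add: \<delta>_def)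
    have "X powr (- B1) \<le> X powr 0" using X1 B by (intro powr_mono) auto
    moreover have "X powr 0 = 1" using X1 by simp
    ultimately have \<delta>1: "\<delta> \<le> 1" unfolding \<delta>_def by linarith
    have "ln \<delta> = - B1 * ln X" unfolding \<delta>_def using X1 by (subst ln_powr) auto
    hence ln\<delta>: "ln (1 / \<delta>) = B1 * ln X" using \<delta> by (simp add: ln_div)
    have "X powr (- B3) \<le> X powr (- B1)" using X1 B by (intro powr_mono) auto
    hence v: "\<bar>VF \<Lambda> m X \<delta> - 1/2 * \<delta> * X\<^sup>2 * (d * ln (1 / \<delta>) + c1)\<bar> \<le> C2 * (\<delta> powr (1 + c) * X\<^sup>2)"
      by (intro V X) (auto simp: \<delta>_def)
    have VU: "VF \<Lambda> m X \<delta> \<le> \<delta> * X\<^sup>2 * ((\<bar>d\<bar> + 1) * B1 * ln X + (\<bar>c1\<bar> + C2 + 1))"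
    proof -
      have "\<delta> powr (1 + c) \<le> \<delta> powr 1" using \<delta> \<delta>1 c by (intro powr_mono') auto
      hence "C2 * (\<delta> powr (1 + c) * X\<^sup>2) \<le> C2 * (\<delta> * X\<^sup>2)" using C2 \<delta> by (intro mult_left_mono mult_right_mono) auto
      hence 1: "VF \<Lambda> m X \<delta> \<le> 1/2 * \<delta> * X\<^sup>2 * (d * ln (1 / \<delta>) + c1) + C2 * (\<delta> * X\<^sup>2)" using v by linarith
      have lx: "0 \<le> B1 * ln X" using X1 B by simp
      have "d * ln (1 / \<delta>) \<le> (\<bar>d\<bar> + 1) * (B1 * ln X)" unfolding ln\<delta> using lx by (intro mult_right_mono) auto
      hence "d * ln (1 / \<delta>) + c1 \<le> (\<bar>d\<bar> + 1) * B1 * ln X + (\<bar>c1\<bar> + 1)" by simp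
      hence "1/2 * \<delta> * X\<^sup>2 * (d * ln (1 / \<delta>) + c1) \<le> 1/2 * \<delta> * X\<^sup>2 * ((\<bar>d\<bar> + 1) * B1 * ln X + (\<bar>c1\<bar> + 1))"
        using \<delta> by (intro mult_left_mono) auto
      also have "\<dots> \<le> \<delta> * X\<^sup>2 * ((\<bar>d\<bar> + 1) * B1 * ln X + (\<bar>c1\<bar> + 1))"
        using \<delta> lx by (intro mult_right_mono) (auto intro!: add_nonneg_nonneg simp: mult.assoc)
      finally have 2: "1/2 * \<delta> * X\<^sup>2 * (d * ln (1 / \<delta>) + c1) \<le> \<delta> * X\<^sup>2 * ((\<bar>d\<bar> + 1) * B1 * ln X + (\<bar>c1\<bar> + 1))" .
      have "\<delta> * X\<^sup>2 * ((\<bar>d\<bar> + 1) * B1 * ln X + (\<bar>c1\<bar> + C2 + 1)) = \<delta> * X\<^sup>2 * ((\<bar>d\<bar> + 1) * B1 * ln X + (\<bar>c1\<bar> + 1)) + C2 * (\<delta> * X\<^sup>2)"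
        by (simp add: algebra_simps)
      thus ?thesis using 1 2 by linarith
    qed
    have pt: "D * \<delta>\<^sup>2 * x\<^sup>2 \<le> 2 * (norm (psi_gap \<Lambda> (real m) x (\<delta> * x)))\<^sup>2 + 2 * (norm (psi_gap \<Lambda> M x (\<delta> * x)))\<^sup>2" for x
    proof -
      define p q where "p = psi_gap \<Lambda> (real m) x (\<delta> * x)" and "q = psi_gap \<Lambda> M x (\<delta> * x)"
      have "p - q = of_real ((M - real m) * (\<delta> * x))" by (simp add: p_def q_def psi_gap_def algebra_simps)
      hence "(norm (p - q))\<^sup>2 = ((M - real m) * (\<delta> * x))\<^sup>2" by (simp only: norm_of_real power2_abs)
      hence "D * \<delta>\<^sup>2 * x\<^sup>2 = (norm (p - q))\<^sup>2" by (simp add: D_def power_mult_distrib)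
      also have "\<dots> \<le> (norm p + norm q)\<^sup>2" by (intro power_mono norm_triangle_ineq4) auto
      also have "\<dots> \<le> 2 * (norm p)\<^sup>2 + 2 * (norm q)\<^sup>2"
        using sum_squares_bound[of "norm p" "norm q"] by (simp add: power2_sum)
      finally show ?thesis by (simp add: p_def q_def)
    qed
    define fm where "fm x = (norm (psi_gap \<Lambda> (real m) x (\<delta> * x)))\<^sup>2" for x
    define fM where "fM x = (norm (psi_gap \<Lambda> M x (\<delta> * x)))\<^sup>2" for x
    have [measurable]: "fm \<in> borel_measurable borel" "fM \<in> borel_measurable borel" unfolding fm_def fM_def by measurable
    have bm: "\<exists>B. \<forall>x\<in>{1..X}. fm x \<le> B"
    proof -
      obtain B where B: "\<And>x v. x \<le> X \<Longrightarrow> 0 \<le> v \<Longrightarrow> v \<le> \<delta> * X \<Longrightarrow> (norm (psi_gap \<Lambda> (real m) x v))\<^sup>2 \<le> B"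
        using psi_gap_bounded[of X "\<delta> * X" \<Lambda> "real m"] by metis
      thus ?thesis using \<delta> unfolding fm_def by (intro exI[of _ B]) auto
    qed
    then obtain Bm where Bm: "\<And>x. x \<in> {1..X} \<Longrightarrow> fm x \<le> Bm" by blast
    have sm: "set_integrable lborel {1..X} fm"
      by (rule set_integrable_bounded_Icc[where B = Bm]) (use Bm in \<open>auto simp: fm_def\<close>)
    have "(fm has_integral VF \<Lambda> m X \<delta>) {1..X}"
    proof -
      have "VF \<Lambda> m X \<delta> = integral {1..X} fm" unfolding VF_def fm_def psi_gap_def by (simp add: mult.assoc)
      thus ?thesis using set_borel_integral_eq_integral(1)[OF sm] by (simp add: integrable_integral)
    qed
    hence Vnn: "(\<integral>\<^sup>+x. ennreal (fm x) * indicator {1..X} x \<partial>lborel) = ennreal (VF \<Lambda> m X \<delta>)"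
      by (rule nn_integral_has_integral_lebesgue'[rotated]) (simp add: fm_def)
    have V0: "VF \<Lambda> m X \<delta> \<ge> 0" unfolding VF_def by (intro Henstock_Kurzweil_Integration.integral_nonneg integral_nonneg) (use set_borel_integral_eq_integral(1)[OF sm] in \<open>auto simp: fm_def[abs_def] psi_gap_def mult.assoc\<close>)
    define A where "A = X powr (2 + 2 * e) * (C1 * (\<delta> powr (1 - 4 * e) * (1 + \<delta>) powr (6 * e)))"
    have Mnn: "(\<integral>\<^sup>+x. ennreal (fM x) * indicator {1..X} x \<partial>lborel) \<le> ennreal A"
    proof -
      have "(\<integral>\<^sup>+x. ennreal (fM x) * indicator {1..X} x \<partial>lborel) \<le> (\<integral>\<^sup>+x. ennreal (X powr (2 + 2 * e)) * (indicator {1..X} x * ennreal (fM x * x powr (- 2 - 2 * e))) \<partial>lborel)"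
      proof (rule nn_integral_mono)
        fix x
        show "ennreal (fM x) * indicator {1..X} x \<le> ennreal (X powr (2 + 2 * e)) * (indicator {1..X} x * ennreal (fM x * x powr (- 2 - 2 * e)))"
        proof (cases "x \<in> {1..X}")
          case True
          have "fM x = fM x * (x powr (2 + 2 * e) * x powr (- 2 - 2 * e))" using True by (simp flip: powr_add)
          also have "\<dots> \<le> fM x * (X powr (2 + 2 * e) * x powr (- 2 - 2 * e))"
            using True e by (intro mult_left_mono mult_right_mono powr_mono2) (auto simp: fM_def)
          finally have "ennreal (fM x) \<le> ennreal (X powr (2 + 2 * e) * (fM x * x powr (- 2 - 2 * e)))" by (intro ennreal_leI) (simp add: mult_ac)
          thus ?thesis using True by (simp add: ennreal_mult')
        qed simp
      qed
      also have "\<dots> = ennreal (X powr (2 + 2 * e)) * (\<integral>\<^sup>+x. indicator {1..X} x * ennreal (fM x * x powr (- 2 - 2 * e)) \<partial>lborel)"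
        by (rule nn_integral_cmult) measurable
      also have "\<dots> \<le> ennreal (X powr (2 + 2 * e)) * ennreal (C1 * (\<delta> powr (1 - 4 * e) * (1 + \<delta>) powr (6 * e)))"
        unfolding fM_def by (intro mult_left_mono b1 \<delta>) auto
      also have "\<dots> = ennreal A" unfolding A_def by (simp add: ennreal_mult')
      finally show ?thesis .
    qed
    have A0: "A \<ge> 0" using C1 by (simp add: A_def)
    have "((\<lambda>x. D * \<delta>\<^sup>2 * x\<^sup>2) has_integral (D * \<delta>\<^sup>2 * X ^ 3 / 3 - D * \<delta>\<^sup>2 * 1 ^ 3 / 3)) {1..X}"
      by (rule fundamental_theorem_of_calculus[OF X1])
         (auto intro!: derivative_eq_intros simp: has_real_derivative_iff_has_vector_derivative[symmetric])
    hence "ennreal (D * \<delta>\<^sup>2 * X ^ 3 / 3 - D * \<delta>\<^sup>2 * 1 ^ 3 / 3) = (\<integral>\<^sup>+x. ennreal (D * \<delta>\<^sup>2 * x\<^sup>2) * indicator {1..X} x \<partial>lborel)"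
      using D by (intro nn_integral_has_integral_lebesgue'[symmetric]) auto
    also have "\<dots> \<le> (\<integral>\<^sup>+x. 2 * (ennreal (fm x) * indicator {1..X} x) + 2 * (ennreal (fM x) * indicator {1..X} x) \<partial>lborel)"
    proof (rule nn_integral_mono)
      fix x
      have "ennreal (D * \<delta>\<^sup>2 * x\<^sup>2) \<le> ennreal (2 * fm x + 2 * fM x)" unfolding fm_def fM_def by (intro ennreal_leI pt)
      also have "\<dots> = 2 * ennreal (fm x) + 2 * ennreal (fM x)"
        by (subst ennreal_plus) (auto simp: fm_def fM_def ennreal_mult')
      finally show "ennreal (D * \<delta>\<^sup>2 * x\<^sup>2) * indicator {1..X} x \<le> 2 * (ennreal (fm x) * indicator {1..X} x) + 2 * (ennreal (fM x) * indicator {1..X} x)"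
        by (simp add: indicator_def)
    qed
    also have "\<dots> = 2 * (\<integral>\<^sup>+x. ennreal (fm x) * indicator {1..X} x \<partial>lborel) + 2 * (\<integral>\<^sup>+x. ennreal (fM x) * indicator {1..X} x \<partial>lborel)"
      by (subst nn_integral_add) (auto simp: nn_integral_cmult)
    also have "\<dots> \<le> 2 * ennreal (VF \<Lambda> m X \<delta>) + 2 * ennreal A" unfolding Vnn by (intro add_left_mono mult_left_mono Mnn) auto
    also have "\<dots> = ennreal (2 * VF \<Lambda> m X \<delta> + 2 * A)" using V0 A0 by (simp add: ennreal_mult')
    finally have "D * \<delta>\<^sup>2 * X ^ 3 / 3 - D * \<delta>\<^sup>2 * 1 ^ 3 / 3 \<le> 2 * VF \<Lambda> m X \<delta> + 2 * A"
      using V0 A0 by (subst (asm) ennreal_le_iff) auto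
    hence "D * \<delta>\<^sup>2 * X ^ 3 / 3 - D * \<delta>\<^sup>2 / 3 \<le> 2 * VF \<Lambda> m X \<delta> + 2 * A" by simp
    moreover have "A \<le> \<delta> * X\<^sup>2 * (2 * (C1 + 1) * X powr ((1 - B1) / 2))"
    proof -
      have "(1 + \<delta>) powr (6 * e) \<le> 2 powr (6 * e)" using \<delta> \<delta>1 e by (intro powr_mono2) auto
      also have "\<dots> \<le> 2 powr 1" using e by (intro powr_mono) auto
      finally have p1: "(1 + \<delta>) powr (6 * e) \<le> 2" by simp
      have p2: "\<delta> powr (1 - 4 * e) = \<delta> * X powr (4 * e * B1)"
        using X1 \<delta> by (simp add: \<delta>_def powr_powr algebra_simps flip: powr_add)
      have "X powr (2 * e) * X powr (4 * e * B1) \<le> X powr (2 * e) * X powr (4 * e)"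
        using X1 e B by (intro mult_left_mono powr_mono) (auto simp: mult_le_cancel_left1)
      also have "\<dots> \<le> X powr ((1 - B1) / 2)" using X1 e by (simp flip: powr_add) (intro powr_mono, auto)
      finally have p3: "X powr (2 * e) * X powr (4 * e * B1) \<le> X powr ((1 - B1) / 2)" .
      have "A = C1 * (\<delta> * X\<^sup>2) * (X powr (2 * e) * X powr (4 * e * B1)) * (1 + \<delta>) powr (6 * e)"
      proof -
        have "X powr (2 + 2 * e) = X\<^sup>2 * X powr (2 * e)" using X1 by (simp add: powr_add)
        thus ?thesis unfolding A_def p2 by (simp only: mult_ac)
      qed
      also have "\<dots> \<le> (C1 + 1) * (\<delta> * X\<^sup>2) * X powr ((1 - B1) / 2) * 2"
        using p1 p3 C1 \<delta> by (intro mult_mono) auto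
      finally show ?thesis by (simp only: mult_ac)
    qed
    moreover have "\<delta> * X\<^sup>2 * (2 * ((\<bar>d\<bar> + 1) * B1 * ln X + (\<bar>c1\<bar> + C2 + 1)) + 4 * (C1 + 1) * X powr ((1 - B1) / 2))
        = 2 * (\<delta> * X\<^sup>2 * ((\<bar>d\<bar> + 1) * B1 * ln X + (\<bar>c1\<bar> + C2 + 1))) + 2 * (\<delta> * X\<^sup>2 * (2 * (C1 + 1) * X powr ((1 - B1) / 2)))"
      by (simp add: algebra_simps)
    ultimately have "D * \<delta>\<^sup>2 * X ^ 3 / 3 - D * \<delta>\<^sup>2 / 3 \<le> \<delta> * X\<^sup>2 * (2 * ((\<bar>d\<bar> + 1) * B1 * ln X + (\<bar>c1\<bar> + C2 + 1)) + 4 * (C1 + 1) * X powr ((1 - B1) / 2))"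
      using VU by linarith
    moreover have "\<delta> * X\<^sup>2 * (D * (\<delta> * (X - 1)) / 3) \<le> D * \<delta>\<^sup>2 * X ^ 3 / 3 - D * \<delta>\<^sup>2 / 3"
    proof -
      have "1 \<le> X\<^sup>2" using X1 by (simp add: one_le_power)
      hence "D * \<delta>\<^sup>2 * 1 \<le> D * \<delta>\<^sup>2 * X\<^sup>2" using D by (intro mult_left_mono) auto
      moreover have "\<delta> * X\<^sup>2 * (D * (\<delta> * (X - 1)) / 3) = D * \<delta>\<^sup>2 * X ^ 3 / 3 - D * \<delta>\<^sup>2 * X\<^sup>2 / 3"
        by (simp add: power2_eq_square power3_eq_cube algebra_simps diff_divide_distrib)
      ultimately show ?thesis by linarith
    qed
    ultimately have "\<delta> * X\<^sup>2 * (D * (\<delta> * (X - 1)) / 3) \<le> \<delta> * X\<^sup>2 * (2 * ((\<bar>d\<bar> + 1) * B1 * ln X + (\<bar>c1\<bar> + C2 + 1)) + 4 * (C1 + 1) * X powr ((1 - B1) / 2))"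
      by linarith
    moreover have "\<delta> * X\<^sup>2 > 0" using \<delta> X1 by simp
    ultimately show ?thesis unfolding \<delta>_def by (simp only: mult_le_cancel_left_pos)
  qed
  have "filterlim (\<lambda>X. D * (X powr (- B1) * (X - 1)) / 3 - (2 * (p * B1 * ln X + q) + 4 * r * X powr ((1 - B1) / 2))) at_top at_top"
    if "p > 0" "q > 0" "r > 0" for p q r
    using that D B by real_asymp
  from this[of "\<bar>d\<bar> + 1" "\<bar>c1\<bar> + C2 + 1" "C1 + 1"]
  have "filterlim (\<lambda>X. D * (X powr (- B1) * (X - 1)) / 3 - (2 * ((\<bar>d\<bar> + 1) * B1 * ln X + (\<bar>c1\<bar> + C2 + 1)) + 4 * (C1 + 1) * X powr ((1 - B1) / 2))) at_top at_top"
    using C1 C2 by (auto simp: add_nonneg_pos)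
  hence "\<forall>\<^sub>F X in at_top. D * (X powr (- B1) * (X - 1)) / 3 - (2 * ((\<bar>d\<bar> + 1) * B1 * ln X + (\<bar>c1\<bar> + C2 + 1)) + 4 * (C1 + 1) * X powr ((1 - B1) / 2)) > 0"
    unfolding filterlim_at_top_dense by blast
  from eventually_happens'[OF trivial_limit_at_top_linorder eventually_conj[OF this eventually_ge_at_top[of X0]]] obtain X
    where X: "0 < D * (X powr (- B1) * (X - 1)) / 3 - (2 * ((\<bar>d\<bar> + 1) * B1 * ln X + (\<bar>c1\<bar> + C2 + 1)) + 4 * (C1 + 1) * X powr ((1 - B1) / 2))" "X0 \<le> X"
    by (elim exE conjE)
  show False using main[OF X(2)] X(1) by linarith
qed

section \<open>Passage from slopes to lengths\<close>

text \<open>From 2xy \<le> \<mu>*x^2 + y^2/\<mu>. The weights are unequal because b will be much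
  smaller than p in mean square.\<close>

lemma perturb_square_bounds:
  fixes p b :: complex and \<mu> :: real
  assumes \<mu>: "0 < \<mu>" "\<mu> \<le> 1"
  shows "(norm (p - b))\<^sup>2 \<le> (1 + \<mu>) * (norm p)\<^sup>2 + (1 + 1 / \<mu>) * (norm b)\<^sup>2"
    and "(1 - \<mu>) * (norm p)\<^sup>2 \<le> (norm (p - b))\<^sup>2 + (1 / \<mu>) * (norm b)\<^sup>2"
proof -
  define x y where "x = norm p" and "y = norm b"
  have xy: "2 * x * y \<le> \<mu> * x\<^sup>2 + 1 / \<mu> * y\<^sup>2"
  proof -
    have "0 \<le> (\<mu> * x - y)\<^sup>2 / \<mu>" using \<mu> by simp
    also have "\<dots> = \<mu> * x\<^sup>2 - 2 * x * y + 1 / \<mu> * y\<^sup>2" using \<mu> by (simp add: power2_eq_square field_simps)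
    finally show ?thesis by simp
  qed
  have "(norm (p - b))\<^sup>2 \<le> (x + y)\<^sup>2" unfolding x_def y_def by (intro power_mono norm_triangle_ineq4) auto
  also have "\<dots> = x\<^sup>2 + 2 * x * y + y\<^sup>2" by (simp add: power2_sum)
  also have "\<dots> \<le> (1 + \<mu>) * x\<^sup>2 + (1 + 1 / \<mu>) * y\<^sup>2" using xy by (simp add: distrib_right)
  finally show "(norm (p - b))\<^sup>2 \<le> (1 + \<mu>) * (norm p)\<^sup>2 + (1 + 1 / \<mu>) * (norm b)\<^sup>2" by (simp add: x_def y_def)
  have "x - y \<le> norm (p - b)" "y - x \<le> norm (p - b)"
    unfolding x_def y_def using norm_triangle_ineq2[of p b] norm_triangle_ineq2[of b p] by (auto simp: norm_minus_commute)
  hence "\<bar>x - y\<bar> \<le> norm (p - b)" by simp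
  hence "(x - y)\<^sup>2 \<le> (norm (p - b))\<^sup>2" by (metis abs_ge_zero power2_abs power_mono)
  hence "x\<^sup>2 - 2 * x * y + y\<^sup>2 \<le> (norm (p - b))\<^sup>2" by (simp add: power2_diff)
  hence "(1 - \<mu>) * x\<^sup>2 \<le> (norm (p - b))\<^sup>2 + (1 / \<mu>) * y\<^sup>2 - y\<^sup>2" using xy by (simp add: left_diff_distrib)
  also have "\<dots> \<le> (norm (p - b))\<^sup>2 + (1 / \<mu>) * y\<^sup>2" by simp
  finally show "(1 - \<mu>) * (norm p)\<^sup>2 \<le> (norm (p - b))\<^sup>2 + (1 / \<mu>) * (norm b)\<^sup>2" by (simp add: x_def y_def)
qed

text \<open>(x, x + h] is (x, x + u] without (x + h, x + u]; the excess is a gap of length u - h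
  starting at x + h \<le> 2X, whence the doubled range in r.\<close>

lemma short_interval_compare:
  fixes \<Lambda> :: "nat \<Rightarrow> complex" and M X h u \<mu> :: real
  assumes h: "0 < h" "h \<le> X" "h \<le> u" and X: "1 \<le> X" and \<mu>: "0 < \<mu>" "\<mu> \<le> 1"
  defines "V \<equiv> (\<lambda>v. \<integral>x. indicator {1..X} x * (norm (psi_gap \<Lambda> M x v))\<^sup>2 \<partial>lborel)"
    and "r \<equiv> (\<integral>x. indicator {1..2*X} x * (norm (psi_gap \<Lambda> M x (u - h)))\<^sup>2 \<partial>lborel)"
  shows "V h \<le> (1 + \<mu>) * V u + (1 + 1 / \<mu>) * r" and "(1 - \<mu>) * V u \<le> V h + (1 / \<mu>) * r"
proof -
  define b where "b x = indicator {1..X} x * (norm (psi_gap \<Lambda> M (x + h) (u - h)))\<^sup>2" for x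
  have u: "u \<ge> 0" "u - h \<ge> 0" using h by auto
  have gap: "psi_gap \<Lambda> M x h = psi_gap \<Lambda> M x u - psi_gap \<Lambda> M (x + h) (u - h)" for x
    by (simp add: psi_gap_def algebra_simps)
  have iV: "integrable lborel (\<lambda>x. indicator {1..X} x * (norm (psi_gap \<Lambda> M x v))\<^sup>2)" if "v \<ge> 0" for v
    using psi_gap_integrals(1)[OF that, of 1 X \<Lambda> M] by (simp add: set_integrable_def)
  have i2: "integrable lborel (\<lambda>x. indicator {1..2*X} x * (norm (psi_gap \<Lambda> M x (u - h)))\<^sup>2)"
    using psi_gap_integrals(1)[OF u(2), of 1 "2 * X" \<Lambda> M] by (simp add: set_integrable_def)
  have i2s: "integrable lborel (\<lambda>x. indicator {1..2*X} (h + 1 * x) * (norm (psi_gap \<Lambda> M (h + 1 * x) (u - h)))\<^sup>2)"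
    by (rule lborel_integrable_real_affine[OF i2]) simp
  have r_shift: "r = (\<integral>x. indicator {1..2*X} (h + 1 * x) * (norm (psi_gap \<Lambda> M (h + 1 * x) (u - h)))\<^sup>2 \<partial>lborel)"
    unfolding r_def by (subst lborel_integral_real_affine[where c = 1 and t = h]) auto
  have bm: "b \<in> borel_measurable borel" unfolding b_def by measurable
  have b_le: "b x \<le> indicator {1..2*X} (h + 1 * x) * (norm (psi_gap \<Lambda> M (h + 1 * x) (u - h)))\<^sup>2" for x
    using h X by (auto simp: b_def indicator_def add.commute)
  have b0: "b x \<ge> 0" for x by (simp add: b_def)
  have ib: "integrable lborel b"
    by (rule Bochner_Integration.integrable_bound[OF i2s])
       (use bm b_le b0 in \<open>auto intro!: AE_I2 order.trans[OF b_le abs_ge_self]\<close>)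
  have Bint: "integral\<^sup>L lborel b \<le> r" unfolding r_shift by (intro integral_mono ib i2s b_le)
  have "V h \<le> (\<integral>x. (1 + \<mu>) * (indicator {1..X} x * (norm (psi_gap \<Lambda> M x u))\<^sup>2) + (1 + 1 / \<mu>) * b x \<partial>lborel)"
    unfolding V_def
  proof (rule integral_mono)
    fix x
    show "indicator {1..X} x * (norm (psi_gap \<Lambda> M x h))\<^sup>2 \<le> (1 + \<mu>) * (indicator {1..X} x * (norm (psi_gap \<Lambda> M x u))\<^sup>2) + (1 + 1 / \<mu>) * b x"
      using perturb_square_bounds(1)[OF \<mu>, of "psi_gap \<Lambda> M x u" "psi_gap \<Lambda> M (x + h) (u - h)"] unfolding gap[of x]
      by (cases "x \<in> {1..X}") (auto simp: b_def)
  qed (use iV[of h] iV[of u] ib h u in auto)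
  also have "\<dots> = (1 + \<mu>) * V u + (1 + 1 / \<mu>) * integral\<^sup>L lborel b"
    unfolding V_def using iV[of u] ib u by simp
  also have "\<dots> \<le> (1 + \<mu>) * V u + (1 + 1 / \<mu>) * r" using Bint \<mu> by (intro add_left_mono mult_left_mono) auto
  finally show "V h \<le> (1 + \<mu>) * V u + (1 + 1 / \<mu>) * r" .
  have "(1 - \<mu>) * V u = (\<integral>x. (1 - \<mu>) * (indicator {1..X} x * (norm (psi_gap \<Lambda> M x u))\<^sup>2) \<partial>lborel)"
    unfolding V_def by simp
  also have "\<dots> \<le> (\<integral>x. indicator {1..X} x * (norm (psi_gap \<Lambda> M x h))\<^sup>2 + (1 / \<mu>) * b x \<partial>lborel)"
  proof (rule integral_mono)
    fix x
    show "(1 - \<mu>) * (indicator {1..X} x * (norm (psi_gap \<Lambda> M x u))\<^sup>2) \<le> indicator {1..X} x * (norm (psi_gap \<Lambda> M x h))\<^sup>2 + (1 / \<mu>) * b x"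
      using perturb_square_bounds(2)[OF \<mu>, of "psi_gap \<Lambda> M x u" "psi_gap \<Lambda> M (x + h) (u - h)"] unfolding gap[of x]
      by (cases "x \<in> {1..X}") (auto simp: b_def)
  qed (use iV[of h] iV[of u] ib h u in auto)
  also have "\<dots> = V h + (1 / \<mu>) * integral\<^sup>L lborel b" unfolding V_def using iV[of h] ib h by simp
  also have "\<dots> \<le> V h + (1 / \<mu>) * r" using Bint \<mu> by (intro add_left_mono mult_left_mono) auto
  finally show "(1 - \<mu>) * V u \<le> V h + (1 / \<mu>) * r" .
qed

section \<open>The main term\<close>

text \<open>Integrating the logarithm lowers the constant by d. This is how (1 - gamma - ln 2pi)*d
  in the hypothesis becomes -(gamma + ln 2pi)*d in the conclusion.\<close>

lemma model_antiderivative: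
  fixes d c1 u :: real
  assumes u: "u > 0" and Y: "0 < Y" "Y \<le> X"
  shows "set_integrable lborel {Y..X} (\<lambda>x. u * (d * ln (x / u) + c1))"
    and "(\<integral>x. indicator {Y..X} x * (u * (d * ln (x / u) + c1)) \<partial>lborel)
      = u * X * (d * ln (X / u) + (c1 - d)) - u * Y * (d * ln (Y / u) + (c1 - d))"
proof -
  have cont: "continuous_on {Y..X} (\<lambda>x. u * (d * ln (x / u) + c1))"
    using u Y by (intro continuous_intros) auto
  show "set_integrable lborel {Y..X} (\<lambda>x. u * (d * ln (x / u) + c1))"
    by (rule borel_integrable_atLeastAtMost'[OF cont])
  have "(\<integral>x. indicator {Y..X} x *\<^sub>R (u * (d * ln (x / u) + c1)) \<partial>lborel)
      = u * X * (d * ln (X / u) + (c1 - d)) - u * Y * (d * ln (Y / u) + (c1 - d))"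
  proof (rule integral_FTC_Icc[OF Y(2) _ cont])
    fix x assume x: "Y \<le> x" "x \<le> X"
    have "((\<lambda>x. u * x * (d * ln (x / u) + (c1 - d))) has_real_derivative u * (d * ln (x / u) + c1)) (at x within {Y..X})"
      using u Y x by (auto intro!: derivative_eq_intros simp: field_simps)
    thus "((\<lambda>x. u * x * (d * ln (x / u) + (c1 - d))) has_vector_derivative u * (d * ln (x / u) + c1)) (at x within {Y..X})"
      by (simp add: has_real_derivative_iff_has_vector_derivative)
  qed
  thus "(\<integral>x. indicator {Y..X} x * (u * (d * ln (x / u) + c1)) \<partial>lborel)
      = u * X * (d * ln (X / u) + (c1 - d)) - u * Y * (d * ln (Y / u) + (c1 - d))" by simp
qed

text \<open>Mean value theorem for the cost of replacing u by h in the main term; h \<ge> 1 and u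
  \<le> X keep the logarithm between 0 and ln X.\<close>

lemma model_lipschitz:
  fixes d c2 h u X :: real
  assumes h: "1 \<le> h" "h \<le> u" "u \<le> X"
  shows "\<bar>u * X * (d * ln (X / u) + c2) - h * X * (d * ln (X / h) + c2)\<bar> \<le> (u - h) * X * (\<bar>d\<bar> * ln X + \<bar>c2\<bar> + \<bar>d\<bar>)"
proof (cases "h = u")
  case False
  hence hu: "h < u" using h by simp
  have "\<exists>z. h < z \<and> z < u \<and> u * (d * ln (X / u) + c2) - h * (d * ln (X / h) + c2) = (u - h) * (d * ln (X / z) + c2 - d)"
  proof (rule MVT2[OF hu])
    fix z assume z: "h \<le> z" "z \<le> u"
    show "((\<lambda>z. z * (d * ln (X / z) + c2)) has_real_derivative (d * ln (X / z) + c2 - d)) (at z)"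
      using h z by (auto intro!: derivative_eq_intros simp: field_simps)
  qed
  then obtain z where z: "h < z" "z < u" and eq: "u * (d * ln (X / u) + c2) - h * (d * ln (X / h) + c2) = (u - h) * (d * ln (X / z) + c2 - d)" by blast
  have z1: "1 \<le> X / z" "X / z \<le> X" using z h by (auto simp: field_simps)
  hence lz: "\<bar>ln (X / z)\<bar> \<le> ln X" using z h by (auto intro!: ln_mono)
  have "\<bar>d * ln (X / z) + c2 - d\<bar> \<le> \<bar>d * ln (X / z)\<bar> + \<bar>c2\<bar> + \<bar>d\<bar>" by linarith
  also have "\<bar>d * ln (X / z)\<bar> \<le> \<bar>d\<bar> * ln X" unfolding abs_mult using lz by (intro mult_left_mono) auto
  finally have b: "\<bar>d * ln (X / z) + c2 - d\<bar> \<le> \<bar>d\<bar> * ln X + \<bar>c2\<bar> + \<bar>d\<bar>" by simp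
  have "u * X * (d * ln (X / u) + c2) - h * X * (d * ln (X / h) + c2) = X * (u * (d * ln (X / u) + c2) - h * (d * ln (X / h) + c2))"
    by (simp add: algebra_simps)
  also have "\<dots> = (u - h) * X * (d * ln (X / z) + c2 - d)" unfolding eq by (simp add: mult_ac)
  finally have "\<bar>u * X * (d * ln (X / u) + c2) - h * X * (d * ln (X / h) + c2)\<bar> = (u - h) * X * \<bar>d * ln (X / z) + c2 - d\<bar>"
    using hu h by (simp add: abs_mult)
  also have "\<dots> \<le> (u - h) * X * (\<bar>d\<bar> * ln X + \<bar>c2\<bar> + \<bar>d\<bar>)" using b hu h by (intro mult_left_mono) auto
  finally show ?thesis .
qed simp

lemma model_bound:
  fixes d c2 u Y X :: real
  assumes "1 \<le> u" "u \<le> Y" "Y \<le> X"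
  shows "\<bar>u * Y * (d * ln (Y / u) + c2)\<bar> \<le> u * Y * (\<bar>d\<bar> * ln X + \<bar>c2\<bar> + \<bar>d\<bar>)"
proof -
  have "1 \<le> Y / u" "Y / u \<le> X" using assms by (auto simp: field_simps intro: order_trans mult_left_mono[of 1 u X, simplified])
  hence "\<bar>ln (Y / u)\<bar> \<le> ln X" using assms by (auto intro!: ln_mono)
  hence "\<bar>d * ln (Y / u)\<bar> \<le> \<bar>d\<bar> * ln X" unfolding abs_mult by (intro mult_left_mono) auto
  hence "\<bar>d * ln (Y / u) + c2\<bar> \<le> \<bar>d\<bar> * ln X + \<bar>c2\<bar> + \<bar>d\<bar>" by linarith
  hence "u * Y * \<bar>d * ln (Y / u) + c2\<bar> \<le> u * Y * (\<bar>d\<bar> * ln X + \<bar>c2\<bar> + \<bar>d\<bar>)" using assms by (intro mult_left_mono) auto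
  thus ?thesis using assms by (simp add: abs_mult)
qed

text \<open>Transfers the averaged bound from the nonnegative integral over [0, w] to a Bochner
  integral over a subwindow.\<close>

lemma psi_gap_square_window_integral:
  fixes \<Lambda> :: "nat \<Rightarrow> complex" and M Y A p q w :: real
  defines "W \<equiv> (\<lambda>v. \<integral>x. indicator {1..Y} x * (norm (psi_gap \<Lambda> M x v))\<^sup>2 \<partial>lborel)"
  assumes A: "(\<integral>\<^sup>+v. indicator {0..w} v * (\<integral>\<^sup>+x. indicator {1..Y} x * ennreal ((norm (psi_gap \<Lambda> M x v))\<^sup>2) \<partial>lborel) \<partial>lborel) \<le> ennreal A"
    and A0: "A \<ge> 0" and pq: "0 \<le> p" "q \<le> w"
  shows "integrable lborel (\<lambda>v. indicator {p..q} v * W v)" "(\<integral>v. indicator {p..q} v * W v \<partial>lborel) \<le> A"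
proof -
  have m: "(\<lambda>v. indicator {p..q} v * W v) \<in> borel_measurable borel" unfolding W_def by measurable
  have W0: "W v \<ge> 0" for v unfolding W_def by (intro Bochner_Integration.integral_nonneg) auto
  have "(\<integral>\<^sup>+v. ennreal (indicator {p..q} v * W v) \<partial>lborel)
      \<le> (\<integral>\<^sup>+v. indicator {0..w} v * (\<integral>\<^sup>+x. indicator {1..Y} x * ennreal ((norm (psi_gap \<Lambda> M x v))\<^sup>2) \<partial>lborel) \<partial>lborel)"
  proof (rule nn_integral_mono)
    fix v :: real
    show "ennreal (indicator {p..q} v * W v) \<le> indicator {0..w} v * (\<integral>\<^sup>+x. indicator {1..Y} x * ennreal ((norm (psi_gap \<Lambda> M x v))\<^sup>2) \<partial>lborel)"
    proof (cases "v \<in> {p..q}")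
      case True
      hence v: "0 \<le> v" "v \<le> w" using pq by auto
      show ?thesis unfolding psi_gap_integrals(3)[OF v(1)] using True v by (simp add: W_def)
    qed simp
  qed
  hence nn: "(\<integral>\<^sup>+v. ennreal (indicator {p..q} v * W v) \<partial>lborel) \<le> ennreal A" using A by (rule order_trans)
  have nonneg: "0 \<le> indicator {p..q} v * W v" for v using W0 by simp
  show "integrable lborel (\<lambda>v. indicator {p..q} v * W v)" "(\<integral>v. indicator {p..q} v * W v \<partial>lborel) \<le> A"
    by (rule nn_integral_le_imp_integral_le[OF m nonneg nn A0])+
qed

text \<open>For u in the window the mean square is split at X1: the part below is charged to A1, the
  part above to the logarithmic average. Replacing u by h is charged to A2, the average over lengths
  u - h \<le> \<mu>^2*h. The factor 2/\<mu>^2 bounds 1/ln(1 + \<mu>^2).\<close>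

lemma VtF_minus_model_le:
  fixes \<Lambda> :: "nat \<Rightarrow> complex" and m :: nat and X X1 h \<mu> c C d c1 A1 A2 :: real
  assumes h: "1 \<le> h" "2 * h \<le> X1" "X1 \<le> X" and \<mu>: "0 < \<mu>" "\<mu> \<le> 1" and c: "0 < c" "c \<le> 1" and C: "C \<ge> 0"
    and H: "\<And>\<delta> y. X1 \<le> y \<Longrightarrow> y \<le> X \<Longrightarrow> h \<le> \<delta> * y \<Longrightarrow> \<delta> * y \<le> 2 * h \<Longrightarrow>
       \<bar>VF \<Lambda> m y \<delta> - 1/2 * \<delta> * y\<^sup>2 * (d * ln (1 / \<delta>) + c1)\<bar> \<le> C * (\<delta> powr (1 + c) * y\<^sup>2)"
    and A1: "(\<integral>\<^sup>+v. indicator {0..2*h} v * (\<integral>\<^sup>+x. indicator {1..X1} x * ennreal ((norm (psi_gap \<Lambda> (real m) x v))\<^sup>2) \<partial>lborel) \<partial>lborel) \<le> ennreal A1" "A1 \<ge> 0"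
    and A2: "(\<integral>\<^sup>+v. indicator {0..\<mu>\<^sup>2*h} v * (\<integral>\<^sup>+x. indicator {1..2*X} x * ennreal ((norm (psi_gap \<Lambda> (real m) x v))\<^sup>2) \<partial>lborel) \<partial>lborel) \<le> ennreal A2" "A2 \<ge> 0"
  shows "\<bar>VtF \<Lambda> m X h - h * X * (d * ln (X / h) + (c1 - d))\<bar>
    \<le> 2 / \<mu>\<^sup>2 * (2 * (8 * C * h * X * (h / X) powr c * ln (2 * X)) + 2 / h * A1 + 2 / (\<mu> * h) * A2)
      + (2 * \<mu> * h * X + \<mu>\<^sup>2 * h * X + 4 * h * X1) * (\<bar>d\<bar> * ln X + \<bar>c1 - d\<bar> + \<bar>d\<bar>)"
proof -
  define k where "k = 1 + \<mu>\<^sup>2"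
  define f where "f x u = (norm (psi_gap \<Lambda> (real m) x u))\<^sup>2" for x u
  define V where "V v = (\<integral>x. indicator {1..X} x * f x v \<partial>lborel)" for v
  define W where "W v = (\<integral>x. indicator {1..X1} x * f x v \<partial>lborel)" for v
  define R where "R v = (\<integral>x. indicator {1..2*X} x * f x v \<partial>lborel)" for v
  \<comment> \<open>The antiderivative of the model, evaluated at Y; the claimed main term is
    \<open>Mn h X\<close>.\<close>
  define Mn where "Mn u Y = u * Y * (d * ln (Y / u) + (c1 - d))" for u Y :: real
  define a where "a u = (\<integral>x. indicator {X1..X} x * (indicator {h..k*h} u * ((f x u - u * (d * ln (x / u) + c1)) / u)) \<partial>lborel)" for u
  define w where "w u = indicator {h..k*h} u * W u" for u
  define rr where "rr u = indicator {h..k*h} u * R (u - h)" for u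
  define E1 where "E1 = 8 * C * h * X * (h / X) powr c * ln (2 * X)"
  define P where "P = \<bar>d\<bar> * ln X + \<bar>c1 - d\<bar> + \<bar>d\<bar>"
  define B0 where "B0 = (2 * \<mu> * h * X + \<mu>\<^sup>2 * h * X + 4 * h * X1) * P"
  define s where "s = V h - Mn h X"
  have X: "1 \<le> X" "h \<le> X" "2 * h \<le> X" "1 \<le> X1" using h by linarith+
  have P0: "P \<ge> 0" using X by (auto simp: P_def)
  have \<mu>2: "0 < \<mu>\<^sup>2" "\<mu>\<^sup>2 \<le> 1" using \<mu> by (auto simp: power_le_one)
  have k: "1 < k" "k \<le> 2" using \<mu>2 by (auto simp: k_def)
  have h0: "h > 0" using h by linarith
  have kh: "k * h \<le> 2 * h" using k h0 by simp
  have kh': "k * h = h + \<mu>\<^sup>2 * h" by (simp add: k_def distrib_right)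
  have fm: "(\<lambda>(x, u). f x u) \<in> borel_measurable (borel \<Otimes>\<^sub>M borel)" unfolding f_def by measurable
  obtain Bd where Bd: "\<And>x v. x \<le> X \<Longrightarrow> 0 \<le> v \<Longrightarrow> v \<le> 2 * h \<Longrightarrow> (norm (psi_gap \<Lambda> (real m) x v))\<^sup>2 \<le> Bd"
    using psi_gap_bounded[of X "2 * h" \<Lambda> "real m"] by metis
  have bdd: "\<bar>f x u\<bar> \<le> Bd" if "1 \<le> x" "x \<le> X" "0 \<le> u" "u \<le> 2 * h" for x u
    using Bd[of x u] that by (simp add: f_def)
  have VFf: "VF \<Lambda> m y \<delta> = integral {1..y} (\<lambda>x. f x (\<delta> * x))" for y \<delta>
    unfolding VF_def f_def psi_gap_def by (simp add: mult.assoc)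
  have H': "\<bar>integral {1..y} (\<lambda>x. f x (\<delta> * x)) - 1/2 * \<delta> * y\<^sup>2 * (d * ln (1 / \<delta>) + c1)\<bar> \<le> C * (\<delta> powr (1 + c) * y\<^sup>2)"
    if "X1 \<le> y" "y \<le> X" "h \<le> \<delta> * y" "\<delta> * y \<le> k * h" for \<delta> y
    unfolding VFf[symmetric] by (rule H) (use that kh in auto)
  have khX1: "k * h \<le> X1" using kh h by linarith
  have aint: "integrable lborel a" and abd: "\<bar>integral\<^sup>L lborel a\<bar> \<le> E1"
    unfolding a_def[abs_def] E1_def
    using log_average_change_of_variables[OF fm bdd h0 k X(4) h(3) khX1 c C H'] by blast+
  have wint: "integrable lborel w" "integral\<^sup>L lborel w \<le> A1"
    unfolding w_def[abs_def] W_def f_def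
    by (rule psi_gap_square_window_integral[OF A1]; use h0 kh in simp)+
  define g where "g v = indicator {0..\<mu>\<^sup>2*h} v * R v" for v
  have gint: "integrable lborel g" "integral\<^sup>L lborel g \<le> A2"
    unfolding g_def[abs_def] R_def f_def
    by (rule psi_gap_square_window_integral[OF A2]; simp)+
  \<comment> \<open>Translation by h turns the window for u into [0, \<mu>^2*h] for the excess
    length u - h.\<close>
  have rrg: "rr u = g (- h + 1 * u)" for u
    unfolding rr_def g_def kh' by (auto simp: indicator_def)
  have rint: "integrable lborel rr" "integral\<^sup>L lborel rr \<le> A2"
  proof -
    show "integrable lborel rr" unfolding rrg[abs_def] by (rule lborel_integrable_real_affine[OF gint(1)]) simp
    have "integral\<^sup>L lborel g = (\<integral>u. g (- h + 1 * u) \<partial>lborel)"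
      by (subst lborel_integral_real_affine[where c = 1 and t = "- h"]) auto
    thus "integral\<^sup>L lborel rr \<le> A2" unfolding rrg[abs_def] using gint(2) by linarith
  qed
  \<comment> \<open>The part below X1, the model on [X1, X], and the deviation above X1; in
    \<open>a\<close> the deviation is divided by u, which the factor u undoes.\<close>
  have Vu: "V u = Mn u X + u * a u + W u - Mn u X1" if u: "h \<le> u" "u \<le> k * h" for u
  proof -
    have u0: "u \<ge> 0" "u > 0" using u h0 by linarith+
    have iX: "set_integrable lborel {p..q} (\<lambda>x. f x u)" for p q unfolding f_def by (rule psi_gap_integrals(1)[OF u0(1)])
    have hk: "integral {p..q} (\<lambda>x. f x u) = (\<integral>x. indicator {p..q} x * f x u \<partial>lborel)" for p q
      unfolding f_def by (rule psi_gap_integrals(2)[OF u0(1)])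
    have "integral {1..X1} (\<lambda>x. f x u) + integral {X1..X} (\<lambda>x. f x u) = integral {1..X} (\<lambda>x. f x u)"
      by (rule Henstock_Kurzweil_Integration.integral_combine) (use X h set_borel_integral_eq_integral(1)[OF iX] in auto)
    hence tail: "(\<integral>x. indicator {X1..X} x * f x u \<partial>lborel) = V u - W u" by (simp add: hk V_def W_def)
    have X10: "0 < X1" using X by linarith
    have i1: "integrable lborel (\<lambda>x. indicator {X1..X} x * f x u)" using iX[of X1 X] by (simp add: set_integrable_def)
    have i2: "integrable lborel (\<lambda>x. indicator {X1..X} x * (u * (d * ln (x / u) + c1)))"
      using model_antiderivative(1)[OF u0(2) X10 h(3), of d c1] by (simp add: set_integrable_def)
    have "a u = (\<integral>x. (indicator {X1..X} x * f x u - indicator {X1..X} x * (u * (d * ln (x / u) + c1))) / u \<partial>lborel)"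
      unfolding a_def using u by (intro Bochner_Integration.integral_cong) (auto simp: indicator_def)
    also have "\<dots> = ((\<integral>x. indicator {X1..X} x * f x u \<partial>lborel) - (\<integral>x. indicator {X1..X} x * (u * (d * ln (x / u) + c1)) \<partial>lborel)) / u"
      by (simp only: integral_divide_zero Bochner_Integration.integral_diff[OF i1 i2])
    also have "\<dots> = (V u - W u - (Mn u X - Mn u X1)) / u"
      unfolding tail model_antiderivative(2)[OF u0(2) X10 h(3)] Mn_def ..
    finally show ?thesis using u0 by simp
  qed
  have W0: "W u \<ge> 0" and R0: "R u \<ge> 0" for u
    unfolding W_def R_def f_def by (intro Bochner_Integration.integral_nonneg; auto)+
  \<comment> \<open>Collects all discrepancies of main terms: the factor 1 + \<mu> or 1 - \<mu> in
    front of \<open>V u\<close>, the change from u to h, and the model missing below X1.\<close>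
  have br: "\<mu> * \<bar>Mn u X\<bar> + \<bar>Mn u X - Mn h X\<bar> + 2 * \<bar>Mn u X1\<bar> \<le> B0" if u: "h \<le> u" "u \<le> k * h" for u
  proof -
    have u2: "1 \<le> u" "u \<le> 2 * h" "u \<le> X1" "u \<le> X" using u h kh by linarith+
    have uh: "u - h \<le> \<mu>\<^sup>2 * h" using u kh' by linarith
    have "\<bar>Mn u X\<bar> \<le> u * X * P" unfolding Mn_def P_def by (rule model_bound) (use u2 X in auto)
    also have "\<dots> \<le> 2 * h * X * P" using u2 X P0 by (intro mult_right_mono) auto
    finally have 1: "\<mu> * \<bar>Mn u X\<bar> \<le> \<mu> * (2 * h * X * P)" using \<mu> by (intro mult_left_mono) auto
    have "\<bar>Mn u X1\<bar> \<le> u * X1 * P" unfolding Mn_def P_def by (rule model_bound) (use u2 X h in auto)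
    also have "\<dots> \<le> 2 * h * X1 * P" using u2 X P0 by (intro mult_right_mono) auto
    finally have 2: "2 * \<bar>Mn u X1\<bar> \<le> 2 * (2 * h * X1 * P)" by (intro mult_left_mono) auto
    have "\<bar>Mn u X - Mn h X\<bar> \<le> (u - h) * X * P" unfolding Mn_def P_def by (rule model_lipschitz) (use u u2 h in auto)
    also have "\<dots> \<le> \<mu>\<^sup>2 * h * X * P" using uh X P0 by (intro mult_right_mono) auto
    finally have 3: "\<bar>Mn u X - Mn h X\<bar> \<le> \<mu>\<^sup>2 * h * X * P" .
    have "B0 = \<mu> * (2 * h * X * P) + \<mu>\<^sup>2 * h * X * P + 2 * (2 * h * X1 * P)" unfolding B0_def by (simp add: algebra_simps)
    thus ?thesis using 1 2 3 by linarith
  qed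
  \<comment> \<open>W and R are nonnegative, so 1/u may be replaced by 1/h there. The sign of
    \<open>a\<close> is unknown, so its factor 1/u has to stay exact.\<close>
  have divu: "t / u \<le> p * a u + B0 / u + 2 / h * w u + 2 / (\<mu> * h) * rr u"
    if u: "h \<le> u" "u \<le> k * h" and t: "t \<le> p * (u * a u) + B0 + 2 * W u + 2 / \<mu> * R (u - h)" for t p u
  proof -
    have u0: "u > 0" using u h0 by linarith
    have "t / u \<le> (p * (u * a u) + B0 + 2 * W u + 2 / \<mu> * R (u - h)) / u" using t u0 by (intro divide_right_mono) auto
    also have "\<dots> = p * a u + B0 / u + 2 * W u / u + 2 / \<mu> * R (u - h) / u" using u0 by (simp add: add_divide_distrib)
    also have "2 * W u / u \<le> 2 * W u / h" using W0 u h0 by (intro divide_left_mono) auto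
    also have "2 / \<mu> * R (u - h) / u \<le> 2 / \<mu> * R (u - h) / h" using R0 \<mu> u h0 by (intro divide_left_mono mult_nonneg_nonneg) auto
    finally show ?thesis using u by (simp add: w_def rr_def)
  qed
  have hu: "V h \<le> (1 + \<mu>) * V u + (1 + 1 / \<mu>) * R (u - h)" "(1 - \<mu>) * V u \<le> V h + (1 / \<mu>) * R (u - h)" if u: "h \<le> u" for u
    unfolding V_def R_def f_def by (rule short_interval_compare[OF h0 X(2) u X(1) \<mu>])+
  have out: "a u = 0 \<and> w u = 0 \<and> rr u = 0" if "u \<notin> {h..k*h}" for u
    using that by (simp add: a_def w_def rr_def)
  have \<mu>i: "1 \<le> 1 / \<mu>" using \<mu> by simp
  have up: "s * ln k \<le> (1 + \<mu>) * integral\<^sup>L lborel a + B0 * ln k + 2 / h * integral\<^sup>L lborel w + 2 / (\<mu> * h) * integral\<^sup>L lborel rr"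
  proof (rule log_average_le[OF h0 k(1) aint wint(1) rint(1) divu out])
    fix u assume u: "h \<le> u" "u \<le> k * h"
    have "s \<le> (1 + \<mu>) * (Mn u X + u * a u + W u - Mn u X1) + (1 + 1 / \<mu>) * R (u - h) - Mn h X"
      unfolding s_def Vu[OF u, symmetric] using hu(1)[OF u(1)] by linarith
    also have "\<dots> = (1 + \<mu>) * (u * a u) + (1 + \<mu>) * W u + (1 + 1 / \<mu>) * R (u - h) + (\<mu> * Mn u X + (Mn u X - Mn h X) - (1 + \<mu>) * Mn u X1)"
      by (simp add: algebra_simps)
    also have "(1 + \<mu>) * W u \<le> 2 * W u" using \<mu> W0 by (intro mult_right_mono) auto
    also have "(1 + 1 / \<mu>) * R (u - h) \<le> 2 / \<mu> * R (u - h)" using \<mu>i R0 by (intro mult_right_mono) auto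
    also have "\<mu> * Mn u X + (Mn u X - Mn h X) - (1 + \<mu>) * Mn u X1 \<le> B0"
    proof -
      have "\<mu> * Mn u X \<le> \<mu> * \<bar>Mn u X\<bar>" using \<mu> by (intro mult_left_mono) auto
      moreover have "- ((1 + \<mu>) * Mn u X1) \<le> 2 * \<bar>Mn u X1\<bar>"
      proof -
        have "- ((1 + \<mu>) * Mn u X1) \<le> \<bar>(1 + \<mu>) * Mn u X1\<bar>" by linarith
        also have "\<dots> = (1 + \<mu>) * \<bar>Mn u X1\<bar>" using \<mu> by (simp add: abs_mult)
        also have "\<dots> \<le> 2 * \<bar>Mn u X1\<bar>" using \<mu> by (intro mult_right_mono) auto
        finally show ?thesis .
      qed
      ultimately show ?thesis using br[OF u] by linarith
    qed
    finally show "s \<le> (1 + \<mu>) * (u * a u) + B0 + 2 * W u + 2 / \<mu> * R (u - h)" by simp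
  qed
  \<comment> \<open>Here the deviation enters with the opposite sign, which the bound on the
    absolute value of its average covers; \<mu> \<le> 1 gives the W term a sign that allows it to be
    dropped.\<close>
  have lo: "(- s) * ln k \<le> (- (1 - \<mu>)) * integral\<^sup>L lborel a + B0 * ln k + 2 / h * integral\<^sup>L lborel w + 2 / (\<mu> * h) * integral\<^sup>L lborel rr"
  proof (rule log_average_le[OF h0 k(1) aint wint(1) rint(1) divu out])
    fix u assume u: "h \<le> u" "u \<le> k * h"
    have "- s \<le> Mn h X - (1 - \<mu>) * (Mn u X + u * a u + W u - Mn u X1) + 1 / \<mu> * R (u - h)"
      unfolding s_def Vu[OF u, symmetric] using hu(2)[OF u(1)] by linarith
    also have "\<dots> = (- (1 - \<mu>)) * (u * a u) - (1 - \<mu>) * W u + 1 / \<mu> * R (u - h) + (\<mu> * Mn u X + (Mn h X - Mn u X) + (1 - \<mu>) * Mn u X1)"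
      by (simp add: algebra_simps)
    also have "1 / \<mu> * R (u - h) \<le> 2 / \<mu> * R (u - h)" using \<mu> R0 by (intro mult_right_mono divide_right_mono) auto
    also have "\<mu> * Mn u X + (Mn h X - Mn u X) + (1 - \<mu>) * Mn u X1 \<le> B0"
    proof -
      have "\<mu> * Mn u X \<le> \<mu> * \<bar>Mn u X\<bar>" using \<mu> by (intro mult_left_mono) auto
      moreover have "(1 - \<mu>) * Mn u X1 \<le> 2 * \<bar>Mn u X1\<bar>"
      proof -
        have "(1 - \<mu>) * Mn u X1 \<le> (1 - \<mu>) * \<bar>Mn u X1\<bar>" using \<mu> by (intro mult_left_mono) auto
        also have "\<dots> \<le> 2 * \<bar>Mn u X1\<bar>" using \<mu> by (intro mult_right_mono) auto
        finally show ?thesis .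
      qed
      ultimately show ?thesis using br[OF u] by linarith
    qed
    finally have "- s \<le> (- (1 - \<mu>)) * (u * a u) - (1 - \<mu>) * W u + 2 / \<mu> * R (u - h) + B0" by simp
    moreover have "0 \<le> (1 - \<mu>) * W u" using \<mu> W0 by simp
    ultimately show "- s \<le> (- (1 - \<mu>)) * (u * a u) + B0 + 2 * W u + 2 / \<mu> * R (u - h)" using W0[of u] by linarith
  qed
  define T where "T = 2 * E1 + 2 / h * A1 + 2 / (\<mu> * h) * A2"
  have T: "z * integral\<^sup>L lborel a + B0 * ln k + 2 / h * integral\<^sup>L lborel w + 2 / (\<mu> * h) * integral\<^sup>L lborel rr \<le> B0 * ln k + T" if z: "\<bar>z\<bar> \<le> 2" for z
  proof -
    have "z * integral\<^sup>L lborel a \<le> \<bar>z\<bar> * \<bar>integral\<^sup>L lborel a\<bar>" unfolding abs_mult[symmetric] by (rule abs_ge_self)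
    also have "\<dots> \<le> 2 * E1" using z abd by (intro mult_mono) auto
    finally have "z * integral\<^sup>L lborel a \<le> 2 * E1" .
    moreover have "2 / h * integral\<^sup>L lborel w \<le> 2 / h * A1" using wint(2) h0 by (intro mult_left_mono) auto
    moreover have "2 / (\<mu> * h) * integral\<^sup>L lborel rr \<le> 2 / (\<mu> * h) * A2" using rint(2) h0 \<mu> by (intro mult_left_mono) auto
    ultimately show ?thesis unfolding T_def by linarith
  qed
  \<comment> \<open>ln y \<le> y - 1 at y = 1/k gives ln k \<ge> 1 - 1/k = \<mu>^2/k \<ge>
    \<mu>^2/2.\<close>
  have lnk: "\<mu>\<^sup>2 / 2 \<le> ln k"
  proof -
    have "1 - 1 / k \<le> ln k" using ln_le_minus_one[of "1 / k"] k by (simp add: ln_div)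
    moreover have "\<mu>\<^sup>2 / 2 \<le> \<mu>\<^sup>2 / k" using \<mu>2 k by (intro divide_left_mono) auto
    moreover have "(k - 1) / k = 1 - 1 / k" using k by (simp add: diff_divide_distrib)
    moreover have "(k - 1) / k = \<mu>\<^sup>2 / k" by (simp add: k_def)
    ultimately show ?thesis by linarith
  qed
  have lk0: "ln k > 0" using k by simp
  have T0: "T \<ge> 0"
  proof -
    have "E1 \<ge> 0" using abd by linarith
    thus ?thesis unfolding T_def using A1 A2 h0 \<mu> by (intro add_nonneg_nonneg mult_nonneg_nonneg) auto
  qed
  have fin: "t \<le> 2 / \<mu>\<^sup>2 * T + B0" if "t * ln k \<le> B0 * ln k + T" for t
  proof -
    have "(t - B0) * ln k \<le> T" using that by (simp add: left_diff_distrib)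
    hence "t - B0 \<le> T / ln k" using lk0 by (simp add: pos_le_divide_eq)
    also have "\<dots> \<le> T / (\<mu>\<^sup>2 / 2)" using T0 lnk \<mu>2 lk0 by (intro divide_left_mono) auto
    also have "\<dots> = 2 / \<mu>\<^sup>2 * T" by simp
    finally show ?thesis by simp
  qed
  have "s \<le> 2 / \<mu>\<^sup>2 * T + B0" by (rule fin[OF order_trans[OF up T]]) (use \<mu> in auto)
  moreover have "- s \<le> 2 / \<mu>\<^sup>2 * T + B0" by (rule fin[OF order_trans[OF lo T]]) (use \<mu> in auto)
  moreover have "VtF \<Lambda> m X h = V h"
    using psi_gap_integrals(2)[OF less_imp_le[OF h0], of 1 X \<Lambda> "real m"]
    unfolding VtF_def V_def f_def psi_gap_def by simp
  ultimately show ?thesis unfolding s_def Mn_def T_def E1_def B0_def P_def by linarith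
qed

section \<open>Choice of parameters\<close>

lemma powr_third_add_le:
  fixes x y :: real
  assumes "0 \<le> x" "0 \<le> y"
  shows "(x + y) powr (1/3) \<le> 2 * (x powr (1/3) + y powr (1/3))"
proof -
  have *: "(p + q) powr (1/3) \<le> 2 * q powr (1/3)" if "0 \<le> p" "p \<le> q" for p q :: real
  proof -
    have "(p + q) powr (1/3) \<le> (2 * q) powr (1/3)" using that by (intro powr_mono2) auto
    also have "\<dots> = 2 powr (1/3) * q powr (1/3)" using that by (intro powr_mult)
    also have "\<dots> \<le> 2 powr 1 * q powr (1/3)" by (intro mult_right_mono powr_mono) auto
    finally show ?thesis by simp
  qed
  have "(x + y) powr (1/3) \<le> 2 * max x y powr (1/3)"
    using *[of x y] *[of y x] assms by (cases "x \<le> y") (auto simp: max_def add.commute)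
  also have "max x y powr (1/3) \<le> x powr (1/3) + y powr (1/3)" by (simp add: max_def)
  finally show ?thesis by simp
qed

text \<open>z stands for the power of h/X and L for ln(2X). As \<mu>^3 dominates z and X1/X, every
  summand is at most a constant times \<mu>*h*X^(1 + e): the first two lose 1/\<mu>^2, the third
  carries \<mu>^4/(\<mu>*\<mu>^2), and 7 = 2 + 1 + 4.\<close>

lemma combined_error_le:
  fixes h X X1 \<mu> e z L P Kp C Ca :: real
  assumes h: "1 \<le> h" and X: "1 \<le> X" and X1: "1 \<le> X1" "X1 \<le> X" "X1 \<le> \<mu> ^ 3 * X" and \<mu>: "0 < \<mu>" "\<mu> \<le> 1"
    and z: "0 \<le> z" "z \<le> \<mu> ^ 3" and L: "0 \<le> L" "L \<le> X powr e" and P: "0 \<le> P" "P \<le> Kp * X powr e" and C: "0 \<le> C" "0 \<le> Ca" and e: "e > 0"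
  shows "2 / \<mu>\<^sup>2 * (2 * (8 * C * h * X * z * L) + 2 / h * (Ca * ((2 * h)\<^sup>2 * X1 powr (1 + e))) + 2 / (\<mu> * h) * (Ca * ((\<mu>\<^sup>2 * h)\<^sup>2 * (2 * X) powr (1 + e))))
      + (2 * \<mu> * h * X + \<mu>\<^sup>2 * h * X + 4 * h * X1) * P
    \<le> (32 * C + 16 * Ca + 4 * Ca * 2 powr (1 + e) + 7 * Kp) * (\<mu> * (h * X powr (1 + e)))"
proof -
  define S where "S = \<mu> * (h * X powr (1 + e))"
  have h0: "h > 0" and X0: "X > 0" using h X by linarith+
  have Xe: "X powr (1 + e) = X * X powr e" using X0 by (simp add: powr_add)
  have \<mu>3: "\<mu> ^ 3 = \<mu> * \<mu>\<^sup>2" by (simp add: power2_eq_square power3_eq_cube)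
  have "z * L \<le> \<mu> ^ 3 * X powr e" using z L \<mu> by (intro mult_mono) auto
  hence "32 * C * h * X / \<mu>\<^sup>2 * (z * L) \<le> 32 * C * h * X / \<mu>\<^sup>2 * (\<mu> ^ 3 * X powr e)"
    using C h0 X0 by (intro mult_left_mono) auto
  hence t1: "2 / \<mu>\<^sup>2 * (2 * (8 * C * h * X * z * L)) \<le> 32 * C * S"
    using \<mu> unfolding S_def Xe \<mu>3 by (simp add: field_simps)
  have "X1 powr (1 + e) = X1 * X1 powr e" using X1 by (simp add: powr_add)
  also have "\<dots> \<le> (\<mu> ^ 3 * X) * X powr e" using X1 X0 \<mu> e by (intro mult_mono powr_mono2) auto
  finally have "16 * Ca * h / \<mu>\<^sup>2 * X1 powr (1 + e) \<le> 16 * Ca * h / \<mu>\<^sup>2 * (\<mu> ^ 3 * X * X powr e)"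
    using C h0 by (intro mult_left_mono) auto
  hence t2: "2 / \<mu>\<^sup>2 * (2 / h * (Ca * ((2 * h)\<^sup>2 * X1 powr (1 + e)))) \<le> 16 * Ca * S"
    using \<mu> h0 unfolding S_def Xe \<mu>3 by (simp add: field_simps power2_eq_square)
  have "(2 * X) powr (1 + e) = 2 powr (1 + e) * X powr (1 + e)" using X0 by (intro powr_mult)
  hence t3: "2 / \<mu>\<^sup>2 * (2 / (\<mu> * h) * (Ca * ((\<mu>\<^sup>2 * h)\<^sup>2 * (2 * X) powr (1 + e)))) = 4 * Ca * 2 powr (1 + e) * S"
    using \<mu> h0 unfolding S_def by (simp add: field_simps power2_eq_square)
  have \<mu>2: "\<mu>\<^sup>2 \<le> \<mu>" "\<mu> ^ 3 \<le> \<mu>" using \<mu> power_decreasing[of 1 2 \<mu>] power_decreasing[of 1 3 \<mu>] by auto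
  have "h * X1 \<le> h * (\<mu> * X)" using h0 X1(3) X0 mult_right_mono[OF \<mu>2(2), of X] by (intro mult_left_mono) linarith+
  moreover have "\<mu>\<^sup>2 * h * X \<le> \<mu> * h * X" using \<mu>2 h0 X0 by (intro mult_right_mono) auto
  ultimately have "2 * \<mu> * h * X + \<mu>\<^sup>2 * h * X + 4 * h * X1 \<le> 7 * (\<mu> * h * X)" by (simp add: mult_ac)
  hence "(2 * \<mu> * h * X + \<mu>\<^sup>2 * h * X + 4 * h * X1) * P \<le> 7 * (\<mu> * h * X) * (Kp * X powr e)"
    using P \<mu> h0 X0 by (intro mult_mono) auto
  also have "\<dots> = 7 * Kp * S" by (simp add: S_def Xe mult_ac)
  finally have t4: "(2 * \<mu> * h * X + \<mu>\<^sup>2 * h * X + 4 * h * X1) * P \<le> 7 * Kp * S" .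
  have "(32 * C + 16 * Ca + 4 * Ca * 2 powr (1 + e) + 7 * Kp) * S = 32 * C * S + 16 * Ca * S + 4 * Ca * 2 powr (1 + e) * S + 7 * Kp * S"
    by (simp only: distrib_right)
  thus ?thesis unfolding S_def[symmetric] using t1 t2 t3 t4 by (simp only: distrib_left)
qed

text \<open>The slopes u/y with X1 \<le> y \<le> X must stay in the range of the hypothesis at y,
  not at X: B3 < 1 secures the lower end for the smaller y, the choice of X1 secures the upper
  end.\<close>

lemma VtF_asymptotic:
  assumes ms: "mean_square_bounded \<Lambda> (real m)" and as: "VF_asymptotic \<Lambda> m d c1 c B1 B3"
    and B: "0 < B1" "B1 < B2" "B2 \<le> B3" "B3 < 1" and c: "c > 0" and e: "e > 0" and k1: "k1 > 0" and k2: "k2 > 0"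
  shows "\<exists>C X0. \<forall>X\<ge>X0. \<forall>h. k1 * X powr (1 - B3) \<le> h \<and> h \<le> k2 * X powr (1 - B2) \<longrightarrow>
        \<bar>VtF \<Lambda> m X h - h * X * (d * ln (X / h) + (c1 - d))\<bar>
        \<le> C * (h * X powr (1 + e) * (h / X) powr (c / 3)
             + h * X powr (1 + e) * (h * X powr (- (1 - B1))) powr (1 / (3 * (1 - B1))))"
proof -
  obtain Ca where Ca: "Ca \<ge> 0" and avg: "\<And>X w. X \<ge> 1 \<Longrightarrow> 1 / X \<le> w \<Longrightarrow> w \<le> 2 * X \<Longrightarrow>
    (\<integral>\<^sup>+v. indicator {0..w} v * (\<integral>\<^sup>+x. indicator {1..X} x * ennreal ((norm (psi_gap \<Lambda> (real m) x v))\<^sup>2) \<partial>lborel) \<partial>lborel)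
      \<le> ennreal (Ca * (w\<^sup>2 * X powr (1 + e)))"
    apply (rule psi_gap_average_bound[OF ms e])
    subgoal premises p by (rule p(1)[OF p(2,3)])
    done
  \<comment> \<open>The lower constant k1 is inherited unchanged; the upper constant 2 accommodates
    lengths up to 2h.\<close>
  obtain C X0 where C: "C \<ge> 0" "X0 \<ge> 1" and V: "\<And>X \<delta>. X \<ge> X0 \<Longrightarrow> k1 * X powr (- B3) \<le> \<delta> \<Longrightarrow> \<delta> \<le> 2 * X powr (- B1) \<Longrightarrow>
     \<bar>VF \<Lambda> m X \<delta> - 1/2 * \<delta> * X\<^sup>2 * (d * ln (1 / \<delta>) + c1)\<bar> \<le> C * (\<delta> powr (1 + c) * X\<^sup>2)"
    by (rule VF_asymptoticD[OF as k1, of 2]) auto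
  define \<beta> where "\<beta> = 1 / (1 - B1)"
  \<comment> \<open>The slice estimate requires an exponent of at most 1.\<close>
  define c' where "c' = min c 1"
  have B1: "0 < 1 - B1" "1 - B1 < 1" using B by linarith+
  have \<beta>: "\<beta> > 1" "\<beta> * (1 - B1) = 1" using B1 by (auto simp: \<beta>_def)
  have c': "0 < c'" "c' \<le> 1" "c' \<le> c" using c by (auto simp: c'_def)
  define Kp where "Kp = 2 * \<bar>d\<bar> + \<bar>c1 - d\<bar>"
  define K where "K = 32 * C + 16 * Ca + 4 * Ca * 2 powr (1 + e) + 7 * Kp"
  have K0: "K \<ge> 0" using C Ca by (auto simp: K_def Kp_def)
  \<comment> \<open>Conditions on h alone; they hold for large X because h \<ge> k1*X^(1 - B3) and
    B3 < 1.\<close>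
  have "\<forall>\<^sub>F h in at_top. 1 \<le> h \<and> X0 \<le> h powr \<beta> \<and> 2 \<le> h powr (\<beta> - 1)"
  proof (intro eventually_conj eventually_ge_at_top)
    have "filterlim (\<lambda>h::real. h powr \<beta>) at_top at_top" using \<beta> by real_asymp
    thus "\<forall>\<^sub>F h in at_top. X0 \<le> h powr \<beta>" unfolding filterlim_at_top by blast
    have "\<beta> - 1 > 0" using \<beta> by simp
    hence "filterlim (\<lambda>h::real. h powr (\<beta> - 1)) at_top at_top" by real_asymp
    thus "\<forall>\<^sub>F h::real in at_top. 2 \<le> h powr (\<beta> - 1)" unfolding filterlim_at_top by blast
  qed
  then obtain K1 where K1: "\<And>h. h \<ge> K1 \<Longrightarrow> 1 \<le> h \<and> X0 \<le> h powr \<beta> \<and> 2 \<le> h powr (\<beta> - 1)"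
    unfolding eventually_at_top_linorder by blast
  have "\<forall>\<^sub>F X in at_top. 1 \<le> X \<and> K1 \<le> k1 * X powr (1 - B3) \<and> (k2 * X powr (1 - B2)) powr \<beta> / X < 1/2
      \<and> (k2 * X powr (- B2)) powr c' < 1/2 \<and> ln (2 * X) / X powr e < 1"
  proof (intro eventually_conj eventually_ge_at_top)
    have "filterlim (\<lambda>X::real. k1 * X powr (1 - B3)) at_top at_top" using k1 B by real_asymp
    thus "\<forall>\<^sub>F X in at_top. K1 \<le> k1 * X powr (1 - B3)" unfolding filterlim_at_top by blast
    \<comment> \<open>Here B1 < B2 enters: it makes X1/X tend to 0 uniformly in h.\<close>
    have lt: "(1 - B2) * \<beta> < 1" using B B1 by (simp add: \<beta>_def field_simps)
    have "((\<lambda>X::real. k2 powr \<beta> * X powr ((1 - B2) * \<beta> - 1)) \<longlongrightarrow> 0) at_top"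
    proof -
      define t where "t = (1 - B2) * \<beta> - 1"
      have "t < 0" using lt by (simp add: t_def)
      hence "((\<lambda>X::real. X powr t) \<longlongrightarrow> 0) at_top" by real_asymp
      thus ?thesis unfolding t_def[symmetric] by (rule tendsto_mult_right_zero)
    qed
    hence "\<forall>\<^sub>F X in at_top. k2 powr \<beta> * X powr ((1 - B2) * \<beta> - 1) < 1/2" by (rule order_tendstoD) simp
    thus "\<forall>\<^sub>F X in at_top. (k2 * X powr (1 - B2)) powr \<beta> / X < 1/2"
      using eventually_ge_at_top[of 1]
    proof eventually_elim
      case (elim X)
      have "(k2 * X powr (1 - B2)) powr \<beta> / X = k2 powr \<beta> * X powr ((1 - B2) * \<beta> - 1)"
        using elim k2 by (simp add: powr_mult powr_powr powr_diff[of X _ 1])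
      thus ?case using elim by simp
    qed
    have "((\<lambda>X::real. k2 powr c' * X powr (- B2 * c')) \<longlongrightarrow> 0) at_top"
    proof -
      define t where "t = - B2 * c'"
      have "t < 0" using B c' by (simp add: t_def)
      hence "((\<lambda>X::real. X powr t) \<longlongrightarrow> 0) at_top" by real_asymp
      thus ?thesis unfolding t_def[symmetric] by (rule tendsto_mult_right_zero)
    qed
    hence "\<forall>\<^sub>F X in at_top. k2 powr c' * X powr (- B2 * c') < 1/2" by (rule order_tendstoD) simp
    thus "\<forall>\<^sub>F X in at_top. (k2 * X powr (- B2)) powr c' < 1/2"
    proof eventually_elim
      case (elim X)
      thus ?case using k2 by (simp add: powr_mult powr_powr)
    qed
    have "((\<lambda>X::real. ln (2 * X) / X powr e) \<longlongrightarrow> 0) at_top" using e by real_asymp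
    thus "\<forall>\<^sub>F X in at_top. ln (2 * X) / X powr e < 1" by (rule order_tendstoD) simp
  qed
  then obtain N where N: "\<And>X. X \<ge> N \<Longrightarrow> 1 \<le> X \<and> K1 \<le> k1 * X powr (1 - B3) \<and> (k2 * X powr (1 - B2)) powr \<beta> / X < 1/2
      \<and> (k2 * X powr (- B2)) powr c' < 1/2 \<and> ln (2 * X) / X powr e < 1"
    unfolding eventually_at_top_linorder by blast
  show ?thesis
  proof (rule exI[of _ "4 * K"], rule exI[of _ N], intro allI impI, elim conjE)
    fix X h assume XN: "N \<le> X" and hk: "k1 * X powr (1 - B3) \<le> h" "h \<le> k2 * X powr (1 - B2)"
    note NX = N[OF XN]
    have X: "1 \<le> X" "0 < X" using NX by linarith+
    have "K1 \<le> h" using NX hk by linarith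
    note Kh = K1[OF this]
    have h: "1 \<le> h" "0 < h" using Kh by linarith+
    define X1 where "X1 = h powr \<beta>"
    \<comment> \<open>Each summand was made at most 1/2, so \<rho> \<le> 1 and \<mu> is an
      admissible weight.\<close>
    define \<rho> where "\<rho> = (h / X) powr c' + X1 / X"
    define \<mu> where "\<mu> = \<rho> powr (1/3)"
    have "h powr \<beta> = h * h powr (\<beta> - 1)" using h by (simp add: powr_diff)
    hence hX1: "2 * h \<le> X1" unfolding X1_def using Kh h mult_left_mono[of 2 "h powr (\<beta> - 1)" h] by simp
    have X11: "1 \<le> X1" "h \<le> X1" using hX1 h by linarith+
    have "h powr \<beta> \<le> (k2 * X powr (1 - B2)) powr \<beta>" using hk h \<beta> by (intro powr_mono2) auto
    hence "X1 / X \<le> (k2 * X powr (1 - B2)) powr \<beta> / X" unfolding X1_def using X by (intro divide_right_mono) auto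
    hence r1: "X1 / X \<le> 1/2" using NX by linarith
    hence X1X: "X1 \<le> X" using X by (simp add: field_simps)
    have "h / X \<le> k2 * X powr (1 - B2) / X" using hk X by (intro divide_right_mono) auto
    also have "\<dots> = k2 * X powr (- B2)" using X by (simp add: powr_diff powr_minus field_simps)
    finally have "(h / X) powr c' \<le> (k2 * X powr (- B2)) powr c'" using h X c' by (intro powr_mono2) auto
    hence r2: "(h / X) powr c' \<le> 1/2" using NX by linarith
    have hX: "0 < h / X" "0 < X1 / X" "h / X \<le> X1 / X" using h X X11 by (auto intro: divide_right_mono)
    have \<rho>: "0 < \<rho>" "\<rho> \<le> 1" "(h / X) powr c' \<le> \<rho>" "X1 / X \<le> \<rho>"
    proof -
      have "0 \<le> (h / X) powr c'" by simp
      thus "0 < \<rho>" "\<rho> \<le> 1" "(h / X) powr c' \<le> \<rho>" "X1 / X \<le> \<rho>"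
        unfolding \<rho>_def using r1 r2 hX by linarith+
    qed
    have \<mu>: "0 < \<mu>" "\<mu> \<le> 1" using \<rho> unfolding \<mu>_def by (auto intro: powr_le1)
    have \<mu>3: "\<mu> ^ 3 = \<rho>" unfolding \<mu>_def using \<rho> by (simp add: powr_power)
    have lnX: "ln (2 * X) \<le> X powr e" using NX X by (simp add: field_simps)
    have H: "\<bar>VF \<Lambda> m y \<delta> - 1/2 * \<delta> * y\<^sup>2 * (d * ln (1 / \<delta>) + c1)\<bar> \<le> C * (\<delta> powr (1 + c') * y\<^sup>2)"
      if y: "X1 \<le> y" "y \<le> X" and \<delta>: "h \<le> \<delta> * y" "\<delta> * y \<le> 2 * h" for \<delta> y
    proof -
      have y0: "y > 0" using y X11 by linarith
      have "\<delta> * y > 0" using \<delta> h by linarith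
      hence \<delta>0: "\<delta> > 0" using y0 by (simp add: zero_less_mult_iff)
      have "\<delta> * y \<le> 1 * y" using \<delta> hX1 y by linarith
      hence \<delta>1: "\<delta> \<le> 1" using y0 by (simp only: mult_le_cancel_right_pos)
      have "X0 \<le> y" using Kh y unfolding X1_def by linarith
      \<comment> \<open>Multiplied by y the claim reads k1*y^(1 - B3) \<le> \<delta>*y, and y^(1 -
        B3) increases with y because B3 < 1.\<close>
      moreover have "k1 * y powr (- B3) \<le> \<delta>"
      proof -
        have "k1 * y powr (- B3) * y = k1 * y powr (1 - B3)" using y0 by (simp add: powr_diff powr_minus field_simps)
        also have "\<dots> \<le> k1 * X powr (1 - B3)" using k1 y y0 B by (intro mult_left_mono powr_mono2) auto
        also have "\<dots> \<le> \<delta> * y" using hk \<delta> by linarith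
        finally show ?thesis using y0 by (simp only: mult_le_cancel_right_pos)
      qed
      moreover have "\<delta> \<le> 2 * y powr (- B1)"
      proof -
        \<comment> \<open>At y = X1 the slope h/y equals y^(-B1) exactly; a larger y only
          helps.\<close>
        have "h = X1 powr (1 - B1)" unfolding X1_def using h \<beta> by (simp add: powr_powr)
        also have "\<dots> \<le> y powr (1 - B1)" using y X11 B1 by (intro powr_mono2) auto
        also have "\<dots> = y powr (- B1) * y" using y0 by (simp add: powr_diff powr_minus field_simps)
        finally have "\<delta> * y \<le> 2 * y powr (- B1) * y" using \<delta> by linarith
        thus ?thesis using y0 by (simp only: mult_le_cancel_right_pos)
      qed
      ultimately have "\<bar>VF \<Lambda> m y \<delta> - 1/2 * \<delta> * y\<^sup>2 * (d * ln (1 / \<delta>) + c1)\<bar> \<le> C * (\<delta> powr (1 + c) * y\<^sup>2)" by (rule V)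
      also have "\<dots> \<le> C * (\<delta> powr (1 + c') * y\<^sup>2)"
        using C \<delta>0 \<delta>1 c' by (intro mult_left_mono mult_right_mono powr_mono') auto
      finally show ?thesis .
    qed
    have "1 / X1 \<le> 1" using X11 by simp
    hence a1: "1 / X1 \<le> 2 * h" "2 * h \<le> 2 * X1" using h X11 by linarith+
    \<comment> \<open>The averaged bound requires a length of at least 1/(2X); this follows from h
      \<ge> 1 and h/X \<le> X1/X \<le> \<mu>^3 \<le> \<mu>^2.\<close>
    have a2: "1 / (2 * X) \<le> \<mu>\<^sup>2 * h" "\<mu>\<^sup>2 * h \<le> 2 * (2 * X)"
    proof -
      have "1 / (2 * X) \<le> h / X" using X h by (simp add: field_simps)
      also have "\<dots> \<le> \<mu> ^ 3" using hX \<rho> \<mu>3 by linarith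
      also have "\<dots> \<le> \<mu>\<^sup>2" using \<mu> by (intro power_decreasing) auto
      also have "\<dots> \<le> \<mu>\<^sup>2 * h" using h mult_left_mono[of 1 h "\<mu>\<^sup>2"] by simp
      finally show "1 / (2 * X) \<le> \<mu>\<^sup>2 * h" .
      have "\<mu>\<^sup>2 * h \<le> 1 * h" using \<mu> h by (intro mult_right_mono power_le_one) auto
      thus "\<mu>\<^sup>2 * h \<le> 2 * (2 * X)" using X11 X1X h by linarith
    qed
    have X2: "1 \<le> 2 * X" using X by linarith
    have P: "\<bar>d\<bar> * ln X + \<bar>c1 - d\<bar> + \<bar>d\<bar> \<le> Kp * X powr e"
    proof -
      have "ln X \<le> ln (2 * X)" using X by simp
      hence "\<bar>d\<bar> * ln X \<le> \<bar>d\<bar> * X powr e" using lnX by (intro mult_left_mono) auto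
      moreover have "(\<bar>c1 - d\<bar> + \<bar>d\<bar>) * 1 \<le> (\<bar>c1 - d\<bar> + \<bar>d\<bar>) * X powr e" using X e by (intro mult_left_mono ge_one_powr_ge_zero) auto
      ultimately have "\<bar>d\<bar> * ln X + (\<bar>c1 - d\<bar> + \<bar>d\<bar>) * 1 \<le> \<bar>d\<bar> * X powr e + (\<bar>c1 - d\<bar> + \<bar>d\<bar>) * X powr e" by (rule add_mono)
      thus ?thesis by (simp add: Kp_def algebra_simps)
    qed
    have "\<bar>VtF \<Lambda> m X h - h * X * (d * ln (X / h) + (c1 - d))\<bar>
      \<le> 2 / \<mu>\<^sup>2 * (2 * (8 * C * h * X * (h / X) powr c' * ln (2 * X)) + 2 / h * (Ca * ((2 * h)\<^sup>2 * X1 powr (1 + e))) + 2 / (\<mu> * h) * (Ca * ((\<mu>\<^sup>2 * h)\<^sup>2 * (2 * X) powr (1 + e))))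
      + (2 * \<mu> * h * X + \<mu>\<^sup>2 * h * X + 4 * h * X1) * (\<bar>d\<bar> * ln X + \<bar>c1 - d\<bar> + \<bar>d\<bar>)"
      by (rule VtF_minus_model_le[OF h(1) hX1 X1X \<mu> c'(1,2) C(1) H avg[OF X11(1) a1] _ avg[OF X2 a2]])
         (use Ca in auto)
    also have "\<dots> \<le> K * (\<mu> * (h * X powr (1 + e)))"
      unfolding K_def
    proof (rule combined_error_le[OF h(1) X(1) X11(1) X1X _ \<mu> _ _ _ lnX _ P C(1) Ca e])
      show "X1 \<le> \<mu> ^ 3 * X" using \<rho>(4) X unfolding \<mu>3 by (simp add: pos_divide_le_eq)
      show "(h / X) powr c' \<le> \<mu> ^ 3" using \<rho>(3) unfolding \<mu>3 .
    qed (use X in auto)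
    also have "\<dots> \<le> K * (4 * ((h / X) powr (c / 3) + (X1 / X) powr (1/3)) * (h * X powr (1 + e)))"
    proof (intro mult_left_mono mult_right_mono K0)
      \<comment> \<open>For c > 1 the capped term (h/X)^(1/3) is absorbed by the second error,
        because h \<le> X1.\<close>
      have "(h / X) powr (c' / 3) \<le> (h / X) powr (c / 3) + (X1 / X) powr (1/3)"
      proof (cases "c \<le> 1")
        case False
        hence "(h / X) powr (c' / 3) \<le> (X1 / X) powr (1/3)" using hX by (auto simp: c'_def intro!: powr_mono2)
        thus ?thesis by (simp add: add_increasing)
      qed (simp add: c'_def)
      moreover have "\<mu> \<le> 2 * ((h / X) powr (c' / 3) + (X1 / X) powr (1/3))"
        using powr_third_add_le[of "(h / X) powr c'" "X1 / X"] hX by (simp add: \<mu>_def \<rho>_def powr_powr)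
      moreover have "0 \<le> (h / X) powr (c / 3)" by simp
      ultimately show "\<mu> \<le> 4 * ((h / X) powr (c / 3) + (X1 / X) powr (1/3))"
        unfolding distrib_left by linarith
    qed (use h in auto)
    also have "(X1 / X) powr (1/3) = (h * X powr (- (1 - B1))) powr (1 / (3 * (1 - B1)))"
    proof -
      have "(X1 / X) powr (1/3) = h powr (\<beta> / 3) * X powr (- (1/3))"
        unfolding X1_def using X h by (simp add: powr_divide powr_powr powr_minus field_simps)
      also have "\<beta> / 3 = 1 / (3 * (1 - B1))" by (simp add: \<beta>_def)
      also have "- (1/3) = - (1 - B1) * (1 / (3 * (1 - B1)))" using B1 by (simp add: field_simps)
      finally show ?thesis using X h by (simp only: powr_mult powr_powr)
    qed
    finally show "\<bar>VtF \<Lambda> m X h - h * X * (d * ln (X / h) + (c1 - d))\<bar>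
        \<le> 4 * K * (h * X powr (1 + e) * (h / X) powr (c / 3)
             + h * X powr (1 + e) * (h * X powr (- (1 - B1))) powr (1 / (3 * (1 - B1))))"
      by (simp only: mult_ac distrib_left distrib_right)
  qed
qed

theorem theoremC1:
  fixes a :: "nat \<Rightarrow> complex" and F :: "complex \<Rightarrow> complex" and m :: nat
    and Q :: real and r :: nat and lam :: "nat \<Rightarrow> real" and mu :: "nat \<Rightarrow> complex"
    and eps :: complex and \<Lambda> :: "nat \<Rightarrow> complex"
    and B1 B2 B3 c :: real
  assumes prim: "selberg_primitive a F"
    and ax: "selberg_axioms a F m Q r lam mu eps"
    and Lam: "is_vonMangoldt_F F \<Lambda>"
    and grh: "GRH F r lam mu"
    and B: "0 < B1" "B1 < B2" "B2 \<le> B3" "B3 < 1 / degree r lam"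
    and c: "c > 0"
    and hyp: "\<forall>k1>0. \<forall>k2>0. \<exists>C X0. \<forall>X\<ge>X0. \<forall>\<delta>.
        k1 * X powr (- B3) \<le> \<delta> \<and> \<delta> \<le> k2 * X powr (- B1) \<longrightarrow>
        \<bar>VF \<Lambda> m X \<delta> - 1/2 * \<delta> * X\<^sup>2 * (degree r lam * ln (1 / \<delta>) + ln (conductor Q r lam)
            + (1 - euler_mascheroni - ln (2 * pi)) * degree r lam)\<bar>
        \<le> C * (\<delta> powr (1 + c) * X\<^sup>2)"
  shows "\<forall>e>0. \<forall>k1>0. \<forall>k2>0. \<exists>C X0. \<forall>X\<ge>X0. \<forall>h.
        k1 * X powr (1 - B3) \<le> h \<and> h \<le> k2 * X powr (1 - B2) \<longrightarrow>
        \<bar>VtF \<Lambda> m X h - h * X * (degree r lam * ln (X / h) + ln (conductor Q r lam)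
            - (euler_mascheroni + ln (2 * pi)) * degree r lam)\<bar>
        \<le> C * (h * X powr (1 + e) * (h / X) powr (c / 3)
             + h * X powr (1 + e) * (h * X powr (- (1 - B1))) powr (1 / (3 * (1 - B1))))"
proof -
  define d where "d = degree r lam"
  define c1 where "c1 = ln (conductor Q r lam) + (1 - euler_mascheroni - ln (2 * pi)) * d"
  have B13: "B1 \<le> B3" "0 < B3" using B by linarith+
  \<comment> \<open>Read off from 0 < B3 < 1/d; as 1/0 = 0, this also excludes d = 0.\<close>
  have "1 / d > 0" using B(4) B13 unfolding d_def by linarith
  hence d: "d > 0" by simp
  have as: "VF_asymptotic \<Lambda> m d c1 c B1 B3"
    using hyp unfolding VF_asymptotic_def c1_def d_def by (simp only: add.assoc)
  have B3: "B3 < 1" by (rule VF_asymptotic_range[OF as B(1) B13(1) c d])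
  obtain M :: real where M: "\<And>e. 0 < e \<Longrightarrow> e < 1/8 \<Longrightarrow> \<exists>C\<ge>0. \<forall>\<delta>>0. \<forall>X.
     (\<integral>\<^sup>+x. indicator {1..X} x * ennreal ((norm (psiF \<Lambda> (x + \<delta> * x) - psiF \<Lambda> x - of_real (M * \<delta> * x)))\<^sup>2 * x powr (- 2 - 2 * e)) \<partial>lborel)
       \<le> ennreal (C * (\<delta> powr (1 - 4 * e) * (1 + \<delta>) powr (6 * e)))"
    apply (rule selberg_GRH_mean_square[OF ax grh Lam])
    subgoal premises p by (rule p(1)[OF p(2)])
    done
  have ms: "mean_square_bounded \<Lambda> M"
    unfolding mean_square_bounded_def psi_gap_def by (intro allI impI) (rule M[unfolded mult.assoc])
  have "M = real m" by (rule residue_eq_pole_order[OF ms as B(1) B13(1) _ c]) (use B13 B3 in linarith)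
  with ms have ms': "mean_square_bounded \<Lambda> (real m)" by simp
  have c1d: "degree r lam * t + ln (conductor Q r lam) - (euler_mascheroni + ln (2 * pi)) * degree r lam = d * t + (c1 - d)" for t
    by (simp add: c1_def d_def algebra_simps)
  show ?thesis
    unfolding c1d by (intro allI impI) (rule VtF_asymptotic[OF ms' as B(1,2,3) B3 c])
qed

end
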